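(* Let $(M,m,u)$ be a naturally Frobenius map monoidale in a monoidal bicategory $\mathcal B$, and let $(a,(\mu,\eta),(\delta,\varepsilon),\sigma)$ be a Hopf monoid in the duoidal category $(\mathcal B(M,M),\bullet,\circ)$. The following assertions are equivalent. (i) The monoid $(a,\mu,\eta)$ in $(\mathcal B(M,M),\bullet,j)$ is separable. (ii) There exists a normalized left integral $i\to a\bullet i$. (iii) There exists a normalized right integral $i\to i\bullet a$. (iv) The forgetful functor $\mathcal B(M,M)^{a\bullet-\bullet i}\to \mathcal B(M,M)^{-\bullet i}$ is separable. (v) The forgetful functor $\mathcal B(M,M)^{i\bullet-\bullet a}\to \mathcal B(M,M)^{i\bullet-}$ is separable. (vi) The forgetful functor $\mathcal B(M,M)^{a\bullet-\bullet i}\to \mathcal B(M,M)^{-\bullet i}$ reflects split epimorphisms. (vii) The forgetful functor $\mathcal B(M,M)^{i\bullet-\bullet a}\to \mathcal B(M,M)^{i\bullet-}$ reflects split epimorphisms.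
   Context: Conventions. $\mathcal B$ is a monoidal bicategory, treated (by coherence) as a Gray monoid; its monoidal product is denoted by juxtaposition, its unit by $I$, and horizontal composition by $g.f$ (first $f$, then $g$). Identity 1-cells are denoted $1$. Coherence isomorphisms, including interchange and associativity/unitality isomorphisms, are denoted $\cong$ or suppressed. Composition of morphisms (2-cells) in hom categories is written $\beta\cdot\alpha$ (first $\alpha$). Naturally Frobenius map monoidale. A monoidale is a pseudo-monoid $(M,m:MM\to M,u:I\to M)$ in $\mathcal B$. It is a map monoidale if $m,u$ have right adjoints $m^*,u^*$, with units $\eta_m:1\to m^*.m$, $\eta_u:1\to u^*.u$ and counits $\varepsilon_m:m.m^*\to 1$, $\varepsilon_u:u.u^*\to1$. Then $(M,m^*,u^* )$ is a pseudo-comonoid via mates; in particular $(u^*1).m^*\cong 1\cong(1u^* ).m^*$. It is naturally Frobenius if the 2-cells $\pi:(m1).(1m^* )\xrightarrow{\eta_m} m^*.m.(m1).(1m^* )\cong m^*.m.(1m).(1m^* )\xrightarrow{1\varepsilon_m} m^*.m$ and $\pi':(1m).(m^*1)\xrightarrow{\eta_m} m^*.m.(1m).(m^*1)\cong m^*.m.(m1).(m^*1)\xrightarrow{\varepsilon_m1} m^*.m$ are invertible. Duoidal structure on $\mathcal B(M,M)$. For $f,g:M\to M$: $f\circ g:=g.f$ with unit $i:=1_M$; $f\bullet g:=m.(fg).m^*$ with unit $j:=u.u^*$. Structure morphisms: $\xi_0=\varepsilon_m:i\bullet i\to i$; $\xi^0_0=\varepsilon_u:j\to i$; $\xi^0=u.\eta_u.u^*:j\to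 j\circ j$; and $\xi:(a\circ b)\bullet(c\circ d)\cong m.(bd).(ac).m^*\to m.(bd).m^*.m.(ac).m^*=(a\bullet c)\circ(b\bullet d)$ obtained by inserting $\eta_m$. Monoidal coherence isomorphisms of $\circ$ and $\bullet$ are suppressed. Thus $(i,\xi_0,\xi^0_0)$ is a $\bullet$-monoid. Bimonoid. An object $a$ with a $\bullet$-monoid structure $\mu:a\bullet a\to a$, $\eta:j\to a$ and a $\circ$-comonoid structure $\delta:a\to a\circ a$, $\varepsilon:a\to i$ such that $\delta\cdot\mu=(\mu\circ\mu)\cdot\xi\cdot(\delta\bullet\delta)$, $\varepsilon\cdot\mu=\xi_0\cdot(\varepsilon\bullet\varepsilon)$, $\delta\cdot\eta=(\eta\circ\eta)\cdot\xi^0$, $\varepsilon\cdot\eta=\xi^0_0$. Hopf monoid. For $b:M\to M$ put $b^-:=(u^*1).(m1).(1b1).(1m^* ).(1u)$. Let $\alpha: u^*1\xrightarrow{\eta_m}(u^*1).m^*.m\cong m$ and $\beta:1u\xrightarrow{\eta_m} m^*.m.(1u)\cong m^*$. For $b,c:M\to M$ let $\varphi_{b,c}: b\circ c^-\cong (u^*1).(m1).(bc1).(1m^* ).(1u)\xrightarrow{\beta}(u^*1).(m1).(bc1).(1m^* ).m^*\cong(u^*1).(m1).(bc1).(m^*1).m^*\cong[(b\bullet c)\circ j]\bullet i$, $\psi_{b,c}: b^-\circ c\cong (u^*1).(m1).(1bc).(1m^* ).(1u)\xrightarrow{\alpha} m.(m1).(1bc).(1m^* ).(1u)\cong m.(1m).(1bc).(1m^*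 ).(1u)\cong i\bullet[j\circ(b\bullet c)]$. A Hopf monoid in $\mathcal B(M,M)$ is a bimonoid $a$ (equivalently, a monoidal comonad on $M$) with a morphism $\sigma:a\to a^-$ (the antipode) such that $[(\mu\circ1)\bullet1]\cdot\varphi_{a,a}\cdot(1\circ\sigma)\cdot\delta=[((\eta\circ1)\cdot\xi^0)\bullet1]\cdot\varepsilon: a\to(a\circ j)\bullet i$ and $[1\bullet(1\circ\mu)]\cdot\psi_{a,a}\cdot(\sigma\circ1)\cdot\delta=[1\bullet(1\circ\eta)\cdot\xi^0]\cdot\varepsilon:a\to i\bullet(j\circ a)$, where $i=j\bullet i=i\bullet j$. Separable monoid. $(a,\mu,\eta)$ in a monoidal category $(\mathsf C,\bullet,j)$ is separable if $\mu$ admits a section $\nabla:a\to a\bullet a$ that is a morphism of $a$-bimodules. Integrals. A left integral is a morphism $\theta:i\to a\bullet i$ that is a morphism of left $a$-modules and right $i$-modules: $(\mu\bullet1)\cdot(1\bullet\theta)=\theta\cdot\xi_0\cdot(\varepsilon\bullet1)$ and $(1\bullet\xi_0)\cdot(\theta\bullet1)=\theta\cdot\xi_0$. It is normalized if $\xi_0\cdot(\varepsilon\bullet1)\cdot\theta=1_i$. A right integral is a right $a$-module and left $i$-module morphism $\theta:i\to i\bullet a$ (i.e. $(1\bullet\mu)\cdot(\theta\bullet1)=\theta\cdot\xi_0\cdot(1\bullet\varepsilon)$ and $(\xi_0\bullet1)\cdot(1\bullet\theta)=\theta\cdot\xi_0$); it is normalized if $\xi_0\cdot(1\bullet\varepsilon)\cdot\theta=1_i$.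 Module categories. $\mathcal B(M,M)^{-\bullet i}$ and $\mathcal B(M,M)^{i\bullet-}$ are the categories of right, respectively left, modules of the $\bullet$-monoid $i$ (Eilenberg–Moore algebras of the monads $-\bullet i$, $i\bullet-$). $\mathcal B(M,M)^{a\bullet-\bullet i}$ is the category of (left $a$, right $i$)-bimodules and $\mathcal B(M,M)^{i\bullet-\bullet a}$ that of (left $i$, right $a$)-bimodules. The forgetful functors forget the $a$-action. Functors. A functor $F:\mathsf X\to\mathsf Y$ is separable if the natural transformation $\mathsf X(-,-)\to\mathsf Y(F-,F-)$, $f\mapsto Ff$, has a natural retraction. $F$ reflects split epimorphisms if $f$ is a split epimorphism whenever $Ff$ is. *)

theory Defs
  imports Main
begin

section \<open>Categories and functors\<close>

text \<open>
  A category is given by its objects and hom sets; arrows need not determine their domain and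
  codomain, so that a morphism of modules can simply be a morphism between the underlying objects.
  The records below carry data only; they are used for the module categories defined at the end.
\<close>

record ('o, 'a) cat =
  Ob :: "'o set"
  Hom :: "'o \<Rightarrow> 'o \<Rightarrow> 'a set"
  Idn :: "'o \<Rightarrow> 'a"
  Comp :: "'a \<Rightarrow> 'a \<Rightarrow> 'a"

definition split_epi :: "('o, 'a, 'z) cat_scheme \<Rightarrow> 'o \<Rightarrow> 'o \<Rightarrow> 'a \<Rightarrow> bool" where
  "split_epi C x y f \<longleftrightarrow> f \<in> Hom C x y \<and> (\<exists>s \<in> Hom C y x. Comp C f s = Idn C y)"

text \<open>A functor is given by its object map \<open>Fo\<close> and its arrow map \<open>Fa\<close>; \<open>P\<close> is the
  natural retraction of the action of the functor on hom sets.\<close>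

definition separable_functor ::
  "('o, 'a, 'y) cat_scheme \<Rightarrow> ('p, 'b, 'z) cat_scheme \<Rightarrow> ('o \<Rightarrow> 'p) \<Rightarrow> ('a \<Rightarrow> 'b) \<Rightarrow> bool" where
  "separable_functor X Y Fo Fa \<longleftrightarrow>
    (\<exists>P :: 'o \<Rightarrow> 'o \<Rightarrow> 'b \<Rightarrow> 'a.
      (\<forall>x \<in> Ob X. \<forall>y \<in> Ob X. \<forall>h \<in> Hom Y (Fo x) (Fo y). P x y h \<in> Hom X x y) \<and>
      (\<forall>x \<in> Ob X. \<forall>y \<in> Ob X. \<forall>x' \<in> Ob X. \<forall>y' \<in> Ob X.
        \<forall>f \<in> Hom X x' x. \<forall>g \<in> Hom X y y'. \<forall>h \<in> Hom Y (Fo x) (Fo y).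
          P x' y' (Comp Y (Fa g) (Comp Y h (Fa f))) = Comp X g (Comp X (P x y h) f)) \<and>
      (\<forall>x \<in> Ob X. \<forall>y \<in> Ob X. \<forall>f \<in> Hom X x y. P x y (Fa f) = f))"

definition reflects_split_epis ::
  "('o, 'a, 'y) cat_scheme \<Rightarrow> ('p, 'b, 'z) cat_scheme \<Rightarrow> ('o \<Rightarrow> 'p) \<Rightarrow> ('a \<Rightarrow> 'b) \<Rightarrow> bool" where
  "reflects_split_epis X Y Fo Fa \<longleftrightarrow>
    (\<forall>x \<in> Ob X. \<forall>y \<in> Ob X. \<forall>f \<in> Hom X x y.
      split_epi Y (Fo x) (Fo y) (Fa f) \<longrightarrow> split_epi X x y f)"


section \<open>Gray monoids\<close>

text \<open>
  Monoidal bicategories are taken in their strict form, as Gray monoids.  The types \<open>'o\<close>, \<open>'f\<close>,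
  \<open>'t\<close> consist of the 0-, 1- and 2-cells of the Gray monoid, so no carrier sets are needed; the
  compositions are only meaningful on composable cells.

  \<open>g \<cdot> f\<close> is composition of 1-cells (first \<open>f\<close>), \<open>t \<odot> s\<close> vertical and \<open>t \<star> s\<close> horizontal
  composition of 2-cells (first \<open>s\<close>), and \<open>\<langle>f\<rangle>\<close> the identity 2-cell of \<open>f\<close>.  The operations
  \<open>A \<rhd> _\<close> and \<open>_ \<lhd> A\<close> are the actions of the 2-functors \<open>A \<otimes> _\<close> and \<open>_ \<otimes> A\<close> on 1- and 2-cells,
  and \<open>\<chi> f g\<close> is the interchanger.
\<close>

record ('o, 'f, 't) gray =
  src :: "'f \<Rightarrow> 'o"
  trg :: "'f \<Rightarrow> 'o"
  dom2 :: "'t \<Rightarrow> 'f"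
  cod2 :: "'t \<Rightarrow> 'f"
  id1 :: "'o \<Rightarrow> 'f" ("\<one>\<index>")
  comp1 :: "'f \<Rightarrow> 'f \<Rightarrow> 'f" (infixr "\<cdot>\<index>" 70)
  id2 :: "'f \<Rightarrow> 't" ("\<langle>_\<rangle>\<index>")
  vcomp :: "'t \<Rightarrow> 't \<Rightarrow> 't" (infixr "\<odot>\<index>" 55)
  hcomp :: "'t \<Rightarrow> 't \<Rightarrow> 't" (infixr "\<star>\<index>" 70)
  unit0 :: "'o" ("\<I>\<index>")
  ten0 :: "'o \<Rightarrow> 'o \<Rightarrow> 'o" (infixr "\<otimes>\<^sub>0\<index>" 80)
  lw1 :: "'o \<Rightarrow> 'f \<Rightarrow> 'f" (infixr "\<rhd>\<^sub>1\<index>" 75)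
  lw2 :: "'o \<Rightarrow> 't \<Rightarrow> 't" (infixr "\<rhd>\<^sub>2\<index>" 75)
  rw1 :: "'f \<Rightarrow> 'o \<Rightarrow> 'f" (infixl "\<lhd>\<^sub>1\<index>" 76)
  rw2 :: "'t \<Rightarrow> 'o \<Rightarrow> 't" (infixl "\<lhd>\<^sub>2\<index>" 76)
  intch :: "'f \<Rightarrow> 'f \<Rightarrow> 't" ("\<chi>\<index>")

definition hom1 :: "('o, 'f, 't, 'z) gray_scheme \<Rightarrow> 'o \<Rightarrow> 'o \<Rightarrow> 'f set" where
  "hom1 B X Y = {f. src B f = X \<and> trg B f = Y}"

definition hom2 :: "('o, 'f, 't, 'z) gray_scheme \<Rightarrow> 'f \<Rightarrow> 'f \<Rightarrow> 't set" where
  "hom2 B f g = {t. dom2 B t = f \<and> cod2 B t = g}"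

context
  fixes B :: "('o, 'f, 't, 'z) gray_scheme" (structure)
begin

definition inverse_2cells :: "'t \<Rightarrow> 't \<Rightarrow> bool" where
  "inverse_2cells t s \<longleftrightarrow> s \<in> hom2 B (cod2 B t) (dom2 B t) \<and>
     s \<odot> t = \<langle>dom2 B t\<rangle> \<and> t \<odot> s = \<langle>cod2 B t\<rangle>"

definition iso2 :: "'t \<Rightarrow> bool" where
  "iso2 t \<longleftrightarrow> (\<exists>s. inverse_2cells t s)"

definition inv2 :: "'t \<Rightarrow> 't" where
  "inv2 t = (THE s. inverse_2cells t s)"

text \<open>Of the two isomorphic composites that may serve as the tensor product of two 1-cells
  (or 2-cells), the one chosen acts on the right-hand factor first.\<close>

definition ten1 :: "'f \<Rightarrow> 'f \<Rightarrow> 'f" where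
  "ten1 f g = (f \<lhd>\<^sub>1 trg B g) \<cdot> (src B f \<rhd>\<^sub>1 g)"

definition ten2 :: "'t \<Rightarrow> 't \<Rightarrow> 't" where
  "ten2 s t = (s \<lhd>\<^sub>2 trg B (dom2 B t)) \<star> (src B (dom2 B s) \<rhd>\<^sub>2 t)"

definition adjunction :: "'f \<Rightarrow> 'f \<Rightarrow> 't \<Rightarrow> 't \<Rightarrow> bool" where
  "adjunction f f' \<eta> \<epsilon> \<longleftrightarrow>
     f' \<in> hom1 B (trg B f) (src B f) \<and>
     \<eta> \<in> hom2 B (\<one> (src B f)) (f' \<cdot> f) \<and>
     \<epsilon> \<in> hom2 B (f \<cdot> f') (\<one> (trg B f)) \<and>
     (\<langle>f'\<rangle> \<star> \<epsilon>) \<odot> (\<eta> \<star> \<langle>f'\<rangle>) = \<langle>f'\<rangle> \<and>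
     (\<epsilon> \<star> \<langle>f\<rangle>) \<odot> (\<langle>f\<rangle> \<star> \<eta>) = \<langle>f\<rangle>"

text \<open>For adjunctions \<open>f \<stileturn> f'\<close> with counit \<open>\<epsilon>\<close> and \<open>g \<stileturn> g'\<close> with unit \<open>\<eta>\<close>, the mate
  \<open>f' \<Rightarrow> g'\<close> of a 2-cell \<open>s : g \<Rightarrow> f\<close>.\<close>

definition mate :: "'t \<Rightarrow> 'f \<Rightarrow> 't \<Rightarrow> 'f \<Rightarrow> 't \<Rightarrow> 't" where
  "mate \<eta> g' s f' \<epsilon> = (\<langle>g'\<rangle> \<star> \<epsilon>) \<odot> (\<langle>g'\<rangle> \<star> s \<star> \<langle>f'\<rangle>) \<odot> (\<eta> \<star> \<langle>f'\<rangle>)"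

end

notation ten1 (infixr "\<otimes>\<^sub>1\<index>" 77)
notation ten2 (infixr "\<otimes>\<^sub>2\<index>" 77)

locale two_category =
  fixes B :: "('o, 'f, 't, 'z) gray_scheme" (structure)
  assumes src_dom_cod: "src B (dom2 B t) = src B (cod2 B t)"
    and trg_dom_cod: "trg B (dom2 B t) = trg B (cod2 B t)"
    and id1_hom: "\<one> X \<in> hom1 B X X"
    and comp1_hom: "\<lbrakk>f \<in> hom1 B X Y; g \<in> hom1 B Y Z\<rbrakk> \<Longrightarrow> g \<cdot> f \<in> hom1 B X Z"
    and comp1_assoc: "\<lbrakk>trg B f = src B g; trg B g = src B h\<rbrakk> \<Longrightarrow> (h \<cdot> g) \<cdot> f = h \<cdot> (g \<cdot> f)"
    and comp1_id_left: "\<one> (trg B f) \<cdot> f = f"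
    and comp1_id_right: "f \<cdot> \<one> (src B f) = f"
    and id2_hom: "\<langle>f\<rangle> \<in> hom2 B f f"
    and vcomp_hom: "\<lbrakk>s \<in> hom2 B f g; t \<in> hom2 B g h\<rbrakk> \<Longrightarrow> t \<odot> s \<in> hom2 B f h"
    and vcomp_assoc: "\<lbrakk>cod2 B s = dom2 B t; cod2 B t = dom2 B r\<rbrakk> \<Longrightarrow> (r \<odot> t) \<odot> s = r \<odot> (t \<odot> s)"
    and vcomp_id_left: "\<langle>cod2 B t\<rangle> \<odot> t = t"
    and vcomp_id_right: "t \<odot> \<langle>dom2 B t\<rangle> = t"
    and hcomp_hom: "\<lbrakk>s \<in> hom2 B f f'; t \<in> hom2 B g g'; trg B f = src B g\<rbrakk>
          \<Longrightarrow> t \<star> s \<in> hom2 B (g \<cdot> f) (g' \<cdot> f')"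
    and hcomp_assoc: "\<lbrakk>trg B (dom2 B s) = src B (dom2 B t); trg B (dom2 B t) = src B (dom2 B r)\<rbrakk>
          \<Longrightarrow> (r \<star> t) \<star> s = r \<star> (t \<star> s)"
    and hcomp_id_left: "\<langle>\<one> (trg B (dom2 B t))\<rangle> \<star> t = t"
    and hcomp_id_right: "t \<star> \<langle>\<one> (src B (dom2 B t))\<rangle> = t"
    and hcomp_id2: "trg B f = src B g \<Longrightarrow> \<langle>g\<rangle> \<star> \<langle>f\<rangle> = \<langle>g \<cdot> f\<rangle>"
    and middle_four: "\<lbrakk>cod2 B s = dom2 B s'; cod2 B t = dom2 B t'; trg B (dom2 B s) = src B (dom2 B t)\<rbrakk>
          \<Longrightarrow> (t' \<odot> t) \<star> (s' \<odot> s) = (t' \<star> s') \<odot> (t \<star> s)"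

locale gray_monoid = two_category +
  assumes lw1_hom: "f \<in> hom1 B X Y \<Longrightarrow> A \<rhd>\<^sub>1 f \<in> hom1 B (A \<otimes>\<^sub>0 X) (A \<otimes>\<^sub>0 Y)"
    and lw2_hom: "t \<in> hom2 B f g \<Longrightarrow> A \<rhd>\<^sub>2 t \<in> hom2 B (A \<rhd>\<^sub>1 f) (A \<rhd>\<^sub>1 g)"
    and lw1_id: "A \<rhd>\<^sub>1 \<one> X = \<one> (A \<otimes>\<^sub>0 X)"
    and lw1_comp: "trg B f = src B g \<Longrightarrow> A \<rhd>\<^sub>1 (g \<cdot> f) = (A \<rhd>\<^sub>1 g) \<cdot> (A \<rhd>\<^sub>1 f)"
    and lw2_id: "A \<rhd>\<^sub>2 \<langle>f\<rangle> = \<langle>A \<rhd>\<^sub>1 f\<rangle>"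
    and lw2_vcomp: "cod2 B s = dom2 B t \<Longrightarrow> A \<rhd>\<^sub>2 (t \<odot> s) = (A \<rhd>\<^sub>2 t) \<odot> (A \<rhd>\<^sub>2 s)"
    and lw2_hcomp: "trg B (dom2 B s) = src B (dom2 B t) \<Longrightarrow> A \<rhd>\<^sub>2 (t \<star> s) = (A \<rhd>\<^sub>2 t) \<star> (A \<rhd>\<^sub>2 s)"
    and rw1_hom: "f \<in> hom1 B X Y \<Longrightarrow> f \<lhd>\<^sub>1 A \<in> hom1 B (X \<otimes>\<^sub>0 A) (Y \<otimes>\<^sub>0 A)"
    and rw2_hom: "t \<in> hom2 B f g \<Longrightarrow> t \<lhd>\<^sub>2 A \<in> hom2 B (f \<lhd>\<^sub>1 A) (g \<lhd>\<^sub>1 A)"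
    and rw1_id: "\<one> X \<lhd>\<^sub>1 A = \<one> (X \<otimes>\<^sub>0 A)"
    and rw1_comp: "trg B f = src B g \<Longrightarrow> (g \<cdot> f) \<lhd>\<^sub>1 A = (g \<lhd>\<^sub>1 A) \<cdot> (f \<lhd>\<^sub>1 A)"
    and rw2_id: "\<langle>f\<rangle> \<lhd>\<^sub>2 A = \<langle>f \<lhd>\<^sub>1 A\<rangle>"
    and rw2_vcomp: "cod2 B s = dom2 B t \<Longrightarrow> (t \<odot> s) \<lhd>\<^sub>2 A = (t \<lhd>\<^sub>2 A) \<odot> (s \<lhd>\<^sub>2 A)"
    and rw2_hcomp: "trg B (dom2 B s) = src B (dom2 B t) \<Longrightarrow> (t \<star> s) \<lhd>\<^sub>2 A = (t \<lhd>\<^sub>2 A) \<star> (s \<lhd>\<^sub>2 A)"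
  assumes ten0_assoc: "(X \<otimes>\<^sub>0 Y) \<otimes>\<^sub>0 Z = X \<otimes>\<^sub>0 (Y \<otimes>\<^sub>0 Z)"
    and ten0_unit_left: "\<I> \<otimes>\<^sub>0 X = X"
    and ten0_unit_right: "X \<otimes>\<^sub>0 \<I> = X"
    and lw1_unit: "\<I> \<rhd>\<^sub>1 f = f"
    and lw2_unit: "\<I> \<rhd>\<^sub>2 t = t"
    and rw1_unit: "f \<lhd>\<^sub>1 \<I> = f"
    and rw2_unit: "t \<lhd>\<^sub>2 \<I> = t"
    and lw1_ten: "(X \<otimes>\<^sub>0 Y) \<rhd>\<^sub>1 f = X \<rhd>\<^sub>1 (Y \<rhd>\<^sub>1 f)"
    and lw2_ten: "(X \<otimes>\<^sub>0 Y) \<rhd>\<^sub>2 t = X \<rhd>\<^sub>2 (Y \<rhd>\<^sub>2 t)"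
    and rw1_ten: "f \<lhd>\<^sub>1 (X \<otimes>\<^sub>0 Y) = (f \<lhd>\<^sub>1 X) \<lhd>\<^sub>1 Y"
    and rw2_ten: "t \<lhd>\<^sub>2 (X \<otimes>\<^sub>0 Y) = (t \<lhd>\<^sub>2 X) \<lhd>\<^sub>2 Y"
    and lw1_rw1: "(X \<rhd>\<^sub>1 f) \<lhd>\<^sub>1 Y = X \<rhd>\<^sub>1 (f \<lhd>\<^sub>1 Y)"
    and lw2_rw2: "(X \<rhd>\<^sub>2 t) \<lhd>\<^sub>2 Y = X \<rhd>\<^sub>2 (t \<lhd>\<^sub>2 Y)"
  assumes intch_hom: "\<lbrakk>f \<in> hom1 B X X'; g \<in> hom1 B Y Y'\<rbrakk> \<Longrightarrow>
          \<chi> f g \<in> hom2 B ((f \<lhd>\<^sub>1 Y') \<cdot> (X \<rhd>\<^sub>1 g)) ((X' \<rhd>\<^sub>1 g) \<cdot> (f \<lhd>\<^sub>1 Y))"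
    and intch_iso: "iso2 B (\<chi> f g)"
    and intch_natural: "\<lbrakk>s \<in> hom2 B f f'; t \<in> hom2 B g g';
            f \<in> hom1 B X X'; g \<in> hom1 B Y Y'\<rbrakk> \<Longrightarrow>
          \<chi> f' g' \<odot> ((s \<lhd>\<^sub>2 Y') \<star> (X \<rhd>\<^sub>2 t)) = ((X' \<rhd>\<^sub>2 t) \<star> (s \<lhd>\<^sub>2 Y)) \<odot> \<chi> f g"
    and intch_id_left: "\<chi> (\<one> X) g = \<langle>X \<rhd>\<^sub>1 g\<rangle>"
    and intch_id_right: "\<chi> f (\<one> Y) = \<langle>f \<lhd>\<^sub>1 Y\<rangle>"
    and intch_comp_left: "\<lbrakk>f \<in> hom1 B X X'; f' \<in> hom1 B X' X''; g \<in> hom1 B Y Y'\<rbrakk> \<Longrightarrow>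
          \<chi> (f' \<cdot> f) g = (\<chi> f' g \<star> \<langle>f \<lhd>\<^sub>1 Y\<rangle>) \<odot> (\<langle>f' \<lhd>\<^sub>1 Y'\<rangle> \<star> \<chi> f g)"
    and intch_comp_right: "\<lbrakk>f \<in> hom1 B X X'; g \<in> hom1 B Y Y'; g' \<in> hom1 B Y' Y''\<rbrakk> \<Longrightarrow>
          \<chi> f (g' \<cdot> g) = (\<langle>X' \<rhd>\<^sub>1 g'\<rangle> \<star> \<chi> f g) \<odot> (\<chi> f g' \<star> \<langle>X \<rhd>\<^sub>1 g\<rangle>)"
    and intch_lw: "\<chi> (A \<rhd>\<^sub>1 f) g = A \<rhd>\<^sub>2 \<chi> f g"
    and intch_mid: "\<chi> (f \<lhd>\<^sub>1 A) g = \<chi> f (A \<rhd>\<^sub>1 g)"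
    and intch_rw: "\<chi> f (g \<lhd>\<^sub>1 A) = \<chi> f g \<lhd>\<^sub>2 A"


section \<open>Naturally Frobenius map monoidales\<close>

text \<open>A Gray monoid together with an object \<open>\<M>\<close>, a multiplication \<open>\<m>\<close> and unit \<open>\<u>\<close>, the
  associativity and unit 2-cells \<open>\<a>\<close>, \<open>\<l>\<close>, \<open>\<r>\<close>, and right adjoints of \<open>\<m>\<close> and \<open>\<u>\<close>.\<close>

record ('o, 'f, 't) monoidale = "('o, 'f, 't) gray" +
  car :: "'o" ("\<M>\<index>")
  mul :: "'f" ("\<m>\<index>")
  unt :: "'f" ("\<u>\<index>")
  asc :: "'t" ("\<a>\<index>")
  lun :: "'t" ("\<l>\<index>")
  run :: "'t" ("\<r>\<index>")
  mul_adj :: "'f" ("\<m>\<^sup>*\<index>")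
  unt_adj :: "'f" ("\<u>\<^sup>*\<index>")
  eta_m :: "'t" ("\<eta>\<^sub>m\<index>")
  eps_m :: "'t" ("\<epsilon>\<^sub>m\<index>")
  eta_u :: "'t" ("\<eta>\<^sub>u\<index>")
  eps_u :: "'t" ("\<epsilon>\<^sub>u\<index>")

locale map_monoidale = gray_monoid B
  for B :: "('o, 'f, 't, 'z) monoidale_scheme" (structure) +
  assumes mul_hom: "\<m> \<in> hom1 B (\<M> \<otimes>\<^sub>0 \<M>) \<M>"
    and unt_hom: "\<u> \<in> hom1 B \<I> \<M>"
    and asc_hom: "\<a> \<in> hom2 B (\<m> \<cdot> (\<m> \<lhd>\<^sub>1 \<M>)) (\<m> \<cdot> (\<M> \<rhd>\<^sub>1 \<m>))"
    and lun_hom: "\<l> \<in> hom2 B (\<m> \<cdot> (\<u> \<lhd>\<^sub>1 \<M>)) (\<one> \<M>)"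
    and run_hom: "\<r> \<in> hom2 B (\<m> \<cdot> (\<M> \<rhd>\<^sub>1 \<u>)) (\<one> \<M>)"
    and asc_iso: "iso2 B \<a>"
    and lun_iso: "iso2 B \<l>"
    and run_iso: "iso2 B \<r>"
    and pentagon:
      "(\<a> \<star> \<langle>(\<M> \<otimes>\<^sub>0 \<M>) \<rhd>\<^sub>1 \<m>\<rangle>)
         \<odot> (\<langle>\<m>\<rangle> \<star> inv2 B (\<chi> \<m> \<m>))
         \<odot> (\<a> \<star> \<langle>\<m> \<lhd>\<^sub>1 (\<M> \<otimes>\<^sub>0 \<M>)\<rangle>)
       = (\<langle>\<m>\<rangle> \<star> (\<M> \<rhd>\<^sub>2 \<a>))
         \<odot> (\<a> \<star> \<langle>\<M> \<rhd>\<^sub>1 \<m> \<lhd>\<^sub>1 \<M>\<rangle>)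
         \<odot> (\<langle>\<m>\<rangle> \<star> (\<a> \<lhd>\<^sub>2 \<M>))"
    and triangle:
      "(\<langle>\<m>\<rangle> \<star> (\<M> \<rhd>\<^sub>2 \<l>)) \<odot> (\<a> \<star> \<langle>\<M> \<rhd>\<^sub>1 \<u> \<lhd>\<^sub>1 \<M>\<rangle>) = \<langle>\<m>\<rangle> \<star> (\<r> \<lhd>\<^sub>2 \<M>)"
    and mul_adjunction: "adjunction B \<m> \<m>\<^sup>* \<eta>\<^sub>m \<epsilon>\<^sub>m"
    and unt_adjunction: "adjunction B \<u> \<u>\<^sup>* \<eta>\<^sub>u \<epsilon>\<^sub>u"

context
  fixes B :: "('o, 'f, 't, 'z) monoidale_scheme" (structure)
begin

definition frob_left :: "'t" where
  "frob_left = (\<langle>\<m>\<^sup>* \<cdot> \<m>\<rangle> \<star> (\<M> \<rhd>\<^sub>2 \<epsilon>\<^sub>m))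
     \<odot> (\<langle>\<m>\<^sup>*\<rangle> \<star> \<a> \<star> \<langle>\<M> \<rhd>\<^sub>1 \<m>\<^sup>*\<rangle>)
     \<odot> (\<eta>\<^sub>m \<star> \<langle>(\<m> \<lhd>\<^sub>1 \<M>) \<cdot> (\<M> \<rhd>\<^sub>1 \<m>\<^sup>*)\<rangle>)"

definition frob_right :: "'t" where
  "frob_right = (\<langle>\<m>\<^sup>* \<cdot> \<m>\<rangle> \<star> (\<epsilon>\<^sub>m \<lhd>\<^sub>2 \<M>))
     \<odot> (\<langle>\<m>\<^sup>*\<rangle> \<star> inv2 B \<a> \<star> \<langle>\<m>\<^sup>* \<lhd>\<^sub>1 \<M>\<rangle>)
     \<odot> (\<eta>\<^sub>m \<star> \<langle>(\<M> \<rhd>\<^sub>1 \<m>) \<cdot> (\<m>\<^sup>* \<lhd>\<^sub>1 \<M>)\<rangle>)"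

definition naturally_frobenius_map_monoidale :: "bool" where
  "naturally_frobenius_map_monoidale \<longleftrightarrow>
     map_monoidale B \<and> iso2 B frob_left \<and> iso2 B frob_right"

text \<open>The pseudo-comonoid structure on \<open>(\<M>, \<m>\<^sup>*, \<u>\<^sup>*)\<close>: mates of the inverses of \<open>\<a>\<close>, \<open>\<l>\<close>, \<open>\<r>\<close>
  with respect to the composite adjunctions.
  \<open>coasc : (\<m>\<^sup>* \<lhd> \<M>) \<cdot> \<m>\<^sup>* \<Rightarrow> (\<M> \<rhd> \<m>\<^sup>*) \<cdot> \<m>\<^sup>*\<close>,
  \<open>colun : (\<u>\<^sup>* \<lhd> \<M>) \<cdot> \<m>\<^sup>* \<Rightarrow> \<one> \<M>\<close> and \<open>corun : (\<M> \<rhd> \<u>\<^sup>*) \<cdot> \<m>\<^sup>* \<Rightarrow> \<one> \<M>\<close>.\<close>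

definition coasc :: "'t" where
  "coasc = mate B
     ((\<langle>\<M> \<rhd>\<^sub>1 \<m>\<^sup>*\<rangle> \<star> \<eta>\<^sub>m \<star> \<langle>\<M> \<rhd>\<^sub>1 \<m>\<rangle>) \<odot> (\<M> \<rhd>\<^sub>2 \<eta>\<^sub>m)) ((\<M> \<rhd>\<^sub>1 \<m>\<^sup>*) \<cdot> \<m>\<^sup>*)
     (inv2 B \<a>)
     ((\<m>\<^sup>* \<lhd>\<^sub>1 \<M>) \<cdot> \<m>\<^sup>*) (\<epsilon>\<^sub>m \<odot> (\<langle>\<m>\<rangle> \<star> (\<epsilon>\<^sub>m \<lhd>\<^sub>2 \<M>) \<star> \<langle>\<m>\<^sup>*\<rangle>))"

definition colun :: "'t" where
  "colun = mate B \<langle>\<one> \<M>\<rangle> (\<one> \<M>) (inv2 B \<l>)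
     ((\<u>\<^sup>* \<lhd>\<^sub>1 \<M>) \<cdot> \<m>\<^sup>*) (\<epsilon>\<^sub>m \<odot> (\<langle>\<m>\<rangle> \<star> (\<epsilon>\<^sub>u \<lhd>\<^sub>2 \<M>) \<star> \<langle>\<m>\<^sup>*\<rangle>))"

definition corun :: "'t" where
  "corun = mate B \<langle>\<one> \<M>\<rangle> (\<one> \<M>) (inv2 B \<r>)
     ((\<M> \<rhd>\<^sub>1 \<u>\<^sup>*) \<cdot> \<m>\<^sup>*) (\<epsilon>\<^sub>m \<odot> (\<langle>\<m>\<rangle> \<star> (\<M> \<rhd>\<^sub>2 \<epsilon>\<^sub>u) \<star> \<langle>\<m>\<^sup>*\<rangle>))"


section \<open>The duoidal category of endo-1-cells\<close>

text \<open>The category \<open>B(\<M>, \<M>)\<close> has the elements of \<open>hom1 B \<M> \<M>\<close> as objects, the sets \<open>hom2 B f g\<close>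
  as hom sets and \<open>\<odot>\<close> as composition.  Its first product \<open>f \<circ> g = g \<cdot> f\<close> is strictly associative and
  unital; its second product is \<open>\<bullet>\<close>.\<close>

definition bul1 :: "'f \<Rightarrow> 'f \<Rightarrow> 'f" where
  "bul1 f g = \<m> \<cdot> (f \<otimes>\<^sub>1 g) \<cdot> \<m>\<^sup>*"

definition bul2 :: "'t \<Rightarrow> 't \<Rightarrow> 't" where
  "bul2 s t = \<langle>\<m>\<rangle> \<star> (s \<otimes>\<^sub>2 t) \<star> \<langle>\<m>\<^sup>*\<rangle>"

definition cir1 :: "'f \<Rightarrow> 'f \<Rightarrow> 'f" where
  "cir1 f g = g \<cdot> f"

definition cir2 :: "'t \<Rightarrow> 't \<Rightarrow> 't" where
  "cir2 s t = t \<star> s"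

definition iobj :: "'f" where
  "iobj = \<one> \<M>"

definition jobj :: "'f" where
  "jobj = \<u> \<cdot> \<u>\<^sup>*"

end

notation bul1 (infixr "\<bullet>\<^sub>1\<index>" 72)
notation bul2 (infixr "\<bullet>\<^sub>2\<index>" 72)
notation cir1 (infixr "\<circ>\<^sub>1\<index>" 72)
notation cir2 (infixr "\<circ>\<^sub>2\<index>" 72)
notation iobj ("\<i>\<index>")
notation jobj ("\<j>\<index>")

context
  fixes B :: "('o, 'f, 't, 'z) monoidale_scheme" (structure)
begin

text \<open>The coherence isomorphisms of \<open>\<bullet>\<close>, assembled from interchangers and the structure 2-cells of
  \<open>\<M>\<close>: \<open>bul_asc a b c : (a \<bullet> b) \<bullet> c \<Rightarrow> a \<bullet> (b \<bullet> c)\<close>, \<open>bul_lun a : \<j> \<bullet> a \<Rightarrow> a\<close> and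
  \<open>bul_run a : a \<bullet> \<j> \<Rightarrow> a\<close>.\<close>

definition bul_asc :: "'f \<Rightarrow> 'f \<Rightarrow> 'f \<Rightarrow> 't" where
  "bul_asc a b c =
     (\<langle>\<m>\<rangle> \<star> inv2 B (\<chi> a \<m>) \<star> \<langle>(\<M> \<rhd>\<^sub>1 (b \<otimes>\<^sub>1 c)) \<cdot> (\<M> \<rhd>\<^sub>1 \<m>\<^sup>*) \<cdot> \<m>\<^sup>*\<rangle>)
     \<odot> (\<a> \<star> \<langle>a \<otimes>\<^sub>1 b \<otimes>\<^sub>1 c\<rangle> \<star> coasc B)
     \<odot> (\<langle>\<m> \<cdot> (\<m> \<lhd>\<^sub>1 \<M>) \<cdot> ((a \<otimes>\<^sub>1 b) \<lhd>\<^sub>1 \<M>)\<rangle> \<star> \<chi> \<m>\<^sup>* c \<star> \<langle>\<m>\<^sup>*\<rangle>)"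

definition bul_lun :: "'f \<Rightarrow> 't" where
  "bul_lun a = (\<l> \<star> \<langle>a\<rangle> \<star> colun B) \<odot> (\<langle>\<m> \<cdot> (\<u> \<lhd>\<^sub>1 \<M>)\<rangle> \<star> \<chi> \<u>\<^sup>* a \<star> \<langle>\<m>\<^sup>*\<rangle>)"

definition bul_run :: "'f \<Rightarrow> 't" where
  "bul_run a = (\<r> \<star> \<langle>a\<rangle> \<star> corun B) \<odot> (\<langle>\<m>\<rangle> \<star> \<chi> a \<u> \<star> \<langle>(\<M> \<rhd>\<^sub>1 \<u>\<^sup>*) \<cdot> \<m>\<^sup>*\<rangle>)"

text \<open>The duoidal structure morphisms \<open>\<xi>\<^sub>0 : \<i> \<bullet> \<i> \<Rightarrow> \<i>\<close>, \<open>\<xi>\<^sup>0\<^sub>0 : \<j> \<Rightarrow> \<i>\<close>, \<open>\<xi>\<^sup>0 : \<j> \<Rightarrow> \<j> \<circ> \<j>\<close> and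
  \<open>\<xi> : (a \<circ> b) \<bullet> (c \<circ> d) \<Rightarrow> (a \<bullet> c) \<circ> (b \<bullet> d)\<close>.\<close>

definition xi_mult :: "'t" where
  "xi_mult = \<epsilon>\<^sub>m"

definition xi_unit :: "'t" where
  "xi_unit = \<epsilon>\<^sub>u"

definition xi_comult :: "'t" where
  "xi_comult = \<langle>\<u>\<rangle> \<star> \<eta>\<^sub>u \<star> \<langle>\<u>\<^sup>*\<rangle>"

definition xi :: "'f \<Rightarrow> 'f \<Rightarrow> 'f \<Rightarrow> 'f \<Rightarrow> 't" where
  "xi a b c d = (\<langle>\<m> \<cdot> (b \<otimes>\<^sub>1 d)\<rangle> \<star> \<eta>\<^sub>m \<star> \<langle>(a \<otimes>\<^sub>1 c) \<cdot> \<m>\<^sup>*\<rangle>)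
     \<odot> (\<langle>\<m> \<cdot> (b \<lhd>\<^sub>1 \<M>)\<rangle> \<star> \<chi> a d \<star> \<langle>(\<M> \<rhd>\<^sub>1 c) \<cdot> \<m>\<^sup>*\<rangle>)"


section \<open>Monoids, modules and bimodules for the product \<open>\<bullet>\<close>\<close>

definition bul_monoid :: "'f \<Rightarrow> 't \<Rightarrow> 't \<Rightarrow> bool" where
  "bul_monoid a \<mu> \<eta> \<longleftrightarrow>
     a \<in> hom1 B \<M> \<M> \<and> \<mu> \<in> hom2 B (a \<bullet>\<^sub>1 a) a \<and> \<eta> \<in> hom2 B \<j> a \<and>
     \<mu> \<odot> (\<mu> \<bullet>\<^sub>2 \<langle>a\<rangle>) = \<mu> \<odot> (\<langle>a\<rangle> \<bullet>\<^sub>2 \<mu>) \<odot> bul_asc a a a \<and>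
     \<mu> \<odot> (\<eta> \<bullet>\<^sub>2 \<langle>a\<rangle>) = bul_lun a \<and>
     \<mu> \<odot> (\<langle>a\<rangle> \<bullet>\<^sub>2 \<eta>) = bul_run a"

definition left_module :: "'f \<Rightarrow> 't \<Rightarrow> 't \<Rightarrow> 'f \<Rightarrow> 't \<Rightarrow> bool" where
  "left_module a \<mu> \<eta> x l \<longleftrightarrow>
     x \<in> hom1 B \<M> \<M> \<and> l \<in> hom2 B (a \<bullet>\<^sub>1 x) x \<and>
     l \<odot> (\<mu> \<bullet>\<^sub>2 \<langle>x\<rangle>) = l \<odot> (\<langle>a\<rangle> \<bullet>\<^sub>2 l) \<odot> bul_asc a a x \<and>
     l \<odot> (\<eta> \<bullet>\<^sub>2 \<langle>x\<rangle>) = bul_lun x"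

definition right_module :: "'f \<Rightarrow> 't \<Rightarrow> 't \<Rightarrow> 'f \<Rightarrow> 't \<Rightarrow> bool" where
  "right_module a \<mu> \<eta> x r \<longleftrightarrow>
     x \<in> hom1 B \<M> \<M> \<and> r \<in> hom2 B (x \<bullet>\<^sub>1 a) x \<and>
     r \<odot> (r \<bullet>\<^sub>2 \<langle>a\<rangle>) = r \<odot> (\<langle>x\<rangle> \<bullet>\<^sub>2 \<mu>) \<odot> bul_asc x a a \<and>
     r \<odot> (\<langle>x\<rangle> \<bullet>\<^sub>2 \<eta>) = bul_run x"

definition left_module_hom :: "'f \<Rightarrow> 'f \<Rightarrow> 't \<Rightarrow> 'f \<Rightarrow> 't \<Rightarrow> 't \<Rightarrow> bool" where
  "left_module_hom a x l y l' t \<longleftrightarrow>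
     t \<in> hom2 B x y \<and> t \<odot> l = l' \<odot> (\<langle>a\<rangle> \<bullet>\<^sub>2 t)"

definition right_module_hom :: "'f \<Rightarrow> 'f \<Rightarrow> 't \<Rightarrow> 'f \<Rightarrow> 't \<Rightarrow> 't \<Rightarrow> bool" where
  "right_module_hom a x r y r' t \<longleftrightarrow>
     t \<in> hom2 B x y \<and> t \<odot> r = r' \<odot> (t \<bullet>\<^sub>2 \<langle>a\<rangle>)"

definition left_module_cat :: "'f \<Rightarrow> 't \<Rightarrow> 't \<Rightarrow> ('f \<times> 't, 't) cat" where
  "left_module_cat a \<mu> \<eta> =
     \<lparr> Ob = {(x, l). left_module a \<mu> \<eta> x l},
       Hom = (\<lambda>(x, l) (y, l'). {t. left_module_hom a x l y l' t}),
       Idn = (\<lambda>(x, l). \<langle>x\<rangle>),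
       Comp = (\<lambda>t s. t \<odot> s) \<rparr>"

definition right_module_cat :: "'f \<Rightarrow> 't \<Rightarrow> 't \<Rightarrow> ('f \<times> 't, 't) cat" where
  "right_module_cat a \<mu> \<eta> =
     \<lparr> Ob = {(x, r). right_module a \<mu> \<eta> x r},
       Hom = (\<lambda>(x, r) (y, r'). {t. right_module_hom a x r y r' t}),
       Idn = (\<lambda>(x, r). \<langle>x\<rangle>),
       Comp = (\<lambda>t s. t \<odot> s) \<rparr>"

text \<open>Bimodules with a left action \<open>l\<close> of the monoid \<open>(a, \<mu>, \<eta>)\<close> and a right action \<open>r\<close> of the
  monoid \<open>(b, \<nu>, \<iota>)\<close>.\<close>

definition bimodule ::
  "'f \<Rightarrow> 't \<Rightarrow> 't \<Rightarrow> 'f \<Rightarrow> 't \<Rightarrow> 't \<Rightarrow> 'f \<Rightarrow> 't \<Rightarrow> 't \<Rightarrow> bool" where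
  "bimodule a \<mu> \<eta> b \<nu> \<iota> x l r \<longleftrightarrow>
     left_module a \<mu> \<eta> x l \<and> right_module b \<nu> \<iota> x r \<and>
     r \<odot> (l \<bullet>\<^sub>2 \<langle>b\<rangle>) = l \<odot> (\<langle>a\<rangle> \<bullet>\<^sub>2 r) \<odot> bul_asc a x b"

definition bimodule_cat ::
  "'f \<Rightarrow> 't \<Rightarrow> 't \<Rightarrow> 'f \<Rightarrow> 't \<Rightarrow> 't \<Rightarrow> ('f \<times> 't \<times> 't, 't) cat" where
  "bimodule_cat a \<mu> \<eta> b \<nu> \<iota> =
     \<lparr> Ob = {(x, l, r). bimodule a \<mu> \<eta> b \<nu> \<iota> x l r},
       Hom = (\<lambda>(x, l, r) (y, l', r').
         {t. left_module_hom a x l y l' t \<and> right_module_hom b x r y r' t}),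
       Idn = (\<lambda>(x, l, r). \<langle>x\<rangle>),
       Comp = (\<lambda>t s. t \<odot> s) \<rparr>"

definition free_left_action :: "'f \<Rightarrow> 't \<Rightarrow> 'f \<Rightarrow> 't" where
  "free_left_action a \<mu> x = (\<mu> \<bullet>\<^sub>2 \<langle>x\<rangle>) \<odot> inv2 B (bul_asc a a x)"

definition free_right_action :: "'f \<Rightarrow> 't \<Rightarrow> 'f \<Rightarrow> 't" where
  "free_right_action a \<mu> x = (\<langle>x\<rangle> \<bullet>\<^sub>2 \<mu>) \<odot> bul_asc x a a"

definition separable_monoid :: "'f \<Rightarrow> 't \<Rightarrow> 't \<Rightarrow> bool" where
  "separable_monoid a \<mu> \<eta> \<longleftrightarrow> bul_monoid a \<mu> \<eta> \<and>
     (\<exists>s. left_module_hom a a \<mu> (a \<bullet>\<^sub>1 a) (free_left_action a \<mu> a) s \<and>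
          right_module_hom a a \<mu> (a \<bullet>\<^sub>1 a) (free_right_action a \<mu> a) s \<and>
          \<mu> \<odot> s = \<langle>a\<rangle>)"


section \<open>Bimonoids, Hopf monoids and integrals\<close>

definition bimonoid :: "'f \<Rightarrow> 't \<Rightarrow> 't \<Rightarrow> 't \<Rightarrow> 't \<Rightarrow> bool" where
  "bimonoid a \<mu> \<eta> \<delta> \<epsilon> \<longleftrightarrow>
     bul_monoid a \<mu> \<eta> \<and>
     \<delta> \<in> hom2 B a (a \<circ>\<^sub>1 a) \<and> \<epsilon> \<in> hom2 B a \<i> \<and>
     (\<delta> \<circ>\<^sub>2 \<langle>a\<rangle>) \<odot> \<delta> = (\<langle>a\<rangle> \<circ>\<^sub>2 \<delta>) \<odot> \<delta> \<and>
     (\<epsilon> \<circ>\<^sub>2 \<langle>a\<rangle>) \<odot> \<delta> = \<langle>a\<rangle> \<and>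
     (\<langle>a\<rangle> \<circ>\<^sub>2 \<epsilon>) \<odot> \<delta> = \<langle>a\<rangle> \<and>
     \<delta> \<odot> \<mu> = (\<mu> \<circ>\<^sub>2 \<mu>) \<odot> xi a a a a \<odot> (\<delta> \<bullet>\<^sub>2 \<delta>) \<and>
     \<epsilon> \<odot> \<mu> = xi_mult \<odot> (\<epsilon> \<bullet>\<^sub>2 \<epsilon>) \<and>
     \<delta> \<odot> \<eta> = (\<eta> \<circ>\<^sub>2 \<eta>) \<odot> xi_comult \<and>
     \<epsilon> \<odot> \<eta> = xi_unit"

definition rev1 :: "'f \<Rightarrow> 'f" where
  "rev1 b = (\<u>\<^sup>* \<lhd>\<^sub>1 \<M>) \<cdot> (\<m> \<lhd>\<^sub>1 \<M>) \<cdot> (\<M> \<rhd>\<^sub>1 b \<lhd>\<^sub>1 \<M>) \<cdot> (\<M> \<rhd>\<^sub>1 \<m>\<^sup>*) \<cdot> (\<M> \<rhd>\<^sub>1 \<u>)"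

text \<open>The 2-cells \<open>\<alpha> : \<u>\<^sup>* \<lhd> \<M> \<Rightarrow> \<m>\<close> and \<open>\<beta> : \<M> \<rhd> \<u> \<Rightarrow> \<m>\<^sup>*\<close>.\<close>

definition alpha :: "'t" where
  "alpha = (colun B \<star> \<langle>\<m>\<rangle>) \<odot> (\<langle>\<u>\<^sup>* \<lhd>\<^sub>1 \<M>\<rangle> \<star> \<eta>\<^sub>m)"

definition beta :: "'t" where
  "beta = (\<langle>\<m>\<^sup>*\<rangle> \<star> \<r>) \<odot> (\<eta>\<^sub>m \<star> \<langle>\<M> \<rhd>\<^sub>1 \<u>\<rangle>)"

text \<open>\<open>phi b c : b \<circ> rev1 c \<Rightarrow> ((b \<bullet> c) \<circ> \<j>) \<bullet> \<i>\<close>.  The first factor to be applied (written last)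
  is the interchange isomorphism moving \<open>b\<close> past \<open>(c \<lhd> \<M>) \<cdot> \<m>\<^sup>* \<cdot> \<u>\<close>; the last one uses
  \<open>\<m> \<cdot> (\<u> \<lhd> \<M>) \<cong> \<one> \<M>\<close>.  The 2-cell \<open>psi b c : rev1 b \<circ> c \<Rightarrow> \<i> \<bullet> (\<j> \<circ> (b \<bullet> c))\<close> is analogous.\<close>

definition phi :: "'f \<Rightarrow> 'f \<Rightarrow> 't" where
  "phi b c =
     (inv2 B \<l> \<star> \<langle>(\<u>\<^sup>* \<lhd>\<^sub>1 \<M>) \<cdot> (\<m> \<lhd>\<^sub>1 \<M>) \<cdot> ((b \<otimes>\<^sub>1 c) \<lhd>\<^sub>1 \<M>) \<cdot> (\<m>\<^sup>* \<lhd>\<^sub>1 \<M>) \<cdot> \<m>\<^sup>*\<rangle>)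
     \<odot> (\<langle>(\<u>\<^sup>* \<lhd>\<^sub>1 \<M>) \<cdot> (\<m> \<lhd>\<^sub>1 \<M>) \<cdot> ((b \<otimes>\<^sub>1 c) \<lhd>\<^sub>1 \<M>)\<rangle> \<star> inv2 B (coasc B))
     \<odot> (\<langle>(\<u>\<^sup>* \<lhd>\<^sub>1 \<M>) \<cdot> (\<m> \<lhd>\<^sub>1 \<M>) \<cdot> ((b \<otimes>\<^sub>1 c) \<lhd>\<^sub>1 \<M>) \<cdot> (\<M> \<rhd>\<^sub>1 \<m>\<^sup>*)\<rangle> \<star> beta)
     \<odot> (\<langle>(\<u>\<^sup>* \<lhd>\<^sub>1 \<M>) \<cdot> (\<m> \<lhd>\<^sub>1 \<M>)\<rangle> \<star> inv2 B (\<chi> b ((c \<lhd>\<^sub>1 \<M>) \<cdot> \<m>\<^sup>* \<cdot> \<u>)))"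

definition psi :: "'f \<Rightarrow> 'f \<Rightarrow> 't" where
  "psi b c =
     (\<langle>\<m> \<cdot> (\<M> \<rhd>\<^sub>1 \<m>) \<cdot> (\<M> \<rhd>\<^sub>1 (b \<otimes>\<^sub>1 c)) \<cdot> (\<M> \<rhd>\<^sub>1 \<m>\<^sup>*) \<cdot> (\<M> \<rhd>\<^sub>1 \<u>)\<rangle> \<star> inv2 B (corun B))
     \<odot> (\<a> \<star> \<langle>(\<M> \<rhd>\<^sub>1 (b \<otimes>\<^sub>1 c)) \<cdot> (\<M> \<rhd>\<^sub>1 \<m>\<^sup>*) \<cdot> (\<M> \<rhd>\<^sub>1 \<u>)\<rangle>)
     \<odot> (alpha \<star> \<langle>(\<m> \<lhd>\<^sub>1 \<M>) \<cdot> (\<M> \<rhd>\<^sub>1 (b \<otimes>\<^sub>1 c)) \<cdot> (\<M> \<rhd>\<^sub>1 \<m>\<^sup>*) \<cdot> (\<M> \<rhd>\<^sub>1 \<u>)\<rangle>)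
     \<odot> (inv2 B (\<chi> (\<u>\<^sup>* \<cdot> \<m> \<cdot> (\<M> \<rhd>\<^sub>1 b)) c) \<star> \<langle>(\<M> \<rhd>\<^sub>1 \<m>\<^sup>*) \<cdot> (\<M> \<rhd>\<^sub>1 \<u>)\<rangle>)"

text \<open>In the antipode axioms the identifications \<open>\<i> = \<j> \<bullet> \<i>\<close> and \<open>\<i> = \<i> \<bullet> \<j>\<close> are made explicit.\<close>

definition hopf_monoid :: "'f \<Rightarrow> 't \<Rightarrow> 't \<Rightarrow> 't \<Rightarrow> 't \<Rightarrow> 't \<Rightarrow> bool" where
  "hopf_monoid a \<mu> \<eta> \<delta> \<epsilon> \<sigma> \<longleftrightarrow>
     bimonoid a \<mu> \<eta> \<delta> \<epsilon> \<and> \<sigma> \<in> hom2 B a (rev1 a) \<and>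
     ((\<mu> \<circ>\<^sub>2 \<langle>\<j>\<rangle>) \<bullet>\<^sub>2 \<langle>\<i>\<rangle>) \<odot> phi a a \<odot> (\<langle>a\<rangle> \<circ>\<^sub>2 \<sigma>) \<odot> \<delta>
       = (((\<eta> \<circ>\<^sub>2 \<langle>\<j>\<rangle>) \<odot> xi_comult) \<bullet>\<^sub>2 \<langle>\<i>\<rangle>) \<odot> inv2 B (bul_lun \<i>) \<odot> \<epsilon> \<and>
     (\<langle>\<i>\<rangle> \<bullet>\<^sub>2 (\<langle>\<j>\<rangle> \<circ>\<^sub>2 \<mu>)) \<odot> psi a a \<odot> (\<sigma> \<circ>\<^sub>2 \<langle>a\<rangle>) \<odot> \<delta>
       = (\<langle>\<i>\<rangle> \<bullet>\<^sub>2 ((\<langle>\<j>\<rangle> \<circ>\<^sub>2 \<eta>) \<odot> xi_comult)) \<odot> inv2 B (bul_run \<i>) \<odot> \<epsilon>"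

text \<open>For the integrals, \<open>\<i>\<close> is an \<open>a\<close>-module by restriction along \<open>\<epsilon>\<close>.\<close>

definition left_integral :: "'f \<Rightarrow> 't \<Rightarrow> 't \<Rightarrow> 't \<Rightarrow> bool" where
  "left_integral a \<mu> \<epsilon> \<theta> \<longleftrightarrow>
     left_module_hom a \<i> (xi_mult \<odot> (\<epsilon> \<bullet>\<^sub>2 \<langle>\<i>\<rangle>)) (a \<bullet>\<^sub>1 \<i>) (free_left_action a \<mu> \<i>) \<theta> \<and>
     right_module_hom \<i> \<i> xi_mult (a \<bullet>\<^sub>1 \<i>) (free_right_action \<i> xi_mult a) \<theta>"

definition normalized_left_integral :: "'f \<Rightarrow> 't \<Rightarrow> 't \<Rightarrow> 't \<Rightarrow> bool" where
  "normalized_left_integral a \<mu> \<epsilon> \<theta> \<longleftrightarrow>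
     left_integral a \<mu> \<epsilon> \<theta> \<and> xi_mult \<odot> (\<epsilon> \<bullet>\<^sub>2 \<langle>\<i>\<rangle>) \<odot> \<theta> = \<langle>\<i>\<rangle>"

definition right_integral :: "'f \<Rightarrow> 't \<Rightarrow> 't \<Rightarrow> 't \<Rightarrow> bool" where
  "right_integral a \<mu> \<epsilon> \<theta> \<longleftrightarrow>
     right_module_hom a \<i> (xi_mult \<odot> (\<langle>\<i>\<rangle> \<bullet>\<^sub>2 \<epsilon>)) (\<i> \<bullet>\<^sub>1 a) (free_right_action a \<mu> \<i>) \<theta> \<and>
     left_module_hom \<i> \<i> xi_mult (\<i> \<bullet>\<^sub>1 a) (free_left_action \<i> xi_mult a) \<theta>"

definition normalized_right_integral :: "'f \<Rightarrow> 't \<Rightarrow> 't \<Rightarrow> 't \<Rightarrow> bool" where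
  "normalized_right_integral a \<mu> \<epsilon> \<theta> \<longleftrightarrow>
     right_integral a \<mu> \<epsilon> \<theta> \<and> xi_mult \<odot> (\<langle>\<i>\<rangle> \<bullet>\<^sub>2 \<epsilon>) \<odot> \<theta> = \<langle>\<i>\<rangle>"

text \<open>The categories of \<open>\<i>\<close>-modules and of bimodules between \<open>a\<close> and \<open>\<i>\<close>.\<close>

definition mod_i :: "('f \<times> 't, 't) cat" where
  "mod_i = right_module_cat \<i> xi_mult xi_unit"

definition i_mod :: "('f \<times> 't, 't) cat" where
  "i_mod = left_module_cat \<i> xi_mult xi_unit"

definition bimod_a_i :: "'f \<Rightarrow> 't \<Rightarrow> 't \<Rightarrow> ('f \<times> 't \<times> 't, 't) cat" where
  "bimod_a_i a \<mu> \<eta> = bimodule_cat a \<mu> \<eta> \<i> xi_mult xi_unit"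

definition bimod_i_a :: "'f \<Rightarrow> 't \<Rightarrow> 't \<Rightarrow> ('f \<times> 't \<times> 't, 't) cat" where
  "bimod_i_a a \<mu> \<eta> = bimodule_cat \<i> xi_mult xi_unit a \<mu> \<eta>"

end

text \<open>Object maps of the functors that forget one of the two actions; on arrows these functors act
  as the identity.\<close>

definition forget_left :: "'f \<times> 't \<times> 't \<Rightarrow> 'f \<times> 't" where
  "forget_left = (\<lambda>(x, l, r). (x, r))"

definition forget_right :: "'f \<times> 't \<times> 't \<Rightarrow> 'f \<times> 't" where
  "forget_right = (\<lambda>(x, l, r). (x, l))"

end

theory Submission
  imports Defs
begin

text \<open>The antipode makes the canonical 2-cell \<open>a \<bullet> a \<Rightarrow> (a \<bullet> \<i>) \<circ> a\<close>, built from \<open>\<delta>\<close>, \<open>\<xi>\<close> and \<open>\<mu>\<close>,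
  invertible.  Transporting a normalized integral \<open>\<theta> : \<i> \<Rightarrow> a \<bullet> \<i>\<close>, composed with \<open>a\<close>, along its inverse
  gives a bilinear section of \<open>\<mu>\<close>, so \<open>a\<close> is separable.  A bilinear section of \<open>\<mu>\<close> turns 2-cells between
  modules into module morphisms by averaging, which makes the forgetful functors separable, and
  separable functors reflect split epimorphisms.  Finally \<open>\<xi>\<^sub>0 \<cdot> (\<epsilon> \<bullet> 1) : a \<bullet> \<i> \<Rightarrow> \<i>\<close> is a morphism of
  bimodules that is split, as a morphism of \<open>\<i>\<close>-modules, by the unit of \<open>a\<close>; a bilinear splitting of it is
  a normalized integral.  The statements on the right follow by reversing the 1-cells and the tensor
  product, which exchanges \<open>m\<close> and \<open>u\<close> with their right adjoints.

  All equations between pasting composites are instances of one soundness theorem.  Composites are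
  described by expressions, an expression is compiled to a list of layers, each of which applies a single
  generating 2-cell, and an equation is derived by a sequence of moves (interchange of layers, naturality
  of the interchangers, rewriting with known equations) that an executable function replays.\<close>

section \<open>Whiskering in a 2-category\<close>

text \<open>The obstacle is coherence: with the interchangers, the associator of m and its mate for
  m^* all explicit, short arguments become long pasting computations. Transposing \<mu> along m
  \<stileturn> m^* to m \<cdot> (a \<otimes> a) \<Rightarrow> a \<cdot> m removes m^* and its
  coassociator from the proof of invertibility.

  In elements, with \<delta>(x) = x' \<circ> x'', the canonical 2-cell sends x, y to x', x''y and
  its inverse sends x, y to x', S(x'')y. The two antipode axioms have separate roles: the one with
  \<open>psi\<close> gives S(x')(x''y) = \<epsilon>(x)y, hence one inverse law; the one with
  \<open>phi\<close> gives x'(S(x'')y) = \<epsilon>(x)y, hence the other.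

  The section is bilinear because the canonical 2-cell intertwines the regular actions on a
  \<bullet> a with actions on (a \<bullet> \<i>) \<circ> a: the left one diagonal through \<delta>,
  the right one by \<i> on the first factor and by a on the second. An integral composed with a is
  bilinear for these actions. It is a section because the canonical 2-cell followed by the counit on
  the first factor is \<mu>.\<close>

context two_category
begin

lemma hom2_src: "t \<in> hom2 B f g \<Longrightarrow> src B g = src B f"
  and hom2_trg: "t \<in> hom2 B f g \<Longrightarrow> trg B g = trg B f"
  using src_dom_cod trg_dom_cod by (auto simp: hom2_def)

lemma comp1_src: "trg B f = src B g \<Longrightarrow> src B (g \<cdot> f) = src B f"
  and comp1_trg: "trg B f = src B g \<Longrightarrow> trg B (g \<cdot> f) = trg B g"
  using comp1_hom[of f "src B f" "trg B f" g "trg B g"] by (auto simp: hom1_def)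

lemma id1_src [simp]: "src B (\<one> X) = X" and id1_trg [simp]: "trg B (\<one> X) = X"
  using id1_hom[of X] by (auto simp: hom1_def)

lemma id2_dom [simp]: "dom2 B \<langle>f\<rangle> = f" and id2_cod [simp]: "cod2 B \<langle>f\<rangle> = f"
  using id2_hom[of f] by (auto simp: hom2_def)

lemma hcomp_hom':
  "\<lbrakk>t \<in> hom2 B g g'; s \<in> hom2 B f f'; src B g = trg B f\<rbrakk> \<Longrightarrow> t \<star> s \<in> hom2 B (g \<cdot> f) (g' \<cdot> f')"
  using hcomp_hom by simp

lemma vcomp_id2_left: "t \<in> hom2 B f g \<Longrightarrow> \<langle>g\<rangle> \<odot> t = t"
  and vcomp_id2_right: "t \<in> hom2 B f g \<Longrightarrow> t \<odot> \<langle>f\<rangle> = t"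
  using vcomp_id_left vcomp_id_right by (auto simp: hom2_def)

lemma vcomp_assoc': "\<lbrakk>s \<in> hom2 B f g; t \<in> hom2 B g h; r \<in> hom2 B h k\<rbrakk> \<Longrightarrow> (r \<odot> t) \<odot> s = r \<odot> t \<odot> s"
  by (simp add: hom2_def vcomp_assoc)

lemma hcomp_assoc':
  "\<lbrakk>r \<in> hom2 B h h'; t \<in> hom2 B g g'; s \<in> hom2 B f f'; trg B f = src B g; trg B g = src B h\<rbrakk>
    \<Longrightarrow> (r \<star> t) \<star> s = r \<star> t \<star> s"
  by (simp add: hom2_def hcomp_assoc)

lemma interchange:
  assumes "s \<in> hom2 B f f'" "t \<in> hom2 B g g'" "src B f = trg B g"
  shows "(s \<star> \<langle>g'\<rangle>) \<odot> (\<langle>f\<rangle> \<star> t) = s \<star> t" and "(\<langle>f'\<rangle> \<star> t) \<odot> (s \<star> \<langle>g\<rangle>) = s \<star> t"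
proof -
  have "(s \<odot> \<langle>f\<rangle>) \<star> (\<langle>g'\<rangle> \<odot> t) = (s \<star> \<langle>g'\<rangle>) \<odot> (\<langle>f\<rangle> \<star> t)"
    "(\<langle>f'\<rangle> \<odot> s) \<star> (t \<odot> \<langle>g\<rangle>) = (\<langle>f'\<rangle> \<star> t) \<odot> (s \<star> \<langle>g\<rangle>)"
    using assms hom2_src[OF assms(1)] hom2_trg[OF assms(2)]
    by (auto intro!: middle_four simp: hom2_def)
  then show "(s \<star> \<langle>g'\<rangle>) \<odot> (\<langle>f\<rangle> \<star> t) = s \<star> t" "(\<langle>f'\<rangle> \<star> t) \<odot> (s \<star> \<langle>g\<rangle>) = s \<star> t"
    using vcomp_id2_left[OF assms(1)] vcomp_id2_right[OF assms(1)]
      vcomp_id2_left[OF assms(2)] vcomp_id2_right[OF assms(2)] by auto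
qed

definition whisk :: "'f \<Rightarrow> 't \<Rightarrow> 'f \<Rightarrow> 't" where
  "whisk f t g = \<langle>f\<rangle> \<star> t \<star> \<langle>g\<rangle>"

lemma whisk_hom:
  assumes "t \<in> hom2 B s s'" "src B f = trg B s" "trg B g = src B s"
  shows "whisk f t g \<in> hom2 B (f \<cdot> s \<cdot> g) (f \<cdot> s' \<cdot> g)"
  unfolding whisk_def
  by (intro hcomp_hom' id2_hom assms) (use assms in \<open>auto simp: comp1_trg\<close>)

lemma whisk_vcomp:
  assumes "s \<in> hom2 B h h'" "t \<in> hom2 B h' h''" "src B f = trg B h" "trg B g = src B h"
  shows "whisk f (t \<odot> s) g = whisk f t g \<odot> whisk f s g"
proof -
  have 1: "(t \<odot> s) \<star> (\<langle>g\<rangle> \<odot> \<langle>g\<rangle>) = (t \<star> \<langle>g\<rangle>) \<odot> (s \<star> \<langle>g\<rangle>)"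
    by (rule middle_four) (use assms in \<open>auto simp: hom2_def\<close>)
  have h: "s \<star> \<langle>g\<rangle> \<in> hom2 B (h \<cdot> g) (h' \<cdot> g)" "t \<star> \<langle>g\<rangle> \<in> hom2 B (h' \<cdot> g) (h'' \<cdot> g)"
    using assms hom2_src[OF assms(1)] by (auto intro!: hcomp_hom' id2_hom)
  have 2: "(\<langle>f\<rangle> \<odot> \<langle>f\<rangle>) \<star> ((t \<star> \<langle>g\<rangle>) \<odot> (s \<star> \<langle>g\<rangle>)) = (\<langle>f\<rangle> \<star> t \<star> \<langle>g\<rangle>) \<odot> (\<langle>f\<rangle> \<star> s \<star> \<langle>g\<rangle>)"
    by (rule middle_four) (use assms h in \<open>auto simp: hom2_def comp1_trg\<close>)
  show ?thesis
    using 1 2 vcomp_id2_left[OF id2_hom[of f]] vcomp_id2_left[OF id2_hom[of g]] by (simp add: whisk_def)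
qed

lemma whisk_id2:
  assumes "src B f = trg B h" "trg B g = src B h"
  shows "whisk f \<langle>h\<rangle> g = \<langle>f \<cdot> h \<cdot> g\<rangle>"
  using assms by (simp add: whisk_def hcomp_id2 comp1_trg)

lemma whisk_whisk:
  assumes t: "t \<in> hom2 B s s'" and "src B f' = trg B s" "trg B g' = src B s"
    "src B f = trg B f'" "trg B g = src B g'"
  shows "whisk f (whisk f' t g') g = whisk (f \<cdot> f') t (g' \<cdot> g)"
proof -
  have tg: "t \<star> \<langle>g'\<rangle> \<in> hom2 B (s \<cdot> g') (s' \<cdot> g')"
    using assms by (auto intro!: hcomp_hom' id2_hom)
  have tgg: "t \<star> \<langle>g' \<cdot> g\<rangle> \<in> hom2 B (s \<cdot> g' \<cdot> g) (s' \<cdot> g' \<cdot> g)"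
    using assms by (auto intro!: hcomp_hom' id2_hom simp: comp1_trg)
  have "(\<langle>f'\<rangle> \<star> t \<star> \<langle>g'\<rangle>) \<star> \<langle>g\<rangle> = \<langle>f'\<rangle> \<star> (t \<star> \<langle>g'\<rangle>) \<star> \<langle>g\<rangle>"
    by (rule hcomp_assoc'[OF id2_hom tg id2_hom]) (use assms in \<open>auto simp: comp1_trg comp1_src\<close>)
  also have "(t \<star> \<langle>g'\<rangle>) \<star> \<langle>g\<rangle> = t \<star> \<langle>g'\<rangle> \<star> \<langle>g\<rangle>"
    by (rule hcomp_assoc'[OF t id2_hom id2_hom]) (use assms in auto)
  also have "\<langle>g'\<rangle> \<star> \<langle>g\<rangle> = \<langle>g' \<cdot> g\<rangle>"
    using assms by (simp add: hcomp_id2)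
  finally have "whisk f (whisk f' t g') g = \<langle>f\<rangle> \<star> \<langle>f'\<rangle> \<star> t \<star> \<langle>g' \<cdot> g\<rangle>"
    by (simp add: whisk_def)
  also have "\<dots> = (\<langle>f\<rangle> \<star> \<langle>f'\<rangle>) \<star> t \<star> \<langle>g' \<cdot> g\<rangle>"
    by (rule hcomp_assoc'[OF id2_hom id2_hom tgg, symmetric]) (use assms in \<open>auto simp: comp1_trg\<close>)
  also have "\<langle>f\<rangle> \<star> \<langle>f'\<rangle> = \<langle>f \<cdot> f'\<rangle>"
    using assms by (simp add: hcomp_id2)
  finally show ?thesis
    by (simp add: whisk_def)
qed

lemma whisk_one:
  "t \<in> hom2 B s s' \<Longrightarrow> src B s = X \<Longrightarrow> trg B s = Y \<Longrightarrow> whisk (\<one> Y) t (\<one> X) = t"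
  using hcomp_id_left[of t] hcomp_id_right[of t] by (auto simp: whisk_def hom2_def)

text \<open>The content of the moves \<open>SR\<close> and \<open>SL\<close>: 2-cells acting on the
  disjoint factors f and g of w \<cdot> f \<cdot> x \<cdot> g \<cdot> y commute. The context of the
  second cell is absorbed into it, after which \<open>interchange\<close> applies.\<close>

lemma whisk_slide:
  assumes s: "s \<in> hom2 B f f'" and t: "t \<in> hom2 B g g'"
    and "src B w = trg B f" "src B f = trg B x" "src B x = trg B g" "src B g = trg B y"
  shows "whisk (w \<cdot> f' \<cdot> x) t y \<odot> whisk w s (x \<cdot> g \<cdot> y) = whisk w s (x \<cdot> g' \<cdot> y) \<odot> whisk (w \<cdot> f \<cdot> x) t y"
proof -
  have u: "whisk x t y \<in> hom2 B (x \<cdot> g \<cdot> y) (x \<cdot> g' \<cdot> y)"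
    by (rule whisk_hom) (use assms in auto)
  have tr: "trg B (x \<cdot> g \<cdot> y) = trg B x"
    using assms by (simp add: comp1_trg comp1_src)
  have tr': "trg B (x \<cdot> g' \<cdot> y) = trg B x"
    using assms tr hom2_trg[OF u] by simp
  \<comment> \<open>Separating the left context into horizontal factors gives both sides the same
    outermost factor w, which can then be taken out of the vertical composite.\<close>
  have a: "whisk (w \<cdot> h \<cdot> x) t y = \<langle>w\<rangle> \<star> \<langle>h\<rangle> \<star> whisk x t y" if h: "src B w = trg B h" "src B h = trg B x" for h
  proof -
    have v: "t \<star> \<langle>y\<rangle> \<in> hom2 B (g \<cdot> y) (g' \<cdot> y)"
      using assms by (auto intro!: hcomp_hom' id2_hom)
    have tv: "trg B (g \<cdot> y) = trg B g" using assms by (simp add: comp1_trg)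
    have "\<langle>w \<cdot> h \<cdot> x\<rangle> \<star> t \<star> \<langle>y\<rangle> = (\<langle>w\<rangle> \<star> \<langle>h \<cdot> x\<rangle>) \<star> t \<star> \<langle>y\<rangle>"
      using h assms by (simp add: hcomp_id2 comp1_trg)
    also have "\<dots> = \<langle>w\<rangle> \<star> \<langle>h \<cdot> x\<rangle> \<star> t \<star> \<langle>y\<rangle>"
      by (rule hcomp_assoc'[OF id2_hom id2_hom v]) (use h assms tv in \<open>auto simp: comp1_trg comp1_src\<close>)
    also have "\<langle>h \<cdot> x\<rangle> \<star> t \<star> \<langle>y\<rangle> = (\<langle>h\<rangle> \<star> \<langle>x\<rangle>) \<star> t \<star> \<langle>y\<rangle>"
      using h assms by (simp add: hcomp_id2)
    also have "\<dots> = \<langle>h\<rangle> \<star> \<langle>x\<rangle> \<star> t \<star> \<langle>y\<rangle>"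
      by (rule hcomp_assoc'[OF id2_hom id2_hom v]) (use h assms tv in \<open>auto simp: comp1_trg comp1_src\<close>)
    finally show ?thesis by (simp add: whisk_def)
  qed
  have fu: "\<langle>f\<rangle> \<star> whisk x t y \<in> hom2 B (f \<cdot> x \<cdot> g \<cdot> y) (f \<cdot> x \<cdot> g' \<cdot> y)"
    "\<langle>f'\<rangle> \<star> whisk x t y \<in> hom2 B (f' \<cdot> x \<cdot> g \<cdot> y) (f' \<cdot> x \<cdot> g' \<cdot> y)"
    using assms tr hom2_src[OF s] by (auto intro!: hcomp_hom' id2_hom u)
  have sx: "s \<star> \<langle>x \<cdot> g \<cdot> y\<rangle> \<in> hom2 B (f \<cdot> x \<cdot> g \<cdot> y) (f' \<cdot> x \<cdot> g \<cdot> y)"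
    "s \<star> \<langle>x \<cdot> g' \<cdot> y\<rangle> \<in> hom2 B (f \<cdot> x \<cdot> g' \<cdot> y) (f' \<cdot> x \<cdot> g' \<cdot> y)"
    using assms tr tr' by (auto intro!: hcomp_hom' id2_hom)
  have trw: "trg B (f \<cdot> x \<cdot> g \<cdot> y) = src B w" using assms tr by (simp add: comp1_trg)
  have c: "(\<langle>w\<rangle> \<star> r) \<odot> (\<langle>w\<rangle> \<star> r') = \<langle>w\<rangle> \<star> (r \<odot> r')" if "r' \<in> hom2 B h h'" "r \<in> hom2 B h' h''" "trg B h = src B w" for r r' h h' h''
    using middle_four[of r' r "\<langle>w\<rangle>" "\<langle>w\<rangle>"] that vcomp_id2_left[OF id2_hom[of w]] by (auto simp: hom2_def)
  have 1: "(\<langle>w\<rangle> \<star> \<langle>f'\<rangle> \<star> whisk x t y) \<odot> (\<langle>w\<rangle> \<star> s \<star> \<langle>x \<cdot> g \<cdot> y\<rangle>) = \<langle>w\<rangle> \<star> ((\<langle>f'\<rangle> \<star> whisk x t y) \<odot> (s \<star> \<langle>x \<cdot> g \<cdot> y\<rangle>))"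
    by (rule c[OF sx(1) fu(2) trw])
  have 2: "(\<langle>w\<rangle> \<star> s \<star> \<langle>x \<cdot> g' \<cdot> y\<rangle>) \<odot> (\<langle>w\<rangle> \<star> \<langle>f\<rangle> \<star> whisk x t y) = \<langle>w\<rangle> \<star> ((s \<star> \<langle>x \<cdot> g' \<cdot> y\<rangle>) \<odot> (\<langle>f\<rangle> \<star> whisk x t y))"
    by (rule c[OF fu(1) sx(2) trw])
  have "src B f = trg B (x \<cdot> g \<cdot> y)" using assms tr by simp
  from interchange[OF s u this] 1 2 show ?thesis
    using a[of f] a[of f'] assms hom2_trg[OF s] hom2_src[OF s] by (simp add: whisk_def)
qed

lemma inv2_unique:
  assumes "inverse_2cells B t s" "inverse_2cells B t r"
  shows "s = r"
proof -
  have t: "t \<in> hom2 B (dom2 B t) (cod2 B t)" by (simp add: hom2_def)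
  have s: "s \<in> hom2 B (cod2 B t) (dom2 B t)" "t \<odot> s = \<langle>cod2 B t\<rangle>" "s \<odot> t = \<langle>dom2 B t\<rangle>"
    and r: "r \<in> hom2 B (cod2 B t) (dom2 B t)" "t \<odot> r = \<langle>cod2 B t\<rangle>" "r \<odot> t = \<langle>dom2 B t\<rangle>"
    using assms by (auto simp: inverse_2cells_def)
  have "s = (r \<odot> t) \<odot> s" using vcomp_id2_left[OF s(1)] r(3) by simp
  also have "\<dots> = r" using vcomp_assoc'[OF s(1) t r(1)] s(2) vcomp_id2_right[OF r(1)] by simp
  finally show ?thesis .
qed

text \<open>\<open>inv2\<close> is a definite description; uniqueness of inverses allows any
  exhibited inverse to replace it.\<close>

lemma inv2_eq: "inverse_2cells B t s \<Longrightarrow> inv2 B t = s"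
  unfolding inv2_def using inv2_unique by blast

lemma inverse_inv2: "iso2 B t \<Longrightarrow> inverse_2cells B t (inv2 B t)"
  using inv2_eq by (auto simp: iso2_def)

lemma inverse_2cellsI:
  "\<lbrakk>t \<in> hom2 B f g; s \<in> hom2 B g f; s \<odot> t = \<langle>f\<rangle>; t \<odot> s = \<langle>g\<rangle>\<rbrakk> \<Longrightarrow> inverse_2cells B t s"
  by (auto simp: inverse_2cells_def hom2_def)

lemma inv2_hom: "iso2 B t \<Longrightarrow> t \<in> hom2 B f g \<Longrightarrow> inv2 B t \<in> hom2 B g f"
  and inv2_left: "iso2 B t \<Longrightarrow> t \<in> hom2 B f g \<Longrightarrow> inv2 B t \<odot> t = \<langle>f\<rangle>"
  and inv2_right: "iso2 B t \<Longrightarrow> t \<in> hom2 B f g \<Longrightarrow> t \<odot> inv2 B t = \<langle>g\<rangle>"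
  using inverse_inv2[of t] by (auto simp: inverse_2cells_def hom2_def)

end

section \<open>Diagrams in a Gray monoid\<close>

datatype atom = Mul | Unt | MulA | UntA | V nat

fun ain :: "atom \<Rightarrow> nat" where
  "ain Mul = 2" | "ain Unt = 0" | "ain MulA = 1" | "ain UntA = 1" | "ain (V n) = 1"

fun aout :: "atom \<Rightarrow> nat" where
  "aout Mul = 1" | "aout Unt = 1" | "aout MulA = 2" | "aout UntA = 0" | "aout (V n) = 1"

text \<open>The letter \<open>(p, f, q)\<close> stands for the 1-cell \<open>M\<^sup>p \<otimes> f \<otimes> M\<^sup>q\<close>, and a word for the composite of its
  letters, the last one being applied first.  Since the empty word does not determine its object,
  words are accompanied by the exponent \<open>k\<close> of their target \<open>M\<^sup>k\<close>.\<close>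

type_synonym word = "(nat \<times> atom \<times> nat) list"

definition sh :: "nat \<Rightarrow> nat \<Rightarrow> word \<Rightarrow> word" where
  "sh p q w = map (\<lambda>(a, f, b). (p + a, f, b + q)) w"

fun wok :: "nat \<Rightarrow> word \<Rightarrow> bool" where
  "wok k [] \<longleftrightarrow> True"
| "wok k ((p, f, q) # w) \<longleftrightarrow> k = p + aout f + q \<and> wok (p + ain f + q) w"

fun sr :: "nat \<Rightarrow> word \<Rightarrow> nat" where
  "sr k [] = k"
| "sr k ((p, f, q) # w) = sr (p + ain f + q) w"

text \<open>A suffix \<open>I\<close> marks inverses.  \<open>V 0\<close> is the Hopf monoid.  \<open>Muh\<close> and \<open>Etah\<close> are \<open>Mu\<close> and \<open>Eta\<close>
  transposed along the adjunctions, \<open>m \<cdot> (a \<otimes> a) \<Rightarrow> a \<cdot> m\<close> and \<open>u \<Rightarrow> a \<cdot> u\<close>, and \<open>Etac\<close> is the transpose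
  \<open>u\<^sup>* \<Rightarrow> u\<^sup>* \<cdot> a\<close>.  \<open>ActL\<close> and \<open>ActRA\<close> are left and right actions of \<open>a\<close>, \<open>ActLI\<close> and \<open>ActR\<close> those of the
  identity, \<open>Nab\<close> is a section of \<open>Mu\<close>, and \<open>The\<close> and \<open>TheR\<close> are a left and a right integral.\<close>

datatype gen = Asc | AscI | Lun | LunI | Run | RunI | EtaM | EpsM | EtaU | EpsU
  | CoAsc | CoAscI | CoLun | CoLunI | CoRun | CoRunI
  | Mu | Eta | Del | Eps | Sig | Muh | Etah | Etac
  | Two nat nat nat | ActL nat | ActR nat | ActRA nat | ActLI nat | Nab | The | TheR

fun gdom :: "gen \<Rightarrow> word" where
  "gdom Asc = [(0, Mul, 0), (0, Mul, 1)]" | "gdom AscI = [(0, Mul, 0), (1, Mul, 0)]"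
| "gdom Lun = [(0, Mul, 0), (0, Unt, 1)]" | "gdom LunI = []"
| "gdom Run = [(0, Mul, 0), (1, Unt, 0)]" | "gdom RunI = []"
| "gdom EtaM = []" | "gdom EpsM = [(0, Mul, 0), (0, MulA, 0)]"
| "gdom EtaU = []" | "gdom EpsU = [(0, Unt, 0), (0, UntA, 0)]"
| "gdom CoAsc = [(0, MulA, 1), (0, MulA, 0)]" | "gdom CoAscI = [(1, MulA, 0), (0, MulA, 0)]"
| "gdom CoLun = [(0, UntA, 1), (0, MulA, 0)]" | "gdom CoLunI = []"
| "gdom CoRun = [(1, UntA, 0), (0, MulA, 0)]" | "gdom CoRunI = []"
| "gdom Mu = [(0, Mul, 0), (0, V 0, 1), (1, V 0, 0), (0, MulA, 0)]"
| "gdom Eta = [(0, Unt, 0), (0, UntA, 0)]"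
| "gdom Del = [(0, V 0, 0)]" | "gdom Eps = [(0, V 0, 0)]" | "gdom Sig = [(0, V 0, 0)]"
| "gdom Muh = [(0, Mul, 0), (0, V 0, 1), (1, V 0, 0)]"
| "gdom Etah = [(0, Unt, 0)]" | "gdom Etac = [(0, UntA, 0)]"
| "gdom (Two n f g) = [(0, V f, 0)]"
| "gdom (ActL f) = [(0, Mul, 0), (0, V 0, 1), (1, V f, 0), (0, MulA, 0)]"
| "gdom (ActR f) = [(0, Mul, 0), (0, V f, 1), (0, MulA, 0)]"
| "gdom (ActRA f) = [(0, Mul, 0), (0, V f, 1), (1, V 0, 0), (0, MulA, 0)]"
| "gdom (ActLI f) = [(0, Mul, 0), (1, V f, 0), (0, MulA, 0)]"
| "gdom Nab = [(0, V 0, 0)]" | "gdom The = []" | "gdom TheR = []"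

fun gcod :: "gen \<Rightarrow> word" where
  "gcod Asc = [(0, Mul, 0), (1, Mul, 0)]" | "gcod AscI = [(0, Mul, 0), (0, Mul, 1)]"
| "gcod Lun = []" | "gcod LunI = [(0, Mul, 0), (0, Unt, 1)]"
| "gcod Run = []" | "gcod RunI = [(0, Mul, 0), (1, Unt, 0)]"
| "gcod EtaM = [(0, MulA, 0), (0, Mul, 0)]" | "gcod EpsM = []"
| "gcod EtaU = [(0, UntA, 0), (0, Unt, 0)]" | "gcod EpsU = []"
| "gcod CoAsc = [(1, MulA, 0), (0, MulA, 0)]" | "gcod CoAscI = [(0, MulA, 1), (0, MulA, 0)]"
| "gcod CoLun = []" | "gcod CoLunI = [(0, UntA, 1), (0, MulA, 0)]"
| "gcod CoRun = []" | "gcod CoRunI = [(1, UntA, 0), (0, MulA, 0)]"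
| "gcod Mu = [(0, V 0, 0)]" | "gcod Eta = [(0, V 0, 0)]"
| "gcod Del = [(0, V 0, 0), (0, V 0, 0)]" | "gcod Eps = []"
| "gcod Sig = [(0, UntA, 1), (0, Mul, 1), (1, V 0, 1), (1, MulA, 0), (1, Unt, 0)]"
| "gcod Muh = [(0, V 0, 0), (0, Mul, 0)]"
| "gcod Etah = [(0, V 0, 0), (0, Unt, 0)]" | "gcod Etac = [(0, UntA, 0), (0, V 0, 0)]"
| "gcod (Two n f g) = [(0, V g, 0)]"
| "gcod (ActL f) = [(0, V f, 0)]" | "gcod (ActR f) = [(0, V f, 0)]"
| "gcod Nab = [(0, Mul, 0), (0, V 0, 1), (1, V 0, 0), (0, MulA, 0)]"
| "gcod (ActRA f) = [(0, V f, 0)]" | "gcod (ActLI f) = [(0, V f, 0)]"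
| "gcod The = [(0, Mul, 0), (0, V 0, 1), (0, MulA, 0)]"
| "gcod TheR = [(0, Mul, 0), (1, V 0, 0), (0, MulA, 0)]"

fun gin :: "gen \<Rightarrow> nat" where
  "gin Asc = 3" | "gin AscI = 3" | "gin EtaM = 2" | "gin EtaU = 0" | "gin Muh = 2" | "gin Etah = 0"
| "gin _ = 1"

fun gout :: "gen \<Rightarrow> nat" where
  "gout EtaM = 2" | "gout EtaU = 0" | "gout CoAsc = 3" | "gout CoAscI = 3" | "gout Etac = 0"
| "gout _ = 1"

text \<open>\<open>Ch f k g\<close> is the interchanger of \<open>f\<close> and \<open>g\<close>, with \<open>k\<close> strands between them, and \<open>ChI f k g\<close> its
  inverse.\<close>

datatype cell = G gen | Ch atom nat atom | ChI atom nat atom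

fun cin :: "cell \<Rightarrow> nat" where
  "cin (G g) = gin g" | "cin (Ch f k g) = ain f + k + ain g" | "cin (ChI f k g) = ain f + k + ain g"

fun cout :: "cell \<Rightarrow> nat" where
  "cout (G g) = gout g" | "cout (Ch f k g) = aout f + k + aout g" | "cout (ChI f k g) = aout f + k + aout g"

fun cdom :: "cell \<Rightarrow> word" where
  "cdom (G g) = gdom g"
| "cdom (Ch f k g) = [(0, f, k + aout g), (ain f + k, g, 0)]"
| "cdom (ChI f k g) = [(aout f + k, g, 0), (0, f, k + ain g)]"

fun ccod :: "cell \<Rightarrow> word" where
  "ccod (G g) = gcod g"
| "ccod (Ch f k g) = [(aout f + k, g, 0), (0, f, k + ain g)]"
| "ccod (ChI f k g) = [(0, f, k + aout g), (ain f + k, g, 0)]"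

fun cinv :: "cell \<Rightarrow> cell" where
  "cinv (Ch f k g) = ChI f k g" | "cinv (ChI f k g) = Ch f k g" | "cinv (G g) = G g"

text \<open>The layer \<open>(o, p, c, q)\<close> applies \<open>M\<^sup>p \<otimes> c \<otimes> M\<^sup>q\<close> to the letters of a word that follow the
  first \<open>o\<close> ones.\<close>

type_synonym layer = "nat \<times> nat \<times> cell \<times> nat"
type_synonym diag = "layer list"

definition shd :: "nat \<Rightarrow> nat \<Rightarrow> nat \<Rightarrow> diag \<Rightarrow> diag" where
  "shd n p q D = map (\<lambda>(a, b, c, d). (n + a, p + b, c, d + q)) D"

text \<open>The exponent in front of the layer is checked as well as the letters: a cell with an
  empty domain, such as \<open>EtaM\<close>, matches at every position of a word, and only the
  exponent tells whether it may be inserted there.\<close>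

fun lapp :: "nat \<Rightarrow> word \<Rightarrow> layer \<Rightarrow> word option" where
  "lapp k w (n, p, c, q) = (let w1 = take n w; w2 = drop n w; d = sh p q (cdom c); m = length d in
     if length w1 = n \<and> take m w2 = d \<and> sr k w1 = p + cout c + q
     then Some (w1 @ sh p q (ccod c) @ drop m w2) else None)"

fun dapp :: "nat \<Rightarrow> word \<Rightarrow> diag \<Rightarrow> word option" where
  "dapp k w [] = Some w"
| "dapp k w (l # D) = (case lapp k w l of None \<Rightarrow> None | Some v \<Rightarrow> dapp k v D)"

lemma sh_simps [simp]: "sh p q [] = []" "sh p q ((a, f, b) # w) = (p + a, f, b + q) # sh p q w"
  "sh p q (v @ w) = sh p q v @ sh p q w" "length (sh p q w) = length w"
  "sh p q (sh p' q' w) = sh (p + p') (q' + q) w" "sh 0 0 w = w"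
  by (auto simp: sh_def add_ac intro: map_idI)

lemma shd_simps [simp]: "shd n p q [] = []"
  "shd n p q ((a, b, c, d) # D) = (n + a, p + b, c, d + q) # shd n p q D"
  "shd n p q (D @ E) = shd n p q D @ shd n p q E"
  "shd n p q (shd n' p' q' D) = shd (n + n') (p + p') (q' + q) D" "shd 0 0 0 D = D"
  by (auto simp: shd_def add_ac intro: map_idI)

lemma wok_append [simp]: "wok k (v @ w) \<longleftrightarrow> wok k v \<and> wok (sr k v) w"
  by (induction k v rule: wok.induct) auto

lemma sr_append [simp]: "sr k (v @ w) = sr (sr k v) w"
  by (induction k v rule: sr.induct) auto

lemma sr_sh [simp]: "wok k w \<Longrightarrow> sr (p + k + q) (sh p q w) = p + sr k w + q"
  by (induction k w rule: wok.induct) (auto simp: add_ac)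

lemma wok_sh [simp]: "wok k w \<Longrightarrow> wok (p + k + q) (sh p q w)"
  by (induction k w rule: wok.induct) (auto simp: add_ac)

lemma lapp_iff:
  "lapp k w (n, p, c, q) = Some w' \<longleftrightarrow> (\<exists>w1 w2. w = w1 @ sh p q (cdom c) @ w2 \<and>
     w' = w1 @ sh p q (ccod c) @ w2 \<and> length w1 = n \<and> sr k w1 = p + cout c + q)"
proof
  assume "lapp k w (n, p, c, q) = Some w'"
  then have *: "length (take n w) = n" "take (length (cdom c)) (drop n w) = sh p q (cdom c)"
    "sr k (take n w) = p + cout c + q"
    "w' = take n w @ sh p q (ccod c) @ drop (length (cdom c)) (drop n w)"
    by (auto simp: Let_def split: if_splits)
  have "w = take n w @ take (length (cdom c)) (drop n w) @ drop (length (cdom c)) (drop n w)"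
    by (metis append_take_drop_id)
  then show "\<exists>w1 w2. w = w1 @ sh p q (cdom c) @ w2 \<and>
     w' = w1 @ sh p q (ccod c) @ w2 \<and> length w1 = n \<and> sr k w1 = p + cout c + q"
    using * by metis
qed (auto simp: Let_def)

lemma dapp_append:
  "dapp k w (D @ E) = (case dapp k w D of None \<Rightarrow> None | Some v \<Rightarrow> dapp k v E)"
  by (induction D arbitrary: w) (auto split: option.splits)

lemma cell_wok [simp]: "wok (cout c) (cdom c)" "wok (cout c) (ccod c)"
  "sr (cout c) (cdom c) = cin c" "sr (cout c) (ccod c) = cin c"
proof -
  have g: "wok (gout g) (gdom g) \<and> wok (gout g) (gcod g) \<and> sr (gout g) (gdom g) = gin g \<and>
      sr (gout g) (gcod g) = gin g" for g
    by (cases g) (simp_all add: numeral_2_eq_2 numeral_3_eq_3)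
  show "wok (cout c) (cdom c)" "wok (cout c) (ccod c)"
    "sr (cout c) (cdom c) = cin c" "sr (cout c) (ccod c) = cin c"
    using g by (cases c; simp)+
qed

lemma lapp_wok:
  assumes "wok k w" "lapp k w l = Some w'"
  shows "wok k w'" "sr k w' = sr k w"
proof -
  obtain n p c q where l: "l = (n, p, c, q)" by (cases l) auto
  obtain w1 w2 where *: "w = w1 @ sh p q (cdom c) @ w2" "w' = w1 @ sh p q (ccod c) @ w2"
    "sr k w1 = p + cout c + q"
    using assms(2) unfolding l lapp_iff by auto
  show "wok k w'" "sr k w' = sr k w"
    using assms(1) * wok_sh[of "cout c" "cdom c" p q] wok_sh[of "cout c" "ccod c" p q] by simp_all
qed

lemma dapp_wok: "wok k w \<Longrightarrow> dapp k w D = Some w' \<Longrightarrow> wok k w' \<and> sr k w' = sr k w"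
proof (induction D arbitrary: w)
  case (Cons l D)
  then obtain v where v: "lapp k w l = Some v" "dapp k v D = Some w'"
    by (auto split: option.splits)
  show ?case
    using Cons.IH[OF lapp_wok(1)[OF Cons.prems(1) v(1)] v(2)] lapp_wok(2)[OF Cons.prems(1) v(1)] by simp
qed simp

text \<open>The interchanger of a composite with a single letter, decomposed according to
  \<open>intch_comp_left\<close>. The letter g starts to the right of the word and passes its last
  letter first, hence the recursive call comes before the new layer.\<close>

fun crossR :: "nat \<Rightarrow> nat \<Rightarrow> atom \<Rightarrow> nat \<Rightarrow> word \<Rightarrow> diag" where
  "crossR n k g q [] = []"
| "crossR n k g q ((a, f, b) # w) = crossR (Suc n) k g q w @ [(n, a, Ch f (b + k) g, q)]"

text \<open>The decomposition in the second argument, according to \<open>intch_comp_right\<close>: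
  the first letter of the second word crosses the whole first word before the others do.\<close>

fun cross :: "nat \<Rightarrow> word \<Rightarrow> word \<Rightarrow> diag" where
  "cross n f [] = []"
| "cross n f ((a, g, b) # w) = crossR n a g b f @ cross (Suc n) f w"

text \<open>An inverse for diagrams of interchangers only, since \<open>cinv\<close> leaves
  generators unchanged; compare \<open>crossing\<close>.\<close>

definition dinv :: "diag \<Rightarrow> diag" where
  "dinv D = rev (map (\<lambda>(n, p, c, q). (n, p, cinv c, q)) D)"

lemma crossR_shd: "crossR n k g q w = shd n 0 0 (crossR 0 k g q w)"
proof (induction w arbitrary: n)
  case (Cons x w)
  obtain a f b where x: "x = (a, f, b)" by (cases x) auto
  have "crossR (Suc n) k g q w = shd n 0 0 (crossR (Suc 0) k g q w)"
    using Cons[of "Suc n"] Cons[of "Suc 0"] by simp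
  then show ?case by (simp add: x)
qed simp

lemma cross_shd: "cross n f w = shd n 0 0 (cross 0 f w)"
proof (induction w arbitrary: n)
  case (Cons x w)
  obtain a g b where x: "x = (a, g, b)" by (cases x) auto
  have "cross (Suc n) f w = shd n 0 0 (cross (Suc 0) f w)"
    using Cons[of "Suc n"] Cons[of "Suc 0"] by simp
  then show ?case using crossR_shd[of n a g b f] by (simp add: x)
qed simp

datatype expr = Cell gen | Id nat word | Chi nat word nat word | ChiInv nat word nat word
  | VC expr expr | HC expr expr | LW nat expr | RW expr nat

text \<open>The default is for the empty word: it denotes an identity, whose target is its source,
  and callers pass the exponent of the source.\<close>

definition tg :: "nat \<Rightarrow> word \<Rightarrow> nat" where
  "tg n w = (case w of [] \<Rightarrow> n | (p, f, q) # v \<Rightarrow> p + aout f + q)"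

text \<open>Horizontal composites are made sequential with the right factor first. By interchange
  the choice of order does not affect the value; fixing it makes the layer lists of different
  expressions comparable.\<close>

fun compile :: "expr \<Rightarrow> (nat \<times> word \<times> diag \<times> word) option" where
  "compile (Cell g) = Some (gout g, gdom g, [(0, 0, G g, 0)], gcod g)"
| "compile (Id k w) = (if wok k w then Some (k, w, [], w) else None)"
| "compile (Chi m f n g) = (let m' = tg m f; n' = tg n g in
     if wok m' f \<and> wok n' g \<and> sr m' f = m \<and> sr n' g = n
     then Some (m' + n', sh 0 n' f @ sh m 0 g, cross 0 f g, sh m' 0 g @ sh 0 n f) else None)"
| "compile (ChiInv m f n g) = (let m' = tg m f; n' = tg n g in
     if wok m' f \<and> wok n' g \<and> sr m' f = m \<and> sr n' g = n
     then Some (m' + n', sh m' 0 g @ sh 0 n f, dinv (cross 0 f g), sh 0 n' f @ sh m 0 g) else None)"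
| "compile (VC s t) = (case (compile s, compile t) of
     (Some (k, w, D, v), Some (k', w', D', v')) \<Rightarrow>
       if k = k' \<and> v' = w then Some (k, w', D' @ D, v) else None | _ \<Rightarrow> None)"
| "compile (HC s t) = (case (compile s, compile t) of
     (Some (k, w, D, v), Some (k', w', D', v')) \<Rightarrow>
       if sr k w = k' then Some (k, w @ w', shd (length w) 0 0 D' @ D, v @ v') else None | _ \<Rightarrow> None)"
| "compile (LW p s) = (case compile s of None \<Rightarrow> None
     | Some (k, w, D, v) \<Rightarrow> Some (p + k, sh p 0 w, shd 0 p 0 D, sh p 0 v))"
| "compile (RW s q) = (case compile s of None \<Rightarrow> None
     | Some (k, w, D, v) \<Rightarrow> Some (k + q, sh 0 q w, shd 0 0 q D, sh 0 q v))"

section \<open>Certificates\<close>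

text \<open>\<open>NR c k g\<close> and \<open>NL c k g\<close> are the naturality of the interchanger with respect to the cell \<open>c\<close>
  and an atom \<open>g\<close> to the right or to the left of it, with \<open>k\<close> strands between them; \<open>NRi\<close> and \<open>NLi\<close>
  are the versions for the inverse interchangers.  \<open>U i\<close> is the \<open>i\<close>-th given rule.\<close>

datatype ref = U nat | NR cell nat atom | NRi cell nat atom | NL cell nat atom | NLi cell nat atom
  | CX atom nat atom | CY atom nat atom

type_synonym rule = "nat \<times> word \<times> diag \<times> diag"

text \<open>An index out of range stands for the trivial rule between empty diagrams, so soundness
  holds without a bound on the index.\<close>

fun ref_rule :: "rule list \<Rightarrow> ref \<Rightarrow> rule" where
  "ref_rule R (U i) = (if i < length R then R ! i else (0, [], [], []))"
| "ref_rule R (NR c k g) = (cout c + (k + aout g), sh 0 (k + aout g) (cdom c) @ [(cin c + k, g, 0)],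
     (0, 0, c, k + aout g) # cross 0 (ccod c) [(k, g, 0)],
     cross 0 (cdom c) [(k, g, 0)] @ [(1, 0, c, k + ain g)])"
| "ref_rule R (NRi c k g) = (cout c + (k + aout g), (cout c + k, g, 0) # sh 0 (k + ain g) (cdom c),
     (1, 0, c, k + ain g) # dinv (cross 0 (ccod c) [(k, g, 0)]),
     dinv (cross 0 (cdom c) [(k, g, 0)]) @ [(0, 0, c, k + aout g)])"
| "ref_rule R (NL c k g) = (aout g + k + cout c, (0, g, k + cout c) # sh (ain g + k) 0 (cdom c),
     (1, ain g + k, c, 0) # cross 0 [(0, g, k)] (ccod c),
     cross 0 [(0, g, k)] (cdom c) @ [(0, aout g + k, c, 0)])"
| "ref_rule R (NLi c k g) = (aout g + k + cout c, sh (aout g + k) 0 (cdom c) @ [(0, g, k + cin c)],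
     (0, aout g + k, c, 0) # dinv (cross 0 [(0, g, k)] (ccod c)),
     dinv (cross 0 [(0, g, k)] (cdom c)) @ [(1, ain g + k, c, 0)])"
| "ref_rule R (CX f k g) = (cout (Ch f k g), cdom (Ch f k g), [(0, 0, Ch f k g, 0), (0, 0, ChI f k g, 0)], [])"
| "ref_rule R (CY f k g) = (cout (Ch f k g), ccod (Ch f k g), [(0, 0, ChI f k g, 0), (0, 0, Ch f k g, 0)], [])"

text \<open>\<open>SR i\<close> (\<open>SL i\<close>) interchanges the layers \<open>i\<close> and \<open>i + 1\<close>, the second of which acts to the right
  (left) of the first one.  \<open>RF\<close> and \<open>RB\<close> apply a rule forwards and backwards.\<close>

datatype move = SR nat | SL nat | RF ref nat nat nat nat | RB ref nat nat nat nat

text \<open>Before c acts, its place in the word is occupied by the domain of c instead of the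
  codomain, which shifts the offset of the second cell by the difference of the lengths. The guard
  also keeps the subtraction of natural numbers from truncating.\<close>

fun slideR :: "layer \<Rightarrow> layer \<Rightarrow> diag option" where
  "slideR (n, p, c, q) (n', p', c', q') = (if n + length (ccod c) \<le> n'
     then Some [(n' - length (ccod c) + length (cdom c), p', c', q'), (n, p, c, q)] else None)"

fun slideL :: "layer \<Rightarrow> layer \<Rightarrow> diag option" where
  "slideL (n, p, c, q) (n', p', c', q') = (if n' + length (cdom c') \<le> n
     then Some [(n', p', c', q'), (n - length (cdom c') + length (ccod c'), p, c, q)] else None)"

fun at2 :: "(layer \<Rightarrow> layer \<Rightarrow> diag option) \<Rightarrow> nat \<Rightarrow> diag \<Rightarrow> diag option" where
  "at2 f 0 (l # l' # D) = map_option (\<lambda>E. E @ D) (f l l')"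
| "at2 f (Suc i) (l # D) = map_option ((#) l) (at2 f i D)"
| "at2 f _ _ = None"

text \<open>Matching the layers is not enough. When \<open>L\<close> is empty, as in the insertion
  of an inverse pair, they say nothing about the place of application, so the word reached at that
  point is recomputed and compared with the source word of the rule and its exponent.\<close>

definition rw :: "nat \<Rightarrow> word \<Rightarrow> diag \<Rightarrow> nat \<Rightarrow> nat \<Rightarrow> nat \<Rightarrow> nat \<Rightarrow> nat \<Rightarrow> word \<Rightarrow> diag \<Rightarrow> diag \<Rightarrow> diag option" where
  "rw k w D i n p q k0 w0 L L' = (let P = take i D; Q = drop i D; S = shd n p q L; m = length S in
     if take m Q = S then
       (case dapp k w P of None \<Rightarrow> None | Some v \<Rightarrow>
          let v1 = take n v in
          if length v1 = n \<and> take (length w0) (drop n v) = sh p q w0 \<and> sr k v1 = p + k0 + q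
          then Some (P @ shd n p q L' @ drop m Q) else None)
     else None)"

fun step :: "rule list \<Rightarrow> nat \<Rightarrow> word \<Rightarrow> move \<Rightarrow> diag \<Rightarrow> diag option" where
  "step R k w (SR i) D = at2 slideR i D"
| "step R k w (SL i) D = at2 slideL i D"
| "step R k w (RF r i n p q) D = (case ref_rule R r of (k0, w0, L, L') \<Rightarrow> rw k w D i n p q k0 w0 L L')"
| "step R k w (RB r i n p q) D = (case ref_rule R r of (k0, w0, L, L') \<Rightarrow> rw k w D i n p q k0 w0 L' L)"

fun steps :: "rule list \<Rightarrow> nat \<Rightarrow> word \<Rightarrow> move list \<Rightarrow> diag \<Rightarrow> diag option" where
  "steps R k w [] D = Some D"
| "steps R k w (s # ss) D = (case step R k w s D of None \<Rightarrow> None | Some E \<Rightarrow> steps R k w ss E)"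

definition the_rule :: "expr \<times> expr \<Rightarrow> rule" where
  "the_rule r = (case (compile (fst r), compile (snd r)) of
     (Some (k, w, D, v), Some (k', w', D', v')) \<Rightarrow> (k, w, D, D') | _ \<Rightarrow> (0, [], [], []))"

definition proves :: "(expr \<times> expr) list \<Rightarrow> expr \<Rightarrow> expr \<Rightarrow> move list \<Rightarrow> bool" where
  "proves R s t ss \<longleftrightarrow> (case (compile s, compile t) of
     (Some (k, w, D, v), Some (k', w', D', v')) \<Rightarrow>
        k = k' \<and> w = w' \<and> v = v' \<and> steps (map the_rule R) k w ss D = Some D' | _ \<Rightarrow> False)"

locale gray_object = gray_monoid B
  for B :: "('o, 'f, 't, 'z) gray_scheme" (structure) +
  fixes M :: 'o
begin

primrec pow :: "nat \<Rightarrow> 'o" where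
  "pow 0 = \<I>"
| "pow (Suc n) = M \<otimes>\<^sub>0 pow n"

text \<open>An equality and not merely an isomorphism, because the tensor product of a Gray monoid
  is strictly associative and unital. This is what allows natural numbers to stand for the objects
  of a diagram.\<close>

lemma pow_add: "pow (m + n) = pow m \<otimes>\<^sub>0 pow n"
  by (induction m) (auto simp: ten0_unit_left ten0_assoc)

end

section \<open>Tensoring a cell with objects on both sides\<close>

context gray_monoid
begin

lemma lw1_src: "src B (A \<rhd>\<^sub>1 f) = A \<otimes>\<^sub>0 src B f" and lw1_trg: "trg B (A \<rhd>\<^sub>1 f) = A \<otimes>\<^sub>0 trg B f"
  using lw1_hom[of f "src B f" "trg B f" A] by (auto simp: hom1_def)

lemma rw1_src: "src B (f \<lhd>\<^sub>1 A) = src B f \<otimes>\<^sub>0 A" and rw1_trg: "trg B (f \<lhd>\<^sub>1 A) = trg B f \<otimes>\<^sub>0 A"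
  using rw1_hom[of f "src B f" "trg B f" A] by (auto simp: hom1_def)

definition pad1 where
  "pad1 X f Y = X \<rhd>\<^sub>1 (f \<lhd>\<^sub>1 Y)"

definition pad2 where
  "pad2 X t Y = X \<rhd>\<^sub>2 (t \<lhd>\<^sub>2 Y)"

lemma pad1_src: "src B (pad1 X f Y) = X \<otimes>\<^sub>0 src B f \<otimes>\<^sub>0 Y"
  and pad1_trg: "trg B (pad1 X f Y) = X \<otimes>\<^sub>0 trg B f \<otimes>\<^sub>0 Y"
  by (simp_all add: pad1_def lw1_src lw1_trg rw1_src rw1_trg)

lemma pad1_comp: "trg B f = src B g \<Longrightarrow> pad1 X (g \<cdot> f) Y = pad1 X g Y \<cdot> pad1 X f Y"
  by (simp add: pad1_def lw1_comp rw1_comp rw1_src rw1_trg)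

lemma pad1_id: "pad1 X (\<one> A) Y = \<one> (X \<otimes>\<^sub>0 A \<otimes>\<^sub>0 Y)"
  by (simp add: pad1_def lw1_id rw1_id)

lemma pad1_pad1: "pad1 X (pad1 X' f Y') Y = pad1 (X \<otimes>\<^sub>0 X') f (Y' \<otimes>\<^sub>0 Y)"
  by (simp add: pad1_def lw1_rw1 rw1_ten lw1_ten)

lemma pad2_hom: "t \<in> hom2 B f g \<Longrightarrow> pad2 X t Y \<in> hom2 B (pad1 X f Y) (pad1 X g Y)"
  unfolding pad1_def pad2_def by (intro lw2_hom rw2_hom)

lemma pad2_id: "pad2 X \<langle>f\<rangle> Y = \<langle>pad1 X f Y\<rangle>"
  by (simp add: pad1_def pad2_def lw2_id rw2_id)

lemma pad2_vcomp: "s \<in> hom2 B f g \<Longrightarrow> t \<in> hom2 B g h \<Longrightarrow> pad2 X (t \<odot> s) Y = pad2 X t Y \<odot> pad2 X s Y"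
  using rw2_hom[of s f g Y] rw2_hom[of t g h Y]
  by (auto simp: pad2_def lw2_vcomp rw2_vcomp hom2_def)

lemma pad2_hcomp:
  assumes "s \<in> hom2 B f f'" "t \<in> hom2 B g g'" "trg B f = src B g"
  shows "pad2 X (t \<star> s) Y = pad2 X t Y \<star> pad2 X s Y"
  using assms rw2_hom[OF assms(1), of Y] rw2_hom[OF assms(2), of Y]
  by (auto simp: pad2_def lw2_hcomp rw2_hcomp hom2_def rw1_src rw1_trg)

lemma pad2_whisk:
  assumes "t \<in> hom2 B s s'" "src B f = trg B s" "trg B g = src B s"
  shows "pad2 X (whisk f t g) Y = whisk (pad1 X f Y) (pad2 X t Y) (pad1 X g Y)"
proof -
  have "t \<star> \<langle>g\<rangle> \<in> hom2 B (s \<cdot> g) (s' \<cdot> g)"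
    using assms by (auto intro!: hcomp_hom' id2_hom)
  then show ?thesis
    using assms by (simp add: whisk_def pad2_hcomp[OF _ id2_hom] pad2_hcomp[OF id2_hom] pad2_id comp1_trg)
qed

lemma pad2_pad2: "pad2 X (pad2 X' t Y') Y = pad2 (X \<otimes>\<^sub>0 X') t (Y' \<otimes>\<^sub>0 Y)"
  by (simp add: pad2_def lw2_rw2 rw2_ten lw2_ten)

lemma pad2_unit: "pad2 \<I> t \<I> = t"
  by (simp add: pad2_def lw2_unit rw2_unit)

lemma pad2_intch: "pad2 X (\<chi> f g) Y = \<chi> (X \<rhd>\<^sub>1 f) (g \<lhd>\<^sub>1 Y)"
  by (simp add: pad2_def intch_lw intch_rw lw2_rw2)

lemma pad2_inverse:
  assumes "inverse_2cells B t s"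
  shows "inverse_2cells B (pad2 X t Y) (pad2 X s Y)"
proof -
  have t: "t \<in> hom2 B (dom2 B t) (cod2 B t)" and s: "s \<in> hom2 B (cod2 B t) (dom2 B t)"
    "s \<odot> t = \<langle>dom2 B t\<rangle>" "t \<odot> s = \<langle>cod2 B t\<rangle>"
    using assms by (auto simp: inverse_2cells_def hom2_def)
  show ?thesis
    by (rule inverse_2cellsI[OF pad2_hom[OF t] pad2_hom[OF s(1)]])
      (simp_all flip: pad2_vcomp[OF t s(1)] pad2_vcomp[OF s(1) t] add: s pad2_id)
qed

end

section \<open>Evaluation of words and layers in a Gray monoid\<close>

locale diagrams = gray_object B M
  for B :: "('o, 'f, 't, 'z) gray_scheme" (structure) and M +
  fixes F :: "atom \<Rightarrow> 'f" and T :: "gen \<Rightarrow> 't"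
  assumes F_hom: "F f \<in> hom1 B (pow (ain f)) (pow (aout f))"
begin

definition lt :: "nat \<times> atom \<times> nat \<Rightarrow> 'f" where
  "lt = (\<lambda>(p, f, q). pad1 (pow p) (F f) (pow q))"

fun ev :: "nat \<Rightarrow> word \<Rightarrow> 'f" where
  "ev k [] = \<one> (pow k)"
| "ev k ((p, f, q) # w) = lt (p, f, q) \<cdot> ev (p + ain f + q) w"

fun ce :: "cell \<Rightarrow> 't" where
  "ce (G g) = T g"
| "ce (Ch f k g) = \<chi> (F f \<lhd>\<^sub>1 pow k) (F g)"
| "ce (ChI f k g) = inv2 B (\<chi> (F f \<lhd>\<^sub>1 pow k) (F g))"

text \<open>\<open>T\<close> is a total function with no typing assumption, because a given
  application attaches a meaning to some generators only. Typing is therefore a property of single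
  cells and is demanded just for those that occur.\<close>

definition good :: "cell \<Rightarrow> bool" where
  "good c \<longleftrightarrow> ce c \<in> hom2 B (ev (cout c) (cdom c)) (ev (cout c) (ccod c))"

definition goods :: "diag \<Rightarrow> bool" where
  "goods D \<longleftrightarrow> (\<forall>(n, p, c, q) \<in> set D. good c)"

fun lev :: "nat \<Rightarrow> word \<Rightarrow> layer \<Rightarrow> 't" where
  "lev k w (n, p, c, q) = whisk (ev k (take n w)) (pad2 (pow p) (ce c) (pow q))
     (ev (p + cin c + q) (drop (n + length (cdom c)) w))"

text \<open>The value is meant only if \<open>dapp\<close> succeeds; otherwise \<open>the\<close>
  yields an unspecified word.\<close>

fun dev :: "nat \<Rightarrow> word \<Rightarrow> diag \<Rightarrow> 't" where
  "dev k w [] = \<langle>ev k w\<rangle>"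
| "dev k w (l # D) = dev k (the (lapp k w l)) D \<odot> lev k w l"

lemma lt_src: "src B (lt (p, f, q)) = pow (p + ain f + q)"
  and lt_trg: "trg B (lt (p, f, q)) = pow (p + aout f + q)"
  using F_hom[of f] by (simp_all add: lt_def pad1_src pad1_trg hom1_def pow_add ten0_assoc)

lemma ev_trg [simp]: "wok k w \<Longrightarrow> trg B (ev k w) = pow k"
  and ev_src [simp]: "wok k w \<Longrightarrow> src B (ev k w) = pow (sr k w)"
proof (induction k w rule: wok.induct)
  case (2 k p f q w)
  {
    case 1
    then show ?case using 2 by (simp add: comp1_trg lt_src lt_trg)
  next
    case 2
    then show ?case using "2.IH" by (simp add: comp1_src lt_src lt_trg)
  }
qed auto

lemma ev_append [simp]: "wok k (v @ w) \<Longrightarrow> ev k (v @ w) = ev k v \<cdot> ev (sr k v) w"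
proof (induction k v rule: wok.induct)
  case (1 k)
  then show ?case using comp1_id_left[of "ev k w"] by simp
next
  case (2 k p f q v)
  then show ?case by (simp add: comp1_assoc lt_src)
qed

lemma ev_sh [simp]: "wok k w \<Longrightarrow> ev (p + k + q) (sh p q w) = pad1 (pow p) (ev k w) (pow q)"
proof (induction k w rule: wok.induct)
  case (1 k)
  then show ?case by (simp add: pad1_id pow_add ten0_assoc)
next
  case (2 k a f b w)
  have "ev (p + a + ain f + (b + q)) (sh p q w) = ev (p + (a + ain f + b) + q) (sh p q w)"
    by (simp add: add_ac)
  moreover have "pad1 (pow p) (lt (a, f, b) \<cdot> ev (a + ain f + b) w) (pow q)
      = pad1 (pow p) (lt (a, f, b)) (pow q) \<cdot> pad1 (pow p) (ev (a + ain f + b) w) (pow q)"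
    using 2 by (intro pad1_comp) (simp add: lt_src)
  ultimately show ?case using 2
    by (simp add: lt_def pad1_pad1 pow_add)
qed

lemma inverse_intch: "inverse_2cells B (\<chi> f g) (inv2 B (\<chi> f g))"
  by (rule inverse_inv2[OF intch_iso])

lemma ev_X:
  "ev (aout f + k + aout g) [(0, f, k + aout g), (ain f + k, g, 0)] =
    ((F f \<lhd>\<^sub>1 pow k) \<lhd>\<^sub>1 pow (aout g)) \<cdot> (pow (ain f + k) \<rhd>\<^sub>1 F g)" (is ?X)
  and ev_Y: "ev (aout f + k + aout g) [(aout f + k, g, 0), (0, f, k + ain g)] =
    (pow (aout f + k) \<rhd>\<^sub>1 F g) \<cdot> ((F f \<lhd>\<^sub>1 pow k) \<lhd>\<^sub>1 pow (ain g))" (is ?Y)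
proof -
  have *: "lt (0, f, k + m) = (F f \<lhd>\<^sub>1 pow k) \<lhd>\<^sub>1 pow m" "lt (m, g, 0) = pow m \<rhd>\<^sub>1 F g" for m
    by (simp_all add: lt_def pad1_def lw1_unit pow_add rw1_ten rw1_unit)
  have s: "lt (m, h, m') \<cdot> \<one> (pow (m + ain h + m')) = lt (m, h, m')" for m h m'
    using comp1_id_right[of "lt (m, h, m')"] by (simp add: lt_src)
  show ?X ?Y
    using s[of "ain f + k" g 0] s[of 0 f "k + ain g"] by (simp_all flip: * add: add_ac)
qed

lemma intch_typed:
  "\<chi> (F f \<lhd>\<^sub>1 pow k) (F g) \<in> hom2 B
    (((F f \<lhd>\<^sub>1 pow k) \<lhd>\<^sub>1 pow (aout g)) \<cdot> (pow (ain f + k) \<rhd>\<^sub>1 F g))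
    ((pow (aout f + k) \<rhd>\<^sub>1 F g) \<cdot> ((F f \<lhd>\<^sub>1 pow k) \<lhd>\<^sub>1 pow (ain g)))"
  using intch_hom[OF rw1_hom[OF F_hom[of f]] F_hom[of g]] by (simp add: pow_add)

lemma good_cross [simp]: "good (Ch f k g)" "good (ChI f k g)"
  using intch_typed[of f k g] inv2_hom[OF intch_iso intch_typed[of f k g]]
  by (simp_all only: good_def ce.simps cdom.simps ccod.simps cout.simps ev_X ev_Y)

lemma cinv_inverse: "c = Ch f k g \<or> c = ChI f k g \<Longrightarrow> inverse_2cells B (ce c) (ce (cinv c))"
  using inverse_intch[of "F f \<lhd>\<^sub>1 pow k" "F g"] by (auto simp: inverse_2cells_def hom2_def)

lemma goods_simps [simp]: "goods []" "goods ((n, p, c, q) # D) \<longleftrightarrow> good c \<and> goods D"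
  "goods (D @ E) \<longleftrightarrow> goods D \<and> goods E" "goods (shd n p q D) = goods D"
  unfolding goods_def shd_def by (simp, simp, fastforce, fastforce)

lemma lev_split:
  assumes "w = w1 @ sh p q (cdom c) @ w2" "length w1 = n"
  shows "lev k w (n, p, c, q) = whisk (ev k w1) (pad2 (pow p) (ce c) (pow q)) (ev (p + cin c + q) w2)"
  using assms by simp

lemma split_typed:
  assumes "wok k (w1 @ sh p q (cdom c) @ w2)" "sr k w1 = p + cout c + q"
  shows "wok k w1" "wok (p + cin c + q) w2"
    "ev k (w1 @ sh p q (cdom c) @ w2)
       = ev k w1 \<cdot> pad1 (pow p) (ev (cout c) (cdom c)) (pow q) \<cdot> ev (p + cin c + q) w2"
    "ev k (w1 @ sh p q (ccod c) @ w2)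
       = ev k w1 \<cdot> pad1 (pow p) (ev (cout c) (ccod c)) (pow q) \<cdot> ev (p + cin c + q) w2"
proof -
  have s: "sr (p + cout c + q) (sh p q (cdom c)) = p + cin c + q"
    "sr (p + cout c + q) (sh p q (ccod c)) = p + cin c + q"
    using sr_sh[of "cout c" "cdom c" p q] sr_sh[of "cout c" "ccod c" p q] by simp_all
  show w: "wok k w1" "wok (p + cin c + q) w2"
    using assms s by simp_all
  show "ev k (w1 @ sh p q (cdom c) @ w2)
       = ev k w1 \<cdot> pad1 (pow p) (ev (cout c) (cdom c)) (pow q) \<cdot> ev (p + cin c + q) w2"
    using assms w s ev_append[of "p + cout c + q" "sh p q (cdom c)" w2] ev_sh[of "cout c" "cdom c" p q]
      wok_sh[of "cout c" "cdom c" p q]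
    by (subst ev_append) simp_all
  show "ev k (w1 @ sh p q (ccod c) @ w2)
       = ev k w1 \<cdot> pad1 (pow p) (ev (cout c) (ccod c)) (pow q) \<cdot> ev (p + cin c + q) w2"
    using assms w s ev_append[of "p + cout c + q" "sh p q (ccod c)" w2] ev_sh[of "cout c" "ccod c" p q]
      wok_sh[of "cout c" "ccod c" p q]
    by (subst ev_append) simp_all
qed

lemma pad_cell_src: "src B (pad1 (pow p) (ev (cout c) (cdom c)) (pow q)) = pow (p + cin c + q)"
    "src B (pad1 (pow p) (ev (cout c) (ccod c)) (pow q)) = pow (p + cin c + q)"
  and pad_cell_trg: "trg B (pad1 (pow p) (ev (cout c) (cdom c)) (pow q)) = pow (p + cout c + q)"
    "trg B (pad1 (pow p) (ev (cout c) (ccod c)) (pow q)) = pow (p + cout c + q)"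
  by (simp_all add: pad1_src pad1_trg pow_add ten0_assoc)

lemma pad_cell_hom:
  "good c \<Longrightarrow> pad2 (pow p) (ce c) (pow q) \<in> hom2 B (pad1 (pow p) (ev (cout c) (cdom c)) (pow q))
     (pad1 (pow p) (ev (cout c) (ccod c)) (pow q))"
  by (rule pad2_hom) (simp add: good_def)

lemma lev_hom:
  assumes "wok k w" "lapp k w (n, p, c, q) = Some w'" "good c"
  shows "lev k w (n, p, c, q) \<in> hom2 B (ev k w) (ev k w')"
proof -
  obtain w1 w2 where *: "w = w1 @ sh p q (cdom c) @ w2" "w' = w1 @ sh p q (ccod c) @ w2"
    "length w1 = n" "sr k w1 = p + cout c + q"
    using assms(2) unfolding lapp_iff by auto
  note st = split_typed[OF assms(1)[unfolded *(1)] *(4)]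
  show ?thesis
    unfolding lev_split[OF *(1,3)] unfolding *(1,2) st(3,4)
    by (rule whisk_hom[OF pad_cell_hom[OF assms(3)]])
      (use st(1,2) *(4) in \<open>simp_all add: pad_cell_src pad_cell_trg\<close>)
qed

lemma dev_hom:
  "\<lbrakk>wok k w; dapp k w D = Some w'; goods D\<rbrakk> \<Longrightarrow> dev k w D \<in> hom2 B (ev k w) (ev k w')"
proof (induction D arbitrary: w)
  case (Cons l D)
  obtain n p c q where l: "l = (n, p, c, q)" by (cases l) auto
  obtain v where v: "lapp k w l = Some v" "dapp k v D = Some w'"
    using Cons.prems by (auto split: option.splits)
  have "dev k v D \<in> hom2 B (ev k v) (ev k w')"
    using Cons.IH[OF lapp_wok(1)[OF Cons.prems(1) v(1)] v(2)] Cons.prems l by simp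
  then show ?case
    using lev_hom[OF Cons.prems(1) v(1)[unfolded l]] Cons.prems(3) v(1) unfolding l
    by (auto intro: vcomp_hom)
qed (auto intro: id2_hom)

lemma dev_append:
  assumes "wok k w" "dapp k w D = Some v" "dapp k v E = Some w'" "goods D" "goods E"
  shows "dev k w (D @ E) = dev k v E \<odot> dev k w D"
  using assms
proof (induction D arbitrary: w)
  case Nil
  then show ?case using dev_hom[of k v E w'] vcomp_id2_right by fastforce
next
  case (Cons l D)
  obtain n p c q where l: "l = (n, p, c, q)" by (cases l) auto
  obtain u where u: "lapp k w l = Some u" "dapp k u D = Some v"
    using Cons.prems by (auto split: option.splits)
  have wu: "wok k u" "wok k v" using lapp_wok(1)[OF Cons.prems(1) u(1)] dapp_wok u(2) by blast+
  have IH: "dev k u (D @ E) = dev k v E \<odot> dev k u D"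
    using Cons.IH[OF wu(1) u(2) Cons.prems(3)] Cons.prems l by simp
  have h: "lev k w l \<in> hom2 B (ev k w) (ev k u)"
    using lev_hom[OF Cons.prems(1) u(1)[unfolded l]] Cons.prems(4) l by simp
  have "dev k u D \<in> hom2 B (ev k u) (ev k v)" "dev k v E \<in> hom2 B (ev k v) (ev k w')"
    using dev_hom wu u Cons.prems l by auto
  then show ?case
    using u(1) IH vcomp_assoc'[OF h] by simp
qed

text \<open>The relation preserved by every move. Typing and a common boundary are part of it, so a
  chain of moves needs no typing argument of its own.\<close>

definition eqd :: "nat \<Rightarrow> word \<Rightarrow> diag \<Rightarrow> diag \<Rightarrow> bool" where
  "eqd k w D E \<longleftrightarrow> wok k w \<and> goods D \<and> goods E \<and> dapp k w D \<noteq> None \<and> dapp k w E = dapp k w D \<and>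
     dev k w D = dev k w E"

lemma eqd_sym: "eqd k w D E \<Longrightarrow> eqd k w E D"
  and eqd_trans: "eqd k w D E \<Longrightarrow> eqd k w E E' \<Longrightarrow> eqd k w D E'"
  and eqd_refl: "wok k w \<Longrightarrow> goods D \<Longrightarrow> dapp k w D \<noteq> None \<Longrightarrow> eqd k w D D"
  by (auto simp: eqd_def)

lemma eqd_context:
  assumes "wok k w" "dapp k w P = Some v" "eqd k v D E" "dapp k w (P @ D @ Q) \<noteq> None"
    "goods P" "goods Q"
  shows "eqd k w (P @ D @ Q) (P @ E @ Q)"
proof -
  have v: "wok k v" using dapp_wok assms(1,2) by blast
  obtain v' where v': "dapp k v D = Some v'" "dapp k v E = Some v'"
    using assms(3) by (auto simp: eqd_def)
  obtain w' where w': "dapp k v' Q = Some w'"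
    using assms(2,4) v' by (auto simp: dapp_append)
  have "dapp k v (D @ Q) = Some w'" "dapp k v (E @ Q) = Some w'"
    using v' w' by (simp_all add: dapp_append)
  then have "dev k w (P @ D @ Q) = (dev k v' Q \<odot> dev k v D) \<odot> dev k w P"
    "dev k w (P @ E @ Q) = (dev k v' Q \<odot> dev k v E) \<odot> dev k w P"
    using assms v v' w' by (simp_all add: dev_append[OF _ assms(2)] dev_append[OF v v'(1) w']
      dev_append[OF v v'(2) w'] eqd_def)
  then show ?thesis
    using assms v' w' by (simp add: eqd_def dapp_append)
qed

text \<open>Padding and whiskering are functorial for vertical composition, so shifting all layers
  of a diagram pads and whiskers its value. Through this lemma an equation proved on its own
  boundary can be used at any place of a larger diagram.\<close>

lemma shd_lift:
  assumes "wok k0 w" "dapp k0 w D = Some w'" "goods D" "wok k (w1 @ sh p q w @ w2)" "sr k w1 = p + k0 + q"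
  shows "dapp k (w1 @ sh p q w @ w2) (shd (length w1) p q D) = Some (w1 @ sh p q w' @ w2) \<and>
    dev k (w1 @ sh p q w @ w2) (shd (length w1) p q D)
      = whisk (ev k w1) (pad2 (pow p) (dev k0 w D) (pow q)) (ev (p + sr k0 w + q) w2)"
  using assms
proof (induction D arbitrary: w)
  case Nil
  have "wok k w1" "wok (p + k0 + q) (sh p q w)" "wok (p + sr k0 w + q) w2"
    using Nil by simp_all
  moreover have "trg B (pad1 (pow p) (ev k0 w) (pow q)) = pow (p + k0 + q)"
    "src B (pad1 (pow p) (ev k0 w) (pow q)) = pow (p + sr k0 w + q)"
    using Nil by (simp_all add: pad1_src pad1_trg pow_add ten0_assoc)
  ultimately show ?case
    using Nil by (simp add: pad2_id whisk_id2)
next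
  case (Cons l D)
  obtain n a c b where l: "l = (n, a, c, b)" by (cases l) auto
  obtain v where v: "lapp k0 w l = Some v" "dapp k0 v D = Some w'"
    using Cons.prems by (auto split: option.splits)
  obtain x y where xy: "w = x @ sh a b (cdom c) @ y" "v = x @ sh a b (ccod c) @ y" "length x = n"
    "sr k0 x = a + cout c + b"
    using v(1) unfolding l lapp_iff by auto
  have gc: "good c" "goods D" using Cons.prems(3) l by auto
  have wv: "wok k0 v" "sr k0 v = sr k0 w" using lapp_wok[OF Cons.prems(1) v(1)] by auto
  let ?w = "w1 @ sh p q w @ w2" and ?v = "w1 @ sh p q v @ w2"
  have wx: "wok k0 x" "wok (a + cin c + b) y"
    using split_typed(1,2) Cons.prems(1) xy by metis+
  have lw: "lapp k ?w (length w1 + n, p + a, c, b + q) = Some ?v"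
    unfolding lapp_iff
    by (rule exI[of _ "w1 @ sh p q x"], rule exI[of _ "sh p q y @ w2"])
      (use xy Cons.prems sr_sh[OF wx(1), of p q] in simp)
  have wkv: "wok k ?v" using lapp_wok(1)[OF Cons.prems(4) lw] .
  note IH = Cons.IH[OF wv(1) v(2) gc(2) wkv Cons.prems(5)]
  have wp: "wok k w1" "wok (p + sr k0 w + q) w2" using Cons.prems by simp_all
  have srw: "sr k0 w = sr (a + cin c + b) y"
    using xy(1) xy(4) sr_sh[of "cout c" "cdom c" a b] by simp
  have dv: "dev k0 v D \<in> hom2 B (ev k0 v) (ev k0 w')" and lv: "lev k0 w l \<in> hom2 B (ev k0 w) (ev k0 v)"
    using dev_hom[OF wv(1) v(2) gc(2)] lev_hom[OF Cons.prems(1) v(1)[unfolded l] gc(1)] l by auto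
  have "lev k ?w (length w1 + n, p + a, c, b + q)
      = whisk (ev k (w1 @ sh p q x)) (pad2 (pow (p + a)) (ce c) (pow (b + q))) (ev (p + a + cin c + (b + q)) (sh p q y @ w2))"
    by (rule lev_split) (use xy in simp_all)
  also have "ev k (w1 @ sh p q x) = ev k w1 \<cdot> pad1 (pow p) (ev k0 x) (pow q)"
    using Cons.prems(5) wx(1) wp(1) by simp
  also have "ev (p + a + cin c + (b + q)) (sh p q y @ w2)
      = pad1 (pow p) (ev (a + cin c + b) y) (pow q) \<cdot> ev (p + sr k0 w + q) w2"
  proof -
    have e: "p + a + cin c + (b + q) = p + (a + cin c + b) + q" by simp
    show ?thesis unfolding e using wx(2) wp(2) srw
      by (subst ev_append) simp_all
  qed
  also have "pad2 (pow (p + a)) (ce c) (pow (b + q)) = pad2 (pow p) (pad2 (pow a) (ce c) (pow b)) (pow q)"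
    by (simp add: pad2_pad2 pow_add)
  also have "whisk (ev k w1 \<cdot> pad1 (pow p) (ev k0 x) (pow q)) (pad2 (pow p) (pad2 (pow a) (ce c) (pow b)) (pow q))
       (pad1 (pow p) (ev (a + cin c + b) y) (pow q) \<cdot> ev (p + sr k0 w + q) w2)
     = whisk (ev k w1) (whisk (pad1 (pow p) (ev k0 x) (pow q)) (pad2 (pow p) (pad2 (pow a) (ce c) (pow b)) (pow q))
         (pad1 (pow p) (ev (a + cin c + b) y) (pow q))) (ev (p + sr k0 w + q) w2)"
    by (rule whisk_whisk[symmetric, OF pad2_hom[OF pad_cell_hom[OF gc(1)]]])
      (use wx wp xy(4) srw Cons.prems(5) in \<open>simp_all add: pad1_src pad1_trg pow_add ten0_assoc\<close>)
  also have "whisk (pad1 (pow p) (ev k0 x) (pow q)) (pad2 (pow p) (pad2 (pow a) (ce c) (pow b)) (pow q))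
         (pad1 (pow p) (ev (a + cin c + b) y) (pow q)) = pad2 (pow p) (lev k0 w l) (pow q)"
    unfolding l lev_split[OF xy(1,3)]
    by (rule pad2_whisk[symmetric, OF pad_cell_hom[OF gc(1)]])
      (use wx xy(4) in \<open>simp_all add: pad_cell_src pad_cell_trg\<close>)
  finally have L: "lev k ?w (length w1 + n, p + a, c, b + q)
      = whisk (ev k w1) (pad2 (pow p) (lev k0 w l) (pow q)) (ev (p + sr k0 w + q) w2)" .
  have W: "whisk (ev k w1) (pad2 (pow p) (dev k0 v D) (pow q) \<odot> pad2 (pow p) (lev k0 w l) (pow q)) (ev (p + sr k0 w + q) w2)
     = whisk (ev k w1) (pad2 (pow p) (dev k0 v D) (pow q)) (ev (p + sr k0 w + q) w2)
       \<odot> whisk (ev k w1) (pad2 (pow p) (lev k0 w l) (pow q)) (ev (p + sr k0 w + q) w2)"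
    by (rule whisk_vcomp[OF pad2_hom[OF lv] pad2_hom[OF dv]])
      (use Cons.prems(1,5) wp in \<open>simp_all add: pad1_src pad1_trg pow_add ten0_assoc\<close>)
  have D: "dev k0 w (l # D) = dev k0 v D \<odot> lev k0 w l" using v(1) by simp
  show ?case
    using IH lw L W wv(2) unfolding D pad2_vcomp[OF lv dv] by (simp add: l del: lapp.simps lev.simps)
qed

lemma eqd_lift:
  assumes "eqd k0 w D E" "wok k (w1 @ sh p q w @ w2)" "sr k w1 = p + k0 + q"
  shows "eqd k (w1 @ sh p q w @ w2) (shd (length w1) p q D) (shd (length w1) p q E)"
proof -
  obtain w' where "wok k0 w" "dapp k0 w D = Some w'" "dapp k0 w E = Some w'" "goods D" "goods E"
    "dev k0 w D = dev k0 w E"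
    using assms(1) by (auto simp: eqd_def)
  then show ?thesis
    using shd_lift[of k0 w D w' k w1 p q w2] shd_lift[of k0 w E w' k w1 p q w2] assms(2,3)
    by (simp add: eqd_def)
qed

lemma eqd_slide:
  assumes w: "wok k (w1 @ sh p q (cdom c) @ x @ sh p' q' (cdom c') @ w2)"
    and "sr k w1 = p + cout c + q" "sr (p + cin c + q) x = p' + cout c' + q'" "good c" "good c'"
  shows "eqd k (w1 @ sh p q (cdom c) @ x @ sh p' q' (cdom c') @ w2)
    [(length w1, p, c, q), (length w1 + length (ccod c) + length x, p', c', q')]
    [(length w1 + length (cdom c) + length x, p', c', q'), (length w1, p, c, q)]"
proof -
  let ?d = "sh p q (cdom c)" and ?e = "sh p q (ccod c)" and ?d' = "sh p' q' (cdom c')" and ?e' = "sh p' q' (ccod c')"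
  have s: "sr (p + cout c + q) ?d = p + cin c + q" "sr (p + cout c + q) ?e = p + cin c + q"
    "sr (p' + cout c' + q') ?d' = p' + cin c' + q'" "sr (p' + cout c' + q') ?e' = p' + cin c' + q'"
    using sr_sh[of "cout c" _ p q] sr_sh[of "cout c'" _ p' q'] by simp_all
  have wk: "wok (p + cout c + q) ?d" "wok (p + cout c + q) ?e" "wok (p' + cout c' + q') ?d'" "wok (p' + cout c' + q') ?e'"
    using wok_sh[of "cout c" _ p q] wok_sh[of "cout c'" _ p' q'] by simp_all
  have w1: "wok k w1" and wx: "wok (p + cin c + q) x" and w2: "wok (p' + cin c' + q') w2"
    using w assms(2,3) s by simp_all
  have l1: "lapp k (w1 @ ?d @ x @ ?d' @ w2) (length w1, p, c, q) = Some (w1 @ ?e @ x @ ?d' @ w2)"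
    unfolding lapp_iff using assms by blast
  have l2: "lapp k (w1 @ ?e @ x @ ?d' @ w2) (length w1 + length (ccod c) + length x, p', c', q')
      = Some (w1 @ ?e @ x @ ?e' @ w2)"
    unfolding lapp_iff by (rule exI[of _ "w1 @ ?e @ x"], rule exI[of _ w2]) (use assms s in simp)
  have l3: "lapp k (w1 @ ?d @ x @ ?d' @ w2) (length w1 + length (cdom c) + length x, p', c', q')
      = Some (w1 @ ?d @ x @ ?e' @ w2)"
    unfolding lapp_iff by (rule exI[of _ "w1 @ ?d @ x"], rule exI[of _ w2]) (use assms s in simp)
  have l4: "lapp k (w1 @ ?d @ x @ ?e' @ w2) (length w1, p, c, q) = Some (w1 @ ?e @ x @ ?e' @ w2)"
    unfolding lapp_iff using assms by blast
  let ?t = "pad2 (pow p) (ce c) (pow q)" and ?t' = "pad2 (pow p') (ce c') (pow q')"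
  let ?D = "pad1 (pow p) (ev (cout c) (cdom c)) (pow q)" and ?E = "pad1 (pow p) (ev (cout c) (ccod c)) (pow q)"
  let ?D' = "pad1 (pow p') (ev (cout c') (cdom c')) (pow q')" and ?E' = "pad1 (pow p') (ev (cout c') (ccod c')) (pow q')"
  let ?W = "ev k w1" and ?X = "ev (p + cin c + q) x" and ?Z = "ev (p' + cin c' + q') w2"
  have ed: "ev (p + cout c + q) ?d = ?D" "ev (p + cout c + q) ?e = ?E" "ev (p' + cout c' + q') ?d' = ?D'"
    "ev (p' + cout c' + q') ?e' = ?E'" by simp_all
  have "lev k (w1 @ ?d @ x @ ?d' @ w2) (length w1, p, c, q) = whisk ?W ?t (ev (p + cin c + q) (x @ ?d' @ w2))"
    "lev k (w1 @ ?d @ x @ ?e' @ w2) (length w1, p, c, q) = whisk ?W ?t (ev (p + cin c + q) (x @ ?e' @ w2))"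
    by (rule lev_split; simp)+
  moreover have "lev k (w1 @ ?e @ x @ ?d' @ w2) (length w1 + length (ccod c) + length x, p', c', q')
      = whisk (ev k (w1 @ ?e @ x)) ?t' ?Z"
    by (rule lev_split[of _ "w1 @ ?e @ x" _ _ _ w2]) simp_all
  moreover have "lev k (w1 @ ?d @ x @ ?d' @ w2) (length w1 + length (cdom c) + length x, p', c', q')
      = whisk (ev k (w1 @ ?d @ x)) ?t' ?Z"
    by (rule lev_split[of _ "w1 @ ?d @ x" _ _ _ w2]) simp_all
  moreover have "ev (p + cin c + q) (x @ ?d' @ w2) = ?X \<cdot> ?D' \<cdot> ?Z" "ev (p + cin c + q) (x @ ?e' @ w2) = ?X \<cdot> ?E' \<cdot> ?Z"
    "ev k (w1 @ ?e @ x) = ?W \<cdot> ?E \<cdot> ?X" "ev k (w1 @ ?d @ x) = ?W \<cdot> ?D \<cdot> ?X"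
    using wk s w1 wx w2 assms(2,3) ed by simp_all
  moreover have "whisk (?W \<cdot> ?E \<cdot> ?X) ?t' ?Z \<odot> whisk ?W ?t (?X \<cdot> ?D' \<cdot> ?Z)
      = whisk ?W ?t (?X \<cdot> ?E' \<cdot> ?Z) \<odot> whisk (?W \<cdot> ?D \<cdot> ?X) ?t' ?Z"
    by (rule whisk_slide[OF pad_cell_hom[OF assms(4)] pad_cell_hom[OF assms(5)]])
      (use w1 wx w2 assms(2,3) in \<open>simp_all add: pad_cell_src pad_cell_trg\<close>)
  moreover have "\<langle>ev k (w1 @ ?e @ x @ ?e' @ w2)\<rangle> \<odot> r = r" if "r \<in> hom2 B f (ev k (w1 @ ?e @ x @ ?e' @ w2))" for r f
    using vcomp_id2_left[OF that] .
  moreover have "lev k (w1 @ ?e @ x @ ?d' @ w2) (length w1 + length (ccod c) + length x, p', c', q')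
     \<in> hom2 B (ev k (w1 @ ?e @ x @ ?d' @ w2)) (ev k (w1 @ ?e @ x @ ?e' @ w2))"
    "lev k (w1 @ ?d @ x @ ?e' @ w2) (length w1, p, c, q) \<in> hom2 B (ev k (w1 @ ?d @ x @ ?e' @ w2)) (ev k (w1 @ ?e @ x @ ?e' @ w2))"
    using lev_hom[OF lapp_wok(1)[OF w l1] l2 assms(5)] lev_hom[OF lapp_wok(1)[OF w l3] l4 assms(4)] by blast+
  ultimately show ?thesis
    using w assms(4,5) l1 l2 l3 l4 by (simp add: eqd_def del: lapp.simps lev.simps ev_append)
qed

end

section \<open>Interchangers of composites and their inverses\<close>

context diagrams
begin

lemma lt_eq: "lt (p, f, q) = pow p \<rhd>\<^sub>1 (F f \<lhd>\<^sub>1 pow q)"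
  by (simp add: lt_def pad1_def)

lemma lt_id: "lt (p, f, q) \<cdot> \<one> (pow (p + ain f + q)) = lt (p, f, q)"
  using comp1_id_right[of "lt (p, f, q)"] by (simp add: lt_src)

lemma ev_hom: "wok k w \<Longrightarrow> ev k w \<in> hom1 B (pow (sr k w)) (pow k)"
  by (simp add: hom1_def)

lemma lt_hom: "lt (p, f, q) \<in> hom1 B (pow (p + ain f + q)) (pow (p + aout f + q))"
  by (simp add: hom1_def lt_src lt_trg)

lemma ev_sh0: "wok k w \<Longrightarrow> ev (k + q) (sh 0 q w) = ev k w \<lhd>\<^sub>1 pow q"
  "wok k w \<Longrightarrow> ev (p + k) (sh p 0 w) = pow p \<rhd>\<^sub>1 ev k w"
  using ev_sh[of k w 0 q] ev_sh[of k w p 0] by (simp_all add: pad1_def lw1_unit rw1_unit)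

lemma wok_sh0: "wok k w \<Longrightarrow> wok (k + q) (sh 0 q w)" "wok k w \<Longrightarrow> wok (p + k) (sh p 0 w)"
  "wok k w \<Longrightarrow> sr (k + q) (sh 0 q w) = sr k w + q" "wok k w \<Longrightarrow> sr (p + k) (sh p 0 w) = p + sr k w"
  using wok_sh[of k w 0 q] wok_sh[of k w p 0] sr_sh[of k w 0 q] sr_sh[of k w p 0] by simp_all

lemma dev_single:
  assumes "wok k w" "lapp k w l = Some v" "l = (n, p, c, q)" "good c"
  shows "dev k w [l] = lev k w l"
  using vcomp_id2_left[OF lev_hom[OF assms(1) assms(2)[unfolded assms(3)] assms(4)]] assms(2,3) by simp

text \<open>Induction on the word: \<open>intch_comp_left\<close> separates the first letter, whose
  crossing is the last layer. The strands around the two letters are absorbed because \<chi> is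
  compatible with tensoring its arguments.\<close>

lemma crossR_sound:
  assumes "wok m w"
  shows "wok (m + k + aout g + q) (sh 0 (k + aout g + q) w @ [(sr m w + k, g, q)])"
    "goods (crossR 0 k g q w)"
    "dapp (m + k + aout g + q) (sh 0 (k + aout g + q) w @ [(sr m w + k, g, q)]) (crossR 0 k g q w)
       = Some ((m + k, g, q) # sh 0 (k + ain g + q) w)" (is ?A)
    "dev (m + k + aout g + q) (sh 0 (k + aout g + q) w @ [(sr m w + k, g, q)]) (crossR 0 k g q w)
       = \<chi> (ev m w \<lhd>\<^sub>1 pow k) (F g \<lhd>\<^sub>1 pow q)" (is ?B)
proof -
  have W: "wok (m + k + aout g + q) (sh 0 (k + aout g + q) w @ [(sr m w + k, g, q)])" if "wok m w" for m w
    using that wok_sh0(1,3)[of m w "k + aout g + q"] by (simp add: add_ac)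
  have Gd: "goods (crossR n k g q w)" for n w
    by (induction n k g q w rule: crossR.induct) auto
  have "?A \<and> ?B"
    using assms
  proof (induction w arbitrary: m)
    case Nil
    have "lt (m + k, g, q) = pow (m + k) \<rhd>\<^sub>1 (F g \<lhd>\<^sub>1 pow q)" by (simp add: lt_def pad1_def)
    then show ?case using lt_id[of "m + k" g q]
      by (simp add: rw1_id intch_id_left pow_add)
  next
    case (Cons x w)
    obtain a f b where x: "x = (a, f, b)" by (cases x) auto
    define m' where "m' = a + ain f + b"
    have m: "m = a + aout f + b" and w: "wok m' w" using Cons.prems x by (simp_all add: m'_def)
    let ?r = "k + aout g + q" and ?r' = "k + ain g + q"
    let ?K = "m + k + aout g + q" and ?K' = "m' + k + aout g + q"
    let ?s = "sh 0 ?r w @ [(sr m' w + k, g, q)]" and ?t = "(m' + k, g, q) # sh 0 ?r' w"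
    note IH = Cons.IH[OF w]
    have W0: "wok ?K ([(a, f, b + ?r)] @ sh 0 0 ?s @ [])"
      using W[OF w] by (simp add: m m'_def add_ac)
    have S0: "sr ?K [(a, f, b + ?r)] = 0 + ?K' + 0" by (simp add: m'_def)
    note L = shd_lift[OF W[OF w] IH[THEN conjunct1] Gd W0 S0]
    have t: "sh 0 ?r (x # w) @ [(sr m (x # w) + k, g, q)] = [(a, f, b + ?r)] @ sh 0 0 ?s @ []"
      by (simp add: x m'_def)
    have t': "[(a, f, b + ?r)] @ sh 0 0 ?t @ [] = (a, f, b + ?r) # (m' + k, g, q) # sh 0 ?r' w" by simp
    let ?v = "(a, f, b + ?r) # (m' + k, g, q) # sh 0 ?r' w"
    have l: "lapp ?K ?v (0, a, Ch f (b + k) g, q) = Some ((m + k, g, q) # (a, f, b + ?r') # sh 0 ?r' w)"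
      unfolding lapp_iff
      by (rule exI[of _ "[]"], rule exI[of _ "sh 0 ?r' w"]) (simp add: m m'_def add_ac)
    have wv: "wok ?K ?v"
      using dapp_wok[OF W0 L[THEN conjunct1]] by simp
    let ?y = "F g \<lhd>\<^sub>1 pow q"
    let ?f' = "lt (a, f, b) \<lhd>\<^sub>1 pow k" and ?f = "ev m' w \<lhd>\<^sub>1 pow k"
    have yh: "?y \<in> hom1 B (pow (ain g + q)) (pow (aout g + q))"
      using rw1_hom[OF F_hom[of g], of "pow q"] by (simp add: pow_add)
    have fh: "?f \<in> hom1 B (pow (sr m' w + k)) (pow (m' + k))" "?f' \<in> hom1 B (pow (m' + k)) (pow (m + k))"
      using rw1_hom[OF ev_hom[OF w], of "pow k"] rw1_hom[OF lt_hom[of a f b], of "pow k"]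
      by (simp_all add: pow_add m m'_def)
    have lev: "lev ?K ?v (0, a, Ch f (b + k) g, q) = \<chi> ?f' ?y \<star> \<langle>?f \<lhd>\<^sub>1 pow (ain g + q)\<rangle>"
    proof -
      have "lev ?K ?v (0, a, Ch f (b + k) g, q) = whisk (\<one> (pow ?K)) (pad2 (pow a) (\<chi> (F f \<lhd>\<^sub>1 pow (b + k)) (F g)) (pow q))
          (ev (a + (ain f + (b + k) + ain g) + q) (sh 0 ?r' w))"
        by simp
      also have "pad2 (pow a) (\<chi> (F f \<lhd>\<^sub>1 pow (b + k)) (F g)) (pow q) = \<chi> ?f' ?y"
        by (simp add: pad2_intch lt_eq pow_add rw1_ten lw1_rw1)
      also have "ev (a + (ain f + (b + k) + ain g) + q) (sh 0 ?r' w) = ?f \<lhd>\<^sub>1 pow (ain g + q)"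
        using ev_sh0(1)[OF w, of ?r'] by (simp add: m'_def add_ac pow_add rw1_ten)
      also have "whisk (\<one> (pow ?K)) (\<chi> ?f' ?y) (?f \<lhd>\<^sub>1 pow (ain g + q)) = \<chi> ?f' ?y \<star> \<langle>?f \<lhd>\<^sub>1 pow (ain g + q)\<rangle>"
      proof -
        have "\<chi> ?f' ?y \<star> \<langle>?f \<lhd>\<^sub>1 pow (ain g + q)\<rangle> \<in> hom2 B
           (((?f' \<lhd>\<^sub>1 pow (aout g + q)) \<cdot> (pow (m' + k) \<rhd>\<^sub>1 ?y)) \<cdot> (?f \<lhd>\<^sub>1 pow (ain g + q)))
           (((pow (m + k) \<rhd>\<^sub>1 ?y) \<cdot> (?f' \<lhd>\<^sub>1 pow (ain g + q))) \<cdot> (?f \<lhd>\<^sub>1 pow (ain g + q)))"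
          by (rule hcomp_hom'[OF intch_hom[OF fh(2) yh] id2_hom])
            (use fh yh in \<open>simp add: hom1_def comp1_src lw1_src lw1_trg rw1_src rw1_trg\<close>)
        moreover have "trg B (((?f' \<lhd>\<^sub>1 pow (aout g + q)) \<cdot> (pow (m' + k) \<rhd>\<^sub>1 ?y)) \<cdot> (?f \<lhd>\<^sub>1 pow (ain g + q))) = pow ?K"
          using fh yh by (simp add: hom1_def comp1_src comp1_trg lw1_src lw1_trg rw1_src rw1_trg flip: pow_add) (simp add: add_ac)
        ultimately show ?thesis
          using hcomp_id_left[of "\<chi> ?f' ?y \<star> \<langle>?f \<lhd>\<^sub>1 pow (ain g + q)\<rangle>"] by (auto simp: whisk_def hom2_def)
      qed
      finally show ?thesis .
    qed
    have fst: "dev ?K ([(a, f, b + ?r)] @ sh 0 0 ?s @ []) (shd (length [(a, f, b + ?r)]) 0 0 (crossR 0 k g q w))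
        = \<langle>?f' \<lhd>\<^sub>1 pow (aout g + q)\<rangle> \<star> \<chi> ?f ?y"
    proof -
      have "ev ?K [(a, f, b + ?r)] = ?f' \<lhd>\<^sub>1 pow (aout g + q)"
        using lt_id[of a f "b + ?r"] by (simp add: lt_eq pow_add rw1_ten lw1_rw1 add.assoc)
      moreover have "\<chi> ?f ?y \<star> \<langle>\<one> (pow (0 + sr ?K' ?s + 0))\<rangle> = \<chi> ?f ?y"
      proof -
        have "sr ?K' ?s = sr m' w + k + ain g + q" by simp
        then show ?thesis
          using hcomp_id_right[of "\<chi> ?f ?y"] intch_hom[OF fh(1) yh] fh yh
          by (auto simp: hom2_def hom1_def comp1_src comp1_trg lw1_src lw1_trg rw1_src rw1_trg pow_add ten0_assoc)
      qed
      ultimately show ?thesis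
        using L[THEN conjunct2] IH[THEN conjunct2] by (simp add: whisk_def pad2_unit)
    qed
    have d1: "dapp ?K ([(a, f, b + ?r)] @ sh 0 0 ?s @ []) (crossR (Suc 0) k g q w) = Some ?v"
      using L[THEN conjunct1] t' by (subst crossR_shd) simp
    have d2: "dapp ?K ?v [(0, a, Ch f (b + k) g, q)] = Some ((m + k, g, q) # (a, f, b + ?r') # sh 0 ?r' w)"
      using l by simp
    have c: "crossR (Suc 0) k g q w = shd (length [(a, f, b + ?r)]) 0 0 (crossR 0 k g q w)"
      by (subst crossR_shd) simp
    have "dev ?K ([(a, f, b + ?r)] @ sh 0 0 ?s @ []) (crossR (Suc 0) k g q w @ [(0, a, Ch f (b + k) g, q)])
      = (\<chi> ?f' ?y \<star> \<langle>?f \<lhd>\<^sub>1 pow (ain g + q)\<rangle>) \<odot> (\<langle>?f' \<lhd>\<^sub>1 pow (aout g + q)\<rangle> \<star> \<chi> ?f ?y)"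
      using dev_append[OF W0 d1 d2 Gd] dev_single[OF wv l refl] lev fst c
      by (simp del: lev.simps lapp.simps ev.simps)
    also have "\<dots> = \<chi> (?f' \<cdot> ?f) ?y"
      using intch_comp_left[OF fh yh] by simp
    also have "?f' \<cdot> ?f = ev m (x # w) \<lhd>\<^sub>1 pow k"
      using w by (simp add: x m'_def rw1_comp lt_src)
    finally have "dev ?K ([(a, f, b + ?r)] @ sh 0 0 ?s @ []) (crossR 0 k g q (x # w)) = \<chi> (ev m (x # w) \<lhd>\<^sub>1 pow k) ?y"
      by (simp add: x)
    moreover have "dapp ?K ([(a, f, b + ?r)] @ sh 0 0 ?s @ []) (crossR 0 k g q (x # w)) = Some ((m + k, g, q) # sh 0 ?r' (x # w))"
      using d1 d2 by (simp add: x dapp_append del: lapp.simps)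
    ultimately show ?case unfolding t by simp
  qed
  then show ?A ?B by auto
  show "wok (m + k + aout g + q) (sh 0 (k + aout g + q) w @ [(sr m w + k, g, q)])" using W[OF assms] .
  show "goods (crossR 0 k g q w)" by (rule Gd)
qed

lemma whisk_unit_left:
  assumes "t \<in> hom2 B s s'" "trg B s = X" "trg B g = src B s"
  shows "whisk (\<one> X) t g = t \<star> \<langle>g\<rangle>"
proof -
  have "t \<star> \<langle>g\<rangle> \<in> hom2 B (s \<cdot> g) (s' \<cdot> g)" using assms by (auto intro!: hcomp_hom' id2_hom)
  then show ?thesis
    using hcomp_id_left[of "t \<star> \<langle>g\<rangle>"] assms by (auto simp: whisk_def hom2_def comp1_trg)
qed

lemma whisk_unit_right:
  assumes "t \<in> hom2 B s s'" "src B s = X"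
  shows "whisk f t (\<one> X) = \<langle>f\<rangle> \<star> t"
  using hcomp_id_right[of t] assms by (auto simp: whisk_def hom2_def)

lemma cross_sound:
  assumes f: "wok m f" and "wok l w"
  shows "wok (m + l) (sh 0 l f @ sh (sr m f) 0 w)"
    "goods (cross 0 f w)"
    "dapp (m + l) (sh 0 l f @ sh (sr m f) 0 w) (cross 0 f w) = Some (sh m 0 w @ sh 0 (sr l w) f)" (is ?A)
    "dev (m + l) (sh 0 l f @ sh (sr m f) 0 w) (cross 0 f w) = \<chi> (ev m f) (ev l w)" (is ?B)
proof -
  have W: "wok (m + l) (sh 0 l f @ sh (sr m f) 0 w)" if "wok l w" for l w
    using that f wok_sh0[of m f] wok_sh0[of l w] by simp
  have Gd: "goods (cross n f w)" for n w
  proof (induction w arbitrary: n)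
    case (Cons x w)
    then show ?case using crossR_sound(2)[OF f] by (cases x) (simp, subst crossR_shd, simp)
  qed simp
  have "?A \<and> ?B"
    using assms(2)
  proof (induction w arbitrary: l)
    case Nil
    then show ?case using f ev_sh0(1)[OF f] by (simp add: intch_id_right)
  next
    case (Cons x w)
    obtain a g b where x: "x = (a, g, b)" by (cases x) auto
    define l' where "l' = a + ain g + b"
    have l: "l = a + aout g + b" and w: "wok l' w" using Cons.prems x by (simp_all add: l'_def)
    let ?n = "sr m f"
    let ?K = "m + a + aout g + b"
    have K: "?K = m + l" by (simp add: l)
    note C = crossR_sound[OF f, of a g b] and IH = Cons.IH[OF w]
    let ?s = "sh 0 (a + aout g + b) f @ [(?n + a, g, b)]" and ?u = "(m + a, g, b) # sh 0 (a + ain g + b) f"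
    let ?w2 = "sh ?n 0 w"
    have s: "[] @ sh 0 0 ?s @ ?w2 = sh 0 l f @ sh ?n 0 (x # w)" by (simp add: x l)
    have W1: "wok ?K ([] @ sh 0 0 ?s @ ?w2)" unfolding s K by (rule W[OF Cons.prems])
    have C1: "dapp ?K ([] @ sh 0 0 ?s @ ?w2) (shd (length ([]::word)) 0 0 (crossR 0 a g b f)) = Some ([] @ sh 0 0 ?u @ ?w2) \<and>
        dev ?K ([] @ sh 0 0 ?s @ ?w2) (shd (length ([]::word)) 0 0 (crossR 0 a g b f))
        = whisk (ev ?K []) (pad2 (pow 0) (dev ?K ?s (crossR 0 a g b f)) (pow 0)) (ev (0 + sr ?K ?s + 0) ?w2)"
      by (rule shd_lift[OF C(1) C(3) C(2) W1]) simp
    let ?v = "sh 0 l' f @ sh ?n 0 w"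
    have u: "[] @ sh 0 0 ?u @ ?w2 = [(m + a, g, b)] @ sh 0 0 ?v @ []" by (simp add: l'_def)
    have W2: "wok ?K ([(m + a, g, b)] @ sh 0 0 ?v @ [])"
      using dapp_wok[OF W1 C1[THEN conjunct1]] unfolding u by simp
    have C2: "dapp ?K ([(m + a, g, b)] @ sh 0 0 ?v @ []) (shd (length [(m + a, g, b)]) 0 0 (cross 0 f w))
          = Some ([(m + a, g, b)] @ sh 0 0 (sh m 0 w @ sh 0 (sr l' w) f) @ []) \<and>
        dev ?K ([(m + a, g, b)] @ sh 0 0 ?v @ []) (shd (length [(m + a, g, b)]) 0 0 (cross 0 f w))
        = whisk (ev ?K [(m + a, g, b)]) (pad2 (pow 0) (dev (m + l') ?v (cross 0 f w)) (pow 0)) (ev (0 + sr (m + l') ?v + 0) [])"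
      by (rule shd_lift[OF W[OF w] IH[THEN conjunct1] Gd W2]) (simp add: l'_def)
    have c: "cross (Suc 0) f w = shd (length [(m + a, g, b)]) 0 0 (cross 0 f w)"
      by (subst cross_shd) simp
    let ?f = "ev m f" and ?g = "ev l' w"
    have fh: "?f \<in> hom1 B (pow ?n) (pow m)" and gh: "?g \<in> hom1 B (pow (sr l' w)) (pow l')"
      and xh: "lt x \<in> hom1 B (pow l') (pow l)"
      using ev_hom[OF f] ev_hom[OF w] lt_hom[of a g b] by (simp_all add: x l l'_def)
    have d1: "dev ?K ([] @ sh 0 0 ?s @ ?w2) (crossR 0 a g b f) = \<chi> ?f (lt x) \<star> \<langle>pow ?n \<rhd>\<^sub>1 ?g\<rangle>"
    proof -
      \<comment> \<open>The strands to the left of g may be counted with either argument of the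
        interchanger; this is \<open>intch_mid\<close>.\<close>
      have "\<chi> (?f \<lhd>\<^sub>1 pow a) (F g \<lhd>\<^sub>1 pow b) = \<chi> ?f (lt x)"
        by (simp add: intch_mid x lt_eq)
      moreover have "ev (?n + a + ain g + b) ?w2 = pow ?n \<rhd>\<^sub>1 ?g"
        using ev_sh0(2)[OF w, of ?n] by (simp add: l'_def add.assoc)
      moreover have "whisk (\<one> (pow ?K)) (\<chi> ?f (lt x)) (pow ?n \<rhd>\<^sub>1 ?g) = \<chi> ?f (lt x) \<star> \<langle>pow ?n \<rhd>\<^sub>1 ?g\<rangle>"
        by (rule whisk_unit_left[OF intch_hom[OF fh xh]])
          (use fh xh gh in \<open>auto simp: hom1_def comp1_src comp1_trg lw1_src lw1_trg rw1_src rw1_trg pow_add l ten0_assoc\<close>)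
      ultimately show ?thesis
        using C1[THEN conjunct2] C(4) by (simp add: pad2_unit)
    qed
    have d2: "dev ?K ([] @ sh 0 0 ?u @ ?w2) (cross (Suc 0) f w) = \<langle>pow m \<rhd>\<^sub>1 lt x\<rangle> \<star> \<chi> ?f ?g"
    proof -
      have "ev ?K [(m + a, g, b)] = pow m \<rhd>\<^sub>1 lt x"
        using lt_id[of "m + a" g b] by (simp add: lt_eq x pow_add lw1_ten)
      moreover have "sr (m + l') ?v = ?n + sr l' w"
        using f w wok_sh0[of m f] wok_sh0[of l' w] by simp
      moreover have "whisk (pow m \<rhd>\<^sub>1 lt x) (\<chi> ?f ?g) (\<one> (pow (?n + sr l' w))) = \<langle>pow m \<rhd>\<^sub>1 lt x\<rangle> \<star> \<chi> ?f ?g"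
        by (rule whisk_unit_right[OF intch_hom[OF fh gh]])
          (use fh gh in \<open>auto simp: hom1_def comp1_src comp1_trg lw1_src lw1_trg rw1_src rw1_trg pow_add ten0_assoc\<close>)
      ultimately show ?thesis
        using C2[THEN conjunct2] IH[THEN conjunct2] unfolding u c by (simp add: pad2_unit)
    qed
    have a1: "dapp ?K ([] @ sh 0 0 ?s @ ?w2) (crossR 0 a g b f) = Some ([] @ sh 0 0 ?u @ ?w2)"
      using C1[THEN conjunct1] by simp
    have a2: "dapp ?K ([] @ sh 0 0 ?u @ ?w2) (cross (Suc 0) f w) = Some (sh m 0 (x # w) @ sh 0 (sr l (x # w)) f)"
      using C2[THEN conjunct1] unfolding u c by (simp add: x l'_def)
    have g1: "goods (crossR 0 a g b f)" by (rule C(2))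
    have "dev ?K ([] @ sh 0 0 ?s @ ?w2) (cross 0 f (x # w)) = \<chi> ?f (lt x \<cdot> ?g)"
      using dev_append[OF W1 a1 a2 g1 Gd] unfolding d1 d2 x
      using intch_comp_right[OF fh gh xh] by (simp add: x)
    moreover have "lt x \<cdot> ?g = ev l (x # w)" by (simp add: x l'_def)
    ultimately show ?case
      using a1 a2 unfolding s K by (simp add: x dapp_append)
  qed
  then show ?A ?B by auto
  show "wok (m + l) (sh 0 l f @ sh (sr m f) 0 w)" by (rule W[OF assms(2)])
  show "goods (cross 0 f w)" by (rule Gd)
qed

lemma dinv_Cons: "dinv ((n, p, c, q) # D) = dinv D @ [(n, p, cinv c, q)]"
  and dinv_Nil: "dinv [] = []"
  by (simp_all add: dinv_def)

definition crossing :: "diag \<Rightarrow> bool" where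
  "crossing D \<longleftrightarrow> (\<forall>(n, p, c, q) \<in> set D. \<exists>f k g. c = Ch f k g \<or> c = ChI f k g)"

lemma crossing_good: "crossing D \<Longrightarrow> goods D \<and> goods (dinv D)"
  by (fastforce simp: crossing_def goods_def dinv_def)

lemma crossing_crossR: "crossing (crossR n k g q w)"
  by (induction n k g q w rule: crossR.induct) (auto simp: crossing_def)

lemma crossing_cross: "crossing (cross n f w)"
proof (induction n f w rule: cross.induct)
  case (2 n f a g b w)
  then show ?case using crossing_crossR[of n a g b f] by (auto simp: crossing_def)
qed (simp add: crossing_def)

lemma dinv_sound:
  "\<lbrakk>wok k w; dapp k w D = Some v; crossing D\<rbrakk> \<Longrightarrow> dapp k v (dinv D) = Some w \<and>
     inverse_2cells B (dev k w D) (dev k v (dinv D))"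
proof (induction D arbitrary: w)
  case Nil
  then show ?case using id2_hom[of "ev k w"] vcomp_id2_left[OF id2_hom[of "ev k w"]]
    by (auto simp: dinv_def intro!: inverse_2cellsI)
next
  case (Cons l D)
  obtain n p c q where l: "l = (n, p, c, q)" by (cases l) auto
  obtain u where u: "lapp k w l = Some u" "dapp k u D = Some v"
    using Cons.prems by (auto split: option.splits)
  have cr: "crossing D" and "\<exists>f m g. c = Ch f m g \<or> c = ChI f m g"
    using Cons.prems(3) by (auto simp: crossing_def l)
  then obtain f m g where c: "c = Ch f m g \<or> c = ChI f m g" by blast
  have ci: "cdom (cinv c) = ccod c" "ccod (cinv c) = cdom c" "cout (cinv c) = cout c" "cin (cinv c) = cin c" and gc: "good c" "good (cinv c)"
    using c by auto
  have wu: "wok k u" using lapp_wok(1)[OF Cons.prems(1) u(1)] .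
  note IH = Cons.IH[OF wu u(2) cr]
  obtain w1 w2 where w: "w = w1 @ sh p q (cdom c) @ w2" "u = w1 @ sh p q (ccod c) @ w2" "length w1 = n"
    "sr k w1 = p + cout c + q"
    using u(1) unfolding l lapp_iff by auto
  have bk: "lapp k u (n, p, cinv c, q) = Some w" unfolding lapp_iff using w ci by auto
  have gi: "goods (dinv D)" "goods D" using crossing_good[OF cr] by auto
  have wv: "wok k v" using dapp_wok[OF wu u(2)] by simp
  have d: "dapp k v (dinv D) = Some u" "inverse_2cells B (dev k u D) (dev k v (dinv D))" using IH by auto
  have e: "dev k v (dinv D @ [(n, p, cinv c, q)]) = lev k u (n, p, cinv c, q) \<odot> dev k v (dinv D)"
    using dev_append[OF wv d(1), of "[(n, p, cinv c, q)]" w] bk gi gc(2) dev_single[OF wu bk refl gc(2)]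
    by (simp del: lapp.simps lev.simps)
  let ?a = "lev k w l" and ?b = "lev k u (n, p, cinv c, q)" and ?c = "dev k u D" and ?d = "dev k v (dinv D)"
  have h: "?a \<in> hom2 B (ev k w) (ev k u)" "?b \<in> hom2 B (ev k u) (ev k w)" "?c \<in> hom2 B (ev k u) (ev k v)"
    "?d \<in> hom2 B (ev k v) (ev k u)"
    using lev_hom[OF Cons.prems(1) u(1)[unfolded l] gc(1)] lev_hom[OF wu bk gc(2)] dev_hom[OF wu u(2) gi(2)]
      dev_hom[OF wv d(1) gi(1)] l by auto
  have cd: "?d \<odot> ?c = \<langle>ev k u\<rangle>" "?c \<odot> ?d = \<langle>ev k v\<rangle>"
    using d(2) h(3) by (auto simp: inverse_2cells_def hom2_def)
  note st = split_typed[OF Cons.prems(1)[unfolded w(1)] w(4)]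
  let ?s = "pad2 (pow p) (ce c) (pow q)" and ?t = "pad2 (pow p) (ce (cinv c)) (pow q)"
  let ?S = "pad1 (pow p) (ev (cout c) (cdom c)) (pow q)" and ?T = "pad1 (pow p) (ev (cout c) (ccod c)) (pow q)"
  have inv: "inverse_2cells B ?s ?t" by (rule pad2_inverse[OF cinv_inverse[OF c]])
  have sh: "?s \<in> hom2 B ?S ?T" "?t \<in> hom2 B ?T ?S"
    using pad_cell_hom[OF gc(1)] pad_cell_hom[OF gc(2), of p q] ci by auto
  have stt: "?t \<odot> ?s = \<langle>?S\<rangle>" "?s \<odot> ?t = \<langle>?T\<rangle>"
    using inv sh(1) by (auto simp: inverse_2cells_def hom2_def)
  have A: "?a = whisk (ev k w1) ?s (ev (p + cin c + q) w2)" "?b = whisk (ev k w1) ?t (ev (p + cin c + q) w2)"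
    using lev_split[OF w(1) w(3)] lev_split[of u w1 p q "cinv c" w2 n k] w ci l by simp_all
  have tt: "src B (ev k w1) = trg B ?S" "trg B (ev (p + cin c + q) w2) = src B ?S"
     "src B (ev k w1) = trg B ?T" "trg B (ev (p + cin c + q) w2) = src B ?T"
    using st(1,2) w(4) by (simp_all add: pad_cell_src pad_cell_trg)
  have "whisk (ev k w1) ?t (ev (p + cin c + q) w2) \<odot> whisk (ev k w1) ?s (ev (p + cin c + q) w2) = \<langle>ev k w\<rangle>"
    "whisk (ev k w1) ?s (ev (p + cin c + q) w2) \<odot> whisk (ev k w1) ?t (ev (p + cin c + q) w2) = \<langle>ev k u\<rangle>"
    using whisk_vcomp[OF sh tt(1,2)] whisk_vcomp[OF sh(2,1) tt(3,4)] whisk_id2[OF tt(1,2)] whisk_id2[OF tt(3,4)]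
      st(3,4) stt w(1,2) by simp_all
  then have ab: "?b \<odot> ?a = \<langle>ev k w\<rangle>" "?a \<odot> ?b = \<langle>ev k u\<rangle>"
    by (simp_all only: A)
  have "(?b \<odot> ?d) \<odot> (?c \<odot> ?a) = \<langle>ev k w\<rangle>"
    using vcomp_assoc'[OF vcomp_hom[OF h(1,3)] h(4) h(2)] vcomp_assoc'[OF h(1,3,4)] cd ab
      vcomp_id2_left[OF h(1)] by simp
  moreover have "(?c \<odot> ?a) \<odot> (?b \<odot> ?d) = \<langle>ev k v\<rangle>"
    using vcomp_assoc'[OF vcomp_hom[OF h(4,2)] h(1) h(3)] vcomp_assoc'[OF h(4,2,1)] cd ab
      vcomp_id2_left[OF h(4)] by simp
  ultimately have "inverse_2cells B (?c \<odot> ?a) (?b \<odot> ?d)"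
    by (rule inverse_2cellsI[OF vcomp_hom[OF h(1,3)] vcomp_hom[OF h(4,2)]])
  then show ?case
    using e d(1) bk u(1) l by (simp add: dinv_Cons dapp_append del: lapp.simps lev.simps)
qed

text \<open>A commuting square with two opposite sides invertible can be turned around. In this way
  naturality of the inverse interchangers, the rules \<open>NRi\<close> and \<open>NLi\<close>,
  follows from \<open>NR\<close> and \<open>NL\<close>.\<close>

lemma eqd_inverse:
  assumes e: "eqd k w (D @ A) (C @ E)" and "crossing A" "crossing C"
    and u: "dapp k w D = Some u" and v: "dapp k w C = Some v"
  shows "eqd k v (E @ dinv A) (dinv C @ D)"
proof -
  obtain w' where w': "wok k w" "dapp k w (D @ A) = Some w'" "dapp k w (C @ E) = Some w'"
    and g: "goods D" "goods E" "goods A" "goods C" and eq: "dev k w (D @ A) = dev k w (C @ E)"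
    using e by (auto simp: eqd_def)
  have A: "dapp k u A = Some w'" and E: "dapp k v E = Some w'"
    using w' u v by (simp_all add: dapp_append)
  have wu: "wok k u" "wok k v" "wok k w'" using dapp_wok w' u v by blast+
  have iA: "dapp k w' (dinv A) = Some u" "inverse_2cells B (dev k u A) (dev k w' (dinv A))"
    and iC: "dapp k v (dinv C) = Some w" "inverse_2cells B (dev k w C) (dev k v (dinv C))"
    using dinv_sound[OF wu(1) A assms(2)] dinv_sound[OF w'(1) v assms(3)] by auto
  have gi: "goods (dinv A)" "goods (dinv C)" using crossing_good assms(2,3) by auto
  let ?A = "dev k u A" and ?Ai = "dev k w' (dinv A)" and ?C = "dev k w C" and ?Ci = "dev k v (dinv C)"
    and ?D = "dev k w D" and ?E = "dev k v E"
  have h: "?A \<in> hom2 B (ev k u) (ev k w')" "?Ai \<in> hom2 B (ev k w') (ev k u)" "?C \<in> hom2 B (ev k w) (ev k v)"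
    "?Ci \<in> hom2 B (ev k v) (ev k w)" "?D \<in> hom2 B (ev k w) (ev k u)" "?E \<in> hom2 B (ev k v) (ev k w')"
    using dev_hom[OF wu(1) A g(3)] dev_hom[OF wu(3) iA(1) gi(1)] dev_hom[OF w'(1) v g(4)] dev_hom[OF wu(2) iC(1) gi(2)]
      dev_hom[OF w'(1) u g(1)] dev_hom[OF wu(2) E g(2)] by auto
  have i: "?Ai \<odot> ?A = \<langle>ev k u\<rangle>" "?C \<odot> ?Ci = \<langle>ev k v\<rangle>"
    using iA(2) iC(2) h(1,3) by (auto simp: inverse_2cells_def hom2_def)
  have AD: "?A \<odot> ?D = ?E \<odot> ?C"
    using eq dev_append[OF w'(1) u A g(1,3)] dev_append[OF w'(1) v E g(4,2)] by simp
  have "dev k v (E @ dinv A) = ?Ai \<odot> ?E" "dev k v (dinv C @ D) = ?D \<odot> ?Ci"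
    using dev_append[OF wu(2) E iA(1) g(2) gi(1)] dev_append[OF wu(2) iC(1) u gi(2) g(1)] by auto
  moreover have "?Ai \<odot> ?E = ?D \<odot> ?Ci"
  proof -
    have "?Ai \<odot> ?E = ?Ai \<odot> ?E \<odot> ?C \<odot> ?Ci" using i(2) vcomp_id2_right[OF h(6)] by simp
    also have "\<dots> = ?Ai \<odot> (?A \<odot> ?D) \<odot> ?Ci" using vcomp_assoc'[OF h(4,3,6)] AD by simp
    also have "\<dots> = (?Ai \<odot> ?A) \<odot> ?D \<odot> ?Ci"
      using vcomp_assoc'[OF h(4,5,1)] vcomp_assoc'[OF vcomp_hom[OF h(4,5)] h(1,2)] by simp
    finally show ?thesis using i(1) vcomp_id2_left[OF vcomp_hom[OF h(4,5)]] by simp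
  qed
  ultimately show ?thesis
    using wu(2) g gi E iA(1) iC(1) u by (simp add: eqd_def dapp_append)
qed

end

section \<open>Soundness of the moves and of compilation\<close>

context diagrams
begin

definition sound_rule :: "rule \<Rightarrow> bool" where
  "sound_rule = (\<lambda>(k, w, D, E). eqd k w D E)"

lemma ev_single: "p + aout g + q = k \<Longrightarrow> ev k [(p, g, q)] = lt (p, g, q)"
  using lt_id[of p g q] by simp

lemma good_hom: "good c \<Longrightarrow> ce c \<in> hom2 B (ev (cout c) (cdom c)) (ev (cout c) (ccod c))"
  by (simp add: good_def)

lemma cell_ev_hom: "ev (cout c) (cdom c) \<in> hom1 B (pow (cin c)) (pow (cout c))"
  "ev (cout c) (ccod c) \<in> hom1 B (pow (cin c)) (pow (cout c))"
  using ev_hom[of "cout c"] by (metis cell_wok)+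

text \<open>The axiom \<open>intch_natural\<close> with an identity 2-cell on the letter g;
  \<open>cross_sound\<close> expands the interchangers of g with the two boundary words of c into
  single crossings.\<close>

lemma NR_sound:
  assumes c: "good c"
  shows "eqd (cout c + (k + aout g)) (sh 0 (k + aout g) (cdom c) @ [(cin c + k, g, 0)])
     ([(0, 0, c, k + aout g)] @ cross 0 (ccod c) [(k, g, 0)])
     (cross 0 (cdom c) [(k, g, 0)] @ [(1, 0, c, k + ain g)])"
    "lapp (cout c + (k + aout g)) (sh 0 (k + aout g) (cdom c) @ [(cin c + k, g, 0)]) (0, 0, c, k + aout g)
       = Some (sh 0 (k + aout g) (ccod c) @ [(cin c + k, g, 0)])" (is ?l1)
    "dapp (cout c + (k + aout g)) (sh 0 (k + aout g) (cdom c) @ [(cin c + k, g, 0)]) (cross 0 (cdom c) [(k, g, 0)])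
       = Some ((cout c + k, g, 0) # sh 0 (k + ain g) (cdom c))" (is ?c1)
proof -
  let ?K = "cout c + (k + aout g)" and ?d = "cdom c" and ?e = "ccod c" and ?g = "[(k, g, 0)]"
  let ?w = "sh 0 (k + aout g) ?d @ [(cin c + k, g, 0)]" and ?v = "sh 0 (k + aout g) ?e @ [(cin c + k, g, 0)]"
  let ?u = "(cout c + k, g, 0) # sh 0 (k + ain g) ?d" and ?t = "(cout c + k, g, 0) # sh 0 (k + ain g) ?e"
  have gw: "wok (k + aout g) ?g" "sr (k + aout g) ?g = k + ain g" "ev (k + aout g) ?g = lt (k, g, 0)"
    using lt_id[of k g 0] by simp_all
  note C = cross_sound[OF cell_wok(1)[of c] gw(1), unfolded gw(2,3) cell_wok] and D = cross_sound[OF cell_wok(2)[of c] gw(1), unfolded gw(2,3) cell_wok]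
  have wok: "wok ?K ?w" "wok ?K ?v" using C(1) D(1) by (simp_all add: add.assoc)
  show ?c1 using C(3) by (simp add: add.assoc)
  have c1: ?c1 using C(3) by (simp add: add.assoc)
  have c2: "dapp ?K ?v (cross 0 ?e ?g) = Some ?t" using D(3) by (simp add: add.assoc)
  have l1: ?l1 unfolding lapp_iff by (rule exI[of _ "[]"], rule exI[of _ "[(cin c + k, g, 0)]"]) simp
  show ?l1 by (rule l1)
  have l2: "lapp ?K ?u (1, 0, c, k + ain g) = Some ?t"
    unfolding lapp_iff by (rule exI[of _ "[(cout c + k, g, 0)]"], rule exI[of _ "[]"]) simp
  have wu: "wok ?K ?u" using dapp_wok[OF wok(1) c1] by simp
  let ?f = "ev (cout c) ?d" and ?f' = "ev (cout c) ?e" and ?x = "lt (k, g, 0)"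
  have xh: "?x \<in> hom1 B (pow (k + ain g)) (pow (k + aout g))" using lt_hom[of k g 0] by simp
  have a: "lev ?K ?w (0, 0, c, k + aout g) = (ce c \<lhd>\<^sub>2 pow (k + aout g)) \<star> (pow (cin c) \<rhd>\<^sub>2 \<langle>?x\<rangle>)"
  proof -
    have "lev ?K ?w (0, 0, c, k + aout g) = whisk (\<one> (pow ?K)) (ce c \<lhd>\<^sub>2 pow (k + aout g)) (ev (cin c + (k + aout g)) [(cin c + k, g, 0)])"
      by (subst lev_split[of _ "[]" _ _ _ "[(cin c + k, g, 0)]"]) (simp_all add: pad2_def lw2_unit)
    also have "ev (cin c + (k + aout g)) [(cin c + k, g, 0)] = pow (cin c) \<rhd>\<^sub>1 ?x"
      by (subst ev_single) (simp_all add: lt_eq pow_add lw1_ten)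
    also have "whisk (\<one> (pow ?K)) (ce c \<lhd>\<^sub>2 pow (k + aout g)) (pow (cin c) \<rhd>\<^sub>1 ?x) = (ce c \<lhd>\<^sub>2 pow (k + aout g)) \<star> \<langle>pow (cin c) \<rhd>\<^sub>1 ?x\<rangle>"
      by (rule whisk_unit_left[OF rw2_hom[OF good_hom[OF c]]])
        (use xh cell_ev_hom[of c] in \<open>auto simp: hom1_def lw1_trg rw1_src rw1_trg pow_add\<close>)
    finally show ?thesis by (simp add: lw2_id)
  qed
  have b: "lev ?K ?u (1, 0, c, k + ain g) = (pow (cout c) \<rhd>\<^sub>2 \<langle>?x\<rangle>) \<star> (ce c \<lhd>\<^sub>2 pow (k + ain g))"
  proof -
    have "lev ?K ?u (1, 0, c, k + ain g) = whisk (ev ?K [(cout c + k, g, 0)]) (ce c \<lhd>\<^sub>2 pow (k + ain g)) (\<one> (pow (cin c + (k + ain g))))"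
      by (subst lev_split[of _ "[(cout c + k, g, 0)]" _ _ _ "[]"]) (simp_all add: pad2_def lw2_unit)
    also have "ev ?K [(cout c + k, g, 0)] = pow (cout c) \<rhd>\<^sub>1 ?x"
      by (subst ev_single) (simp_all add: lt_eq pow_add lw1_ten)
    also have "whisk (pow (cout c) \<rhd>\<^sub>1 ?x) (ce c \<lhd>\<^sub>2 pow (k + ain g)) (\<one> (pow (cin c + (k + ain g)))) = \<langle>pow (cout c) \<rhd>\<^sub>1 ?x\<rangle> \<star> (ce c \<lhd>\<^sub>2 pow (k + ain g))"
      by (rule whisk_unit_right[OF rw2_hom[OF good_hom[OF c]]])
        (use xh cell_ev_hom[of c] in \<open>auto simp: hom1_def lw1_trg rw1_src rw1_trg pow_add\<close>)
    finally show ?thesis by (simp add: lw2_id)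
  qed
  have "dev ?K ?w ([(0, 0, c, k + aout g)] @ cross 0 ?e ?g) = \<chi> ?f' ?x \<odot> ((ce c \<lhd>\<^sub>2 pow (k + aout g)) \<star> (pow (cin c) \<rhd>\<^sub>2 \<langle>?x\<rangle>))"
    using l1 a D(4) gw(3) by (simp add: add.assoc del: lapp.simps lev.simps ev.simps ev_append)
  moreover have "dev ?K ?w (cross 0 ?d ?g @ [(1, 0, c, k + ain g)]) = ((pow (cout c) \<rhd>\<^sub>2 \<langle>?x\<rangle>) \<star> (ce c \<lhd>\<^sub>2 pow (k + ain g))) \<odot> \<chi> ?f ?x"
    using dev_append[OF wok(1) c1, of "[(1, 0, c, k + ain g)]" ?t] l2 dev_single[OF wu l2 refl c] b C(2,4) gw(3) c
    by (simp add: add.assoc del: lapp.simps lev.simps ev.simps ev_append)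
  moreover have "\<chi> ?f' ?x \<odot> ((ce c \<lhd>\<^sub>2 pow (k + aout g)) \<star> (pow (cin c) \<rhd>\<^sub>2 \<langle>?x\<rangle>))
      = ((pow (cout c) \<rhd>\<^sub>2 \<langle>?x\<rangle>) \<star> (ce c \<lhd>\<^sub>2 pow (k + ain g))) \<odot> \<chi> ?f ?x"
    by (rule intch_natural[OF good_hom[OF c] id2_hom cell_ev_hom(1) xh])
  ultimately show "eqd ?K ?w ([(0, 0, c, k + aout g)] @ cross 0 ?e ?g) (cross 0 ?d ?g @ [(1, 0, c, k + ain g)])"
    using wok c C(2) D(2) l1 l2 c1 c2 by (simp add: eqd_def dapp_append del: lapp.simps)
qed

lemma NL_sound:
  assumes c: "good c"
  shows "eqd (aout g + k + cout c) ((0, g, k + cout c) # sh (ain g + k) 0 (cdom c))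
     ([(1, ain g + k, c, 0)] @ cross 0 [(0, g, k)] (ccod c))
     (cross 0 [(0, g, k)] (cdom c) @ [(0, aout g + k, c, 0)])"
    "lapp (aout g + k + cout c) ((0, g, k + cout c) # sh (ain g + k) 0 (cdom c)) (1, ain g + k, c, 0)
       = Some ((0, g, k + cout c) # sh (ain g + k) 0 (ccod c))" (is ?l1)
    "dapp (aout g + k + cout c) ((0, g, k + cout c) # sh (ain g + k) 0 (cdom c)) (cross 0 [(0, g, k)] (cdom c))
       = Some (sh (aout g + k) 0 (cdom c) @ [(0, g, k + cin c)])" (is ?c1)
proof -
  let ?K = "aout g + k + cout c" and ?d = "cdom c" and ?e = "ccod c" and ?g = "[(0, g, k)]"
  let ?w = "(0, g, k + cout c) # sh (ain g + k) 0 ?d" and ?v = "(0, g, k + cout c) # sh (ain g + k) 0 ?e"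
  let ?u = "sh (aout g + k) 0 ?d @ [(0, g, k + cin c)]" and ?t = "sh (aout g + k) 0 ?e @ [(0, g, k + cin c)]"
  have gw: "wok (aout g + k) ?g" "ev (aout g + k) ?g = lt (0, g, k)" "sr (aout g + k) ?g = ain g + k"
    using lt_id[of 0 g k] by simp_all
  note C = cross_sound[OF gw(1) cell_wok(1)[of c], unfolded gw(3) cell_wok] and D = cross_sound[OF gw(1) cell_wok(2)[of c], unfolded gw(3) cell_wok]
  have wok: "wok ?K ?w" "wok ?K ?v" using C(1) D(1) by simp_all
  have c1: ?c1 using C(3) by simp
  show ?c1 by (rule c1)
  have c2: "dapp ?K ?v (cross 0 ?g ?e) = Some ?t" using D(3) by simp
  have l1: ?l1 unfolding lapp_iff by (rule exI[of _ "[(0, g, k + cout c)]"], rule exI[of _ "[]"]) simp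
  show ?l1 by (rule l1)
  have l2: "lapp ?K ?u (0, aout g + k, c, 0) = Some ?t"
    unfolding lapp_iff by (rule exI[of _ "[]"], rule exI[of _ "[(0, g, k + cin c)]"]) simp
  have wu: "wok ?K ?u" using dapp_wok[OF wok(1) c1] by simp
  let ?f = "ev (cout c) ?d" and ?f' = "ev (cout c) ?e" and ?x = "lt (0, g, k)"
  have xh: "?x \<in> hom1 B (pow (ain g + k)) (pow (aout g + k))" using lt_hom[of 0 g k] by simp
  have a: "lev ?K ?w (1, ain g + k, c, 0) = (\<langle>?x\<rangle> \<lhd>\<^sub>2 pow (cout c)) \<star> (pow (ain g + k) \<rhd>\<^sub>2 ce c)"
  proof -
    have "lev ?K ?w (1, ain g + k, c, 0) = whisk (ev ?K [(0, g, k + cout c)]) (pow (ain g + k) \<rhd>\<^sub>2 ce c) (\<one> (pow (ain g + k + cin c)))"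
      by (subst lev_split[of _ "[(0, g, k + cout c)]" _ _ _ "[]"]) (simp_all add: pad2_def rw2_unit)
    also have "ev ?K [(0, g, k + cout c)] = ?x \<lhd>\<^sub>1 pow (cout c)"
      by (subst ev_single) (simp_all add: lt_eq pow_add rw1_ten lw1_unit)
    also have "whisk (?x \<lhd>\<^sub>1 pow (cout c)) (pow (ain g + k) \<rhd>\<^sub>2 ce c) (\<one> (pow (ain g + k + cin c)))
        = \<langle>?x \<lhd>\<^sub>1 pow (cout c)\<rangle> \<star> (pow (ain g + k) \<rhd>\<^sub>2 ce c)"
      by (rule whisk_unit_right[OF lw2_hom[OF good_hom[OF c]]])
        (use cell_ev_hom[of c] in \<open>auto simp: hom1_def lw1_src pow_add ten0_assoc\<close>)
    finally show ?thesis by (simp add: rw2_id)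
  qed
  have b: "lev ?K ?u (0, aout g + k, c, 0) = (pow (aout g + k) \<rhd>\<^sub>2 ce c) \<star> (\<langle>?x\<rangle> \<lhd>\<^sub>2 pow (cin c))"
  proof -
    have "lev ?K ?u (0, aout g + k, c, 0) = whisk (\<one> (pow ?K)) (pow (aout g + k) \<rhd>\<^sub>2 ce c) (ev (aout g + k + cin c) [(0, g, k + cin c)])"
      by (subst lev_split[of _ "[]" _ _ _ "[(0, g, k + cin c)]"]) (simp_all add: pad2_def rw2_unit)
    also have "ev (aout g + k + cin c) [(0, g, k + cin c)] = ?x \<lhd>\<^sub>1 pow (cin c)"
      by (subst ev_single) (simp_all add: lt_eq pow_add rw1_ten lw1_unit)
    also have "whisk (\<one> (pow ?K)) (pow (aout g + k) \<rhd>\<^sub>2 ce c) (?x \<lhd>\<^sub>1 pow (cin c))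
        = (pow (aout g + k) \<rhd>\<^sub>2 ce c) \<star> \<langle>?x \<lhd>\<^sub>1 pow (cin c)\<rangle>"
      by (rule whisk_unit_left[OF lw2_hom[OF good_hom[OF c]]])
        (use xh cell_ev_hom[of c] in \<open>auto simp: hom1_def lw1_src lw1_trg rw1_trg pow_add ten0_assoc\<close>)
    finally show ?thesis by (simp add: rw2_id)
  qed
  have "dev ?K ?w ([(1, ain g + k, c, 0)] @ cross 0 ?g ?e) = \<chi> ?x ?f' \<odot> ((\<langle>?x\<rangle> \<lhd>\<^sub>2 pow (cout c)) \<star> (pow (ain g + k) \<rhd>\<^sub>2 ce c))"
    using l1 a D(4) gw(2) by (simp del: lapp.simps lev.simps ev.simps ev_append)
  moreover have "dev ?K ?w (cross 0 ?g ?d @ [(0, aout g + k, c, 0)]) = ((pow (aout g + k) \<rhd>\<^sub>2 ce c) \<star> (\<langle>?x\<rangle> \<lhd>\<^sub>2 pow (cin c))) \<odot> \<chi> ?x ?f"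
    using dev_append[OF wok(1) c1, of "[(0, aout g + k, c, 0)]" ?t] l2 dev_single[OF wu l2 refl c] b C(2,4) gw(2) c
    by (simp del: lapp.simps lev.simps ev.simps ev_append)
  moreover have "\<chi> ?x ?f' \<odot> ((\<langle>?x\<rangle> \<lhd>\<^sub>2 pow (cout c)) \<star> (pow (ain g + k) \<rhd>\<^sub>2 ce c))
      = ((pow (aout g + k) \<rhd>\<^sub>2 ce c) \<star> (\<langle>?x\<rangle> \<lhd>\<^sub>2 pow (cin c))) \<odot> \<chi> ?x ?f"
    by (rule intch_natural[OF id2_hom good_hom[OF c] xh cell_ev_hom(1)])
  ultimately show "eqd ?K ?w ([(1, ain g + k, c, 0)] @ cross 0 ?g ?e) (cross 0 ?g ?d @ [(0, aout g + k, c, 0)])"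
    using wok c C(2) D(2) l1 l2 c1 c2 by (simp add: eqd_def dapp_append del: lapp.simps)
qed

lemma cancel_sound:
  assumes "c = Ch f k g \<or> c = ChI f k g"
  shows "eqd (cout c) (cdom c) [(0, 0, c, 0), (0, 0, cinv c, 0)] []"
proof -
  have l: "lapp (cout c) (cdom c) (0, 0, c, 0) = Some (ccod c)"
    unfolding lapp_iff by (rule exI[of _ "[]"], rule exI[of _ "[]"]) simp
  then have d: "dapp (cout c) (cdom c) [(0, 0, c, 0)] = Some (ccod c)" by simp
  have cr: "crossing [(0, 0, c, 0)]" using assms by (auto simp: crossing_def)
  have g: "good c" "good (cinv c)" using assms by auto
  note i = dinv_sound[OF cell_wok(1) d cr, unfolded dinv_Cons dinv_Nil]
  have i1: "dapp (cout c) (ccod c) [(0, 0, cinv c, 0)] = Some (cdom c)" using i by simp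
  have "dev (cout c) (cdom c) ([(0, 0, c, 0)] @ [(0, 0, cinv c, 0)]) = \<langle>ev (cout c) (cdom c)\<rangle>"
    using dev_append[OF cell_wok(1) d i1] i g dev_hom[OF cell_wok(1) d]
    by (simp add: inverse_2cells_def hom2_def del: dev.simps)
  moreover have "dapp (cout c) (cdom c) ([(0, 0, c, 0)] @ [(0, 0, cinv c, 0)]) = Some (cdom c)"
    unfolding dapp_append d using i1 by (simp del: lapp.simps dapp.simps)
  ultimately show ?thesis
    using g by (simp add: eqd_def del: lapp.simps dapp.simps(2) dev.simps(2))
qed

text \<open>The naturality rules hold for well-typed cells. Since c occurs on both sides of such a
  rule, goodness of one side supplies its typing, which covers forward and backward use at
  once.\<close>

lemma ref_rule_sound:
  assumes R: "\<And>r. r \<in> set R \<Longrightarrow> sound_rule r" and r: "ref_rule R x = (k, w, L, L')"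
    and g: "goods L \<or> goods L'"
  shows "eqd k w L L'"
proof (cases x)
  case (U i)
  show ?thesis
  proof (cases "i < length R")
    case True
    then have "sound_rule (k, w, L, L')" using R[OF nth_mem[OF True]] r U by simp
    then show ?thesis by (simp add: sound_rule_def)
  qed (use r U in \<open>auto simp: eqd_def\<close>)
next
  case (NR c n h)
  then have "good c" using r g by auto
  then show ?thesis using NR_sound(1)[of c n h] r NR by simp
next
  case (NRi c n h)
  then have c: "good c" using r g by auto
  show ?thesis
    using eqd_inverse[OF NR_sound(1)[OF c, of n h] crossing_cross crossing_cross _ NR_sound(3)[OF c]]
      NR_sound(2)[OF c, of n h] r NRi by simp
next
  case (NL c n h)
  then have "good c" using r g by auto
  then show ?thesis using NL_sound(1)[of c h n] r NL by simp
next
  case (NLi c n h)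
  then have c: "good c" using r g by auto
  show ?thesis
    using eqd_inverse[OF NL_sound(1)[OF c, of h n] crossing_cross crossing_cross _ NL_sound(3)[OF c]]
      NL_sound(2)[OF c, of h n] r NLi by simp
next
  case (CX f n h)
  then show ?thesis using cancel_sound[of "Ch f n h" f n h] r by simp
next
  case (CY f n h)
  then show ?thesis using cancel_sound[of "ChI f n h" f n h] r by simp
qed

lemma rw_sound:
  assumes "rw k w D i n p q k0 w0 L L' = Some E" "wok k w" "goods D" "dapp k w D \<noteq> None"
    "goods L \<Longrightarrow> eqd k0 w0 L L'"
  shows "eqd k w D E"
proof -
  define P Q where "P = take i D" and "Q = drop i D"
  define S where "S = shd n p q L"
  define m where "m = length S"
  have *: "take m Q = S" and "\<exists>v. dapp k w P = Some v \<and> length (take n v) = n \<and>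
      take (length w0) (drop n v) = sh p q w0 \<and> sr k (take n v) = p + k0 + q \<and> E = P @ shd n p q L' @ drop m Q"
    using assms(1) by (auto simp: rw_def Let_def P_def Q_def S_def m_def split: if_splits option.splits)
  then obtain v where v: "dapp k w P = Some v" "length (take n v) = n" "take (length w0) (drop n v) = sh p q w0"
      "sr k (take n v) = p + k0 + q" "E = P @ shd n p q L' @ drop m Q" by blast
  have D: "D = P @ S @ drop m Q" using * by (metis P_def Q_def append_take_drop_id)
  have g: "goods P" "goods S" "goods (drop m Q)" using assms(3) unfolding D by auto
  have vv: "v = take n v @ sh p q w0 @ drop (length w0) (drop n v)" using v(3) by (metis append_take_drop_id)
  have "wok k v" using dapp_wok[OF assms(2) v(1)] by simp
  then have wv: "wok k (take n v @ sh p q w0 @ drop (length w0) (drop n v))" using vv by simp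
  have "eqd k0 w0 L L'" using assms(5) g(2) by (simp add: S_def)
  from eqd_lift[OF this wv v(4)] have "eqd k v S (shd n p q L')" using v(2) vv by (simp add: S_def)
  from eqd_context[OF assms(2) v(1) this _ g(1,3)] show ?thesis
    using assms(4) D v(5) by simp
qed

lemma slideR_sound:
  assumes "slideR l l' = Some E" "wok k w" "goods [l, l']" "dapp k w [l, l'] \<noteq> None"
  shows "eqd k w [l, l'] E"
proof -
  obtain n p c q n' p' c' q' where l: "l = (n, p, c, q)" "l' = (n', p', c', q')" by (cases l; cases l') auto
  obtain v v' where v: "lapp k w l = Some v" "lapp k v l' = Some v'"
    using assms(4) by (auto split: option.splits)
  have le: "n + length (ccod c) \<le> n'" and E: "E = [(n' - length (ccod c) + length (cdom c), p', c', q'), l]"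
    using assms(1) l by (auto split: if_splits)
  obtain w1 w2 where w: "w = w1 @ sh p q (cdom c) @ w2" "v = w1 @ sh p q (ccod c) @ w2" "length w1 = n" "sr k w1 = p + cout c + q"
    using v(1) unfolding l lapp_iff by auto
  obtain v1 v2 where v': "v = v1 @ sh p' q' (cdom c') @ v2" "length v1 = n'" "sr k v1 = p' + cout c' + q'"
    using v(2) unfolding l lapp_iff by auto
  obtain x where v1: "v1 = (w1 @ sh p q (ccod c)) @ x" and w2: "w2 = x @ sh p' q' (cdom c') @ v2"
  proof -
    have "(w1 @ sh p q (ccod c)) @ w2 = v1 @ sh p' q' (cdom c') @ v2" using w(2) v'(1) by (metis append_assoc)
    then obtain us where "(w1 @ sh p q (ccod c)) = v1 @ us \<and> us @ w2 = sh p' q' (cdom c') @ v2 \<or>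
        (w1 @ sh p q (ccod c)) @ us = v1 \<and> w2 = us @ sh p' q' (cdom c') @ v2"
      unfolding append_eq_append_conv2 by (elim exE)
    \<comment> \<open>The two splittings of the intermediate word are compared. The guard of
      \<open>slideR\<close> excludes an overlap, so in the first case \<open>us\<close> is
      empty.\<close>
    then have "v1 = (w1 @ sh p q (ccod c)) @ us \<and> w2 = us @ sh p' q' (cdom c') @ v2"
    proof
      assume a: "(w1 @ sh p q (ccod c)) = v1 @ us \<and> us @ w2 = sh p' q' (cdom c') @ v2"
      have "length (w1 @ sh p q (ccod c)) = length (v1 @ us)" using a by metis
      then have "length us = 0" using le w(3) v'(2) by (simp only: length_append sh_simps)
      then have "us = []" by simp
      then show ?thesis using a by simp
    qed simp
    then show thesis by (elim conjE) (rule that)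
  qed
  have srx: "sr (p + cin c + q) x = p' + cout c' + q'"
    using v'(3) w(4) sr_sh[of "cout c" "ccod c" p q] unfolding v1 by simp
  have n': "n' - length (ccod c) + length (cdom c) = length w1 + length (cdom c) + length x"
    "n' = length w1 + length (ccod c) + length x" using v'(2) unfolding v1 by simp_all
  have W: "w = w1 @ sh p q (cdom c) @ x @ sh p' q' (cdom c') @ v2" unfolding w(1) w2 ..
  have g: "good c" "good c'" using assms(3) l by simp_all
  show ?thesis
    using eqd_slide[OF assms(2)[unfolded W] w(4) srx g] unfolding E l n'(1) W[symmetric] w(3)
    unfolding n'(2) w(3) .
qed

lemma slideL_sound:
  assumes "slideL l l' = Some E" "wok k w" "goods [l, l']" "dapp k w [l, l'] \<noteq> None"
  shows "eqd k w [l, l'] E"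
proof -
  obtain n p c q n' p' c' q' where l: "l = (n, p, c, q)" "l' = (n', p', c', q')" by (cases l; cases l') auto
  obtain v v' where v: "lapp k w l = Some v" "lapp k v l' = Some v'"
    using assms(4) by (auto split: option.splits)
  have le: "n' + length (cdom c') \<le> n" and E: "E = [l', (n - length (cdom c') + length (ccod c'), p, c, q)]"
    using assms(1) l by (auto split: if_splits)
  obtain w1 w2 where w: "w = w1 @ sh p q (cdom c) @ w2" "v = w1 @ sh p q (ccod c) @ w2" "length w1 = n" "sr k w1 = p + cout c + q"
    using v(1) unfolding l lapp_iff by auto
  obtain v1 v2 where v': "v = v1 @ sh p' q' (cdom c') @ v2" "length v1 = n'" "sr k v1 = p' + cout c' + q'"
    using v(2) unfolding l lapp_iff by auto
  obtain x where w1: "w1 = (v1 @ sh p' q' (cdom c')) @ x" and v2: "v2 = x @ sh p q (ccod c) @ w2"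
  proof -
    have "w1 @ sh p q (ccod c) @ w2 = (v1 @ sh p' q' (cdom c')) @ v2" using w(2) v'(1) by (metis append_assoc)
    then obtain us where "w1 = (v1 @ sh p' q' (cdom c')) @ us \<and> us @ sh p q (ccod c) @ w2 = v2 \<or>
        w1 @ us = v1 @ sh p' q' (cdom c') \<and> sh p q (ccod c) @ w2 = us @ v2"
      unfolding append_eq_append_conv2 by (elim exE)
    then have "w1 = (v1 @ sh p' q' (cdom c')) @ us \<and> v2 = us @ sh p q (ccod c) @ w2"
    proof (rule disjE)
      assume a: "w1 @ us = v1 @ sh p' q' (cdom c') \<and> sh p q (ccod c) @ w2 = us @ v2"
      have "length (w1 @ us) = length (v1 @ sh p' q' (cdom c'))" using a by metis
      then have "length us = 0" using le w(3) v'(2) by (simp only: length_append sh_simps)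
      then have "us = []" by simp
      then show ?thesis using a by simp
    qed simp
    then show thesis by (elim conjE) (rule that)
  qed
  have srx: "sr (p' + cin c' + q') x = p + cout c + q"
    using w(4) v'(3) sr_sh[of "cout c'" "cdom c'" p' q'] unfolding w1 by simp
  have n: "n - length (cdom c') + length (ccod c') = length v1 + length (ccod c') + length x"
    "n = length v1 + length (cdom c') + length x" using w(3) unfolding w1 by simp_all
  have W: "w = v1 @ sh p' q' (cdom c') @ x @ sh p q (cdom c) @ w2" unfolding w(1) w1 by simp
  have g: "good c'" "good c" using assms(3) l by simp_all
  show ?thesis
    using eqd_slide[OF assms(2)[unfolded W] v'(3) srx g, THEN eqd_sym] unfolding E l n(1) W[symmetric] v'(2)
    unfolding n(2) v'(2) .
qed

lemma at2_sound:
  assumes f: "\<And>l l' E w. \<lbrakk>f l l' = Some E; wok k w; goods [l, l']; dapp k w [l, l'] \<noteq> None\<rbrakk> \<Longrightarrow> eqd k w [l, l'] E"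
  shows "\<lbrakk>at2 f i D = Some E; wok k w; goods D; dapp k w D \<noteq> None\<rbrakk> \<Longrightarrow> eqd k w D E"
proof (induction i arbitrary: D w E)
  case 0
  then obtain l l' D' where D: "D = [l, l'] @ D'"
    by (cases D rule: remdups_adj.cases) auto
  then obtain E' where E': "f l l' = Some E'" "E = E' @ D'" using 0 by auto
  have "dapp k w [l, l'] \<noteq> None" using "0.prems"(4) unfolding D dapp_append by (auto split: option.splits)
  moreover have g: "goods [l, l']" "goods D'" using "0.prems"(3) D by (auto simp: goods_def)
  ultimately have "eqd k w [l, l'] E'" using f[OF E'(1) "0.prems"(2)] by blast
  from eqd_context[OF "0.prems"(2) _ this _ _ g(2), of "[]"] show ?case
    using "0.prems"(4) E'(2) D by simp
next
  case (Suc i)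
  then obtain l D' where D: "D = l # D'" by (cases D) auto
  then obtain E' where E': "at2 f i D' = Some E'" "E = l # E'" using Suc.prems by auto
  obtain v where v: "lapp k w l = Some v" "dapp k v D' \<noteq> None"
    using Suc.prems(4) D by (auto split: option.splits)
  have g: "goods [l]" "goods D'" using Suc.prems(3) D by (auto simp: goods_def)
  have "eqd k v D' E'"
    by (rule Suc.IH[OF E'(1) lapp_wok(1)[OF Suc.prems(2) v(1)] g(2) v(2)])
  moreover have "dapp k w [l] = Some v" using v(1) by simp
  ultimately have "eqd k w ([l] @ D' @ []) ([l] @ E' @ [])"
    using Suc.prems(4) D g(1) by (intro eqd_context[OF Suc.prems(2)]) auto
  then show ?case using D E' by simp
qed

lemma step_sound:
  assumes R: "\<And>r. r \<in> set R \<Longrightarrow> sound_rule r" and s: "step R k w s D = Some E"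
    and w: "wok k w" "goods D" "dapp k w D \<noteq> None"
  shows "eqd k w D E"
proof (cases s)
  case (SR i)
  show ?thesis by (rule at2_sound[OF slideR_sound]) (use s w SR in simp_all)
next
  case (SL i)
  show ?thesis by (rule at2_sound[OF slideL_sound]) (use s w SL in simp_all)
next
  case (RF x i n p q)
  obtain k0 w0 L L' where r: "ref_rule R x = (k0, w0, L, L')" by (metis prod_cases4)
  show ?thesis
    by (rule rw_sound[of k w D i n p q k0 w0 L L' E]) (use s RF r w ref_rule_sound[OF R r] in auto)
next
  case (RB x i n p q)
  obtain k0 w0 L L' where r: "ref_rule R x = (k0, w0, L, L')" by (metis prod_cases4)
  show ?thesis
    by (rule rw_sound[of k w D i n p q k0 w0 L' L E]) (use s RB r w ref_rule_sound[OF R r] in \<open>auto intro: eqd_sym\<close>)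
qed

lemma steps_sound:
  assumes R: "\<And>r. r \<in> set R \<Longrightarrow> sound_rule r"
  shows "\<lbrakk>steps R k w ss D = Some E; wok k w; goods D; dapp k w D \<noteq> None\<rbrakk> \<Longrightarrow> eqd k w D E"
proof (induction ss arbitrary: D)
  case Nil
  then show ?case by (simp add: eqd_refl)
next
  case (Cons s ss)
  then obtain D' where D': "step R k w s D = Some D'" "steps R k w ss D' = Some E"
    by (auto split: option.splits)
  have e: "eqd k w D D'" by (rule step_sound[OF R D'(1) Cons.prems(2-4)])
  then have "eqd k w D' E" using Cons.IH[OF D'(2) Cons.prems(2)] by (auto simp: eqd_def)
  with e show ?case by (rule eqd_trans)
qed

fun sem :: "expr \<Rightarrow> 't" where
  "sem (Cell g) = T g"
| "sem (Id k w) = \<langle>ev k w\<rangle>"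
| "sem (Chi m f n g) = \<chi> (ev (tg m f) f) (ev (tg n g) g)"
| "sem (ChiInv m f n g) = inv2 B (\<chi> (ev (tg m f) f) (ev (tg n g) g))"
| "sem (VC s t) = sem s \<odot> sem t"
| "sem (HC s t) = sem s \<star> sem t"
| "sem (LW p s) = pow p \<rhd>\<^sub>2 sem s"
| "sem (RW s q) = sem s \<lhd>\<^sub>2 pow q"

text \<open>Each constructor of expressions has a known effect on layers: \<open>cross_sound\<close>
  and \<open>dinv_sound\<close> treat the interchangers, \<open>shd_lift\<close> the tensoring with
  objects, and \<open>interchange\<close> the horizontal composites.\<close>

lemma compile_sound:
  "compile s = Some (k, w, D, v) \<Longrightarrow> goods D \<Longrightarrow> wok k w \<and> dapp k w D = Some v \<and> sem s = dev k w D"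
proof (induction s arbitrary: k w D v)
  case (Cell g)
  have l: "lapp (gout g) (gdom g) (0, 0, G g, 0) = Some (gcod g)"
    unfolding lapp_iff by (rule exI[of _ "[]"], rule exI[of _ "[]"]) simp
  have w: "wok (gout g) (gdom g)" using cell_wok(1)[of "G g"] by simp
  have gd: "good (G g)" using Cell by auto
  have "lev (gout g) (gdom g) (0, 0, G g, 0) = T g"
    using whisk_one[OF good_hom[OF gd], of "pow (gin g)" "pow (gout g)"] cell_ev_hom(1)[of "G g"]
    by (simp add: pad2_unit hom1_def)
  then show ?case
    using Cell l w dev_single[OF w l refl gd] by (auto simp del: lapp.simps lev.simps dev.simps)
next
  case (Id k' w')
  then show ?case by (auto split: if_splits)
next
  case (Chi m f n g)
  then have *: "wok (tg m f) f" "wok (tg n g) g" "sr (tg m f) f = m" "sr (tg n g) g = n"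
    by (auto simp: Let_def split: if_splits)
  show ?case using Chi cross_sound[OF *(1,2)] * by (auto simp: Let_def)
next
  case (ChiInv m f n g)
  then have *: "wok (tg m f) f" "wok (tg n g) g" "sr (tg m f) f = m" "sr (tg n g) g = n"
    by (auto simp: Let_def split: if_splits)
  note c = cross_sound[OF *(1,2), unfolded *(3,4)]
  note d = dinv_sound[OF c(1,3) crossing_cross]
  have "wok (tg m f + tg n g) (sh (tg m f) 0 g @ sh 0 n f)" using dapp_wok[OF c(1,3)] by simp
  moreover have "inv2 B (\<chi> (ev (tg m f) f) (ev (tg n g) g))
      = dev (tg m f + tg n g) (sh (tg m f) 0 g @ sh 0 n f) (dinv (cross 0 f g))"
    using d inv2_eq unfolding c(4) by blast
  ultimately show ?case using ChiInv d * by (auto simp: Let_def)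
next
  case (VC s t)
  obtain D1 D2 u where c: "compile s = Some (k, u, D2, v)" "compile t = Some (k, w, D1, u)" "D = D1 @ D2"
    using VC.prems(1) by (auto split: option.splits if_splits)
  have g: "goods D1" "goods D2" using VC.prems(2) c(3) by auto
  show ?case
    using VC.IH(1)[OF c(1) g(2)] VC.IH(2)[OF c(2) g(1)] dev_append[of k w D1 u D2 v] g c(3)
    by (simp add: dapp_append)
next
  case (HC s t)
  obtain w1 w2 D1 D2 v1 v2 where c: "compile s = Some (k, w1, D1, v1)" "compile t = Some (sr k w1, w2, D2, v2)"
    "w = w1 @ w2" "D = shd (length w1) 0 0 D2 @ D1" "v = v1 @ v2"
    using HC.prems(1) by (auto split: option.splits if_splits)
  have g: "goods D1" "goods D2" using HC.prems(2) c(4) by auto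
  have s: "wok k w1" "dapp k w1 D1 = Some v1" "sem s = dev k w1 D1"
    and t: "wok (sr k w1) w2" "dapp (sr k w1) w2 D2 = Some v2" "sem t = dev (sr k w1) w2 D2"
    using HC.IH(1)[OF c(1) g(1)] HC.IH(2)[OF c(2) g(2)] by auto
  have sv: "wok k v1" "sr k v1 = sr k w1" "wok (sr k w1) v2" "sr (sr k w1) v2 = sr (sr k w1) w2"
    using dapp_wok[OF s(1,2)] dapp_wok[OF t(1,2)] by auto
  have W: "wok k (w1 @ sh 0 0 w2 @ [])" "wok k ([] @ sh 0 0 w1 @ v2)" using s t sv by simp_all
  have L: "dapp k (w1 @ w2) (shd (length w1) 0 0 D2) = Some (w1 @ v2)"
    "dev k (w1 @ w2) (shd (length w1) 0 0 D2) = whisk (ev k w1) (sem t) (\<one> (pow (sr (sr k w1) w2)))"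
    using shd_lift[OF t(1,2) g(2) W(1)] t(3) by (simp_all add: pad2_unit)
  have K: "dapp k (w1 @ v2) D1 = Some (v1 @ v2)" "dev k (w1 @ v2) D1 = whisk (\<one> (pow k)) (sem s) (ev (sr k w1) v2)"
    using shd_lift[OF s(1,2) g(1) W(2)] s(3) by (simp_all add: pad2_unit)
  have h: "sem s \<in> hom2 B (ev k w1) (ev k v1)" "sem t \<in> hom2 B (ev (sr k w1) w2) (ev (sr k w1) v2)"
    using dev_hom[OF s(1,2) g(1)] dev_hom[OF t(1,2) g(2)] s(3) t(3) by auto
  have L': "dev k (w1 @ w2) (shd (length w1) 0 0 D2) = \<langle>ev k w1\<rangle> \<star> sem t"
    unfolding L(2) by (rule whisk_unit_right[OF h(2)]) (use t in simp)
  have K': "dev k (w1 @ v2) D1 = sem s \<star> \<langle>ev (sr k w1) v2\<rangle>"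
    unfolding K(2) by (rule whisk_unit_left[OF h(1)]) (use s sv in simp_all)
  have "dev k w D = (sem s \<star> \<langle>ev (sr k w1) v2\<rangle>) \<odot> (\<langle>ev k w1\<rangle> \<star> sem t)"
    unfolding c(3,4) using dev_append[OF _ L(1) K(1)] g L' K' W(1) by simp
  also have "\<dots> = sem s \<star> sem t"
    by (rule interchange(1)[OF h]) (use s t in simp)
  finally show ?case using W(1) c(3-5) L(1) K(1) by (simp add: dapp_append)
next
  case (LW p s)
  obtain k' w' D' v' where c: "compile s = Some (k', w', D', v')" "k = p + k'" "w = sh p 0 w'" "D = shd 0 p 0 D'" "v = sh p 0 v'"
    using LW.prems(1) by (auto split: option.splits)
  have g: "goods D'" using LW.prems(2) c(4) by simp
  have s: "wok k' w'" "dapp k' w' D' = Some v'" "sem s = dev k' w' D'" using LW.IH[OF c(1) g] by auto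
  have W: "wok k ([] @ sh p 0 w' @ [])" using wok_sh0(2)[OF s(1)] c(2) by simp
  have h: "pow p \<rhd>\<^sub>2 sem s \<in> hom2 B (pow p \<rhd>\<^sub>1 ev k' w') (pow p \<rhd>\<^sub>1 ev k' v')"
    using lw2_hom[OF dev_hom[OF s(1,2) g]] s(3) by simp
  have "whisk (\<one> (pow k)) (pow p \<rhd>\<^sub>2 sem s) (\<one> (pow (p + sr k' w'))) = pow p \<rhd>\<^sub>2 sem s"
    by (rule whisk_one[OF h]) (use s c(2) in \<open>simp_all add: lw1_src lw1_trg pow_add\<close>)
  then show ?case using shd_lift[OF s(1,2) g W] c W s(3) by (simp add: pad2_def rw2_unit)
next
  case (RW s q)
  obtain k' w' D' v' where c: "compile s = Some (k', w', D', v')" "k = k' + q" "w = sh 0 q w'" "D = shd 0 0 q D'" "v = sh 0 q v'"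
    using RW.prems(1) by (auto split: option.splits)
  have g: "goods D'" using RW.prems(2) c(4) by simp
  have s: "wok k' w'" "dapp k' w' D' = Some v'" "sem s = dev k' w' D'" using RW.IH[OF c(1) g] by auto
  have W: "wok k ([] @ sh 0 q w' @ [])" using wok_sh0(1)[OF s(1)] c(2) by simp
  have h: "sem s \<lhd>\<^sub>2 pow q \<in> hom2 B (ev k' w' \<lhd>\<^sub>1 pow q) (ev k' v' \<lhd>\<^sub>1 pow q)"
    using rw2_hom[OF dev_hom[OF s(1,2) g]] s(3) by simp
  have "whisk (\<one> (pow k)) (sem s \<lhd>\<^sub>2 pow q) (\<one> (pow (sr k' w' + q))) = sem s \<lhd>\<^sub>2 pow q"
    by (rule whisk_one[OF h]) (use s c(2) in \<open>simp_all add: rw1_src rw1_trg pow_add\<close>)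
  then show ?case using shd_lift[OF s(1,2) g W] c W s(3) by (simp add: pad2_def lw2_unit)
qed

text \<open>Stronger than equality of the two values: a common boundary and typed layers are
  included, so that a valid equation can itself serve as a rule.\<close>

definition valid :: "expr \<times> expr \<Rightarrow> bool" where
  "valid e \<longleftrightarrow> (\<exists>k w D D' v. compile (fst e) = Some (k, w, D, v) \<and> compile (snd e) = Some (k, w, D', v) \<and>
     eqd k w D D')"

lemma validD: "valid e \<Longrightarrow> sem (fst e) = sem (snd e)"
  using compile_sound by (force simp: valid_def eqd_def)

lemma valid_the_rule: "valid e \<Longrightarrow> sound_rule (the_rule e)"
  by (auto simp: valid_def the_rule_def sound_rule_def)

definition "good_gens L \<longleftrightarrow> (\<forall>g \<in> set L. good (G g))"

end

fun gens :: "expr \<Rightarrow> gen list" where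
  "gens (Cell g) = [g]" | "gens (VC s t) = gens s @ gens t" | "gens (HC s t) = gens s @ gens t"
| "gens (LW p s) = gens s" | "gens (RW s q) = gens s" | "gens _ = []"

text \<open>Collecting the generators of the left side suffices, because every move carries goodness
  over to the diagram that it produces.\<close>

definition certifies :: "gen list \<Rightarrow> (expr \<times> expr) list \<Rightarrow> expr \<times> expr \<Rightarrow> move list \<Rightarrow> bool" where
  "certifies L R e ss \<longleftrightarrow> list_all (\<lambda>g. g \<in> set L) (gens (fst e)) \<and> proves R (fst e) (snd e) ss"

context diagrams
begin

lemma goods_gens: "compile s = Some (k, w, D, v) \<Longrightarrow> (\<forall>g \<in> set (gens s). good (G g)) \<Longrightarrow> goods D"
proof (induction s arbitrary: k w D v)
  case (Chi m f n g)
  then show ?case using crossing_good[OF crossing_cross[of 0 f g]] by (auto simp: Let_def split: if_splits)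
next
  case (ChiInv m f n g)
  then show ?case using crossing_good[OF crossing_cross[of 0 f g]] by (auto simp: Let_def split: if_splits)
qed (auto split: option.splits if_splits)

text \<open>Separates the two kinds of premises: goodness of the generators and validity of the
  rules depend on the interpretation, whereas \<open>certifies\<close> is a closed statement about
  finite data that \<open>code_simp\<close> evaluates.\<close>

theorem certified:
  assumes "good_gens L" and "\<forall>e \<in> set R. valid e" and "certifies L R e ss"
  shows "valid e"
proof -
  obtain k w D D' v where c: "compile (fst e) = Some (k, w, D, v)" "compile (snd e) = Some (k, w, D', v)"
    "steps (map the_rule R) k w ss D = Some D'"
    using assms(3) by (auto simp: certifies_def proves_def split: option.splits)
  have "\<forall>g \<in> set (gens (fst e)). good (G g)"
    using assms(1,3) by (auto simp: certifies_def good_gens_def list_all_iff)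
  then have g: "goods D" using goods_gens[OF c(1)] by blast
  have *: "wok k w" "dapp k w D \<noteq> None" using compile_sound[OF c(1) g] by simp_all
  have "sound_rule r" if "r \<in> set (map the_rule R)" for r using that assms(2) valid_the_rule by auto
  from steps_sound[OF this c(3) *(1) g *(2)] have "eqd k w D D'" by simp
  then show ?thesis using c by (auto simp: valid_def)
qed

text \<open>The certificate without moves from s to itself serves as an executable check that s is
  built from the listed generators.\<close>

lemma sem_hom:
  assumes "good_gens L" "certifies L [] (s, s) []" "compile s = Some (k, w, D, v)"
  shows "sem s \<in> hom2 B (ev k w) (ev k v)"
proof -
  have g: "goods D"
    using goods_gens[OF assms(3)] assms(1,2)
    by (auto simp: certifies_def good_gens_def list_all_iff)
  show ?thesis using compile_sound[OF assms(3) g] dev_hom g by metis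
qed

end

section \<open>The structure of a Hopf monoid in terms of diagrams\<close>

text \<open>Naming convention: \<open>V 0\<close> is the monoid a, and \<open>V 3\<close>,
  \<open>V 1\<close>, \<open>V 2\<close>, \<open>V 4\<close> are the objects of a chain x'
  \<rightarrow> x \<rightarrow> y \<rightarrow> y' of the 2-cells \<open>Two 1 3 1\<close>,
  \<open>Two 0 1 2\<close> and \<open>Two 2 2 4\<close>. Naturality of a retraction is stated along
  this chain.\<close>

abbreviation "wA \<equiv> [(0, V 0, 0)] :: word"
abbreviation "wX \<equiv> [(0, V 1, 0)] :: word"
abbreviation "wY \<equiv> [(0, V 2, 0)] :: word"
abbreviation "wX' \<equiv> [(0, V 3, 0)] :: word"
definition ten :: "word \<Rightarrow> word \<Rightarrow> word" where
  "ten f g = sh 0 1 f @ sh 1 0 g"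

definition bulw :: "word \<Rightarrow> word \<Rightarrow> word" where
  "bulw f g = (0, Mul, 0) # ten f g @ [(0, MulA, 0)]"

fun ginv :: "gen \<Rightarrow> gen" where
  "ginv Asc = AscI" | "ginv AscI = Asc" | "ginv Lun = LunI" | "ginv LunI = Lun"
| "ginv Run = RunI" | "ginv RunI = Run" | "ginv CoAsc = CoAscI" | "ginv CoAscI = CoAsc"
| "ginv CoLun = CoLunI" | "ginv CoLunI = CoLun" | "ginv CoRun = CoRunI" | "ginv CoRunI = CoRun"
| "ginv g = g"

text \<open>Meant for expressions whose generators are all coherence isomorphisms;
  \<open>ginv\<close> leaves every other generator fixed.\<close>

fun einv :: "expr \<Rightarrow> expr" where
  "einv (Cell g) = Cell (ginv g)"
| "einv (Id k w) = Id k w"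
| "einv (Chi m f n g) = ChiInv m f n g"
| "einv (ChiInv m f n g) = Chi m f n g"
| "einv (VC s t) = VC (einv t) (einv s)"
| "einv (HC s t) = HC (einv s) (einv t)"
| "einv (LW p s) = LW p (einv s)"
| "einv (RW s q) = RW (einv s) q"

definition e_bul :: "expr \<Rightarrow> expr \<Rightarrow> expr" where
  "e_bul s t = HC (Id 1 [(0, Mul, 0)]) (HC (HC (RW s 1) (LW 1 t)) (Id 2 [(0, MulA, 0)]))"

definition e_cir :: "expr \<Rightarrow> expr \<Rightarrow> expr" where
  "e_cir s t = HC t s"

definition e_asc :: "word \<Rightarrow> word \<Rightarrow> word \<Rightarrow> expr" where
  "e_asc a b c = VC (HC (Id 1 [(0, Mul, 0)]) (HC (ChiInv 1 a 2 [(0, Mul, 0)])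
       (Id 3 (sh 1 0 (ten b c) @ [(1, MulA, 0), (0, MulA, 0)]))))
     (VC (HC (Cell Asc) (HC (Id 3 (sh 0 2 a @ sh 1 0 (ten b c))) (Cell CoAsc)))
       (HC (Id 1 ([(0, Mul, 0), (0, Mul, 1)] @ sh 0 1 (ten a b)))
         (HC (Chi 1 [(0, MulA, 0)] 1 c) (Id 2 [(0, MulA, 0)]))))"

definition e_lun :: "word \<Rightarrow> expr" where
  "e_lun a = VC (HC (Cell Lun) (HC (Id 1 a) (Cell CoLun)))
     (HC (Id 1 [(0, Mul, 0), (0, Unt, 1)]) (HC (Chi 1 [(0, UntA, 0)] 1 a) (Id 2 [(0, MulA, 0)])))"

definition e_run :: "word \<Rightarrow> expr" where
  "e_run a = VC (HC (Cell Run) (HC (Id 1 a) (Cell CoRun)))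
     (HC (Id 1 [(0, Mul, 0)]) (HC (Chi 1 a 0 [(0, Unt, 0)]) (Id 1 [(1, UntA, 0), (0, MulA, 0)])))"

definition e_xi :: "word \<Rightarrow> word \<Rightarrow> word \<Rightarrow> word \<Rightarrow> expr" where
  "e_xi a b c d = VC (HC (Id 1 ((0, Mul, 0) # ten b d)) (HC (Cell EtaM) (Id 2 (ten a c @ [(0, MulA, 0)]))))
     (HC (Id 1 ((0, Mul, 0) # sh 0 1 b)) (HC (Chi 1 a 1 d) (Id 2 (sh 1 0 c @ [(0, MulA, 0)]))))"

definition e_freeL :: "word \<Rightarrow> expr \<Rightarrow> word \<Rightarrow> expr" where
  "e_freeL p m z = VC (e_bul m (Id 1 z)) (einv (e_asc p p z))"

definition e_freeR :: "word \<Rightarrow> expr \<Rightarrow> word \<Rightarrow> expr" where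
  "e_freeR p m z = VC (e_bul (Id 1 z) m) (e_asc z p p)"

text \<open>The composite z \<cong> \<j> \<bullet> z \<Rightarrow> (a \<bullet> a) \<bullet> z
  \<cong> a \<bullet> (a \<bullet> z) \<Rightarrow> a \<bullet> z. For modules over a ring it is the
  map that sends z to the sum of the e_i \<otimes> f_i z, where the sum of the e_i \<otimes> f_i is
  the separability idempotent.\<close>

definition e_split :: "word \<Rightarrow> expr \<Rightarrow> expr" where
  "e_split z l = VC (e_bul (Id 1 wA) l) (VC (e_asc wA wA z)
     (VC (e_bul (VC (Cell Nab) (Cell Eta)) (Id 1 z)) (einv (e_lun z))))"

definition e_splitR :: "word \<Rightarrow> expr \<Rightarrow> expr" where
  "e_splitR z r = VC (e_bul r (Id 1 wA)) (VC (einv (e_asc z wA wA))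
     (VC (e_bul (Id 1 z) (VC (Cell Nab) (Cell Eta))) (einv (e_run z))))"

definition "e_alpha = VC (HC (Cell CoLun) (Id 1 [(0, Mul, 0)])) (HC (Id 1 [(0, UntA, 1)]) (Cell EtaM))"

definition "e_beta = VC (HC (Id 2 [(0, MulA, 0)]) (Cell Run)) (HC (Cell EtaM) (Id 2 [(1, Unt, 0)]))"

definition e_phi :: "word \<Rightarrow> word \<Rightarrow> expr" where
  "e_phi b c = (let A = [(0, UntA, 1), (0, Mul, 1)]; bc = sh 0 1 (ten b c) in
     VC (HC (Cell LunI) (Id 1 (A @ bc @ [(0, MulA, 1), (0, MulA, 0)])))
       (VC (HC (Id 1 (A @ bc)) (Cell CoAscI))
         (VC (HC (Id 1 (A @ bc @ [(1, MulA, 0)])) e_beta)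
           (HC (Id 1 A) (ChiInv 1 b 0 (sh 0 1 c @ [(0, MulA, 0), (0, Unt, 0)]))))))"

definition e_psi :: "word \<Rightarrow> word \<Rightarrow> expr" where
  "e_psi b c = (let A = [(1, MulA, 0), (1, Unt, 0)]; bc = sh 1 0 (ten b c) in
     VC (HC (Id 1 ([(0, Mul, 0), (1, Mul, 0)] @ bc @ A)) (Cell CoRunI))
       (VC (HC (Cell Asc) (Id 3 (bc @ A)))
         (VC (HC e_alpha (Id 2 ((0, Mul, 1) # bc @ A)))
           (HC (ChiInv 2 ((0, UntA, 0) # (0, Mul, 0) # sh 1 0 b) 1 c) (Id 3 A)))))"

text \<open>Reversal of 1-cells and of the tensor product, which exchanges the multiplication and its right
  adjoint.\<close>

fun amir :: "atom \<Rightarrow> atom" where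
  "amir Mul = MulA" | "amir Unt = UntA" | "amir MulA = Mul" | "amir UntA = Unt" | "amir (V n) = V n"

definition mirw :: "word \<Rightarrow> word" where
  "mirw w = rev (map (\<lambda>(p, f, q). (q, amir f, p)) w)"

definition "muh_expr = VC (HC (Cell Mu) (Id 1 [(0, Mul, 0)])) (HC (Id 1 [(0, Mul, 0), (0, V 0, 1), (1, V 0, 0)])
  (Cell EtaM))"

text \<open>The other transpose of \<mu>, of type (a \<otimes> a) \<cdot> m^* \<Rightarrow> m^*
  \<cdot> a. It is the mirror image of \<open>Muh\<close> and is not a generator, which is why
  \<open>gmir\<close> takes values in expressions.\<close>

definition "muc_expr = VC (HC (Id 2 [(0, MulA, 0)]) (Cell Mu)) (HC (Cell EtaM) (Id 2 [(0, V 0, 1), (1, V 0, 0), (0,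
  MulA, 0)]))"

text \<open>Reversing the 1-cells turns m \<stileturn> m^* into m^* \<stileturn> m while the
  direction of 2-cells is kept, so units and counits are fixed. The codomain of the antipode,
  \<open>rev1\<close>, is its own mirror image; hence \<open>Sig\<close> is fixed and the two
  antipode axioms are exchanged.\<close>

fun gmir :: "gen \<Rightarrow> expr" where
  "gmir Asc = Cell CoAscI" | "gmir AscI = Cell CoAsc" | "gmir CoAsc = Cell AscI" | "gmir CoAscI = Cell Asc"
| "gmir Lun = Cell CoRun" | "gmir LunI = Cell CoRunI" | "gmir Run = Cell CoLun" | "gmir RunI = Cell CoLunI"
| "gmir CoLun = Cell Run" | "gmir CoLunI = Cell RunI" | "gmir CoRun = Cell Lun" | "gmir CoRunI = Cell LunI"
| "gmir Muh = muc_expr" | "gmir Etah = Cell Etac" | "gmir Etac = Cell Etah"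
| "gmir (ActL f) = Cell (ActRA f)" | "gmir (ActR f) = Cell (ActLI f)"
| "gmir (ActRA f) = Cell (ActL f)" | "gmir (ActLI f) = Cell (ActR f)"
| "gmir The = Cell TheR" | "gmir TheR = Cell The" | "gmir g = Cell g"

fun mirror :: "expr \<Rightarrow> expr" where
  "mirror (Cell g) = gmir g"
| "mirror (Id k w) = Id (sr k w) (mirw w)"
| "mirror (Chi m f n g) = Chi (tg n g) (mirw g) (tg m f) (mirw f)"
| "mirror (ChiInv m f n g) = ChiInv (tg n g) (mirw g) (tg m f) (mirw f)"
| "mirror (VC s t) = VC (mirror s) (mirror t)"
| "mirror (HC s t) = HC (mirror t) (mirror s)"
| "mirror (LW p s) = RW (mirror s) p"
| "mirror (RW s q) = LW q (mirror s)"

definition mirror_eq :: "expr \<times> expr \<Rightarrow> expr \<times> expr" where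
  "mirror_eq e = (mirror (fst e), mirror (snd e))"

abbreviation "idI \<equiv> Id 1 []"
abbreviation "idA \<equiv> Id 1 wA"
abbreviation "jw \<equiv> [(0, Unt, 0), (0, UntA, 0)] :: word"

definition "struct_gens = [Asc, AscI, Lun, LunI, Run, RunI, EtaM, EpsM, EtaU, EpsU,
  CoAsc, CoAscI, CoLun, CoLunI, CoRun, CoRunI]"

definition "hopf_gens = [Mu, Eta, Del, Eps, Sig, Muh, Etah, Etac]"

definition "basic_gens = struct_gens @ hopf_gens"

section \<open>The 2-cells of the argument\<close>

definition "counitL = (VC (Cell EpsM) (e_bul (Cell Eps) idI))"
definition "counitR = (VC (Cell EpsM) (e_bul idI (Cell Eps)))"
text \<open>A contraction of m \<cdot> (1 \<otimes> m) \<cdot> (m^* \<otimes> 1) \<cdot> (u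
  \<otimes> 1) to the identity: after reassociation the counit of m applies, then the left unit
  law.\<close>

definition "e_run_counit = (VC (Cell Lun) (HC (VC (HC (Id 1 [(0,Mul,0)]) (RW (Cell EpsM) 1)) (HC (Cell AscI) (Id 3
  [(0,MulA,1)]))) (Id 2 [(0,Unt,1)])))"
text \<open>Of type a \<cdot> m \<cdot> (a^- \<otimes> 1) \<Rightarrow> m \<cdot> (1 \<otimes> a),
  where a^- is \<open>rev1 a\<close>. Interchange brings the outer a next to the copy of a inside
  a^-, \<alpha> replaces u^* by m, \<open>Muh\<close> multiplies the two copies, and the leftover m,
  m^* and u contract. In elements this is the product S(x)y.\<close>

definition "e_regroup = (VC (HC (Id 1 [(0,Mul,0),(1,V 0,0)]) (LW 1 e_run_counit)) (VC (HC (Id 1 [(0,Mul,0)]) (HC (LW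
  1 (Cell Muh)) (Id 3 [(2,Mul,0),(1,MulA,1),(1,Unt,1)]))) (VC (HC (Cell Asc) (Id 3 [(1,V 0,1),(2,V
  0,0),(2,Mul,0),(1,MulA,1),(1,Unt,1)])) (VC (HC e_alpha (Id 2 [(0,Mul,1),(1,V 0,1),(2,V
  0,0),(2,Mul,0),(1,MulA,1),(1,Unt,1)])) (VC (HC (ChiInv 2 [(0,UntA,0),(0,Mul,0),(1,V 0,0)] 1 wA) (HC (Id 3
  [(2,Mul,0)]) (Id 4 [(1,MulA,1),(1,Unt,1)]))) (HC idA (HC (ChiInv 2 [(0,UntA,0),(0,Mul,0),(1,V 0,0)] 2 [(0,Mul,0)])
  (Id 4 [(1,MulA,1),(1,Unt,1)]))))))))"
definition "e_finish = (VC (HC (Id 1 [(0,Mul,0),(1,V 0,0)]) (LW 1 (Cell Lun))) (VC (HC (Id 1 [(0,Mul,0)]) (HC (LW 1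
  (Cell Muh)) (Id 3 [(1,Unt,1)]))) (VC (HC (Id 1 [(0,Mul,0)]) (LW 1 (HC (Id 1 [(0,Mul,0),(0,V 0,1)]) (Chi 0
  [(0,Unt,0)] 1 wA)))) (HC (Cell Asc) (Id 3 [(1,V 0,1),(1,Unt,1),(1,V 0,0)])))))"
definition "psi_lhs = (VC (HC (Id 1 [(0,Mul,0)]) (HC (LW 1 (Cell Mu)) (Id 2 [(1,Unt,0)]))) (VC (HC (Cell Asc) (Id 3
  [(1,V 0,1),(2,V 0,0),(1,MulA,0),(1,Unt,0)])) (VC (HC e_alpha (Id 2 [(0,Mul,1),(1,V 0,1),(2,V
  0,0),(1,MulA,0),(1,Unt,0)])) (VC (HC (ChiInv 2 [(0,UntA,0),(0,Mul,0),(1,V 0,0)] 1 wA) (Id 3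
  [(1,MulA,0),(1,Unt,0)])) (VC (e_cir (Cell Sig) idA) (Cell Del))))))"
definition "psi_rhs = (VC (HC (Id 1 [(0,Mul,0)]) (LW 1 (Cell Etah))) (VC (Cell RunI) (Cell Eps)))"
definition "phi_lhs = (VC (HC (Id 1 [(0,UntA,1)]) (HC (RW (Cell Mu) 1) (Id 2 [(0,MulA,0)]))) (VC (HC (Id 1
  [(0,UntA,1),(0,Mul,1),(0,V 0,2),(1,V 0,1)]) (Cell CoAscI)) (VC (HC (Id 1 [(0,UntA,1),(0,Mul,1),(0,V 0,2),(1,V
  0,1),(1,MulA,0)]) e_beta) (VC (HC (Id 1 [(0,UntA,1),(0,Mul,1)]) (ChiInv 1 wA 0 [(0,V 0,1),(0,MulA,0),(0,Unt,0)]))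
  (VC (e_cir idA (Cell Sig)) (Cell Del))))))"
definition "phi_rhs = (VC (HC (RW (Cell Etac) 1) (Id 2 [(0,MulA,0)])) (VC (Cell CoLunI) (Cell Eps)))"
definition "e_antipode_cancel = (VC e_regroup (VC (HC (Id 1 [(0,V 0,0),(0,Mul,0)]) (RW (Cell Sig) 1)) (VC (HC (Cell
  Muh) (Id 2 [(0,V 0,1)])) (VC (HC (Id 1 [(0,Mul,0),(0,V 0,1)]) (Chi 1 wA 1 wA)) (HC (Id 1 [(0,Mul,0)]) (HC (RW
  (Cell Del) 1) (Id 2 [(1,V 0,0)])))))))"
definition "e_antipode_cancel_psi = (VC e_finish (HC (Id 1 [(0,Mul,0)]) (HC (RW psi_lhs 1) (Id 2 [(1,V 0,0)]))))"
definition "fusion = (VC (HC (Cell Muh) (Id 2 [(0,V 0,1)])) (VC (HC (Id 1 [(0,Mul,0),(0,V 0,1)]) (Chi 1 wA 1 wA))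
  (HC (Id 1 [(0,Mul,0)]) (HC (RW (Cell Del) 1) (Id 2 [(1,V 0,0)])))))"
definition "fusion_inv = (VC (HC (Id 1 [(0,Mul,0)]) (ChiInv 1 wA 1 wA)) (VC (HC e_regroup (Id 2 [(0,V 0,1)])) (VC
  (HC (Id 1 [(0,V 0,0),(0,Mul,0)]) (HC (RW (Cell Sig) 1) (Id 2 [(0,V 0,1)]))) (HC (Id 1 [(0,V 0,0),(0,Mul,0)]) (RW
  (Cell Del) 1)))))"
text \<open>Continues from the codomain of the \<open>phi\<close> axiom: the result of that axiom is
  multiplied by the remaining argument, \<alpha> turning the u^* in front into a
  multiplication.\<close>

definition "e_finish_alpha = (VC (HC (Id 1 [(0,V 0,0),(0,Mul,0)]) (RW (Cell EpsM) 1)) (VC (HC idA (HC (Cell AscI)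
  (Id 3 [(0,MulA,1)]))) (VC (HC (Cell Muh) (Id 2 [(1,Mul,0),(0,MulA,1)])) (VC (HC e_alpha (Id 2 [(0,V 0,1),(1,V
  0,0),(1,Mul,0),(0,MulA,1)])) (VC (HC (ChiInv 1 [(0,UntA,0),(0,V 0,0)] 1 wA) (Id 2 [(1,Mul,0),(0,MulA,1)])) (HC idA
  (HC (ChiInv 1 [(0,UntA,0),(0,V 0,0)] 2 [(0,Mul,0)]) (Id 3 [(0,MulA,1)]))))))))"
definition "e_mult_fusion_inv = (VC (Cell Muh) fusion_inv)"
definition "e_mult_fusion_inv_phi = (VC e_finish_alpha (HC (Id 1 [(0,V 0,0),(0,Mul,0)]) (RW phi_lhs 1)))"
definition "e_mult_fusion_inv_eta = (VC e_finish_alpha (HC (Id 1 [(0,V 0,0),(0,Mul,0)]) (RW phi_rhs 1)))"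
definition "e_counit_beta = (VC (HC (RW (Cell EpsM) 1) (Id 2 [(0,MulA,0)])) (VC (HC (Id 2 [(0,Mul,1)]) (Cell
  CoAscI)) (HC (Id 2 [(0,Mul,1),(1,MulA,0)]) e_beta)))"
text \<open>\<open>e_Z1\<close> and \<open>e_Z2\<close> contract the same 1-cell m \<cdot> (m
  \<otimes> 1) \<cdot> (1 \<otimes> 1 \<otimes> m) \<cdot> (1 \<otimes> m^* \<otimes> 1) \<cdot> (1
  \<otimes> u \<otimes> 1) to m. The first uses the left unit law, as the antipode axiom with
  \<open>psi\<close> would suggest; the second passes through \<beta>, as the axiom with
  \<open>phi\<close> requires.\<close>

definition "e_Z1 = (VC (HC (Id 1 [(0,Mul,0)]) (LW 1 (Cell Lun))) (VC (HC (Id 1 [(0,Mul,0),(1,Mul,0)]) (HC (LW 1 (RW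
  (Cell EpsM) 1)) (Id 3 [(1,Unt,1)]))) (VC (HC (Id 1 [(0,Mul,0)]) (HC (LW 1 (Cell AscI)) (Id 4
  [(1,MulA,1),(1,Unt,1)]))) (HC (Cell Asc) (HC (Id 3 [(2,Mul,0)]) (Id 4 [(1,MulA,1),(1,Unt,1)]))))))"
definition "e_Z2 = (VC (HC (Id 1 [(0,Mul,0)]) (RW (Cell EpsM) 1)) (VC (HC (Cell AscI) (Id 3 [(0,MulA,1)])) (VC (HC
  (Id 1 [(0,Mul,0),(1,Mul,0)]) (RW e_counit_beta 1)) (HC (Id 1 [(0,Mul,0)]) (HC (Chi 2 [(0,Mul,0)] 2 [(0,Mul,0)])
  (Id 4 [(1,MulA,1),(1,Unt,1)]))))))"
definition "e_antipode_middle = (VC (HC (Id 1 [(0,UntA,1),(0,Mul,1)]) (ChiInv 1 wA 1 [(0,V 0,1),(1,V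
  0,0),(1,Mul,0),(0,MulA,1),(0,Unt,1)])) (VC (HC (HC (ChiInv 2 [(0,UntA,0),(0,Mul,0),(1,V 0,0)] 1 wA) (HC (Id 3
  [(2,Mul,0)]) (Id 4 [(1,MulA,1),(1,Unt,1)]))) (Id 2 [(0,V 0,1)])) (HC (HC idA (HC (ChiInv 2
  [(0,UntA,0),(0,Mul,0),(1,V 0,0)] 2 [(0,Mul,0)]) (Id 4 [(1,MulA,1),(1,Unt,1)]))) (Id 2 [(0,V 0,1)]))))"
definition "e_antipode_mult = (VC (HC (Cell Muh) (Id 2 [(0,Mul,1),(2,Mul,0),(1,MulA,1),(1,Unt,1)])) (VC (HC e_alpha
  (HC (Id 2 [(0,V 0,1)]) (HC (Id 2 [(1,V 0,0)]) (Id 2 [(0,Mul,1),(2,Mul,0),(1,MulA,1),(1,Unt,1)])))) (VC (HC (Id 1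
  [(0,UntA,1)]) (HC (Id 2 [(0,V 0,1)]) (HC (Chi 2 [(0,Mul,0)] 1 wA) (Id 3 [(2,Mul,0),(1,MulA,1),(1,Unt,1)])))) (HC
  (Id 1 [(0,UntA,1)]) (HC (RW (Cell Muh) 1) (Id 3 [(2,V 0,0),(2,Mul,0),(1,MulA,1),(1,Unt,1)]))))))"
definition "e_antipode_start = (VC (HC (Id 1 [(0,V 0,0),(0,Mul,0)]) (HC (RW (Cell Sig) 1) (Id 2 [(0,V 0,1)]))) (HC
  (Id 1 [(0,V 0,0),(0,Mul,0)]) (RW (Cell Del) 1)))"
definition "e_C1 = (VC (HC idA e_Z1) (VC e_antipode_mult (VC e_antipode_middle e_antipode_start)))"
definition "e_C2 = (VC (HC idA e_Z2) (VC e_antipode_mult (VC e_antipode_middle e_antipode_start)))"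
definition "muh_left = (VC (HC (Cell Muh) (Id 2 [(0,Mul,1)])) (VC (HC (Id 1 [(0,Mul,0),(0,V 0,1)]) (Chi 2
  [(0,Mul,0)] 1 wA)) (HC (Id 1 [(0,Mul,0)]) (HC (RW (Cell Muh) 1) (Id 3 [(2,V 0,0)])))))"
definition "muh_right = (VC (HC (Cell Muh) (Id 2 [(1,Mul,0)])) (VC (HC (Id 1 [(0,Mul,0),(0,V 0,1)]) (LW 1 (Cell
  Muh))) (HC (Id 1 [(0,Mul,0)]) (HC (ChiInv 1 wA 2 [(0,Mul,0)]) (Id 3 [(1,V 0,1),(2,V 0,0)])))))"
definition "e_unit_mult = (VC (HC (Cell Muh) (Id 2 [(0,Unt,1)])) (VC (HC (Id 1 [(0,Mul,0),(0,V 0,1)]) (Chi 0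
  [(0,Unt,0)] 1 wA)) (HC (Id 1 [(0,Mul,0)]) (HC (RW (Cell Etah) 1) idA))))"
definition "e_etac_alpha = (VC (HC e_alpha (Id 2 [(0,V 0,1)])) (RW (Cell Etac) 1))"
definition "e_kelly_left1 = (VC (HC (Cell Lun) (Id 1 [(0,Mul,0)])) (VC (HC (Id 1 [(0,Mul,0)]) (ChiInv 0 [(0,Unt,0)]
  2 [(0,Mul,0)])) (HC (Cell Asc) (Id 3 [(0,Unt,2)]))))"
definition "e_kelly_left2 = (HC (Id 1 [(0,Mul,0)]) (RW (Cell Lun) 1))"
definition "e_kelly_right1 = (VC (HC (Id 1 [(0,Mul,0)]) (LW 1 (Cell Run))) (HC (Cell Asc) (Id 3 [(2,Unt,0)])))"
definition "e_kelly_right2 = (VC (HC (Cell Run) (Id 1 [(0,Mul,0)])) (HC (Id 1 [(0,Mul,0)]) (Chi 2 [(0,Mul,0)] 0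
  [(0,Unt,0)])))"
definition "can = (VC (e_cir (Id 1 (bulw wA [])) (Cell Mu)) (VC (e_xi wA wA [] wA) (e_bul (Cell Del) idA)))"
definition "can_inv = (HC fusion_inv (Id 2 [(0,MulA,0)]))"
text \<open>The left action through \<delta>: b' acts on the factor a \<bullet> \<i> and b''
  multiplies the second factor. An integral composed with a is linear for it, because moving b'
  through the integral replaces it by \<epsilon>(b') and the counit law leaves b.\<close>

definition "diagL = (VC (e_cir (e_freeL wA (Cell Mu) []) (Cell Mu)) (VC (e_xi wA wA (bulw wA []) wA) (e_bul (Cell
  Del) (Id 1 [(0,V 0,0),(0,Mul,0),(0,V 0,1),(0,MulA,0)]))))"
text \<open>The right action: with a written as \<i> \<circ> a, the unit object acts on a \<bullet>
  \<i> and a multiplies the second factor.\<close>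

definition "diagR = (VC (e_cir (e_freeR [] (Cell EpsM) wA) (Cell Mu)) (e_xi (bulw wA []) wA [] wA))"
definition "thetaA = (e_cir (Cell The) idA)"
definition "nabla = (VC can_inv thetaA)"
definition "splitX = (e_split wX (Cell (ActL 1)))"
definition "splitX' = (e_split wX' (Cell (ActL 3)))"
text \<open>In elements, b and x are sent to the section of b applied to x. It is the common value
  of b times the splitting of x and of the splitting of bx, which shows that the splitting is
  linear.\<close>

definition "e_spread = (VC (e_bul idA (Cell (ActL 1))) (VC (e_asc wA wA wX) (e_bul (Cell Nab) (Id 1 wX))))"
definition "retr = (VC (Cell (ActL 2)) (VC (e_bul idA (Cell (Two 0 1 2))) splitX))"
definition "splitRX = (e_splitR wX (Cell (ActRA 1)))"
definition "splitRX' = (e_splitR wX' (Cell (ActRA 3)))"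
definition "retrR = (VC (Cell (ActRA 2)) (VC (e_bul (Cell (Two 0 1 2)) idA) splitRX))"
definition "unitL = (VC (e_bul (Cell Eta) idI) (einv (e_lun [])))"
definition "unitR = (VC (e_bul idI (Cell Eta)) (einv (e_run [])))"

text \<open>The suffix of \<open>pentagon_r0_2_3\<close> and the like marks the equation obtained by moving invertible
  factors to the other side.  A prefix \<open>kelly\<close> refers to Kelly's derivation of the further unit
  laws from the pentagon and the triangle.  The inverse of \<open>fusion\<close>, the canonical 2-cell with its
  factor \<open>m\<^sup>*\<close> removed, applies the antipode to one of the two factors of \<open>\<delta>\<close>.\<close>

definition "eq_mu_assoc = ((VC (Cell Mu) (e_bul (Cell Mu) idA)), (VC (Cell Mu) (VC (e_bul idA (Cell Mu)) (e_asc wA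
  wA wA))))"
definition "eq_asc_inv_right = ((VC (Cell Asc) (Cell AscI)), (Id 1 [(0,Mul,0),(1,Mul,0)]))"
definition "eq_asc_inv_left = ((VC (Cell AscI) (Cell Asc)), (Id 1 [(0,Mul,0),(0,Mul,1)]))"
definition "eq_pentagon = ((VC (HC (Cell Asc) (LW 2 (Id 1 [(0,Mul,0)]))) (VC (HC (Id 1 [(0,Mul,0)]) (ChiInv 2
  [(0,Mul,0)] 2 [(0,Mul,0)])) (HC (Cell Asc) (RW (Id 1 [(0,Mul,0)]) 2)))), (VC (HC (Id 1 [(0,Mul,0)]) (LW 1 (Cell
  Asc))) (VC (HC (Cell Asc) (Id 3 [(1,Mul,1)])) (HC (Id 1 [(0,Mul,0)]) (RW (Cell Asc) 1)))))"
definition "eq_pentagonI = ((VC (HC (Cell AscI) (Id 3 [(0,Mul,2)])) (VC (HC (Id 1 [(0,Mul,0)]) (Chi 2 [(0,Mul,0)] 2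
  [(0,Mul,0)])) (HC (Cell AscI) (Id 3 [(2,Mul,0)])))), (VC (HC (Id 1 [(0,Mul,0)]) (RW (Cell AscI) 1)) (VC (HC (Cell
  AscI) (Id 3 [(1,Mul,1)])) (HC (Id 1 [(0,Mul,0)]) (LW 1 (Cell AscI))))))"
definition "eq_pentagon_r0_2_3 = ((VC (HC (Cell AscI) (Id 3 [(1,Mul,1)])) (VC (HC (Id 1 [(0,Mul,0)]) (LW 1 (Cell
  AscI))) (HC (Cell Asc) (Id 3 [(2,Mul,0)])))), (VC (HC (Id 1 [(0,Mul,0)]) (RW (Cell Asc) 1)) (VC (HC (Cell AscI)
  (Id 3 [(0,Mul,2)])) (HC (Id 1 [(0,Mul,0)]) (Chi 2 [(0,Mul,0)] 2 [(0,Mul,0)])))))"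
definition "eq_coasc_def = ((Cell CoAsc), (VC (HC (Id 3 [(1,MulA,0),(0,MulA,0)]) (VC (Cell EpsM) (HC (Id 1
  [(0,Mul,0)]) (HC (RW (Cell EpsM) 1) (Id 2 [(0,MulA,0)]))))) (VC (HC (Id 3 [(1,MulA,0),(0,MulA,0)]) (HC (Cell AscI)
  (Id 3 [(0,MulA,1),(0,MulA,0)]))) (HC (VC (HC (LW 1 (Id 2 [(0,MulA,0)])) (HC (Cell EtaM) (LW 1 (Id 1
  [(0,Mul,0)])))) (LW 1 (Cell EtaM))) (Id 3 [(0,MulA,1),(0,MulA,0)])))))"
definition "eq_coascI_def = ((Cell CoAscI), (VC (HC (Id 3 [(0,MulA,1),(0,MulA,0)]) (VC (Cell EpsM) (HC (Id 1
  [(0,Mul,0)]) (HC (LW 1 (Cell EpsM)) (Id 2 [(0,MulA,0)]))))) (VC (HC (Id 3 [(0,MulA,1),(0,MulA,0)]) (HC (Cell Asc)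
  (Id 3 [(1,MulA,0),(0,MulA,0)]))) (HC (VC (HC (RW (Id 2 [(0,MulA,0)]) 1) (HC (Cell EtaM) (RW (Id 1 [(0,Mul,0)])
  1))) (RW (Cell EtaM) 1)) (Id 3 [(1,MulA,0),(0,MulA,0)])))))"
definition "eq_mul_zigzag_left = ((VC (HC (Cell EpsM) (Id 1 [(0,Mul,0)])) (HC (Id 1 [(0,Mul,0)]) (Cell EtaM))), (Id
  1 [(0,Mul,0)]))"
definition "eq_mul_zigzag_right = ((VC (HC (Id 2 [(0,MulA,0)]) (Cell EpsM)) (HC (Cell EtaM) (Id 2 [(0,MulA,0)]))),
  (Id 2 [(0,MulA,0)]))"
definition "eq_coasc_inv_left = ((VC (Cell CoAscI) (Cell CoAsc)), (Id 3 [(0,MulA,1),(0,MulA,0)]))"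
definition "eq_coasc_inv_right = ((VC (Cell CoAsc) (Cell CoAscI)), (Id 3 [(1,MulA,0),(0,MulA,0)]))"
definition "eq_co_pentagon = ((VC (HC (LW 2 (Id 2 [(0,MulA,0)])) (Cell CoAsc)) (VC (HC (Chi 1 [(0,MulA,0)] 1
  [(0,MulA,0)]) (Id 2 [(0,MulA,0)])) (HC (RW (Id 2 [(0,MulA,0)]) 2) (Cell CoAsc)))), (VC (HC (LW 1 (Cell CoAsc)) (Id
  2 [(0,MulA,0)])) (VC (HC (Id 4 [(1,MulA,1)]) (Cell CoAsc)) (HC (RW (Cell CoAsc) 1) (Id 2 [(0,MulA,0)])))))"
definition "eq_co_pentagonI = ((VC (HC (Id 4 [(0,MulA,2)]) (Cell CoAscI)) (VC (HC (ChiInv 1 [(0,MulA,0)] 1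
  [(0,MulA,0)]) (Id 2 [(0,MulA,0)])) (HC (Id 4 [(2,MulA,0)]) (Cell CoAscI)))), (VC (HC (RW (Cell CoAscI) 1) (Id 2
  [(0,MulA,0)])) (VC (HC (Id 4 [(1,MulA,1)]) (Cell CoAscI)) (HC (LW 1 (Cell CoAscI)) (Id 2 [(0,MulA,0)])))))"
definition "eq_co_pentagon_r0_1_3 = ((VC (HC (LW 1 (Cell CoAscI)) (Id 2 [(0,MulA,0)])) (VC (HC (Id 4 [(2,MulA,0)])
  (Cell CoAsc)) (HC (Chi 1 [(0,MulA,0)] 1 [(0,MulA,0)]) (Id 2 [(0,MulA,0)])))), (VC (HC (Id 4 [(1,MulA,1)]) (Cell
  CoAsc)) (VC (HC (RW (Cell CoAsc) 1) (Id 2 [(0,MulA,0)])) (HC (Id 4 [(0,MulA,2)]) (Cell CoAscI)))))"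
definition "eq_free_left_assoc = ((VC (e_freeL wA (Cell Mu) []) (e_bul (Cell Mu) (Id 1 (bulw wA [])))), (VC (e_freeL
  wA (Cell Mu) []) (VC (e_bul idA (e_freeL wA (Cell Mu) [])) (e_asc wA wA (bulw wA [])))))"
definition "eq_mu_lun = ((VC (Cell Mu) (e_bul (Cell Eta) idA)), (e_lun wA))"
definition "eq_lun_inv_right = ((VC (Cell Lun) (Cell LunI)), idI)"
definition "eq_triangle = ((VC (HC (Id 1 [(0,Mul,0)]) (LW 1 (Cell Lun))) (HC (Cell Asc) (Id 3 [(1,Unt,1)]))), (HC
  (Id 1 [(0,Mul,0)]) (RW (Cell Run) 1)))"
definition "eq_kelly_left_whiskered = ((VC (HC (Id 1 [(0,Mul,0)]) (LW 1 e_kelly_left1)) (VC (HC (Cell Asc) (Id 3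
  [(1,Mul,1),(1,Unt,2)])) (HC (Id 1 [(0,Mul,0)]) (HC (RW (Cell Asc) 1) (Id 4 [(1,Unt,2)]))))), (VC (HC (Id 1
  [(0,Mul,0)]) (LW 1 e_kelly_left2)) (VC (HC (Cell Asc) (Id 3 [(1,Mul,1),(1,Unt,2)])) (HC (Id 1 [(0,Mul,0)]) (HC (RW
  (Cell Asc) 1) (Id 4 [(1,Unt,2)]))))))"
definition "eq_kelly_left_cancelled = ((HC (Id 1 [(0,Mul,0)]) (LW 1 e_kelly_left1)), (HC (Id 1 [(0,Mul,0)]) (LW 1
  e_kelly_left2)))"
definition "eq_kelly_left = (e_kelly_left1, e_kelly_left2)"
definition "eq_mate_eps = ((VC (VC (Cell EpsM) (HC (Id 1 [(0,Mul,0)]) (HC (RW (Cell EpsM) 1) (Id 2 [(0,MulA,0)]))))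
  (HC (Id 1 [(0,Mul,0),(0,Mul,1)]) (Cell CoAscI))), (VC (VC (Cell EpsM) (HC (Id 1 [(0,Mul,0)]) (HC (LW 1 (Cell
  EpsM)) (Id 2 [(0,MulA,0)])))) (HC (Cell Asc) (Id 3 [(1,MulA,0),(0,MulA,0)]))))"
definition "eq_colun_def = ((Cell CoLun), (VC (HC idI (VC (Cell EpsM) (HC (Id 1 [(0,Mul,0)]) (HC (RW (Cell EpsU) 1)
  (Id 2 [(0,MulA,0)]))))) (VC (HC idI (HC (Cell LunI) (Id 1 [(0,UntA,1),(0,MulA,0)]))) (HC idI (Id 1
  [(0,UntA,1),(0,MulA,0)])))))"
definition "eq_lun_inv_left = ((VC (Cell LunI) (Cell Lun)), (Id 1 [(0,Mul,0),(0,Unt,1)]))"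
definition "eq_kelly_left_inv = ((VC (HC (Cell Asc) (Id 3 [(0,Unt,2)])) (HC (Id 1 [(0,Mul,0)]) (RW (Cell LunI) 1))),
  (VC (HC (Id 1 [(0,Mul,0)]) (Chi 0 [(0,Unt,0)] 2 [(0,Mul,0)])) (HC (Cell LunI) (Id 1 [(0,Mul,0)]))))"
definition "eq_co_kelly_left = ((VC (HC (RW (Cell CoLun) 1) (Id 2 [(0,MulA,0)])) (HC (Id 2 [(0,UntA,2)]) (Cell
  CoAscI))), (VC (HC (Id 2 [(0,MulA,0)]) (Cell CoLun)) (HC (Chi 1 [(0,UntA,0)] 1 [(0,MulA,0)]) (Id 2
  [(0,MulA,0)]))))"
definition "eq_free_left_unit = ((VC (e_freeL wA (Cell Mu) []) (e_bul (Cell Eta) (Id 1 (bulw wA [])))), (e_lun (bulw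
  wA [])))"
definition "eq_i_assoc = ((VC (Cell EpsM) (e_bul (Cell EpsM) idI)), (VC (Cell EpsM) (VC (e_bul idI (Cell EpsM))
  (e_asc [] [] []))))"
definition "eq_pentagon_r1_0_3 = ((VC (HC (Id 1 [(0,Mul,0)]) (LW 1 (Cell Asc))) (VC (HC (Cell Asc) (Id 3
  [(1,Mul,1)])) (HC (Id 1 [(0,Mul,0)]) (RW (Cell Asc) 1)))), (VC (HC (Cell Asc) (Id 3 [(2,Mul,0)])) (VC (HC (Id 1
  [(0,Mul,0)]) (ChiInv 2 [(0,Mul,0)] 2 [(0,Mul,0)])) (HC (Cell Asc) (Id 3 [(0,Mul,2)])))))"
definition "eq_co_pentagon_r0_0_3 = ((VC (HC (Id 4 [(2,MulA,0)]) (Cell CoAsc)) (VC (HC (Chi 1 [(0,MulA,0)] 1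
  [(0,MulA,0)]) (Id 2 [(0,MulA,0)])) (HC (Id 4 [(0,MulA,2)]) (Cell CoAsc)))), (VC (HC (LW 1 (Cell CoAsc)) (Id 2
  [(0,MulA,0)])) (VC (HC (Id 4 [(1,MulA,1)]) (Cell CoAsc)) (HC (RW (Cell CoAsc) 1) (Id 2 [(0,MulA,0)])))))"
definition "eq_free_right_assoc = ((VC (e_freeR [] (Cell EpsM) wA) (e_bul (e_freeR [] (Cell EpsM) wA) idI)), (VC
  (e_freeR [] (Cell EpsM) wA) (VC (e_bul (Id 1 (bulw wA [])) (Cell EpsM)) (e_asc (bulw wA []) [] []))))"
definition "eq_run_inv_left = ((VC (Cell RunI) (Cell Run)), (Id 1 [(0,Mul,0),(1,Unt,0)]))"
definition "eq_corun_def = ((Cell CoRun), (VC (HC idI (VC (Cell EpsM) (HC (Id 1 [(0,Mul,0)]) (HC (LW 1 (Cell EpsU))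
  (Id 2 [(0,MulA,0)]))))) (VC (HC idI (HC (Cell RunI) (Id 1 [(1,UntA,0),(0,MulA,0)]))) (HC idI (Id 1
  [(1,UntA,0),(0,MulA,0)])))))"
definition "eq_i_run = ((VC (Cell EpsM) (e_bul idI (Cell EpsU))), (e_run []))"
definition "eq_run_inv_right = ((VC (Cell Run) (Cell RunI)), idI)"
definition "eq_triangle_r1_0_1 = ((HC (Id 1 [(0,Mul,0)]) (RW (Cell Run) 1)), (VC (HC (Id 1 [(0,Mul,0)]) (LW 1 (Cell
  Lun))) (HC (Cell Asc) (Id 3 [(1,Unt,1)]))))"
definition "eq_kelly_right_whiskered = ((VC (Cell Asc) (HC (Id 1 [(0,Mul,0)]) (RW e_kelly_right1 1))), (VC (Cell
  Asc) (HC (Id 1 [(0,Mul,0)]) (RW e_kelly_right2 1))))"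
definition "eq_kelly_right_cancelled = ((HC (Id 1 [(0,Mul,0)]) (RW e_kelly_right1 1)), (HC (Id 1 [(0,Mul,0)]) (RW
  e_kelly_right2 1)))"
definition "eq_kelly_right = (e_kelly_right1, e_kelly_right2)"
definition "eq_kelly_right_inv = ((VC (HC (Cell AscI) (Id 3 [(2,Unt,0)])) (HC (Id 1 [(0,Mul,0)]) (LW 1 (Cell
  RunI)))), (VC (HC (Id 1 [(0,Mul,0)]) (ChiInv 2 [(0,Mul,0)] 0 [(0,Unt,0)])) (HC (Cell RunI) (Id 1 [(0,Mul,0)]))))"
definition "eq_co_kelly_right = ((VC (HC (LW 1 (Cell CoRun)) (Id 2 [(0,MulA,0)])) (HC (Id 2 [(2,UntA,0)]) (Cell
  CoAsc))), (VC (HC (Id 2 [(0,MulA,0)]) (Cell CoRun)) (HC (ChiInv 1 [(0,MulA,0)] 1 [(0,UntA,0)]) (Id 2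
  [(0,MulA,0)]))))"
definition "eq_free_right_unit = ((VC (e_freeR [] (Cell EpsM) wA) (e_bul (Id 1 (bulw wA [])) (Cell EpsU))), (e_run
  (bulw wA [])))"
definition "eq_pentagon_r0_5_3 = ((VC (HC (Id 1 [(0,Mul,0)]) (ChiInv 2 [(0,Mul,0)] 2 [(0,Mul,0)])) (VC (HC (Cell
  Asc) (Id 3 [(0,Mul,2)])) (HC (Id 1 [(0,Mul,0)]) (RW (Cell AscI) 1)))), (VC (HC (Cell AscI) (Id 3 [(2,Mul,0)])) (VC
  (HC (Id 1 [(0,Mul,0)]) (LW 1 (Cell Asc))) (HC (Cell Asc) (Id 3 [(1,Mul,1)])))))"
definition "eq_co_pentagon_r1_1_3 = ((VC (HC (Id 4 [(2,MulA,0)]) (Cell CoAscI)) (VC (HC (LW 1 (Cell CoAsc)) (Id 2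
  [(0,MulA,0)])) (HC (Id 4 [(1,MulA,1)]) (Cell CoAsc)))), (VC (HC (Chi 1 [(0,MulA,0)] 1 [(0,MulA,0)]) (Id 2
  [(0,MulA,0)])) (VC (HC (Id 4 [(0,MulA,2)]) (Cell CoAsc)) (HC (RW (Cell CoAscI) 1) (Id 2 [(0,MulA,0)])))))"
definition "eq_free_compatible = ((VC (e_freeR [] (Cell EpsM) wA) (e_bul (e_freeL wA (Cell Mu) []) idI)), (VC
  (e_freeL wA (Cell Mu) []) (VC (e_bul idA (e_freeR [] (Cell EpsM) wA)) (e_asc wA (bulw wA []) []))))"
definition "eq_eps_mu = ((VC (Cell Eps) (Cell Mu)), (VC (Cell EpsM) (e_bul (Cell Eps) (Cell Eps))))"
definition "eq_trivial_assoc = ((VC counitL (e_bul (Cell Mu) idI)), (VC counitL (VC (e_bul idA counitL) (e_asc wA wA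
  []))))"
definition "eq_eps_eta = ((VC (Cell Eps) (Cell Eta)), (Cell EpsU))"
definition "eq_i_lun = ((VC (Cell EpsM) (e_bul (Cell EpsU) idI)), (e_lun []))"
definition "eq_trivial_unit = ((VC counitL (e_bul (Cell Eta) idI)), (e_lun []))"
definition "eq_trivial_compatible = ((VC (Cell EpsM) (e_bul counitL idI)), (VC counitL (VC (e_bul idA (Cell EpsM))
  (e_asc wA [] []))))"
definition "eq_counit_left_linear = ((VC counitL (e_freeL wA (Cell Mu) [])), (VC counitL (e_bul idA counitL)))"
definition "eq_counit_right_linear = ((VC counitL (e_freeR [] (Cell EpsM) wA)), (VC (Cell EpsM) (e_bul counitL idI)))"
definition "eq_colunI_def = ((Cell CoLunI), (VC (HC (Id 1 [(0,UntA,1),(0,MulA,0)]) (Cell Lun)) (VC (HC (RW (Id 0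
  [(0,UntA,0)]) 1) (HC (Cell EtaM) (RW (Id 1 [(0,Unt,0)]) 1))) (RW (Cell EtaU) 1))))"
definition "eq_unt_zigzag_right = ((VC (HC (Id 0 [(0,UntA,0)]) (Cell EpsU)) (HC (Cell EtaU) (Id 0 [(0,UntA,0)]))),
  (Id 0 [(0,UntA,0)]))"
definition "eq_colun_inv_left = ((VC (Cell CoLunI) (Cell CoLun)), (Id 1 [(0,UntA,1),(0,MulA,0)]))"
definition "eq_unt_zigzag_left = ((VC (HC (Cell EpsU) (Id 1 [(0,Unt,0)])) (HC (Id 1 [(0,Unt,0)]) (Cell EtaU))), (Id
  1 [(0,Unt,0)]))"
definition "eq_colun_inv_right = ((VC (Cell CoLun) (Cell CoLunI)), idI)"
definition "eq_co_kelly_left_r1_2_2 = ((VC (HC (Id 2 [(0,UntA,2)]) (Cell CoAsc)) (HC (RW (Cell CoLunI) 1) (Id 2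
  [(0,MulA,0)]))), (VC (HC (ChiInv 1 [(0,UntA,0)] 1 [(0,MulA,0)]) (Id 2 [(0,MulA,0)])) (HC (Id 2 [(0,MulA,0)]) (Cell
  CoLunI))))"
definition "eq_kelly_left_r0_3_2 = ((VC (HC (Cell Asc) (Id 3 [(0,Unt,2)])) (HC (Id 1 [(0,Mul,0)]) (RW (Cell LunI)
  1))), (VC (HC (Id 1 [(0,Mul,0)]) (Chi 0 [(0,Unt,0)] 2 [(0,Mul,0)])) (HC (Cell LunI) (Id 1 [(0,Mul,0)]))))"
definition "eq_unit_right_linear = ((VC unitL (Cell EpsM)), (VC (e_freeR [] (Cell EpsM) wA) (e_bul unitL idI)))"
definition "eq_counit_unit = ((VC counitL unitL), idI)"
definition "eq_co_kelly_left_r0_2_2 = ((VC (HC (ChiInv 1 [(0,UntA,0)] 1 [(0,MulA,0)]) (Id 2 [(0,MulA,0)])) (HC (Id 2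
  [(0,MulA,0)]) (Cell CoLunI))), (VC (HC (Id 2 [(0,UntA,2)]) (Cell CoAsc)) (HC (RW (Cell CoLunI) 1) (Id 2
  [(0,MulA,0)]))))"
definition "eq_kelly_left_r1_1_2 = ((VC (HC (Id 1 [(0,Mul,0)]) (Chi 0 [(0,Unt,0)] 2 [(0,Mul,0)])) (HC (Cell LunI)
  (Id 1 [(0,Mul,0)]))), (VC (HC (Cell Asc) (Id 3 [(0,Unt,2)])) (HC (Id 1 [(0,Mul,0)]) (RW (Cell LunI) 1))))"
definition "eq_nab_right_linear = ((VC (Cell Nab) (Cell Mu)), (VC (e_freeR wA (Cell Mu) wA) (e_bul (Cell Nab) idA)))"
definition "eq_act_x_assoc = ((VC (Cell (ActL 1)) (e_bul (Cell Mu) (Id 1 wX))), (VC (Cell (ActL 1)) (VC (e_bul idA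
  (Cell (ActL 1))) (e_asc wA wA wX))))"
definition "eq_pentagon_r0_0_3 = ((VC (HC (Cell Asc) (Id 3 [(2,Mul,0)])) (VC (HC (Id 1 [(0,Mul,0)]) (ChiInv 2
  [(0,Mul,0)] 2 [(0,Mul,0)])) (HC (Cell Asc) (Id 3 [(0,Mul,2)])))), (VC (HC (Id 1 [(0,Mul,0)]) (LW 1 (Cell Asc)))
  (VC (HC (Cell Asc) (Id 3 [(1,Mul,1)])) (HC (Id 1 [(0,Mul,0)]) (RW (Cell Asc) 1)))))"
definition "eq_spread_balanced = ((VC e_spread (e_bul (Cell Mu) (Id 1 wX))), (VC e_spread (VC (e_bul idA (Cell (ActL
  1))) (e_asc wA wA wX))))"
definition "eq_split_act = ((VC splitX (Cell (ActL 1))), e_spread)"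
definition "eq_nab_left_linear = ((VC (Cell Nab) (Cell Mu)), (VC (e_freeL wA (Cell Mu) wA) (e_bul idA (Cell Nab))))"
definition "eq_pentagon_r0_4_3 = ((VC (HC (Cell Asc) (Id 3 [(0,Mul,2)])) (VC (HC (Id 1 [(0,Mul,0)]) (RW (Cell AscI)
  1)) (HC (Cell AscI) (Id 3 [(1,Mul,1)])))), (VC (HC (Id 1 [(0,Mul,0)]) (Chi 2 [(0,Mul,0)] 2 [(0,Mul,0)])) (VC (HC
  (Cell AscI) (Id 3 [(2,Mul,0)])) (HC (Id 1 [(0,Mul,0)]) (LW 1 (Cell Asc))))))"
definition "eq_co_pentagon_r1_2_3 = ((VC (HC (ChiInv 1 [(0,MulA,0)] 1 [(0,MulA,0)]) (Id 2 [(0,MulA,0)])) (VC (HC (Id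
  4 [(2,MulA,0)]) (Cell CoAscI)) (HC (LW 1 (Cell CoAsc)) (Id 2 [(0,MulA,0)])))), (VC (HC (Id 4 [(0,MulA,2)]) (Cell
  CoAsc)) (VC (HC (RW (Cell CoAscI) 1) (Id 2 [(0,MulA,0)])) (HC (Id 4 [(1,MulA,1)]) (Cell CoAscI)))))"
definition "eq_spread_left_linear = ((VC e_spread (e_freeL wA (Cell Mu) wX)), (VC (e_freeL wA (Cell Mu) wX) (e_bul
  idA e_spread)))"
definition "eq_corunI_def = ((Cell CoRunI), (VC (HC (Id 1 [(1,UntA,0),(0,MulA,0)]) (Cell Run)) (VC (HC (LW 1 (Id 0
  [(0,UntA,0)])) (HC (Cell EtaM) (LW 1 (Id 1 [(0,Unt,0)])))) (LW 1 (Cell EtaU)))))"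
definition "eq_corun_inv_left = ((VC (Cell CoRunI) (Cell CoRun)), (Id 1 [(1,UntA,0),(0,MulA,0)]))"
definition "eq_triangleI = ((VC (HC (Cell AscI) (Id 3 [(1,Unt,1)])) (HC (Id 1 [(0,Mul,0)]) (LW 1 (Cell LunI)))), (HC
  (Id 1 [(0,Mul,0)]) (RW (Cell RunI) 1)))"
definition "eq_co_triangle = ((VC (HC (LW 1 (Cell CoLun)) (Id 2 [(0,MulA,0)])) (HC (Id 2 [(1,UntA,1)]) (Cell
  CoAsc))), (HC (RW (Cell CoRun) 1) (Id 2 [(0,MulA,0)])))"
definition "eq_co_triangle_r1_1_2 = ((VC (HC (Id 2 [(1,UntA,1)]) (Cell CoAscI)) (HC (LW 1 (Cell CoLunI)) (Id 2
  [(0,MulA,0)]))), (HC (RW (Cell CoRunI) 1) (Id 2 [(0,MulA,0)])))"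
definition "eq_mu_run = ((VC (Cell Mu) (e_bul idA (Cell Eta))), (e_run wA))"
definition "eq_corun_inv_right = ((VC (Cell CoRun) (Cell CoRunI)), idI)"
definition "eq_free_act_split = ((VC (e_freeL wA (Cell Mu) wX) (e_bul idA splitX)), e_spread)"
definition "eq_split_a_linear = ((VC splitX (Cell (ActL 1))), (VC (e_freeL wA (Cell Mu) wX) (e_bul idA splitX)))"
definition "eq_nab_splits = ((VC (Cell Mu) (Cell Nab)), idA)"
definition "eq_act_x_unit = ((VC (Cell (ActL 1)) (e_bul (Cell Eta) (Id 1 wX))), (e_lun wX))"
definition "eq_act_split = ((VC (Cell (ActL 1)) splitX), (Id 1 wX))"
definition "eq_co_pentagon_r1_0_3 = ((VC (HC (LW 1 (Cell CoAsc)) (Id 2 [(0,MulA,0)])) (VC (HC (Id 4 [(1,MulA,1)])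
  (Cell CoAsc)) (HC (RW (Cell CoAsc) 1) (Id 2 [(0,MulA,0)])))), (VC (HC (Id 4 [(2,MulA,0)]) (Cell CoAsc)) (VC (HC
  (Chi 1 [(0,MulA,0)] 1 [(0,MulA,0)]) (Id 2 [(0,MulA,0)])) (HC (Id 4 [(0,MulA,2)]) (Cell CoAsc)))))"
definition "eq_act_x_compatible = ((VC (Cell (ActR 1)) (e_bul (Cell (ActL 1)) idI)), (VC (Cell (ActL 1)) (VC (e_bul
  idA (Cell (ActR 1))) (e_asc wA wX []))))"
definition "eq_split_i_linear = ((VC splitX (Cell (ActR 1))), (VC (VC (e_bul idA (Cell (ActR 1))) (e_asc wA wX []))
  (e_bul splitX idI)))"
definition "eq_act_y_assoc = ((VC (Cell (ActL 2)) (e_bul (Cell Mu) (Id 1 wY))), (VC (Cell (ActL 2)) (VC (e_bul idA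
  (Cell (ActL 2))) (e_asc wA wA wY))))"
definition "eq_retract_a_linear = ((VC retr (Cell (ActL 1))), (VC (Cell (ActL 2)) (e_bul idA retr)))"
definition "eq_h_i_linear = ((VC (Cell (Two 0 1 2)) (Cell (ActR 1))), (VC (Cell (ActR 2)) (e_bul (Cell (Two 0 1 2))
  idI)))"
definition "eq_act_y_compatible = ((VC (Cell (ActR 2)) (e_bul (Cell (ActL 2)) idI)), (VC (Cell (ActL 2)) (VC (e_bul
  idA (Cell (ActR 2))) (e_asc wA wY []))))"
definition "eq_retract_i_linear = ((VC retr (Cell (ActR 1))), (VC (Cell (ActR 2)) (e_bul retr idI)))"
definition "eq_f_a_linear = ((VC (Cell (Two 1 3 1)) (Cell (ActL 3))), (VC (Cell (ActL 1)) (e_bul idA (Cell (Two 1 3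
  1)))))"
definition "eq_g_a_linear = ((VC (Cell (Two 2 2 4)) (Cell (ActL 2))), (VC (Cell (ActL 4)) (e_bul idA (Cell (Two 2 2
  4)))))"
definition "eq_retract_natural = ((VC (Cell (ActL 4)) (VC (e_bul idA (VC (Cell (Two 2 2 4)) (VC (Cell (Two 0 1 2))
  (Cell (Two 1 3 1))))) splitX')), (VC (Cell (Two 2 2 4)) (VC retr (Cell (Two 1 3 1)))))"
definition "eq_h_a_linear = ((VC (Cell (Two 0 1 2)) (Cell (ActL 1))), (VC (Cell (ActL 2)) (e_bul idA (Cell (Two 0 1
  2)))))"
definition "eq_retract_of_linear = (retr, (Cell (Two 0 1 2)))"
definition "eq_theta_a_linear = ((VC (Cell The) counitL), (VC (e_freeL wA (Cell Mu) []) (e_bul idA (Cell The))))"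
definition "eq_eps_l = ((VC (e_cir (Cell Eps) idA) (Cell Del)), idA)"
definition "eq_theta_left_linear = ((VC diagL (e_bul idA thetaA)), (VC thetaA (Cell Mu)))"
definition "eq_muh_def = ((Cell Muh), muh_expr)"
definition "eq_mu_muh = ((Cell Mu), (VC (HC idA (Cell EpsM)) (HC (Cell Muh) (Id 2 [(0,MulA,0)]))))"
definition "eq_can_muh = (can, (HC fusion (Id 2 [(0,MulA,0)])))"
definition "eq_del_coassoc = ((VC (e_cir (Cell Del) idA) (Cell Del)), (VC (e_cir idA (Cell Del)) (Cell Del)))"
definition "eq_mate_eta = ((VC (HC (Cell CoAsc) (Id 1 [(0,Mul,0),(0,Mul,1)])) (VC (HC (Id 3 [(0,MulA,1)]) (HC (Cell
  EtaM) (Id 2 [(0,Mul,1)]))) (RW (Cell EtaM) 1))), (VC (HC (Id 3 [(1,MulA,0),(0,MulA,0)]) (Cell AscI)) (VC (HC (Id 3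
  [(1,MulA,0)]) (HC (Cell EtaM) (Id 2 [(1,Mul,0)]))) (LW 1 (Cell EtaM)))))"
definition "eq_muh_assoc = ((VC (HC idA (Cell Asc)) muh_left), (VC muh_right (HC (Cell Asc) (Id 3 [(0,V 0,2),(1,V
  0,1),(2,V 0,0)]))))"
definition "eq_mult_fusion_inv_first = (e_mult_fusion_inv, e_C1)"
definition "eq_pentagon_shifted = ((VC (HC (Id 1 [(0,Mul,0)]) (LW 1 (Cell AscI))) (HC (Cell Asc) (Id 3
  [(2,Mul,0)]))), (VC (HC (Cell Asc) (Id 3 [(1,Mul,1)])) (VC (HC (Id 1 [(0,Mul,0)]) (RW (Cell Asc) 1)) (VC (HC (Cell
  AscI) (Id 3 [(0,Mul,2)])) (HC (Id 1 [(0,Mul,0)]) (Chi 2 [(0,Mul,0)] 2 [(0,Mul,0)]))))))"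
definition "eq_counit_beta = ((VC (Cell EpsM) (HC (Id 1 [(0,Mul,0)]) e_counit_beta)), (VC (Cell Run) (VC (HC (Id 1
  [(0,Mul,0)]) (HC (LW 1 (Cell EpsM)) (Id 2 [(1,Unt,0)]))) (HC (Cell Asc) (Id 3 [(1,MulA,0),(1,Unt,0)])))))"
definition "eq_counit_slide = (e_Z1, e_Z2)"
definition "eq_mult_fusion_inv_second = (e_C2, e_mult_fusion_inv_phi)"
definition "eq_ax_phi = ((VC (e_bul (e_cir (Cell Mu) (Id 1 [(0,Unt,0),(0,UntA,0)])) idI) (VC (e_phi wA wA) (VC
  (e_cir idA (Cell Sig)) (Cell Del)))), (VC (e_bul (VC (e_cir (Cell Eta) (Id 1 [(0,Unt,0),(0,UntA,0)])) (HC (Id 1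
  [(0,Unt,0)]) (HC (Cell EtaU) (Id 0 [(0,UntA,0)])))) idI) (VC (einv (e_lun [])) (Cell Eps))))"
definition "eq_etac_def = ((Cell Etac), (VC (HC (Id 0 [(0,UntA,0)]) (Cell Eta)) (HC (Cell EtaU) (Id 0
  [(0,UntA,0)]))))"
definition "eq_antipode_phi_transposed = (phi_lhs, phi_rhs)"
definition "eq_alpha_def = (e_alpha, (VC (HC (Id 1 [(0,Mul,0)]) (RW (Cell EpsU) 1)) (HC (Cell LunI) (Id 1
  [(0,UntA,1)]))))"
definition "eq_etac_alpha = (e_etac_alpha, (VC (HC (Id 1 [(0,Mul,0)]) (RW (Cell Eta) 1)) (HC (Cell LunI) (Id 1
  [(0,UntA,1)]))))"
definition "eq_etah_def = ((Cell Etah), (VC (HC (Cell Eta) (Id 1 [(0,Unt,0)])) (HC (Id 1 [(0,Unt,0)]) (Cell EtaU))))"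
definition "eq_eta_etah = ((Cell Eta), (VC (HC idA (Cell EpsU)) (HC (Cell Etah) (Id 0 [(0,UntA,0)]))))"
definition "eq_muh_lun = ((VC (HC idA (Cell Lun)) e_unit_mult), (HC (Cell Lun) idA))"
definition "eq_muh_lun2 = (e_unit_mult, (VC (HC idA (Cell LunI)) (HC (Cell Lun) idA)))"
definition "eq_etac_mult = ((VC (Cell Muh) (HC e_etac_alpha (Id 2 [(1,V 0,0)]))), (VC (HC idA e_alpha) (Chi 1
  [(0,UntA,0)] 1 wA)))"
definition "eq_alpha_asc = ((VC (Cell Asc) (HC (Id 1 [(0,Mul,0)]) (RW e_alpha 1))), (VC (HC e_alpha (Id 2
  [(1,Mul,0)])) (ChiInv 1 [(0,UntA,0)] 2 [(0,Mul,0)])))"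
definition "eq_alpha_asc_inv = ((VC (Cell AscI) (VC (HC e_alpha (Id 2 [(1,Mul,0)])) (ChiInv 1 [(0,UntA,0)] 2
  [(0,Mul,0)]))), (HC (Id 1 [(0,Mul,0)]) (RW e_alpha 1)))"
definition "eq_alpha_colun = ((VC (Cell EpsM) (HC e_alpha (Id 2 [(0,MulA,0)]))), (Cell CoLun))"
definition "eq_alpha_counit = ((VC (HC (Id 1 [(0,Mul,0)]) (RW (Cell EpsM) 1)) (VC (HC (Cell AscI) (Id 3
  [(0,MulA,1)])) (VC (HC e_alpha (Id 2 [(1,Mul,0),(0,MulA,1)])) (VC (HC (ChiInv 1 [(0,UntA,0)] 2 [(0,Mul,0)]) (Id 3
  [(0,MulA,1)])) (HC (Id 1 [(0,Mul,0)]) (RW (Cell CoLunI) 1)))))), (Id 1 [(0,Mul,0)]))"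
definition "eq_mult_fusion_inv_counit = (e_mult_fusion_inv_eta, (HC (Id 1 [(0,V 0,0),(0,Mul,0)]) (RW (Cell Eps) 1)))"
definition "eq_mult_fusion_inv = (e_mult_fusion_inv, (HC (Id 1 [(0,V 0,0),(0,Mul,0)]) (RW (Cell Eps) 1)))"
definition "eq_eps_r = ((VC (e_cir idA (Cell Eps)) (Cell Del)), idA)"
definition "eq_fusion_inv_right = ((VC fusion fusion_inv), (Id 1 [(0,V 0,0),(0,Mul,0),(0,V 0,1)]))"
definition "eq_can_inv_right = ((VC can can_inv), (Id 1 [(0,V 0,0),(0,Mul,0),(0,V 0,1),(0,MulA,0)]))"
definition "eq_del_mu = ((VC (Cell Del) (Cell Mu)), (VC (e_cir (Cell Mu) (Cell Mu)) (VC (e_xi wA wA wA wA) (e_bul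
  (Cell Del) (Cell Del)))))"
definition "eq_can_left_linear = ((VC can (e_freeL wA (Cell Mu) wA)), (VC diagL (e_bul idA can)))"
definition "eq_antipode_cancel_regroup = (e_antipode_cancel, e_antipode_cancel_psi)"
definition "eq_ax_psi = ((VC (e_bul idI (e_cir (Id 1 [(0,Unt,0),(0,UntA,0)]) (Cell Mu))) (VC (e_psi wA wA) (VC
  (e_cir (Cell Sig) idA) (Cell Del)))), (VC (e_bul idI (VC (e_cir (Id 1 [(0,Unt,0),(0,UntA,0)]) (Cell Eta)) (HC (Id
  1 [(0,Unt,0)]) (HC (Cell EtaU) (Id 0 [(0,UntA,0)]))))) (VC (einv (e_run [])) (Cell Eps))))"
definition "eq_antipode_psi_transposed = (psi_lhs, psi_rhs)"
definition "eq_antipode_cancel_counit = ((VC e_finish (HC (Id 1 [(0,Mul,0)]) (HC (RW psi_rhs 1) (Id 2 [(1,V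
  0,0)])))), (HC (Id 1 [(0,Mul,0)]) (HC (RW (Cell Eps) 1) (Id 2 [(1,V 0,0)]))))"
definition "eq_antipode_cancel = (e_antipode_cancel, (HC (Id 1 [(0,Mul,0)]) (HC (RW (Cell Eps) 1) (Id 2 [(1,V
  0,0)]))))"
definition "eq_fusion_inv_left = ((VC fusion_inv fusion), (Id 1 [(0,Mul,0),(0,V 0,1),(1,V 0,0)]))"
definition "eq_can_inv_left = ((VC can_inv can), (Id 1 (bulw wA wA)))"
definition "eq_section_left_linear = ((VC nabla (Cell Mu)), (VC (e_freeL wA (Cell Mu) wA) (e_bul idA nabla)))"
definition "eq_theta_i_linear = ((VC (Cell The) (Cell EpsM)), (VC (e_freeR [] (Cell EpsM) wA) (e_bul (Cell The)
  idI)))"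
definition "eq_theta_right_linear = ((VC diagR (e_bul thetaA idA)), (VC thetaA (Cell Mu)))"
definition "eq_can_right_linear = ((VC can (e_freeR wA (Cell Mu) wA)), (VC diagR (e_bul can idA)))"
definition "eq_section_right_linear = ((VC nabla (Cell Mu)), (VC (e_freeR wA (Cell Mu) wA) (e_bul nabla idA)))"
definition "eq_counit_can = ((VC (e_cir counitL idA) can), (Cell Mu))"
definition "eq_theta_normalized = ((VC (Cell EpsM) (VC (e_bul (Cell Eps) idI) (Cell The))), idI)"
definition "eq_section_splits = ((VC (Cell Mu) nabla), idA)"

section \<open>Inverse laws of the coherence isomorphisms of \<bullet>\<close>

definition "eq_inv1_aai = ((VC (einv (e_asc wA wA [])) (e_asc wA wA [])), (Id 1 [(0,Mul,0),(0,Mul,1),(0,V 0,2),(1,V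
  0,1),(0,MulA,1),(0,MulA,0)]))"
definition "eq_inv2_aai = ((VC (e_asc wA wA []) (einv (e_asc wA wA []))), (Id 1 [(0,Mul,0),(0,V 0,1),(1,Mul,0),(1,V
  0,1),(1,MulA,0),(0,MulA,0)]))"
definition "eq_inv1_aax = ((VC (einv (e_asc wA wA wX)) (e_asc wA wA wX)), (Id 1 [(0,Mul,0),(0,Mul,1),(0,V 0,2),(1,V
  0,1),(0,MulA,1),(1,V 1,0),(0,MulA,0)]))"
definition "eq_inv2_aax = ((VC (e_asc wA wA wX) (einv (e_asc wA wA wX))), (Id 1 [(0,Mul,0),(0,V 0,1),(1,Mul,0),(1,V
  0,1),(2,V 1,0),(1,MulA,0),(0,MulA,0)]))"
definition "eq_inv1_aaa = ((VC (einv (e_asc wA wA wA)) (e_asc wA wA wA)), (Id 1 [(0,Mul,0),(0,Mul,1),(0,V 0,2),(1,V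
  0,1),(0,MulA,1),(1,V 0,0),(0,MulA,0)]))"
definition "eq_inv2_aaa = ((VC (e_asc wA wA wA) (einv (e_asc wA wA wA))), (Id 1 [(0,Mul,0),(0,V 0,1),(1,Mul,0),(1,V
  0,1),(2,V 0,0),(1,MulA,0),(0,MulA,0)]))"
definition "eq_inv1_iia = ((VC (einv (e_asc [] [] wA)) (e_asc [] [] wA)), (Id 1 [(0,Mul,0),(0,Mul,1),(0,MulA,1),(1,V
  0,0),(0,MulA,0)]))"
definition "eq_inv2_iia = ((VC (e_asc [] [] wA) (einv (e_asc [] [] wA))), (Id 1 [(0,Mul,0),(1,Mul,0),(2,V
  0,0),(1,MulA,0),(0,MulA,0)]))"
definition "eq_inv1_lx = ((VC (einv (e_lun wX)) (e_lun wX)), (Id 1 [(0,Mul,0),(0,Unt,1),(0,UntA,1),(1,V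
  1,0),(0,MulA,0)]))"
definition "eq_inv2_lx = ((VC (e_lun wX) (einv (e_lun wX))), (Id 1 wX))"
definition "eq_inv1_lx3 = ((VC (einv (e_lun wX')) (e_lun wX')), (Id 1 [(0,Mul,0),(0,Unt,1),(0,UntA,1),(1,V
  3,0),(0,MulA,0)]))"
definition "eq_inv2_lx3 = ((VC (e_lun wX') (einv (e_lun wX'))), (Id 1 wX'))"
definition "eq_inv1_li = ((VC (einv (e_lun [])) (e_lun [])), (Id 1 [(0,Mul,0),(0,Unt,1),(0,UntA,1),(0,MulA,0)]))"
definition "eq_inv2_li = ((VC (e_lun []) (einv (e_lun []))), idI)"
definition "eq_inv1_ri = ((VC (einv (e_run [])) (e_run [])), (Id 1 [(0,Mul,0),(1,Unt,0),(1,UntA,0),(0,MulA,0)]))"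
definition "eq_inv2_ri = ((VC (e_run []) (einv (e_run []))), idI)"
definition "eq_inv1_rx = ((VC (einv (e_run wX)) (e_run wX)), (Id 1 [(0,Mul,0),(0,V
  1,1),(1,Unt,0),(1,UntA,0),(0,MulA,0)]))"
definition "eq_inv2_rx = ((VC (e_run wX) (einv (e_run wX))), (Id 1 wX))"
definition "eq_inv1_rx3 = ((VC (einv (e_run wX')) (e_run wX')), (Id 1 [(0,Mul,0),(0,V
  3,1),(1,Unt,0),(1,UntA,0),(0,MulA,0)]))"
definition "eq_inv2_rx3 = ((VC (e_run wX') (einv (e_run wX'))), (Id 1 wX'))"
definition "eq_inv1_xaa = ((VC (einv (e_asc wX wA wA)) (e_asc wX wA wA)), (Id 1 [(0,Mul,0),(0,Mul,1),(0,V 1,2),(1,V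
  0,1),(0,MulA,1),(1,V 0,0),(0,MulA,0)]))"
definition "eq_inv2_xaa = ((VC (e_asc wX wA wA) (einv (e_asc wX wA wA))), (Id 1 [(0,Mul,0),(0,V 1,1),(1,Mul,0),(1,V
  0,1),(2,V 0,0),(1,MulA,0),(0,MulA,0)]))"
definition "eq_inv1_iaa = ((VC (einv (e_asc [] wA wA)) (e_asc [] wA wA)), (Id 1 [(0,Mul,0),(0,Mul,1),(1,V
  0,1),(0,MulA,1),(1,V 0,0),(0,MulA,0)]))"
definition "eq_inv2_iaa = ((VC (e_asc [] wA wA) (einv (e_asc [] wA wA))), (Id 1 [(0,Mul,0),(1,Mul,0),(1,V 0,1),(2,V
  0,0),(1,MulA,0),(0,MulA,0)]))"

section \<open>Axioms for right actions of a and right integrals\<close>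

definition "eq_ract_x_assoc = ((VC (Cell (ActRA 1)) (e_bul (Cell (ActRA 1)) idA)), (VC (Cell (ActRA 1)) (VC (e_bul
  (Id 1 wX) (Cell Mu)) (e_asc wX wA wA))))"
definition "eq_ract_x_unit = ((VC (Cell (ActRA 1)) (e_bul (Id 1 wX) (Cell Eta))), (e_run wX))"
definition "eq_ract_y_assoc = ((VC (Cell (ActRA 2)) (e_bul (Cell (ActRA 2)) idA)), (VC (Cell (ActRA 2)) (VC (e_bul
  (Id 1 wY) (Cell Mu)) (e_asc wY wA wA))))"
definition "eq_ract_x_compatible = ((VC (Cell (ActRA 1)) (e_bul (Cell (ActLI 1)) idA)), (VC (Cell (ActLI 1)) (VC
  (e_bul idI (Cell (ActRA 1))) (e_asc [] wX wA))))"
definition "eq_ract_y_compatible = ((VC (Cell (ActRA 2)) (e_bul (Cell (ActLI 2)) idA)), (VC (Cell (ActLI 2)) (VC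
  (e_bul idI (Cell (ActRA 2))) (e_asc [] wY wA))))"
definition "eq_h_ra_linear = ((VC (Cell (Two 0 1 2)) (Cell (ActRA 1))), (VC (Cell (ActRA 2)) (e_bul (Cell (Two 0 1
  2)) idA)))"
definition "eq_h_ri_linear = ((VC (Cell (Two 0 1 2)) (Cell (ActLI 1))), (VC (Cell (ActLI 2)) (e_bul idI (Cell (Two 0
  1 2)))))"
definition "eq_f_ra_linear = ((VC (Cell (Two 1 3 1)) (Cell (ActRA 3))), (VC (Cell (ActRA 1)) (e_bul (Cell (Two 1 3
  1)) idA)))"
definition "eq_g_ra_linear = ((VC (Cell (Two 2 2 4)) (Cell (ActRA 2))), (VC (Cell (ActRA 4)) (e_bul (Cell (Two 2 2
  4)) idA)))"
definition "eq_rtheta_a_linear = ((VC (Cell TheR) counitR), (VC (e_freeR wA (Cell Mu) []) (e_bul (Cell TheR) idA)))"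
definition "eq_rtheta_i_linear = ((VC (Cell TheR) (Cell EpsM)), (VC (e_freeL [] (Cell EpsM) wA) (e_bul idI (Cell
  TheR))))"
definition "eq_rtheta_normalized = ((VC (Cell EpsM) (VC (e_bul idI (Cell Eps)) (Cell TheR))), idI)"

section \<open>Consequences of the axioms of a map monoidale\<close>

locale monoidale_diagrams = diagrams +
  assumes good_struct: "good_gens struct_gens"
    and asc_inv_right: "valid eq_asc_inv_right"
    and asc_inv_left: "valid eq_asc_inv_left"
    and pentagon: "valid eq_pentagon"
    and coasc_def: "valid eq_coasc_def"
    and coascI_def: "valid eq_coascI_def"
    and mul_zigzag_left: "valid eq_mul_zigzag_left"
    and mul_zigzag_right: "valid eq_mul_zigzag_right"
    and lun_inv_right: "valid eq_lun_inv_right"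
    and triangle: "valid eq_triangle"
    and colun_def: "valid eq_colun_def"
    and lun_inv_left: "valid eq_lun_inv_left"
    and run_inv_left: "valid eq_run_inv_left"
    and corun_def: "valid eq_corun_def"
    and run_inv_right: "valid eq_run_inv_right"
    and colunI_def: "valid eq_colunI_def"
    and unt_zigzag_right: "valid eq_unt_zigzag_right"
    and unt_zigzag_left: "valid eq_unt_zigzag_left"
    and corunI_def: "valid eq_corunI_def"
begin

lemma pentagonI: "valid eq_pentagonI"
  by (rule certified[where L = "struct_gens" and R = "[eq_asc_inv_right, eq_pentagon, eq_asc_inv_left]" and
    ss = "[RB (U 0) 0 1 1 0, RB (U 0) 1 0 0 0, RB (U 0) 2 1 0 1, RB (U 1) 3 0 0 0, RF (U 2) 5 0 0 0,
    RF (CY Mul 0 Mul) 4 1 0 0, RF (U 2) 3 0 0 0]"])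
    (simp only: good_struct simp_thms, simp add: asc_inv_right pentagon asc_inv_left, code_simp)

lemma pentagon_r0_2_3: "valid eq_pentagon_r0_2_3"
  by (rule certified[where L = "struct_gens" and R = "[eq_asc_inv_right, eq_asc_inv_left, eq_pentagonI]" and
    ss = "[RB (U 0) 3 1 0 1, RB (U 1) 4 0 0 0, RB (CY Mul 0 Mul) 5 1 0 0, RB (U 2) 1 0 0 0,
    RF (U 1) 0 0 0 0, RF (U 0) 1 0 0 0, RF (CX Mul 0 Mul) 0 1 0 0]"])
    (simp only: good_struct simp_thms, simp add: asc_inv_right asc_inv_left pentagonI, code_simp)

text \<open>Mates of mutually inverse 2-cells are mutually inverse: the zigzag identities remove the
  intermediate units and counits and leave \<open>Asc\<close> against \<open>AscI\<close>.\<close>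

lemma coasc_inv_left: "valid eq_coasc_inv_left"
  by (rule certified[where L = "struct_gens" and R = "[eq_coasc_def, eq_coascI_def, eq_mul_zigzag_left, eq_asc_inv_left, eq_mul_zigzag_right]" and
    ss = "[RF (U 0) 0 0 0 0, RF (U 1) 5 0 0 0, SL 4, SL 5, SL 6, SL 7, SL 8, SL 3, SL 4, SL 5, SL 6, SL 7,
    SL 2, SL 3, SL 4, SL 5, SL 6, SL 1, SL 2, SL 3, SL 4, SL 0, SL 1, SL 2, RF (U 2) 3 3 1 0,
    RF (U 2) 3 2 0 0, RF (U 3) 2 2 0 0, SR 1, RF (U 4) 0 0 0 1, RF (U 4) 0 1 0 0]"])
        (simp only: good_struct simp_thms, simp add: coasc_def coascI_def mul_zigzag_left asc_inv_left
      mul_zigzag_right, code_simp)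

lemma coasc_inv_right: "valid eq_coasc_inv_right"
  by (rule certified[where L = "struct_gens" and R = "[eq_coasc_def, eq_coascI_def, eq_mul_zigzag_left, eq_asc_inv_right, eq_mul_zigzag_right]" and
    ss = "[RF (U 0) 1 0 0 0, RF (U 1) 0 0 0 0, SL 4, SL 5, SL 6, SL 7, SL 8, SL 3, SL 4, SL 5, SL 6, SL 7,
    SL 2, SL 3, SL 4, SL 5, SL 6, SL 1, SL 2, SL 3, SL 4, SL 0, SL 1, SL 2, RF (U 2) 3 3 0 1,
    RF (U 2) 3 2 0 0, RF (U 3) 2 2 0 0, SR 1, RF (U 4) 0 0 1 0, RF (U 4) 0 1 0 0]"])
        (simp only: good_struct simp_thms, simp add: coasc_def coascI_def mul_zigzag_left asc_inv_right
      mul_zigzag_right, code_simp)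

text \<open>The mate of the pentagon. Expanding \<open>CoAsc\<close> and cancelling the inner units
  and counits brings all associators to the m side, where \<open>pentagonI\<close> applies; then
  \<open>CoAsc\<close> is folded back.\<close>

lemma co_pentagon: "valid eq_co_pentagon"
  by (rule certified[where L = "struct_gens" and R = "[eq_coasc_def, eq_mul_zigzag_left, eq_pentagonI]" and
    ss = "[RF (U 0) 0 1 0 0, SL 4, SL 5, SL 3, SL 4, SL 2, SL 3, SL 1, RF (U 0) 3 1 0 0, SL 2, SL 3, SL 4,
    SL 5, RF (U 1) 6 3 0 0, RB (NLi (G EtaM) 0 MulA) 0 0 0 0, RF (CY MulA 0 MulA) 2 0 0 0,
    RF (NR (G EpsM) 0 Mul) 5 4 0 0, SL 1, SL 2, SL 3, RF (CY MulA 0 Mul) 4 5 0 0, SL 5,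
    RF (U 2) 3 3 0 0, SR 2, RB (U 1) 3 2 1 0, RB (U 1) 3 3 1 1, SR 2, SR 1, SR 0, SR 4, SR 3, SR 2,
    SR 1, RB (U 0) 2 0 1 0, RB (U 1) 5 4 0 1, SR 2, SR 3, SR 4, SR 5, SR 6, SR 7, SR 8, SR 9, SR 3,
    SR 5, SR 6, SR 7, SR 2, SR 4, SR 5, SR 6, SR 1, SR 3, SR 4, SR 5, SR 2, SR 3, SR 4,
    RB (U 0) 5 1 0 0, RB (U 0) 0 0 0 1]"])
    (simp only: good_struct simp_thms, simp add: coasc_def mul_zigzag_left pentagonI, code_simp)

lemma co_pentagonI: "valid eq_co_pentagonI"
  by (rule certified[where L = "struct_gens" and R = "[eq_coasc_inv_right, eq_co_pentagon, eq_coasc_inv_left]" and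
    ss = "[RB (U 0) 0 0 1 0, RB (U 0) 1 1 0 0, RB (U 0) 2 0 0 1, RB (U 1) 3 0 0 0, RF (U 2) 5 1 0 0,
    RF (CX MulA 0 MulA) 4 0 0 0, RF (U 2) 3 1 0 0]"])
    (simp only: good_struct simp_thms, simp add: coasc_inv_right co_pentagon coasc_inv_left, code_simp)

lemma co_pentagon_r0_1_3: "valid eq_co_pentagon_r0_1_3"
  by (rule certified[where L = "struct_gens" and R = "[eq_coasc_inv_right, eq_coasc_inv_left, eq_co_pentagonI]" and
    ss = "[RB (U 0) 3 1 0 0, RB (U 0) 4 0 0 1, RB (U 1) 5 1 0 0, RB (U 2) 2 0 0 0, RF (U 1) 1 1 0 0,
    RF (CX MulA 0 MulA) 0 0 0 0, RF (U 0) 0 1 0 0]"])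
    (simp only: good_struct simp_thms, simp add: coasc_inv_right coasc_inv_left co_pentagonI, code_simp)

text \<open>Pentagon and triangle yield the unit law only after whiskering by m \<cdot> (1 \<otimes>
  -) and precomposing with associators. \<open>kelly_left_cancelled\<close> removes the associators,
  and \<open>kelly_left\<close> removes the whiskering by substituting u for the free argument,
  since \<l> makes m \<cdot> (u \<otimes> -) isomorphic to the identity. The right unit law is
  obtained in the same way with sides exchanged.\<close>

lemma kelly_left_whiskered: "valid eq_kelly_left_whiskered"
  by (rule certified[where L = "struct_gens" and R = "[eq_pentagon, eq_triangle]" and
    ss = "[RB (U 0) 0 0 0 0, SR 2, RF (U 1) 3 0 0 0, RF (NR (G Run) 0 Mul) 3 1 0 0,
    RF (CY Unt 0 Mul) 2 2 1 0, RF (CY Mul 0 Mul) 1 1 0 0, SR 0, RB (U 1) 0 1 0 1, SL 1]"])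
    (simp only: good_struct simp_thms, simp add: pentagon triangle, code_simp)

lemma kelly_left_cancelled: "valid eq_kelly_left_cancelled"
  by (rule certified[where L = "struct_gens" and R = "[eq_asc_inv_right, eq_kelly_left_whiskered]" and
    ss = "[RB (U 0) 0 0 0 0, RB (U 0) 1 1 0 1, RF (U 1) 2 0 0 0, RF (U 0) 1 1 0 1, RF (U 0) 0 0 0 0]"])
    (simp only: good_struct simp_thms, simp add: asc_inv_right kelly_left_whiskered, code_simp)

lemma kelly_left: "valid eq_kelly_left"
  by (rule certified[where L = "struct_gens" and R = "[eq_lun_inv_right, eq_kelly_left_cancelled]" and
    ss = "[RB (U 0) 3 0 0 0, SL 2, SL 1, RF (NL (G Lun) 0 Unt) 3 1 0 0, SL 0, SL 2,
    RB (CX Unt 1 Mul) 3 2 0 0, RF (NL (G Asc) 0 Unt) 1 1 0 0, RB (CX Unt 0 Mul) 8 1 0 0, SR 7,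
    RF (NL (ChI Unt 0 Mul) 0 Unt) 5 2 0 0, RF (CY Unt 1 Mul) 4 2 0 0, SR 3, RF (U 1) 4 0 0 0,
    RB (NL (G Lun) 0 Unt) 2 2 0 1, SR 1, RF (CX Unt 0 Mul) 2 1 0 0, SR 0, RF (U 0) 1 0 0 0]"])
    (simp only: good_struct simp_thms, simp add: lun_inv_right kelly_left_cancelled, code_simp)

text \<open>The equation that characterizes a mate by its effect on counits; two zigzag identities
  prove it. \<open>mate_eta\<close> is the corresponding equation for units.\<close>

lemma mate_eps: "valid eq_mate_eps"
  by (rule certified[where L = "struct_gens" and R = "[eq_coascI_def, eq_mul_zigzag_left]" and
    ss = "[RF (U 0) 0 2 0 0, SL 4, SL 5, SL 3, SL 4, SL 2, SL 3, SL 1, RF (U 1) 0 1 0 1, RF (U 1) 0 0 0 0]"])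
    (simp only: good_struct simp_thms, simp add: coascI_def mul_zigzag_left, code_simp)

lemma kelly_left_inv: "valid eq_kelly_left_inv"
  by (rule certified[where L = "struct_gens" and R = "[eq_lun_inv_left, eq_kelly_left, eq_lun_inv_right]" and
    ss = "[RB (CY Unt 0 Mul) 2 1 0 0, RB (U 0) 3 0 0 0, RF (U 1) 1 0 0 0, RF (U 2) 0 1 0 1]"])
    (simp only: good_struct simp_thms, simp add: lun_inv_left kelly_left lun_inv_right, code_simp)

text \<open>The mate of \<open>kelly_left_inv\<close>: \<open>mate_eps\<close> trades the
  coassociator for the associator, and naturality of the interchanger carries the counit of u past
  m.\<close>

lemma co_kelly_left: "valid eq_co_kelly_left"
  by (rule certified[where L = "struct_gens" and R = "[eq_coascI_def, eq_mate_eps, eq_mul_zigzag_right, eq_colun_def, eq_kelly_left_inv]" and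
    ss = "[RF (U 0) 0 1 0 0, SL 4, SL 3, SL 2, SL 1, RB (U 1) 3 1 0 0, SR 2, SR 3, SR 1, SR 2, SR 0,
    RF (U 2) 1 1 0 1, SL 1, SL 0, RF (U 3) 2 2 0 1, SL 1, SL 2, RF (U 1) 3 1 0 0, SL 2,
    RF (U 4) 1 1 0 0, RF (NRi (G EpsU) 0 Mul) 3 2 0 0, RF (CX Unt 0 Mul) 2 2 0 0, SR 1, SR 3, SR 2,
    RB (U 3) 3 1 0 0, RB (NL (G EtaM) 0 UntA) 0 0 0 0, RF (CX UntA 0 Mul) 2 1 0 0, SR 1,
    RF (U 2) 0 1 1 0]"])
        (simp only: good_struct simp_thms, simp add: coascI_def mate_eps mul_zigzag_right colun_def
      kelly_left_inv, code_simp)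

text \<open>The multiplication of \<i> is the counit of m, so its associativity is exactly
  \<open>mate_eps\<close>.\<close>

lemma i_assoc: "valid eq_i_assoc"
  by (rule certified[where L = "struct_gens" and R = "[eq_coasc_inv_left, eq_mate_eps]" and
    ss = "[RB (U 0) 0 2 0 0, RF (U 1) 1 0 0 0]"])
    (simp only: good_struct simp_thms, simp add: coasc_inv_left mate_eps, code_simp)

lemma pentagon_r1_0_3: "valid eq_pentagon_r1_0_3"
  by (rule certified[where L = "struct_gens" and R = "[eq_asc_inv_right, eq_pentagon, eq_asc_inv_left]" and
    ss = "[RB (U 0) 3 0 0 0, RB (CX Mul 0 Mul) 4 1 0 0, RB (U 0) 5 0 0 0, RB (U 1) 0 0 0 0,
    RF (U 2) 2 0 0 0, RF (CY Mul 0 Mul) 1 1 0 0, RF (U 2) 0 0 0 0]"])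
    (simp only: good_struct simp_thms, simp add: asc_inv_right pentagon asc_inv_left, code_simp)

lemma co_pentagon_r0_0_3: "valid eq_co_pentagon_r0_0_3"
  by (rule certified[where L = "struct_gens" and R = "[eq_coasc_inv_right, eq_co_pentagon, eq_coasc_inv_left]" and
    ss = "[RB (U 0) 3 0 1 0, RB (U 0) 4 1 0 0, RB (U 0) 5 0 0 1, RF (U 1) 0 0 0 0, RF (U 2) 2 0 1 0,
    RF (U 2) 1 1 0 0, RF (U 2) 0 0 0 1]"])
    (simp only: good_struct simp_thms, simp add: coasc_inv_right co_pentagon coasc_inv_left, code_simp)

lemma free_right_assoc: "valid eq_free_right_assoc"
  by (rule certified[where L = "struct_gens" and R = "[eq_i_assoc, eq_pentagon_r1_0_3, eq_co_pentagon_r0_0_3]" and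
    ss = "[SL 0, SL 1, SR 3, SL 4, SL 5, SL 3, SL 4, SL 2, SL 3, SL 1, RF (U 0) 6 2 1 0, SL 6, SL 5, SL 4,
    RB (NLi (G Asc) 0 (V 0)) 2 1 0 0, RF (U 1) 0 0 0 0, RB (U 2) 5 4 0 0, SL 7,
    RB (CY MulA 0 Mul) 6 3 0 0, SL 5, RB (NL (G EpsM) 0 MulA) 7 3 0 0, SR 2, SR 4, SR 5, SR 6, SR 7,
    SR 3, SR 4, SR 5, SR 6, SR 3, SR 2, SR 1, SR 0]"])
    (simp only: good_struct simp_thms, simp add: i_assoc pentagon_r1_0_3 co_pentagon_r0_0_3, code_simp)

lemma i_run: "valid eq_i_run"
  by (rule certified[where L = "struct_gens" and R = "[eq_run_inv_left, eq_corun_def]" and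
    ss = "[RB (U 0) 0 0 0 0, RB (U 1) 1 0 0 0, SR 0]"])
    (simp only: good_struct simp_thms, simp add: run_inv_left corun_def, code_simp)

lemma triangle_r1_0_1: "valid eq_triangle_r1_0_1"
  by (rule certified[where L = "struct_gens" and R = "[eq_lun_inv_right, eq_asc_inv_right, eq_triangle, eq_lun_inv_left, eq_asc_inv_left]" and
    ss = "[RB (U 0) 1 1 1 0, RB (U 1) 2 0 0 0, RB (U 2) 0 0 0 0, RF (U 3) 1 1 1 0, RF (U 4) 0 0 0 0]"])
        (simp only: good_struct simp_thms, simp add: lun_inv_right asc_inv_right triangle lun_inv_left
      asc_inv_left, code_simp)

lemma kelly_right_whiskered: "valid eq_kelly_right_whiskered"
  by (rule certified[where L = "struct_gens" and R = "[eq_triangle_r1_0_1, eq_pentagon_r1_0_3]" and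
    ss = "[SL 1, RF (U 0) 2 1 1 0, RF (U 1) 0 0 0 0, SR 2, RB (CX Mul 0 Unt) 1 2 0 1,
    RB (NLi (G Lun) 0 Mul) 2 1 0 0, SR 0, RB (U 0) 1 0 0 0]"])
    (simp only: good_struct simp_thms, simp add: triangle_r1_0_1 pentagon_r1_0_3, code_simp)

lemma kelly_right_cancelled: "valid eq_kelly_right_cancelled"
  by (rule certified[where L = "struct_gens" and R = "[eq_asc_inv_left, eq_kelly_right_whiskered]" and
    ss = "[RB (U 0) 2 0 0 0, RF (U 1) 0 0 0 0, RF (U 0) 2 0 0 0]"])
    (simp only: good_struct simp_thms, simp add: asc_inv_left kelly_right_whiskered, code_simp)

lemma kelly_right: "valid eq_kelly_right"
  by (rule certified[where L = "struct_gens" and R = "[eq_run_inv_right, eq_kelly_right_cancelled]" and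
    ss = "[RB (U 0) 1 0 0 0, SL 0, RB (CY Mul 0 Unt) 1 1 0 0, RB (CY Mul 1 Unt) 2 2 0 0,
    RB (NR (G Asc) 0 Unt) 3 1 0 0, SR 6, SR 5, RB (CY Unt 0 Unt) 4 3 2 0,
    RB (NR (G Run) 0 Unt) 5 2 1 0, SR 3, RF (U 1) 4 0 0 0, SR 5, RB (CX Unt 0 Unt) 6 2 1 0,
    RF (NR (Ch Mul 0 Unt) 0 Unt) 4 2 0 0, RF (CY Unt 0 Unt) 3 3 2 0, RF (CY Mul 1 Unt) 2 2 0 0,
    RF (NR (G Run) 0 Unt) 4 1 0 0, RF (CY Unt 0 Unt) 3 2 1 0, SR 1, RF (CY Mul 0 Unt) 2 1 0 0, SR 0,
    SR 1, RF (U 0) 2 0 0 0]"])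
    (simp only: good_struct simp_thms, simp add: run_inv_right kelly_right_cancelled, code_simp)

lemma kelly_right_inv: "valid eq_kelly_right_inv"
  by (rule certified[where L = "struct_gens" and R = "[eq_run_inv_left, eq_kelly_right, eq_asc_inv_right, eq_run_inv_right]" and
    ss = "[RB (CX Mul 0 Unt) 2 1 0 0, RB (U 0) 3 0 0 0, RB (U 1) 2 0 0 0, RF (U 2) 1 0 0 0,
    RF (U 3) 0 1 1 0]"])
    (simp only: good_struct simp_thms, simp add: run_inv_left kelly_right asc_inv_right run_inv_right, code_simp)

text \<open>The unit law on the other side, again as a mate. Here \<open>CoAsc\<close> occurs
  instead of \<open>CoAscI\<close>, so its definition is expanded directly.\<close>

lemma co_kelly_right: "valid eq_co_kelly_right"
  by (rule certified[where L = "struct_gens" and R = "[eq_corun_def, eq_coasc_def, eq_mul_zigzag_left, eq_kelly_right_inv, eq_mul_zigzag_right]" and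
    ss = "[RF (U 0) 1 0 1 0, SL 0, SL 1, RF (U 1) 2 1 0 0, SL 6, SL 5, SL 4, SL 3, RF (U 2) 2 0 1 0, SL 1,
    SL 2, SL 0, RF (U 3) 1 1 0 0, RF (NL (G EpsU) 0 Mul) 3 2 0 0, RF (CY Mul 0 Unt) 2 2 0 0, SR 1,
    SR 3, SR 2, RB (U 0) 3 1 0 0, RB (NRi (G EtaM) 0 UntA) 0 0 0 0, RF (CY Mul 0 UntA) 2 1 0 0, SR 1,
    RF (U 4) 0 1 0 1]"])
        (simp only: good_struct simp_thms, simp add: corun_def coasc_def mul_zigzag_left kelly_right_inv
      mul_zigzag_right, code_simp)

lemma free_right_unit: "valid eq_free_right_unit"
  by (rule certified[where L = "struct_gens" and R = "[eq_i_run, eq_co_kelly_right, eq_kelly_right]" and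
    ss = "[SL 1, SL 2, SL 0, SL 1, RF (NL (G EpsU) 0 MulA) 2 3 0 0, SR 1, SR 2, SR 4, SR 0, SR 1, SR 3,
    SR 2, RF (U 0) 5 2 1 0, SL 2, SL 3, SL 5, SL 1, SL 2, SL 4, SL 0, SL 1, SL 3, RF (U 1) 5 2 0 0,
    RF (CX MulA 0 UntA) 4 2 0 0, RF (NL (G Run) 0 (V 0)) 3 1 0 0, SR 1, RF (CY (V 0) 0 Mul) 2 1 0 0,
    SR 0, SR 1, RF (U 2) 2 0 0 0, SR 3]"])
    (simp only: good_struct simp_thms, simp add: i_run co_kelly_right kelly_right, code_simp)

lemma pentagon_r0_5_3: "valid eq_pentagon_r0_5_3"
  by (rule certified[where L = "struct_gens" and R = "[eq_asc_inv_left, eq_asc_inv_right, eq_pentagon]" and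
    ss = "[RB (U 0) 3 0 0 0, RB (U 1) 4 1 1 0, RB (U 1) 5 0 0 0, RF (U 2) 1 0 0 0, RF (U 1) 0 1 0 1,
    RF (U 0) 1 1 1 0, RF (U 0) 0 0 0 0]"])
    (simp only: good_struct simp_thms, simp add: asc_inv_left asc_inv_right pentagon, code_simp)

lemma co_pentagon_r1_1_3: "valid eq_co_pentagon_r1_1_3"
  by (rule certified[where L = "struct_gens" and R = "[eq_coasc_inv_right, eq_coasc_inv_left, eq_co_pentagonI]" and
    ss = "[RB (CY MulA 0 MulA) 3 0 0 0, RB (U 0) 4 1 0 0, RB (U 1) 5 0 0 1, RF (U 2) 2 0 0 0,
    RF (U 1) 1 0 1 0, RF (U 1) 0 1 0 0, RF (U 0) 0 0 0 1]"])
    (simp only: good_struct simp_thms, simp add: coasc_inv_right coasc_inv_left co_pentagonI, code_simp)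

lemma i_lun: "valid eq_i_lun"
  by (rule certified[where L = "struct_gens" and R = "[eq_lun_inv_left, eq_colun_def]" and
    ss = "[RB (U 0) 0 0 0 0, RB (U 1) 1 0 0 0, SR 0]"])
    (simp only: good_struct simp_thms, simp add: lun_inv_left colun_def, code_simp)

lemma colun_inv_left: "valid eq_colun_inv_left"
  by (rule certified[where L = "struct_gens" and R = "[eq_colun_def, eq_colunI_def, eq_lun_inv_left, eq_mul_zigzag_right, eq_unt_zigzag_right]" and
    ss = "[RF (U 0) 0 0 0 0, RF (U 1) 3 0 0 0, SL 2, SL 1, SL 0, SL 3, SL 2, SL 1, SL 4, SL 3, SL 2,
    RF (U 2) 2 2 0 0, SR 1, RF (U 3) 2 1 0 0, RF (U 4) 0 0 0 1]"])
        (simp only: good_struct simp_thms, simp add: colun_def colunI_def lun_inv_left mul_zigzag_right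
      unt_zigzag_right, code_simp)

lemma colun_inv_right: "valid eq_colun_inv_right"
  by (rule certified[where L = "struct_gens" and R = "[eq_colun_def, eq_colunI_def, eq_mul_zigzag_left, eq_unt_zigzag_left, eq_lun_inv_right]" and
    ss = "[RF (U 0) 1 0 0 0, RF (U 1) 0 0 0 0, SL 2, SL 3, SL 4, SL 1, SL 2, RF (U 2) 3 0 0 0, SL 0,
    RF (U 3) 1 1 0 1, RF (U 4) 0 0 0 0]"])
        (simp only: good_struct simp_thms, simp add: colun_def colunI_def mul_zigzag_left unt_zigzag_left
      lun_inv_right, code_simp)

lemma co_kelly_left_r1_2_2: "valid eq_co_kelly_left_r1_2_2"
  by (rule certified[where L = "struct_gens" and R = "[eq_colun_inv_left, eq_co_kelly_left, eq_coasc_inv_left, eq_colun_inv_right]" and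
    ss = "[RB (CX UntA 0 MulA) 2 0 0 0, RB (U 0) 3 1 0 0, RB (U 1) 2 0 0 0, RF (U 2) 1 1 0 0,
    RF (U 3) 0 0 0 1]"])
        (simp only: good_struct simp_thms, simp add: colun_inv_left co_kelly_left coasc_inv_left
      colun_inv_right, code_simp)

lemma kelly_left_r0_3_2: "valid eq_kelly_left_r0_3_2"
  by (rule certified[where L = "struct_gens" and R = "[eq_lun_inv_left, eq_kelly_left, eq_lun_inv_right]" and
    ss = "[RB (CY Unt 0 Mul) 2 1 0 0, RB (U 0) 3 0 0 0, RF (U 1) 1 0 0 0, RF (U 2) 0 1 0 1]"])
    (simp only: good_struct simp_thms, simp add: lun_inv_left kelly_left lun_inv_right, code_simp)

lemma co_kelly_left_r0_2_2: "valid eq_co_kelly_left_r0_2_2"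
  by (rule certified[where L = "struct_gens" and R = "[eq_coasc_inv_right, eq_colun_inv_left, eq_co_kelly_left, eq_colun_inv_right]" and
    ss = "[RB (U 0) 2 1 0 0, RB (U 1) 3 0 0 1, RF (U 2) 2 0 0 0, RF (CY UntA 0 MulA) 1 0 0 0,
    RF (U 3) 0 1 0 0]"])
        (simp only: good_struct simp_thms, simp add: coasc_inv_right colun_inv_left co_kelly_left
      colun_inv_right, code_simp)

lemma kelly_left_r1_1_2: "valid eq_kelly_left_r1_1_2"
  by (rule certified[where L = "struct_gens" and R = "[eq_asc_inv_right, eq_lun_inv_left, eq_kelly_left, eq_lun_inv_right]" and
    ss = "[RB (U 0) 2 0 0 0, RB (U 1) 3 1 0 1, RB (U 2) 3 0 0 0, RF (U 0) 2 0 0 0,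
    RF (CX Unt 0 Mul) 1 1 0 0, RF (U 3) 0 0 0 0]"])
    (simp only: good_struct simp_thms, simp add: asc_inv_right lun_inv_left kelly_left lun_inv_right, code_simp)

lemma pentagon_r0_0_3: "valid eq_pentagon_r0_0_3"
  by (rule certified[where L = "struct_gens" and R = "[eq_asc_inv_right, eq_pentagon, eq_asc_inv_left]" and
    ss = "[RB (U 0) 3 1 1 0, RB (U 0) 4 0 0 0, RB (U 0) 5 1 0 1, RF (U 1) 0 0 0 0, RF (U 2) 2 1 1 0,
    RF (U 2) 1 0 0 0, RF (U 2) 0 1 0 1]"])
    (simp only: good_struct simp_thms, simp add: asc_inv_right pentagon asc_inv_left, code_simp)

lemma pentagon_r0_4_3: "valid eq_pentagon_r0_4_3"
  by (rule certified[where L = "struct_gens" and R = "[eq_asc_inv_left, eq_asc_inv_right, eq_pentagon]" and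
    ss = "[RB (CY Mul 0 Mul) 3 1 0 0, RB (U 0) 4 0 0 0, RB (U 1) 5 1 1 0, RF (U 2) 2 0 0 0,
    RF (U 1) 1 1 0 1, RF (U 1) 0 0 0 0, RF (U 0) 0 1 1 0]"])
    (simp only: good_struct simp_thms, simp add: asc_inv_left asc_inv_right pentagon, code_simp)

lemma co_pentagon_r1_2_3: "valid eq_co_pentagon_r1_2_3"
  by (rule certified[where L = "struct_gens" and R = "[eq_coasc_inv_right, eq_coasc_inv_left, eq_co_pentagonI]" and
    ss = "[RB (U 0) 3 1 0 0, RB (U 1) 4 0 0 1, RB (U 1) 5 1 0 0, RF (U 2) 1 0 0 0, RF (U 1) 0 0 1 0,
    RF (U 0) 1 0 0 1, RF (U 0) 0 1 0 0]"])
    (simp only: good_struct simp_thms, simp add: coasc_inv_right coasc_inv_left co_pentagonI, code_simp)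

lemma corun_inv_left: "valid eq_corun_inv_left"
  by (rule certified[where L = "struct_gens" and R = "[eq_corun_def, eq_corunI_def, eq_run_inv_left, eq_mul_zigzag_right, eq_unt_zigzag_right]" and
    ss = "[RF (U 0) 0 0 0 0, RF (U 1) 3 0 0 0, SL 2, SL 1, SL 0, SL 3, SL 2, SL 1, SL 4, SL 3, SL 2,
    RF (U 2) 2 2 0 0, SR 1, RF (U 3) 2 1 0 0, RF (U 4) 0 0 1 0]"])
        (simp only: good_struct simp_thms, simp add: corun_def corunI_def run_inv_left mul_zigzag_right
      unt_zigzag_right, code_simp)

lemma triangleI: "valid eq_triangleI"
  by (rule certified[where L = "struct_gens" and R = "[eq_run_inv_right, eq_triangle, eq_lun_inv_left, eq_asc_inv_left]" and
    ss = "[RB (U 0) 0 1 0 1, RB (U 1) 1 0 0 0, RF (U 2) 2 1 1 0, RF (U 3) 1 0 0 0]"])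
    (simp only: good_struct simp_thms, simp add: run_inv_right triangle lun_inv_left asc_inv_left, code_simp)

lemma co_triangle: "valid eq_co_triangle"
  by (rule certified[where L = "struct_gens" and R = "[eq_colun_def, eq_coasc_def, eq_mul_zigzag_left, eq_triangleI, eq_mul_zigzag_right, eq_corun_def]" and
    ss = "[RF (U 0) 1 0 1 0, SL 0, SL 1, RF (U 1) 2 1 0 0, SL 6, SL 5, SL 4, SL 3, RF (U 2) 2 0 1 0, SL 1,
    SL 2, SL 0, RF (U 3) 1 1 0 0, SR 0, SR 1, SR 2, RF (U 4) 3 0 0 0, RB (U 5) 0 0 0 1]"])
        (simp only: good_struct simp_thms, simp add: colun_def coasc_def mul_zigzag_left triangleI
      mul_zigzag_right corun_def, code_simp)

lemma co_triangle_r1_1_2: "valid eq_co_triangle_r1_1_2"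
  by (rule certified[where L = "struct_gens" and R = "[eq_corun_inv_left, eq_co_triangle, eq_coasc_inv_right, eq_colun_inv_right]" and
    ss = "[RB (U 0) 2 0 0 1, RB (U 1) 2 0 0 0, RF (U 2) 1 1 0 0, RF (U 3) 0 0 1 0]"])
        (simp only: good_struct simp_thms, simp add: corun_inv_left co_triangle coasc_inv_right colun_inv_right,
      code_simp)

lemma corun_inv_right: "valid eq_corun_inv_right"
  by (rule certified[where L = "struct_gens" and R = "[eq_corun_def, eq_corunI_def, eq_mul_zigzag_left, eq_unt_zigzag_left, eq_run_inv_right]" and
    ss = "[RF (U 0) 1 0 0 0, RF (U 1) 0 0 0 0, SL 2, SL 3, SL 4, SL 1, SL 2, SL 0, RF (U 2) 3 0 0 0,
    RF (U 3) 1 1 1 0, RF (U 4) 0 0 0 0]"])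
        (simp only: good_struct simp_thms, simp add: corun_def corunI_def mul_zigzag_left unt_zigzag_left
      run_inv_right, code_simp)

lemma co_pentagon_r1_0_3: "valid eq_co_pentagon_r1_0_3"
  by (rule certified[where L = "struct_gens" and R = "[eq_coasc_inv_right, eq_co_pentagon, eq_coasc_inv_left]" and
    ss = "[RB (U 0) 3 1 0 0, RB (CY MulA 0 MulA) 4 0 0 0, RB (U 0) 5 1 0 0, RB (U 1) 0 0 0 0,
    RF (U 2) 2 1 0 0, RF (CX MulA 0 MulA) 1 0 0 0, RF (U 2) 0 1 0 0]"])
    (simp only: good_struct simp_thms, simp add: coasc_inv_right co_pentagon coasc_inv_left, code_simp)

lemma mate_eta: "valid eq_mate_eta"
  by (rule certified[where L = "struct_gens" and R = "[eq_coasc_def, eq_mul_zigzag_left]" and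
    ss = "[RF (U 0) 2 0 0 0, SL 1, SL 2, SL 3, SL 4, SL 0, SL 1, SL 2, RF (U 1) 3 3 0 1, RF (U 1) 3 2 0 0]"])
    (simp only: good_struct simp_thms, simp add: coasc_def mul_zigzag_left, code_simp)

lemma pentagon_shifted: "valid eq_pentagon_shifted"
  by (rule certified[where L = "struct_gens" and R = "[eq_asc_inv_right, eq_pentagon, eq_asc_inv_left]" and
    ss = "[RB (CX Mul 0 Mul) 0 1 0 0, RB (U 0) 1 0 0 0, RF (U 1) 2 0 0 0, RF (U 2) 4 1 1 0]"])
    (simp only: good_struct simp_thms, simp add: asc_inv_right pentagon asc_inv_left, code_simp)

text \<open>Moving the counits across by \<open>mate_eps\<close> leaves the unit of m against its
  counit; the zigzag identity removes both, and what remains of \<beta> is \<r>.\<close>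

lemma counit_beta: "valid eq_counit_beta"
  by (rule certified[where L = "struct_gens" and R = "[eq_mate_eps, eq_mul_zigzag_left]" and
    ss = "[SL 1, SL 2, SL 3, RF (U 0) 1 0 0 0, SL 0, SL 1, RF (U 1) 2 0 0 0]"])
    (simp only: good_struct simp_thms, simp add: mate_eps mul_zigzag_left, code_simp)

text \<open>One contraction uses the left unit law, the other, through \<beta>, the right one. The
  triangle exchanges them once the associators have been shifted by the pentagon.\<close>

lemma counit_slide: "valid eq_counit_slide"
  by (rule certified[where L = "struct_gens" and R = "[eq_pentagon_shifted, eq_triangle, eq_counit_beta]" and
    ss = "[RF (U 0) 0 0 0 0, SR 3, RF (U 1) 4 0 0 0, RB (U 2) 2 1 0 1, SR 1, SR 2, SR 3, SR 4]"])
    (simp only: good_struct simp_thms, simp add: pentagon_shifted triangle counit_beta, code_simp)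

text \<open>\<alpha> is given through the unit of m. Unfolding the mate \<open>colun\<close> and one
  zigzag identity expresses it through the counit of u and the inverse of \<l>, the form to which
  Kelly's left unit law applies.\<close>

lemma alpha_def: "valid eq_alpha_def"
  by (rule certified[where L = "struct_gens" and R = "[eq_colun_def, eq_mul_zigzag_left]" and
    ss = "[RF (U 0) 1 0 0 0, SL 0, SL 1, RF (U 1) 2 0 0 0]"])
    (simp only: good_struct simp_thms, simp add: colun_def mul_zigzag_left, code_simp)

lemma alpha_asc: "valid eq_alpha_asc"
  by (rule certified[where L = "struct_gens" and R = "[eq_alpha_def, eq_kelly_left_inv]" and
    ss = "[RF (U 0) 0 1 0 1, SL 1, RF (U 1) 0 0 0 0, RB (CY UntA 0 Mul) 1 2 0 0, SR 0,
    RB (NR (G EpsU) 0 Mul) 2 1 0 0, RB (U 0) 1 0 0 0]"])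
    (simp only: good_struct simp_thms, simp add: alpha_def kelly_left_inv, code_simp)

lemma alpha_asc_inv: "valid eq_alpha_asc_inv"
  by (rule certified[where L = "struct_gens" and R = "[eq_alpha_asc, eq_asc_inv_left]" and
    ss = "[RB (U 0) 0 0 0 0, RF (U 1) 2 0 0 0]"])
    (simp only: good_struct simp_thms, simp add: alpha_asc asc_inv_left, code_simp)

lemma alpha_colun: "valid eq_alpha_colun"
  by (rule certified[where L = "struct_gens" and R = "[eq_mul_zigzag_right]" and
    ss = "[SR 1, RF (U 0) 0 1 0 0]"])
    (simp only: good_struct simp_thms, simp add: mul_zigzag_right, code_simp)

text \<open>The counit of m after \<alpha> is \<open>colun\<close>, so creating u^* and m^* by the
  inverse of \<open>colun\<close> and contracting them through \<alpha> has no effect. This disposes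
  of the auxiliary 1-cells once the antipode has been eliminated.\<close>

lemma alpha_counit: "valid eq_alpha_counit"
  by (rule certified[where L = "struct_gens" and R = "[eq_alpha_asc_inv, eq_alpha_colun, eq_colun_inv_right]" and
    ss = "[RF (U 0) 1 0 0 0, RF (U 1) 1 1 0 1, RF (U 2) 0 1 0 1]"])
    (simp only: good_struct simp_thms, simp add: alpha_asc_inv alpha_colun colun_inv_right, code_simp)

section \<open>Invertibility of the coherence isomorphisms of \<bullet>\<close>

lemma inv1_aai: "valid eq_inv1_aai"
  by (rule certified[where L = "struct_gens" and R = "[eq_coasc_inv_left, eq_asc_inv_left]" and
    ss = "[SL 0, SL 1, SL 2, RF (U 0) 3 4 0 0, RF (CY (V 0) 0 Mul) 1 1 0 0, RF (U 1) 0 0 0 0]"])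
    (simp only: good_struct simp_thms, simp add: coasc_inv_left asc_inv_left, code_simp)

lemma inv2_aai: "valid eq_inv2_aai"
  by (rule certified[where L = "struct_gens" and R = "[eq_coasc_inv_right, eq_asc_inv_right]" and
    ss = "[SL 1, RF (U 0) 2 4 0 0, RF (U 1) 1 0 0 0, RF (CX (V 0) 0 Mul) 0 1 0 0]"])
    (simp only: good_struct simp_thms, simp add: coasc_inv_right asc_inv_right, code_simp)

lemma inv1_aax: "valid eq_inv1_aax"
  by (rule certified[where L = "struct_gens" and R = "[eq_coasc_inv_left, eq_asc_inv_left]" and
    ss = "[SL 1, SL 2, SL 3, RF (U 0) 4 5 0 0, SL 0, SL 1, SL 2, SL 3, RF (CX MulA 0 (V 1)) 4 4 0 0,
    RF (CY (V 0) 0 Mul) 1 1 0 0, RF (U 1) 0 0 0 0]"])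
    (simp only: good_struct simp_thms, simp add: coasc_inv_left asc_inv_left, code_simp)

lemma inv2_aax: "valid eq_inv2_aax"
  by (rule certified[where L = "struct_gens" and R = "[eq_asc_inv_right, eq_coasc_inv_right]" and
    ss = "[SR 2, SR 3, SR 4, RF (U 0) 5 0 0 0, SR 0, SR 1, SR 2, SR 3, RF (CX (V 0) 0 Mul) 4 1 0 0,
    RF (CY MulA 0 (V 1)) 1 4 0 0, RF (U 1) 0 5 0 0]"])
    (simp only: good_struct simp_thms, simp add: asc_inv_right coasc_inv_right, code_simp)

lemma inv1_aaa: "valid eq_inv1_aaa"
  by (rule certified[where L = "struct_gens" and R = "[eq_coasc_inv_left, eq_asc_inv_left]" and
    ss = "[SL 1, SL 2, SL 3, RF (U 0) 4 5 0 0, SL 0, SL 1, SL 2, SL 3, RF (CX MulA 0 (V 0)) 4 4 0 0,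
    RF (CY (V 0) 0 Mul) 1 1 0 0, RF (U 1) 0 0 0 0]"])
    (simp only: good_struct simp_thms, simp add: coasc_inv_left asc_inv_left, code_simp)

lemma inv2_aaa: "valid eq_inv2_aaa"
  by (rule certified[where L = "struct_gens" and R = "[eq_asc_inv_right, eq_coasc_inv_right]" and
    ss = "[SR 2, SR 3, SR 4, RF (U 0) 5 0 0 0, SR 0, SR 1, SR 2, SR 3, RF (CX (V 0) 0 Mul) 4 1 0 0,
    RF (CY MulA 0 (V 0)) 1 4 0 0, RF (U 1) 0 5 0 0]"])
    (simp only: good_struct simp_thms, simp add: asc_inv_right coasc_inv_right, code_simp)

lemma inv1_iia: "valid eq_inv1_iia"
  by (rule certified[where L = "struct_gens" and R = "[eq_coasc_inv_left, eq_asc_inv_left]" and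
    ss = "[SL 1, RF (U 0) 2 3 0 0, SL 0, SL 1, RF (CX MulA 0 (V 0)) 2 2 0 0, RF (U 1) 0 0 0 0]"])
    (simp only: good_struct simp_thms, simp add: coasc_inv_left asc_inv_left, code_simp)

lemma inv2_iia: "valid eq_inv2_iia"
  by (rule certified[where L = "struct_gens" and R = "[eq_asc_inv_right, eq_coasc_inv_right]" and
    ss = "[SR 1, SR 2, SR 3, RF (U 0) 4 0 0 0, RF (CY MulA 0 (V 0)) 1 2 0 0, RF (U 1) 0 3 0 0]"])
    (simp only: good_struct simp_thms, simp add: asc_inv_right coasc_inv_right, code_simp)

lemma inv1_lx: "valid eq_inv1_lx"
  by (rule certified[where L = "struct_gens" and R = "[eq_colun_inv_left, eq_lun_inv_left]" and
    ss = "[SL 1, RF (U 0) 2 1 0 0, SL 0, SL 1, RF (CX UntA 0 (V 1)) 2 2 0 0, RF (U 1) 0 0 0 0]"])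
    (simp only: good_struct simp_thms, simp add: colun_inv_left lun_inv_left, code_simp)

lemma inv2_lx: "valid eq_inv2_lx"
  by (rule certified[where L = "struct_gens" and R = "[eq_lun_inv_right, eq_colun_inv_right]" and
    ss = "[SR 1, SR 2, SR 3, RF (U 0) 4 0 0 0, RF (CY UntA 0 (V 1)) 1 0 0 0, RF (U 1) 0 1 0 0]"])
    (simp only: good_struct simp_thms, simp add: lun_inv_right colun_inv_right, code_simp)

lemma inv1_lx3: "valid eq_inv1_lx3"
  by (rule certified[where L = "struct_gens" and R = "[eq_colun_inv_left, eq_lun_inv_left]" and
    ss = "[SL 1, RF (U 0) 2 1 0 0, SL 0, SL 1, RF (CX UntA 0 (V 3)) 2 2 0 0, RF (U 1) 0 0 0 0]"])
    (simp only: good_struct simp_thms, simp add: colun_inv_left lun_inv_left, code_simp)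

lemma inv2_lx3: "valid eq_inv2_lx3"
  by (rule certified[where L = "struct_gens" and R = "[eq_lun_inv_right, eq_colun_inv_right]" and
    ss = "[SR 1, SR 2, SR 3, RF (U 0) 4 0 0 0, RF (CY UntA 0 (V 3)) 1 0 0 0, RF (U 1) 0 1 0 0]"])
    (simp only: good_struct simp_thms, simp add: lun_inv_right colun_inv_right, code_simp)

lemma inv1_li: "valid eq_inv1_li"
  by (rule certified[where L = "struct_gens" and R = "[eq_colun_inv_left, eq_lun_inv_left]" and
    ss = "[SL 0, RF (U 0) 1 0 0 0, RF (U 1) 0 0 0 0]"])
    (simp only: good_struct simp_thms, simp add: colun_inv_left lun_inv_left, code_simp)

lemma inv2_li: "valid eq_inv2_li"
  by (rule certified[where L = "struct_gens" and R = "[eq_colun_inv_right, eq_lun_inv_right]" and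
    ss = "[SL 0, RF (U 0) 1 2 0 0, RF (U 1) 0 0 0 0]"])
    (simp only: good_struct simp_thms, simp add: colun_inv_right lun_inv_right, code_simp)

lemma inv1_ri: "valid eq_inv1_ri"
  by (rule certified[where L = "struct_gens" and R = "[eq_corun_inv_left, eq_run_inv_left]" and
    ss = "[SL 0, RF (U 0) 1 0 0 0, RF (U 1) 0 0 0 0]"])
    (simp only: good_struct simp_thms, simp add: corun_inv_left run_inv_left, code_simp)

lemma inv2_ri: "valid eq_inv2_ri"
  by (rule certified[where L = "struct_gens" and R = "[eq_corun_inv_right, eq_run_inv_right]" and
    ss = "[SL 0, RF (U 0) 1 2 0 0, RF (U 1) 0 0 0 0]"])
    (simp only: good_struct simp_thms, simp add: corun_inv_right run_inv_right, code_simp)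

lemma inv1_rx: "valid eq_inv1_rx"
  by (rule certified[where L = "struct_gens" and R = "[eq_corun_inv_left, eq_run_inv_left]" and
    ss = "[SL 1, RF (U 0) 2 1 0 0, RF (U 1) 1 0 0 0, RF (CX (V 1) 0 Unt) 0 1 0 0]"])
    (simp only: good_struct simp_thms, simp add: corun_inv_left run_inv_left, code_simp)

lemma inv2_rx: "valid eq_inv2_rx"
  by (rule certified[where L = "struct_gens" and R = "[eq_corun_inv_right, eq_run_inv_right]" and
    ss = "[SL 0, SL 1, SL 2, RF (U 0) 3 3 0 0, RF (CY (V 1) 0 Unt) 1 1 0 0, RF (U 1) 0 0 0 0]"])
    (simp only: good_struct simp_thms, simp add: corun_inv_right run_inv_right, code_simp)

lemma inv1_rx3: "valid eq_inv1_rx3"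
  by (rule certified[where L = "struct_gens" and R = "[eq_corun_inv_left, eq_run_inv_left]" and
    ss = "[SL 1, RF (U 0) 2 1 0 0, RF (U 1) 1 0 0 0, RF (CX (V 3) 0 Unt) 0 1 0 0]"])
    (simp only: good_struct simp_thms, simp add: corun_inv_left run_inv_left, code_simp)

lemma inv2_rx3: "valid eq_inv2_rx3"
  by (rule certified[where L = "struct_gens" and R = "[eq_corun_inv_right, eq_run_inv_right]" and
    ss = "[SL 0, SL 1, SL 2, RF (U 0) 3 3 0 0, RF (CY (V 3) 0 Unt) 1 1 0 0, RF (U 1) 0 0 0 0]"])
    (simp only: good_struct simp_thms, simp add: corun_inv_right run_inv_right, code_simp)

lemma inv1_xaa: "valid eq_inv1_xaa"
  by (rule certified[where L = "struct_gens" and R = "[eq_coasc_inv_left, eq_asc_inv_left]" and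
    ss = "[SL 1, SL 2, SL 3, RF (U 0) 4 5 0 0, SL 0, SL 1, SL 2, SL 3, RF (CX MulA 0 (V 0)) 4 4 0 0,
    RF (CY (V 1) 0 Mul) 1 1 0 0, RF (U 1) 0 0 0 0]"])
    (simp only: good_struct simp_thms, simp add: coasc_inv_left asc_inv_left, code_simp)

lemma inv2_xaa: "valid eq_inv2_xaa"
  by (rule certified[where L = "struct_gens" and R = "[eq_asc_inv_right, eq_coasc_inv_right]" and
    ss = "[SR 2, SR 3, SR 4, RF (U 0) 5 0 0 0, SR 0, SR 1, SR 2, SR 3, RF (CX (V 1) 0 Mul) 4 1 0 0,
    RF (CY MulA 0 (V 0)) 1 4 0 0, RF (U 1) 0 5 0 0]"])
    (simp only: good_struct simp_thms, simp add: asc_inv_right coasc_inv_right, code_simp)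

lemma inv1_iaa: "valid eq_inv1_iaa"
  by (rule certified[where L = "struct_gens" and R = "[eq_coasc_inv_left, eq_asc_inv_left]" and
    ss = "[SL 1, RF (U 0) 2 4 0 0, SL 0, SL 1, RF (CX MulA 0 (V 0)) 2 3 0 0, RF (U 1) 0 0 0 0]"])
    (simp only: good_struct simp_thms, simp add: coasc_inv_left asc_inv_left, code_simp)

lemma inv2_iaa: "valid eq_inv2_iaa"
  by (rule certified[where L = "struct_gens" and R = "[eq_asc_inv_right, eq_coasc_inv_right]" and
    ss = "[SR 1, SR 2, SR 3, RF (U 0) 4 0 0 0, RF (CY MulA 0 (V 0)) 1 3 0 0, RF (U 1) 0 4 0 0]"])
    (simp only: good_struct simp_thms, simp add: asc_inv_right coasc_inv_right, code_simp)

end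

section \<open>Consequences of the axioms of a Hopf monoid\<close>

locale hopf_diagrams = monoidale_diagrams +
  assumes good_hopf: "good_gens hopf_gens"
    and mu_assoc: "valid eq_mu_assoc"
    and mu_lun: "valid eq_mu_lun"
    and eps_mu: "valid eq_eps_mu"
    and eps_eta: "valid eq_eps_eta"
    and mu_run: "valid eq_mu_run"
    and eps_l: "valid eq_eps_l"
    and muh_def: "valid eq_muh_def"
    and del_coassoc: "valid eq_del_coassoc"
    and ax_phi: "valid eq_ax_phi"
    and etac_def: "valid eq_etac_def"
    and etah_def: "valid eq_etah_def"
    and eps_r: "valid eq_eps_r"
    and del_mu: "valid eq_del_mu"
    and ax_psi: "valid eq_ax_psi"
begin

lemma good_simps: "good_gens []" "good_gens (g # L) \<longleftrightarrow> good (G g) \<and> good_gens L"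
  "good_gens (L @ L') \<longleftrightarrow> good_gens L \<and> good_gens L'" "good_gens basic_gens"
  using good_struct good_hopf by (auto simp: good_gens_def basic_gens_def)

lemma free_left_assoc: "valid eq_free_left_assoc"
  by (rule certified[where L = "basic_gens" and R = "[eq_mu_assoc, eq_pentagon_r0_2_3, eq_coasc_inv_left, eq_co_pentagon_r0_1_3]" and
    ss = "[SL 2, RF (NR (G Mu) 0 Mul) 0 1 0 0, SL 4, SR 5, RF (U 0) 6 1 0 1, SL 5, SL 7, SL 8, SL 6, SL 7,
    SL 5, SL 6, RB (U 1) 3 0 0 0, SL 2, SR 5, SL 1, SL 0, RB (CY (V 0) 0 Mul) 3 1 0 0, SL 2, SL 1,
    RB (NL (G AscI) 0 (V 0)) 4 1 0 0, RF (CX (V 0) 0 Mul) 6 2 0 1, RB (U 2) 11 4 0 0, SR 10,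
    RB (U 3) 8 6 0 0, SR 1, SR 6, SR 7, SR 8, SR 9, SR 10, SR 11, SR 0, SR 5, SR 6, SR 7, SR 8, SR 9,
    SR 4, SR 5, SR 6, SR 7, SR 3, SR 4, SR 5, SR 2, SR 3, SR 4, SR 1, SR 2, SR 3]"])
    (simp only: good_simps simp_thms, simp add: mu_assoc pentagon_r0_2_3 coasc_inv_left co_pentagon_r0_1_3, code_simp)

lemma free_left_unit: "valid eq_free_left_unit"
  by (rule certified[where L = "basic_gens" and R = "[eq_mu_lun, eq_kelly_left, eq_asc_inv_right, eq_co_kelly_left]" and
    ss = "[SL 2, RF (NR (G Eta) 0 Mul) 0 1 0 0, SL 2, SR 3, RF (U 0) 4 1 0 1, SL 3, SL 5, SL 4, SL 3,
    RB (U 1) 3 0 0 0, RF (U 2) 2 0 0 0, RF (CX Unt 0 Mul) 1 1 0 0, SL 0, RF (U 3) 3 2 0 0, SR 0,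
    SR 1, SR 2, SR 3]"])
    (simp only: good_simps simp_thms, simp add: mu_lun kelly_left asc_inv_right co_kelly_left, code_simp)

lemma free_compatible: "valid eq_free_compatible"
  by (rule certified[where L = "basic_gens" and R = "[eq_pentagon_r0_5_3, eq_co_pentagon_r1_1_3]" and
    ss = "[SL 1, SL 4, SL 5, SL 3, SL 2, RF (NRi (G Mu) 0 Mul) 4 1 0 0, SL 3, SL 4, SL 5, RF (U 0) 1 0 0 0,
    SL 0, RB (CY (V 0) 0 Mul) 1 1 0 0, RB (NL (G Asc) 0 (V 0)) 2 1 0 0, SL 4,
    RF (CX (V 0) 1 Mul) 5 2 0 0, SR 8, SR 9, SR 7, RB (CX MulA 0 MulA) 8 5 0 0,
    RB (NLi (G EpsM) 0 MulA) 9 4 0 0, RB (U 1) 6 5 0 0, SR 4, SR 5, SR 6, SR 7, SR 8, SR 3, SR 4,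
    SR 5, SL 7, SR 3, SR 4, SR 6, SR 2, SR 3, SR 1, SR 0]"])
    (simp only: good_simps simp_thms, simp add: pentagon_r0_5_3 co_pentagon_r1_1_3, code_simp)

lemma trivial_assoc: "valid eq_trivial_assoc"
  by (rule certified[where L = "basic_gens" and R = "[eq_eps_mu, eq_i_assoc]" and
    ss = "[RF (U 0) 0 1 0 1, SL 0, RF (U 1) 2 0 0 0, SL 2, SL 1, SL 0, RB (CY (V 0) 0 Mul) 1 1 0 0,
    RB (NR (G Eps) 0 Mul) 2 1 0 0, SR 2, SR 3, SR 4, SR 2, SR 1, SR 0]"])
    (simp only: good_simps simp_thms, simp add: eps_mu i_assoc, code_simp)

lemma trivial_unit: "valid eq_trivial_unit"
  by (rule certified[where L = "basic_gens" and R = "[eq_eps_eta, eq_i_lun]" and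
    ss = "[RF (U 0) 0 1 0 1, RF (U 1) 0 0 0 0]"])
    (simp only: good_simps simp_thms, simp add: eps_eta i_lun, code_simp)

lemma trivial_compatible: "valid eq_trivial_compatible"
  by (rule certified[where L = "basic_gens" and R = "[eq_i_assoc]" and
    ss = "[RF (U 0) 1 0 0 0, SL 1, SL 0, RB (CY (V 0) 0 Mul) 1 1 0 0, RB (NR (G Eps) 0 Mul) 2 1 0 0, SR 2,
    SR 3, SR 1, SR 0]"])
    (simp only: good_simps simp_thms, simp add: i_assoc, code_simp)

text \<open>\<epsilon> is multiplicative, so acting before or after applying the counit differs only
  by associativity of \<i>.\<close>

lemma counit_left_linear: "valid eq_counit_left_linear"
  by (rule certified[where L = "basic_gens" and R = "[eq_eps_mu, eq_i_assoc, eq_asc_inv_right, eq_coasc_inv_right]" and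
    ss = "[SL 1, RF (U 0) 3 1 0 1, SL 2, SL 3, SL 2, RF (U 1) 5 0 0 0, SR 1, SR 2, SR 3, SR 4,
    RF (U 2) 5 0 0 0, RF (U 3) 3 2 0 0, RB (NR (G Eps) 0 Mul) 0 1 0 0, SR 0, SR 1]"])
    (simp only: good_simps simp_thms, simp add: eps_mu i_assoc asc_inv_right coasc_inv_right, code_simp)

lemma counit_right_linear: "valid eq_counit_right_linear"
  by (rule certified[where L = "basic_gens" and R = "[eq_i_assoc]" and
    ss = "[SL 0, SL 1, SL 3, SL 2, RF (NR (G Eps) 0 Mul) 2 1 0 0, RF (CY (V 0) 0 Mul) 1 1 0 0, SR 0, SR 1,
    RB (U 0) 1 0 0 0]"])
    (simp only: good_simps simp_thms, simp add: i_assoc, code_simp)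

lemma unit_right_linear: "valid eq_unit_right_linear"
  by (rule certified[where L = "basic_gens" and R = "[eq_co_kelly_left_r1_2_2, eq_kelly_left_r0_3_2]" and
    ss = "[SL 1, SL 0, SR 1, RF (NLi (G EpsM) 0 UntA) 2 2 0 0, SL 4, RB (U 0) 1 3 0 0, SL 2, SL 3,
    RB (CX (V 0) 0 Mul) 4 1 0 0, RF (NR (G Eta) 0 Mul) 3 1 0 0, RF (CY UntA 0 Mul) 2 2 0 0, SR 0,
    RB (U 1) 1 0 0 0, SR 2, SR 4, SR 3]"])
    (simp only: good_simps simp_thms, simp add: co_kelly_left_r1_2_2 kelly_left_r0_3_2, code_simp)

lemma counit_unit: "valid eq_counit_unit"
  by (rule certified[where L = "basic_gens" and R = "[eq_eps_eta, eq_i_lun, eq_colun_inv_right, eq_lun_inv_right]" and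
    ss = "[RF (U 0) 2 1 0 1, RF (U 1) 2 0 0 0, SL 0, RF (U 2) 1 2 0 0, RF (U 3) 0 0 0 0]"])
    (simp only: good_simps simp_thms, simp add: eps_eta i_lun colun_inv_right lun_inv_right, code_simp)

section \<open>Splitting the actions by a section of the multiplication\<close>

lemma spread_balanced:
  assumes "good (G (ActL 1))" and "good (G Nab)" and "valid eq_act_x_assoc" and "valid eq_nab_right_linear"
  shows "valid eq_spread_balanced"
  by (rule certified[where L = "basic_gens @ [ActL 1, Nab]" and R = "[eq_nab_right_linear, eq_act_x_assoc, eq_co_pentagon_r0_0_3, eq_pentagon_r0_0_3]" and
    ss = "[SL 3, SL 4, SL 2, SL 3, RF (U 0) 0 1 0 1, SL 2, SL 3, SL 5, SL 6, SR 7, SL 1, SL 2, SL 4, SL 5,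
    SL 3, SL 4, SL 2, RB (CX MulA 0 (V 1)) 8 6 1 0, RF (NR (G CoAsc) 0 (V 1)) 6 6 0 0, SR 10,
    RF (U 1) 11 2 1 0, SR 9, RF (CY MulA 0 (V 1)) 10 6 1 0, SL 10, SL 11, SL 9, SL 10, SL 8, SL 9,
    SL 7, SL 8, SL 6, SL 7, SL 5, SL 6, RB (U 2) 10 7 0 0, SR 7, SR 9, SL 12, SR 8,
    RB (CY MulA 0 Mul) 9 4 0 0, SL 8, SL 7, RB (NL (G (ActL 1)) 0 MulA) 10 4 0 0,
    RB (NLi (G Asc) 0 (V 0)) 3 1 0 0, RB (U 3) 1 0 0 0, SL 0, SR 3, SR 5, SR 6, SR 4, SR 5,
    RF (NRi (G Nab) 0 Mul) 1 1 0 0, SR 4, SR 5, SR 6, SR 7, SR 8, SR 3, SR 4, SR 5, SR 6, SR 7, SR 2,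
    SR 3, SR 4, SR 1, SR 2, SR 0, SR 1]"])
        (simp only: good_simps assms simp_thms, simp del: One_nat_def add: co_pentagon_r0_0_3 pentagon_r0_0_3
      assms, code_simp)

text \<open>\<open>spread_balanced\<close> with the unit of a as first factor: in elements, the
  section of 1 applied to cx equals the section of 1c applied to x.\<close>

lemma split_act:
  assumes "good (G (ActL 1))" and "good (G Nab)" and "valid eq_act_x_assoc" and "valid eq_nab_right_linear"
  shows "valid eq_split_act"
  by (rule certified[where L = "basic_gens @ [ActL 1, Nab]" and R = "[eq_co_kelly_left_r0_2_2, eq_kelly_left_r1_1_2, eq_spread_balanced, eq_mu_lun, eq_lun_inv_right, eq_colun_inv_right]" and
    ss = "[SR 0, SL 1, SL 7, SL 8, SL 0, SL 6, SL 7, RF (NLi (G (ActL 1)) 0 UntA) 2 2 0 0, SL 6, SL 7, SL 8,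
    SL 9, RF (U 0) 1 5 0 0, SL 2, SL 3, SL 4, SL 5, SL 6, SL 7, SL 8,
    RB (NR (G CoLunI) 0 (V 1)) 1 4 0 0, RF (CX UntA 1 (V 1)) 3 4 0 0, SL 2, SL 3, SL 4, SL 5, SL 6,
    SL 7, RB (CX Unt 0 Mul) 3 1 0 0, RB (NRi (G Eta) 0 Mul) 4 1 0 0, SL 2, SL 1, RF (U 1) 0 0 0 0,
    SR 1, SR 2, SR 3, SR 8, SR 9, SR 10, SR 11, SR 12, SR 7, SR 8, SR 9, SR 10, SR 11, SR 6, SR 7,
    SR 8, SR 5, SR 6, SR 4, SR 5, RB (U 2) 4 0 0 0, SL 7, SL 8, SL 6, SL 7, RF (U 3) 3 1 0 1, SR 0,
    SR 1, SR 2, SR 3, RF (U 4) 4 1 0 1, RF (CY UntA 0 (V 0)) 1 1 0 1, RF (U 5) 0 2 0 1, SR 2, SR 3,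
    SR 1, SR 2]"])
        (simp only: good_simps assms simp_thms, simp del: One_nat_def add: co_kelly_left_r0_2_2
      kelly_left_r1_1_2 spread_balanced mu_lun lun_inv_right colun_inv_right assms, code_simp)

lemma spread_left_linear:
  assumes "good (G (ActL 1))" and "good (G Nab)" and "valid eq_nab_left_linear"
  shows "valid eq_spread_left_linear"
  by (rule certified[where L = "basic_gens @ [ActL 1, Nab]" and R = "[eq_nab_left_linear, eq_pentagon_r0_4_3, eq_co_pentagon_r1_2_3]" and
    ss = "[SL 1, SL 7, SL 8, SL 6, SL 7, RF (U 0) 4 1 0 1, SL 3, SL 4, SL 6, SL 9, SR 11, SL 2, SL 3, SL 5,
    SL 8, SR 10, SL 4, SL 7, SR 9, SL 6, SL 5, RB (CX MulA 1 (V 1)) 10 6 0 0,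
    RF (NR (G CoAscI) 0 (V 1)) 8 6 0 0, RF (CY MulA 0 (V 1)) 7 7 0 0, SR 1, SR 2, SL 6,
    RF (U 1) 3 0 0 0, SR 0, RB (NL (G Asc) 0 (V 0)) 1 1 0 0, SL 3, SR 5, SR 6, SR 7, SR 8, SR 9,
    SR 4, SR 5, SR 6, SR 7, SR 8, RF (NRi (G Mu) 0 Mul) 11 1 0 0, RF (CX Mul 0 Mul) 10 1 0 0,
    RF (CX (V 0) 1 Mul) 9 2 0 0, SL 8, SR 11, SL 7, SR 10, SL 6, SR 9, SL 5, SR 8, SL 4,
    RB (U 2) 6 7 0 0, SR 12, RB (NLi (G (ActL 1)) 0 MulA) 8 4 0 0, SR 3, SR 4, SR 5, SR 6, SR 7,
    SR 2, SR 3, SR 4, SL 6, SR 2, SR 3, SR 5, SR 1, SR 2]"])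
        (simp only: good_simps assms simp_thms, simp del: One_nat_def add: pentagon_r0_4_3 co_pentagon_r1_2_3
      assms, code_simp)

text \<open>Left linearity of the section at the unit: c times the section of 1 is the section of
  c1, and \<open>mu_run\<close> removes the unit.\<close>

lemma free_act_split:
  assumes "good (G (ActL 1))" and "good (G Nab)" and "valid eq_nab_left_linear"
  shows "valid eq_free_act_split"
  by (rule certified[where L = "basic_gens @ [ActL 1, Nab]" and R = "[eq_spread_left_linear, eq_co_triangle_r1_1_2, eq_mu_run, eq_corun_inv_right, eq_triangle_r1_0_1, eq_asc_inv_right, eq_lun_inv_right]" and
    ss = "[RB (U 0) 4 0 0 0, SL 0, SL 3, SR 4, SL 5, SL 11, SL 12, SL 2, SR 3, SL 4, SL 10, SL 11, SL 1,
    SL 3, SL 2, RF (U 1) 3 5 0 0, RB (NR (G CoRunI) 0 (V 1)) 3 4 0 0, RF (CX UntA 0 (V 1)) 5 4 1 0,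
    SL 4, RF (CX MulA 0 (V 1)) 5 4 0 0, SR 2, SR 1, SR 0, RF (U 2) 4 1 0 1, SL 0, SL 1, SL 2, SL 3,
    RF (U 3) 4 4 0 1, SR 2, RF (NL (G LunI) 0 (V 0)) 0 1 0 0, SR 2, SR 1, SR 0, RF (U 4) 3 0 0 0,
    RF (U 5) 2 0 0 0, RF (U 6) 1 1 1 0, SR 2, SR 3, SR 1, SR 2]"])
        (simp only: good_simps assms simp_thms, simp del: One_nat_def add: spread_left_linear co_triangle_r1_1_2
      mu_run corun_inv_right triangle_r1_0_1 asc_inv_right lun_inv_right assms, code_simp)

text \<open>Both sides equal \<open>e_spread\<close>; classically, the separability element commutes
  with the elements of a.\<close>

lemma split_a_linear:
    assumes "good (G (ActL 1))" and "good (G Nab)" and "valid eq_act_x_assoc" and "valid eq_nab_left_linear" and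
    "valid eq_nab_right_linear"
  shows "valid eq_split_a_linear"
  by (rule certified[where L = "basic_gens @ [ActL 1, Nab]" and R = "[eq_split_act, eq_free_act_split]" and
    ss = "[RF (U 0) 0 0 0 0, RB (U 1) 0 0 0 0]"])
    (simp only: good_simps assms simp_thms, simp del: One_nat_def add: split_act free_act_split assms, code_simp)

lemma act_split:
    assumes "good (G (ActL 1))" and "good (G Nab)" and "valid eq_act_x_assoc" and "valid eq_act_x_unit" and "valid
    eq_nab_splits"
  shows "valid eq_act_split"
  by (rule certified[where L = "basic_gens @ [ActL 1, Nab]" and R = "[eq_act_x_assoc, eq_nab_splits, eq_act_x_unit, eq_lun_inv_right, eq_colun_inv_right]" and
    ss = "[RB (U 0) 5 0 0 0, RF (U 1) 4 1 0 1, SL 0, RF (U 2) 3 0 0 0, SR 0, SR 1, SR 2, SR 3,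
    RF (U 3) 4 0 0 0, RF (CY UntA 0 (V 1)) 1 0 0 0, RF (U 4) 0 1 0 0]"])
    (simp only: good_simps assms simp_thms, simp del: One_nat_def add: lun_inv_right colun_inv_right assms, code_simp)

lemma split_i_linear:
  assumes "good (G (ActL 1))" and "good (G (ActR 1))" and "good (G Nab)" and "valid eq_act_x_compatible"
  shows "valid eq_split_i_linear"
  by (rule certified[where L = "basic_gens @ [ActL 1, ActR 1, Nab]" and R = "[eq_co_kelly_left_r0_2_2, eq_kelly_left_r1_1_2, eq_co_pentagon_r1_0_3, eq_pentagon_r1_0_3, eq_act_x_compatible]" and
    ss = "[SR 0, SL 1, SL 7, SL 8, SL 0, SL 6, SL 7, RF (NLi (G (ActR 1)) 0 UntA) 2 2 0 0, SL 5, SL 6, SL 7,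
    SL 8, RF (U 0) 1 4 0 0, SL 2, SL 3, SL 4, SL 5, SL 6, SL 7, RB (CX Unt 0 Mul) 3 1 0 0,
    RB (NRi (G Eta) 0 Mul) 4 1 0 0, SL 2, SL 1, RF (U 1) 0 0 0 0,
    RF (NL (G (ActR 1)) 0 MulA) 10 4 0 0, SL 9, SL 10, SR 13, RB (U 2) 11 6 0 0, SR 8, SR 7,
    RB (CX (V 0) 0 Mul) 10 3 1 0, SR 9, SR 8, RB (CX (V 0) 1 Mul) 10 2 0 0, SR 9,
    RB (NRi (G Nab) 0 Mul) 5 1 0 0, RF (CY MulA 0 Mul) 9 4 0 0, RF (CY (V 0) 0 Mul) 8 3 1 0,
    RF (CY (V 0) 1 Mul) 7 2 0 0, SR 1, SR 2, SR 3, SR 4, RB (U 3) 5 0 0 0,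
    RF (NLi (G Asc) 0 (V 0)) 7 1 0 0, SR 10, SR 11, SR 12, SR 13, SR 9, SR 10, SR 11, SR 12,
    RB (U 4) 12 2 1 0, SR 0, SR 6, SR 8, SR 9, SR 10, SR 11, SR 7, SR 8, SR 9, SR 10, SR 6, SR 7,
    SL 9, SR 5, SR 6]"])
        (simp only: good_simps assms simp_thms, simp del: One_nat_def add: co_kelly_left_r0_2_2
      kelly_left_r1_1_2 co_pentagon_r1_0_3 pentagon_r1_0_3 assms, code_simp)

lemma retract_a_linear:
    assumes "good (G (ActL 1))" and "good (G (ActL 2))" and "good (G Nab)" and "good (G (Two 0 1 2))" and "valid
    eq_act_y_assoc" and "valid eq_act_x_assoc" and "valid eq_nab_left_linear" and "valid eq_nab_right_linear"
  shows "valid eq_retract_a_linear"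
  by (rule certified[where L = "basic_gens @ [ActL 1, ActL 2, Nab, Two 0 1 2]" and R = "[eq_split_a_linear, eq_act_y_assoc, eq_asc_inv_right, eq_coasc_inv_right]" and
    ss = "[RF (U 0) 0 0 0 0, SL 0, SL 6, SL 7, SL 9, SL 11, SR 14, SL 5, SL 6, SL 8, SL 10, SL 7, SL 9,
    SL 6, SL 8, SL 7, RB (NLi (G (Two 0 1 2)) 0 MulA) 13 4 0 0, SL 12, RF (U 1) 15 0 0 0, SR 7, SR 8,
    SR 9, SR 10, SR 11, SR 12, SR 13, SR 14, SR 15, RF (U 2) 16 0 0 0, SR 6, SR 7, SR 8, SR 9, SR 10,
    SR 11, SR 12, SR 13, SR 14, RF (CX (V 0) 0 Mul) 15 1 0 0, RF (CY MulA 0 (V 2)) 12 4 0 0,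
    RF (U 3) 11 5 0 0, SR 0, SR 6, SR 7, SR 5, SR 6]"])
        (simp only: good_simps assms simp_thms, simp del: One_nat_def add: split_a_linear asc_inv_right
      coasc_inv_right assms, code_simp)

lemma retract_i_linear:
    assumes "good (G (ActL 1))" and "good (G (ActL 2))" and "good (G (ActR 1))" and "good (G Nab)" and "good (G (Two
    0 1 2))" and "valid eq_act_x_compatible" and "valid eq_act_y_compatible" and "valid eq_h_i_linear"
  shows "valid eq_retract_i_linear"
  by (rule certified[where L = "basic_gens @ [ActL 1, ActL 2, ActR 1, Nab, Two 0 1 2]" and R = "[eq_split_i_linear, eq_h_i_linear, eq_act_y_compatible]" and
    ss = "[RF (U 0) 0 0 0 0, RF (U 1) 13 2 1 0, SR 12, SR 11, SL 10, RB (U 2) 11 0 0 0]"])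
    (simp only: good_simps assms simp_thms, simp del: One_nat_def add: split_i_linear assms, code_simp)

lemma retract_natural:
    assumes "good (G (ActL 3))" and "good (G (ActL 4))" and "good (G Nab)" and "good (G (Two 0 1 2))" and "good (G
    (Two 1 3 1))" and "good (G (Two 2 2 4))" and "valid eq_f_a_linear" and "valid eq_g_a_linear"
  shows "valid eq_retract_natural"
  by (rule certified[where L = "basic_gens @ [ActL 3, ActL 4, Nab, Two 0 1 2, Two 1 3 1, Two 2 2 4]" and R = "[eq_f_a_linear, eq_g_a_linear]" and
    ss = "[SL 0, SL 6, SL 7, SL 5, SL 6, RF (U 0) 9 2 1 0, SL 8, RB (U 1) 12 0 0 0,
    RB (NL (G (Two 1 3 1)) 0 MulA) 7 4 0 0, SR 6, SR 5, SR 4, SR 3,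
    RB (NLi (G (Two 1 3 1)) 0 UntA) 2 2 0 0, SR 0, SR 1, SR 7, SR 8, SL 0, SR 6, SR 7]"])
    (simp only: good_simps assms simp_thms, simp del: One_nat_def add: assms, code_simp)

text \<open>A linear h slides past the last action, after which the action meets the splitting and
  cancels it by \<open>act_split\<close>.\<close>

lemma retract_of_linear:
    assumes "good (G (ActL 1))" and "good (G (ActL 2))" and "good (G Nab)" and "good (G (Two 0 1 2))" and "valid
    eq_h_a_linear" and "valid eq_act_x_assoc" and "valid eq_act_x_unit" and "valid eq_nab_splits"
  shows "valid eq_retract_of_linear"
  by (rule certified[where L = "basic_gens @ [ActL 1, ActL 2, Nab, Two 0 1 2]" and R = "[eq_h_a_linear, eq_act_split]" and
    ss = "[RB (U 0) 10 0 0 0, RF (U 1) 0 0 0 0]"])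
    (simp only: good_simps assms simp_thms, simp del: One_nat_def add: act_split assms, code_simp)

section \<open>The canonical 2-cell, its inverse and the section given by an integral\<close>

lemma theta_left_linear:
  assumes "good (G The)" and "valid eq_theta_a_linear"
  shows "valid eq_theta_left_linear"
  by (rule certified[where L = "basic_gens @ [The]" and R = "[eq_theta_a_linear, eq_mul_zigzag_right, eq_eps_l]" and
    ss = "[SL 0, SL 1, SL 2, SL 7, SL 6, SL 5, SL 4, SL 3, RB (U 0) 4 1 0 0, SR 3, SR 4, SR 2,
    RF (U 1) 3 3 0 0, RB (NR (G Eps) 0 (V 0)) 1 2 0 0, RF (U 2) 0 1 0 1]"])
    (simp only: good_simps assms simp_thms, simp del: One_nat_def add: mul_zigzag_right eps_l assms, code_simp)

lemma mu_muh: "valid eq_mu_muh"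
  by (rule certified[where L = "basic_gens" and R = "[eq_mul_zigzag_right, eq_muh_def]" and
    ss = "[RB (U 0) 0 3 0 0, SL 1, RB (U 1) 0 0 0 0]"])
    (simp only: good_simps simp_thms, simp add: mul_zigzag_right muh_def, code_simp)

text \<open>Writing \<mu> through its transpose produces a counit of m against the unit contained in
  \<xi>; the zigzag identity removes both. Invertibility can then be shown for
  \<open>fusion\<close>, which no longer involves m^*.\<close>

lemma can_muh: "valid eq_can_muh"
  by (rule certified[where L = "basic_gens" and R = "[eq_mu_muh, eq_mul_zigzag_left]" and
    ss = "[RF (U 0) 3 0 0 0, SL 2, RF (U 1) 3 1 0 0]"])
    (simp only: good_simps simp_thms, simp add: mu_muh mul_zigzag_left, code_simp)

text \<open>Associativity of \<mu> after transposition. \<open>mate_eta\<close> converts the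
  coassociator hidden in the associativity of \<bullet> into an associator of m, so that only
  coherence cells of m remain.\<close>

lemma muh_assoc: "valid eq_muh_assoc"
  by (rule certified[where L = "basic_gens" and R = "[eq_muh_def, eq_mu_assoc, eq_mate_eta, eq_asc_inv_right]" and
    ss = "[RF (U 0) 0 1 0 1, RB (NRi (G EtaM) 0 (V 0)) 0 4 0 0, SL 2, RF (CY Mul 0 (V 0)) 3 2 0 0,
    RF (U 0) 3 0 0 0, SR 2, RF (U 1) 3 0 0 0, SR 1, RF (CY MulA 0 (V 0)) 2 4 0 0, SL 2, SL 3, SL 1,
    SL 2, SL 0, SL 1, RF (U 2) 2 5 0 0, SL 4, SL 5, RF (U 3) 6 1 0 0, SL 3, RB (U 0) 4 0 0 0,
    RB (U 0) 2 2 1 0]"])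
    (simp only: good_simps simp_thms, simp add: muh_def mu_assoc mate_eta asc_inv_right, code_simp)

text \<open>\<open>muh_assoc\<close> rebrackets x'(S(x'')y) as (x'S(x''))y, so that the antipode
  meets the other leg of \<delta>.\<close>

lemma mult_fusion_inv_first: "valid eq_mult_fusion_inv_first"
  by (rule certified[where L = "basic_gens" and R = "[eq_muh_assoc]" and
    ss = "[SL 4, SL 5, SL 7, SL 8, SL 9, SL 3, SL 6, SL 7, SL 8, SL 5, SL 6, SL 4, SL 5,
    RF (NLi (G Lun) 0 (V 0)) 14 2 0 0, SR 13, SL 16, SL 17, RF (NLi (G EpsM) 0 (V 0)) 14 3 0 1,
    SR 12, SR 13, SL 16, SL 17, SL 18, RF (NLi (G AscI) 0 (V 0)) 14 2 0 0, SR 11, SR 12, SR 13,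
    SL 16, SL 17, RF (NLi (G Muh) 0 (V 0)) 14 1 0 0, SR 8, SR 9, SR 10, SR 11, SR 12, SR 13, SR 14,
    RB (U 0) 15 0 0 0, SR 5, SR 6, SR 7, SR 8, SR 9, SR 10, SR 11, SR 12, SR 13, SR 14, SR 15, SR 4,
    SR 5, SR 6, SR 7, SR 8, SR 9, SR 10, SR 11, SR 12, SR 13, SR 14, SR 3, SR 5, SR 4]"])
    (simp only: good_simps simp_thms, simp add: muh_assoc, code_simp)

text \<open>Naturality of the interchangers collects the product of the two legs of \<delta>, and
  \<open>mu_muh\<close> undoes its transposition. What appears is the left side of the
  \<open>phi\<close> axiom, tensored and composed with the second argument.\<close>

lemma mult_fusion_inv_second: "valid eq_mult_fusion_inv_second"
  by (rule certified[where L = "basic_gens" and R = "[eq_mu_muh]" and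
    ss = "[SL 4, SL 5, SR 7, SR 8, SR 9, SL 14, SL 15, SL 20, SL 21, SL 22, SL 23, SL 3, SL 13, SL 14,
    SL 21, SL 12, SL 13, SL 20, SL 11, SL 12, SL 19, SL 10, SL 11, SL 9, SL 10, SL 8, SL 9, SL 7,
    SL 8, SL 6, SL 7, SL 5, SL 6, SL 4, SL 5, RB (NRi (ChI (V 0) 0 (V 0)) 0 (V 0)) 12 2 0 0,
    RB (CX (V 0) 0 (V 0)) 17 1 0 0, RF (NR (G Muh) 0 (V 0)) 15 1 0 0, RF (CY (V 0) 0 (V 0)) 14 3 1 0,
    RF (CY (V 0) 1 (V 0)) 13 2 0 0, SR 7, SR 8, SR 9, SR 10, SR 11, RF (CY Mul 0 (V 0)) 12 1 0 0,
    SR 7, SR 8, RF (NLi (ChI (V 0) 0 Mul) 0 (V 0)) 9 3 0 0, SR 6, SR 7, SR 8, SR 14, SR 13,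
    RB (NRi (G Muh) 0 Mul) 9 2 0 0, RF (CY Mul 0 Mul) 11 3 0 0, SR 13, SR 14, SR 15, SR 12, SR 13,
    SR 14, SR 11, SR 12, SR 13, SR 10, SR 11, SR 12, SR 9, SR 10, RB (U 0) 11 3 0 2, SR 5, SR 6,
    SR 7, SR 8, SR 9, SR 10, SR 11, SR 12, SR 16, SR 4, SR 5, SR 6, SR 7, SR 8, SR 9, SR 10, SR 11,
    SR 15, SR 3, SR 4, SR 5, SR 6, SR 7, SR 8, SR 9, SR 14, SR 2, SR 3, SR 4, SR 5, SR 6, SR 7,
    SR 13, SR 12, SR 11, SR 10, SR 9, SR 8, SR 7, SR 6]"])
    (simp only: good_simps simp_thms, simp add: mu_muh, code_simp)

lemma antipode_phi_transposed: "valid eq_antipode_phi_transposed"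
  by (rule certified[where L = "basic_gens" and R = "[eq_lun_inv_right, eq_ax_phi, eq_etac_def]" and
    ss = "[RB (U 0) 9 0 0 0, SL 8, RF (U 1) 0 0 0 0, SR 2, SR 3, RF (U 0) 4 0 0 0, RB (U 2) 2 0 0 1]"])
    (simp only: good_simps simp_thms, simp add: lun_inv_right ax_phi etac_def, code_simp)

lemma etac_alpha: "valid eq_etac_alpha"
  by (rule certified[where L = "basic_gens" and R = "[eq_alpha_def, eq_etac_def, eq_unt_zigzag_left]" and
    ss = "[RF (U 0) 1 0 0 0, RF (U 1) 0 0 0 1, SL 1, SL 2, SL 0, RF (U 2) 1 1 0 1]"])
    (simp only: good_simps simp_thms, simp add: alpha_def etac_def unt_zigzag_left, code_simp)

lemma eta_etah: "valid eq_eta_etah"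
  by (rule certified[where L = "basic_gens" and R = "[eq_unt_zigzag_right, eq_etah_def]" and
    ss = "[RB (U 0) 0 1 0 0, SL 1, RB (U 1) 0 0 0 0]"])
    (simp only: good_simps simp_thms, simp add: unt_zigzag_right etah_def, code_simp)

lemma muh_lun: "valid eq_muh_lun"
  by (rule certified[where L = "basic_gens" and R = "[eq_etah_def, eq_muh_def, eq_colunI_def, eq_mu_lun, eq_colun_inv_right]" and
    ss = "[RF (U 0) 0 1 0 1, RB (NRi (G EtaU) 0 (V 0)) 0 2 0 0, SL 2, RF (CY Unt 0 (V 0)) 3 2 0 0,
    RF (U 1) 3 0 0 0, SR 2, SR 4, SR 1, SR 3, SR 2, RB (U 2) 0 3 0 0, RF (U 3) 2 0 0 0,
    RF (CY UntA 0 (V 0)) 1 2 0 0, RF (U 4) 0 3 0 0]"])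
    (simp only: good_simps simp_thms, simp add: etah_def muh_def colunI_def mu_lun colun_inv_right, code_simp)

lemma muh_lun2: "valid eq_muh_lun2"
  by (rule certified[where L = "basic_gens" and R = "[eq_lun_inv_left, eq_muh_lun]" and
    ss = "[RB (U 0) 3 1 0 0, RF (U 1) 0 0 0 0]"])
    (simp only: good_simps simp_thms, simp add: lun_inv_left muh_lun, code_simp)

text \<open>\<alpha> after \<open>Etac\<close> creates a unit of a, and multiplication by that unit
  is removed by \<open>muh_lun2\<close>.\<close>

lemma etac_mult: "valid eq_etac_mult"
  by (rule certified[where L = "basic_gens" and R = "[eq_etac_alpha, eq_eta_etah, eq_muh_lun2, eq_lun_inv_right, eq_alpha_def]" and
    ss = "[RF (U 0) 0 0 0 0, RF (U 1) 1 1 0 1, RF (NR (G EpsU) 0 (V 0)) 2 2 0 0, SR 1, SL 4, SR 0,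
    RF (U 2) 2 0 0 0, RF (U 3) 1 0 0 0, RB (U 4) 1 1 0 0]"])
    (simp only: good_simps simp_thms, simp add: etac_alpha eta_etah muh_lun2 lun_inv_right alpha_def, code_simp)

lemma mult_fusion_inv_counit: "valid eq_mult_fusion_inv_counit"
  by (rule certified[where L = "basic_gens" and R = "[eq_etac_mult, eq_alpha_counit]" and
    ss = "[SL 6, SL 7, RF (NRi (G Etac) 0 Mul) 2 1 0 0, SR 6, SR 5, RF (NRi (G Etac) 0 (V 0)) 3 0 0 0,
    RF (U 0) 4 0 0 0, RF (CY UntA 0 (V 0)) 3 0 0 0, RF (U 1) 1 1 0 0]"])
    (simp only: good_simps simp_thms, simp add: etac_mult alpha_counit, code_simp)

text \<open>In elements, x'(S(x'')y) = \<epsilon>(x)y. Between the rebracketing and the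
  \<open>phi\<close> axiom the contraction \<open>e_Z1\<close> has to be exchanged for
  \<open>e_Z2\<close>.\<close>

lemma mult_fusion_inv: "valid eq_mult_fusion_inv"
  by (rule certified[where L = "basic_gens" and R = "[eq_mult_fusion_inv_first, eq_counit_slide, eq_mult_fusion_inv_second, eq_antipode_phi_transposed, eq_mult_fusion_inv_counit]" and
    ss = "[RF (U 0) 0 0 0 0, RF (U 1) 18 1 0 0, RF (U 2) 0 0 0 0, RF (U 3) 0 2 0 1, RF (U 4) 0 0 0 0]"])
        (simp only: good_simps simp_thms, simp add: mult_fusion_inv_first counit_slide mult_fusion_inv_second
      antipode_phi_transposed mult_fusion_inv_counit, code_simp)

text \<open>Coassociativity regroups the three legs of \<delta> so that
  \<open>mult_fusion_inv\<close> applies to two of them; the counit law removes the \<epsilon> that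
  is left.\<close>

lemma fusion_inv_right: "valid eq_fusion_inv_right"
  by (rule certified[where L = "basic_gens" and R = "[eq_del_coassoc, eq_mult_fusion_inv, eq_eps_r]" and
    ss = "[SL 4, SL 5, SL 7, SL 8, SL 9, SL 3, SL 6, SL 7, SL 8, SL 5, SL 6, SL 4, SL 5,
    RB (CX (V 0) 0 (V 0)) 18 1 0 0, RF (NR (G Del) 0 (V 0)) 16 1 0 0, RF (CY (V 0) 0 (V 0)) 15 1 0 0,
    SR 14, SR 13, SR 12, SR 11, SR 10, SR 9, SR 8, SR 7, SR 6, SR 5, SR 4, SR 3, SR 2, SR 1,
    RF (U 0) 0 2 0 1, SR 6, SR 7, SR 9, SR 10, SR 5, SR 6, SR 8, SR 9, SR 4, SR 7, SR 8, SR 6, SR 5,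
    RF (U 1) 1 0 0 0, RF (U 2) 0 2 0 1]"])
    (simp only: good_simps simp_thms, simp add: del_coassoc mult_fusion_inv eps_r, code_simp)

lemma can_inv_right: "valid eq_can_inv_right"
  by (rule certified[where L = "basic_gens" and R = "[eq_can_muh, eq_fusion_inv_right]" and
    ss = "[RF (U 0) 16 0 0 0, RF (U 1) 0 0 0 0]"])
    (simp only: good_simps simp_thms, simp add: can_muh fusion_inv_right, code_simp)

text \<open>\<delta> is multiplicative: (bx)' and (bx)''y become b'x' and (b''x'')y, and
  \<open>mu_assoc\<close> rebrackets the second factor as b''(x''y). The remaining moves are
  coherence.\<close>

lemma can_left_linear: "valid eq_can_left_linear"
  by (rule certified[where L = "basic_gens" and R = "[eq_del_mu, eq_mu_assoc, eq_asc_inv_right, eq_mate_eta]" and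
    ss = "[SL 1, RF (U 0) 4 1 0 1, SL 3, SL 4, SL 5, SL 6, SL 8, SL 2, SL 3, SL 4, SL 5, SL 7, SL 2, SL 6,
    SR 1, RB (NR (G Del) 0 Mul) 0 1 0 0, SR 7, SR 8, SR 9, SR 10, SR 11, RF (U 1) 12 0 0 0, SR 3,
    SR 4, SR 5, SR 6, SR 7, SR 8, SR 9, SR 10, SR 11, SR 12, RF (U 2) 13 0 0 0, SR 2, SR 3, SR 4,
    SR 5, SR 6, SR 7, SR 8, SR 9, SR 10, SR 11, RF (CX (V 0) 0 Mul) 12 1 0 0, SL 9,
    RF (NR (G Mu) 0 (V 0)) 7 5 0 0, RF (CY MulA 0 (V 0)) 6 8 0 0, SL 5, SL 6, SL 7, SL 9, SL 10,
    SL 11, SL 12, SL 13, SR 4, SR 5, SL 8, SL 9, SL 10, SL 11, SL 12,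
    RF (NR (G EtaM) 0 (V 0)) 6 4 0 0, RF (U 3) 6 5 0 0, SL 8, SL 9, SL 7,
    RB (NL (G EtaM) 0 (V 0)) 6 5 0 0, SR 1, SR 3, SR 5, SL 8, SR 2, SR 4, SR 3,
    RB (NL (G Mu) 0 (V 0)) 4 2 0 0, SR 0, SR 1, SR 2, SR 3, SL 6, SR 8, SR 9, SR 10, SR 8]"])
    (simp only: good_simps simp_thms, simp add: del_mu mu_assoc asc_inv_right mate_eta, code_simp)

text \<open>The step S(x')(x''y) = (S(x')x'')y. \<open>alpha_asc\<close> and the pentagon make room
  for \<open>muh_assoc\<close>, after which the product of the legs is the left side of the
  \<open>psi\<close> axiom.\<close>

lemma antipode_cancel_regroup: "valid eq_antipode_cancel_regroup"
  by (rule certified[where L = "basic_gens" and R = "[eq_alpha_asc, eq_pentagon, eq_muh_assoc, eq_asc_inv_left, eq_mu_muh]" and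
    ss = "[SR 2, SL 6, SL 7, SL 9, SL 10, SL 11, SL 5, SL 8, SL 9, SL 10, SL 7, SL 8, SL 6, SL 7,
    RF (NLi (G Muh) 0 UntA) 3 0 0 0, SL 6, SL 7, RF (NLi (G Muh) 0 Mul) 8 1 0 0, SL 11,
    RB (NR (G Sig) 0 (V 0)) 1 2 0 0, RF (CX UntA 1 (V 0)) 6 2 0 0, SL 5, SL 6, SL 7, SL 8,
    RF (CX Mul 1 (V 0)) 9 3 0 0, SL 4, SL 5, SL 6, SL 7, SL 8, SL 9, SL 10, SL 3, SL 4, SL 5, SL 6,
    SL 7, SL 8, SL 9, SL 2, SL 3, SL 4, SL 5, SL 6, SL 7, SL 8, RB (CY (V 0) 0 (V 0)) 11 3 1 1,
    RB (CY (V 0) 0 Mul) 12 2 1 0, RB (NL (G Muh) 0 (V 0)) 13 2 1 0, RF (CX (V 0) 0 Mul) 15 3 1 0,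
    RF (CX (V 0) 0 (V 0)) 14 2 1 0, SL 10, SL 11, SL 9, SL 10, RB (U 0) 3 0 0 0, SR 5, SR 4, SR 3,
    RF (U 1) 6 0 0 0, SR 8, SR 10, SR 11, SR 9, SR 10, RB (U 2) 11 1 1 0, RF (U 3) 14 2 1 0, SL 3,
    SL 4, SR 8, SR 9, SR 7, SR 8, SR 6, SR 7, SR 5, SR 6, SR 4, SR 5, SR 3, SR 4, SR 2, SR 3,
    RB (CX (V 0) 1 (V 0)) 10 4 1 0, SR 9, SR 8, SR 7, SR 6, SR 5, SR 4, RB (CX Mul 1 (V 0)) 8 3 0 0,
    SR 7, SR 6, SR 5, RB (CX UntA 1 (V 0)) 6 2 0 0, RF (NR (G Sig) 0 (V 0)) 1 2 0 0, SR 15,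
    RB (CY MulA 0 (V 0)) 14 4 1 0, RB (NR (G EpsM) 0 (V 0)) 15 3 1 0, SR 6, SR 7, SR 10, SR 13, SR 5,
    SR 6, SR 9, SR 12, SR 4, SR 8, SR 11, SR 7, SR 10, SR 6, SR 9, SR 5, SR 8, SR 7, SR 6,
    RB (NR (G Sig) 0 (V 0)) 1 2 0 0, RF (CX UntA 1 (V 0)) 6 2 0 0, RF (CX Mul 1 (V 0)) 5 3 0 0,
    RF (CX (V 0) 1 (V 0)) 4 4 1 0, RF (CX MulA 0 (V 0)) 3 5 1 0, SL 2, SL 3, SL 4, SL 5, SL 6, SL 7,
    SL 8, SL 9, SL 10, RB (U 4) 9 2 1 1, SR 7, SR 8, SR 6, SR 5, SR 4]"])
    (simp only: good_simps simp_thms, simp add: alpha_asc pentagon muh_assoc asc_inv_left mu_muh, code_simp)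

lemma antipode_psi_transposed: "valid eq_antipode_psi_transposed"
  by (rule certified[where L = "basic_gens" and R = "[eq_corun_inv_right, eq_ax_psi, eq_etah_def]" and
    ss = "[RB (U 0) 9 3 0 0, SR 8, RF (U 1) 0 0 0 0, SL 1, SL 2, SL 3, RF (U 0) 4 3 0 0, RB (U 2) 2 1 1 0]"])
    (simp only: good_simps simp_thms, simp add: corun_inv_right ax_psi etah_def, code_simp)

lemma antipode_cancel_counit: "valid eq_antipode_cancel_counit"
  by (rule certified[where L = "basic_gens" and R = "[eq_muh_lun, eq_triangle, eq_run_inv_right]" and
    ss = "[SL 2, RF (U 0) 3 1 1 0, RF (U 1) 2 0 0 0, RF (U 2) 1 1 0 1]"])
    (simp only: good_simps simp_thms, simp add: muh_lun triangle run_inv_right, code_simp)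

text \<open>In elements, S(x')(x''y) = \<epsilon>(x)y. With coassociativity and the counit law it
  yields \<open>fusion_inv_left\<close>, as \<open>mult_fusion_inv\<close> yields
  \<open>fusion_inv_right\<close>.\<close>

lemma antipode_cancel: "valid eq_antipode_cancel"
  by (rule certified[where L = "basic_gens" and R = "[eq_antipode_cancel_regroup, eq_antipode_psi_transposed, eq_antipode_cancel_counit]" and
    ss = "[RF (U 0) 0 0 0 0, RF (U 1) 0 1 0 1, RF (U 2) 0 0 0 0]"])
        (simp only: good_simps simp_thms, simp add: antipode_cancel_regroup antipode_psi_transposed
      antipode_cancel_counit, code_simp)

lemma fusion_inv_left: "valid eq_fusion_inv_left"
  by (rule certified[where L = "basic_gens" and R = "[eq_del_coassoc, eq_antipode_cancel, eq_eps_r]" and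
    ss = "[SR 2, SL 7, SL 8, SL 10, SL 11, SL 12, SL 6, SL 9, SL 10, SL 11, SL 8, SL 9, SL 7, SL 8,
    RB (NR (G Del) 0 (V 0)) 1 2 0 0, RF (U 0) 0 1 0 1, SR 1, SR 9, SR 10, SR 12, SR 13, SR 8, SR 9,
    SR 11, SR 12, SR 7, SR 10, SR 11, SR 9, SR 8, RF (U 1) 2 0 0 0, SL 1,
    RF (CX (V 0) 0 (V 0)) 2 1 0 0, RF (U 2) 0 1 0 1]"])
    (simp only: good_simps simp_thms, simp add: del_coassoc antipode_cancel eps_r, code_simp)

lemma can_inv_left: "valid eq_can_inv_left"
  by (rule certified[where L = "basic_gens" and R = "[eq_can_muh, eq_fusion_inv_left]" and
    ss = "[RF (U 0) 0 0 0 0, RF (U 1) 0 0 0 0]"])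
    (simp only: good_simps simp_thms, simp add: can_muh fusion_inv_left, code_simp)

text \<open>Conjugation by \<open>can\<close>: it intertwines the free action with
  \<open>diagL\<close>, for which \<open>thetaA\<close> is linear by
  \<open>theta_left_linear\<close>. The certificate inserts \<open>can\<close> after its inverse in
  order to use this.\<close>

lemma section_left_linear:
  assumes "good (G The)" and "valid eq_theta_a_linear"
  shows "valid eq_section_left_linear"
  by (rule certified[where L = "basic_gens @ [The]" and R = "[eq_theta_left_linear, eq_can_inv_right, eq_can_left_linear, eq_can_inv_left]" and
    ss = "[RB (U 0) 0 0 0 0, SL 0, SR 3, SL 5, SL 7, SL 13, SL 14, SL 16, SL 17, SL 18, SL 6, SL 12, SL 15,
    SL 16, SL 17, SL 5, SL 14, SL 15, SL 13, SL 14, RB (U 1) 2 3 1 0, SR 0, SR 1, SR 2, SR 3, SR 4,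
    SR 5, SR 6, SR 7, SR 8, SR 9, SR 10, SR 11, SR 12, SR 13, SR 14, SR 15, SR 16, SR 17, SR 18,
    SR 19, SR 20, SL 23, SR 25, SR 26, SR 27, SR 34, SR 35, SR 37, SR 38, SR 25, SR 33, SR 34, SR 36,
    SR 37, SR 32, SR 35, SR 36, SR 34, SR 33, RB (U 2) 17 0 0 0, RF (U 3) 22 0 0 0]"])
        (simp only: good_simps assms simp_thms, simp del: One_nat_def add: theta_left_linear can_inv_right
      can_left_linear can_inv_left assms, code_simp)

lemma theta_right_linear:
  assumes "good (G The)" and "valid eq_theta_i_linear"
  shows "valid eq_theta_right_linear"
  by (rule certified[where L = "basic_gens @ [The]" and R = "[eq_theta_i_linear, eq_mul_zigzag_right]" and
    ss = "[SL 5, SL 6, SL 8, SL 7, SL 6, SL 5, RF (NR (G The) 0 (V 0)) 0 2 0 0, SL 0, SL 1, SR 4, SR 3,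
    RB (U 0) 2 1 0 0, SR 1, RF (U 1) 0 3 0 0]"])
    (simp only: good_simps assms simp_thms, simp del: One_nat_def add: mul_zigzag_right assms, code_simp)

text \<open>Only the second leg is affected: (x''y)b = x''(yb), an instance of
  \<open>mu_assoc\<close>. The length of the certificate comes from moving the third factor past the
  interchangers and the unit of m.\<close>

lemma can_right_linear: "valid eq_can_right_linear"
  by (rule certified[where L = "basic_gens" and R = "[eq_mul_zigzag_right, eq_asc_inv_right, eq_mate_eta, eq_mu_assoc]" and
    ss = "[SL 1, SL 2, SL 4, SL 0, SL 1, SL 3, SL 2, RB (NRi (G Del) 0 Mul) 1 1 0 0,
    RF (NL (G Mu) 0 (V 0)) 6 2 0 0, SR 3, SR 4, RF (CY (V 0) 0 Mul) 5 2 0 0, SL 4, SL 5, SL 3,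
    RB (U 0) 7 6 1 0, SL 6, SL 8, SL 9, SL 10, SL 11, SL 7, SL 8, SL 9, SL 10,
    RB (CX (V 0) 0 Mul) 9 3 0 0, SR 8, RF (NL (G EtaM) 0 (V 0)) 6 5 0 0, SL 8, SL 9, SR 7,
    RB (U 1) 10 1 0 0, SR 9, SR 8, RB (U 2) 6 5 0 0, SR 0, SR 2, SR 3, SR 4, SR 5, SR 6, SR 7, SR 1,
    SR 2, SR 3, SR 4, SR 5, SR 6, RB (CY MulA 0 (V 0)) 6 4 0 0, SL 5, RB (U 3) 7 0 0 0, SR 1, SL 6,
    RB (CX (V 0) 0 (V 0)) 4 3 1 0, RB (NL (Ch (V 0) 0 (V 0)) 0 (V 0)) 2 3 0 0,
    RB (CY Mul 0 (V 0)) 9 2 0 0, SR 8, RF (NRi (G EtaM) 0 (V 0)) 6 4 0 0,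
    RB (NR (Ch (V 0) 0 (V 0)) 0 (V 0)) 2 3 0 0, RF (CX (V 0) 0 (V 0)) 4 3 1 0, SL 1, SL 3, SL 4,
    SR 8, SR 9, SR 10, SR 11, SL 2, SL 3, SR 9, SR 8]"])
    (simp only: good_simps simp_thms, simp add: mul_zigzag_right asc_inv_right mate_eta mu_assoc, code_simp)

lemma section_right_linear:
  assumes "good (G The)" and "valid eq_theta_i_linear"
  shows "valid eq_section_right_linear"
  by (rule certified[where L = "basic_gens @ [The]" and R = "[eq_theta_right_linear, eq_can_inv_right, eq_can_right_linear, eq_can_inv_left]" and
    ss = "[RB (U 0) 0 0 0 0, SL 5, SL 6, SL 8, SL 9, SL 10, SL 11, SL 12, SL 13, SL 14, SL 15, SL 16, SL 17,
    SL 18, SL 19, SL 20, SL 21, SL 22, SL 23, SL 24, SL 7, SL 8, SL 9, SL 10, SL 11, SL 12, SL 13,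
    SL 14, SL 15, SL 16, SL 17, SL 18, SL 19, SL 20, SL 21, SL 22, SL 23, SL 6, SL 12, SL 13, SL 15,
    SL 16, SL 17, SL 5, SL 11, SL 14, SL 15, SL 16, SL 13, SL 14, SL 12, SL 13, RB (U 1) 1 1 0 1,
    SR 25, SR 26, SR 33, SR 34, SR 36, SR 37, SR 43, SR 44, SR 32, SR 33, SR 35, SR 36, SR 42, SR 43,
    SR 31, SR 34, SR 35, SR 41, SR 42, SR 33, SR 40, SR 41, SR 32, SR 39, SR 40, SR 38, SR 39, SR 37,
    SR 38, SR 36, SR 37, SR 35, SR 36, SR 34, SR 35, SR 33, SR 34, SR 32, SR 33, SR 31, SR 32, SR 30,
    SR 31, SR 29, SR 30, SR 28, SR 29, SR 27, SR 28, SR 26, SR 25, RB (U 2) 17 0 0 0,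
    RF (U 3) 22 0 0 0]"])
        (simp only: good_simps assms simp_thms, simp del: One_nat_def add: theta_right_linear can_inv_right
      can_right_linear can_inv_left assms, code_simp)

lemma counit_can: "valid eq_counit_can"
  by (rule certified[where L = "basic_gens" and R = "[eq_mul_zigzag_right, eq_eps_l]" and
    ss = "[SR 3, SR 4, SR 2, RF (U 0) 3 3 0 0, RB (NR (G Eps) 0 (V 0)) 1 2 0 0, RF (U 1) 0 1 0 1]"])
    (simp only: good_simps simp_thms, simp add: mul_zigzag_right eps_l, code_simp)

text \<open>By \<open>counit_can\<close>, \<mu> is the counit after \<open>can\<close>. Hence \<mu>
  after \<open>nabla\<close> is the counit after \<open>thetaA\<close>, which is the identity by
  normalization.\<close>

lemma section_splits:
  assumes "good (G The)" and "valid eq_theta_normalized"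
  shows "valid eq_section_splits"
  by (rule certified[where L = "basic_gens @ [The]" and R = "[eq_counit_can, eq_can_inv_right, eq_theta_normalized]" and
    ss = "[RB (U 0) 17 0 0 0, RF (U 1) 1 0 0 0, RF (U 2) 0 1 0 0]"])
    (simp only: good_simps assms simp_thms, simp del: One_nat_def add: counit_can can_inv_right assms, code_simp)

end

section \<open>Duality\<close>

text \<open>The two reversals are made together because then the interchanger with its arguments
  exchanged already has the required direction. Either reversal alone would call for its
  inverse.\<close>

definition opp :: "('o, 'f, 't, 'z) gray_scheme \<Rightarrow> ('o, 'f, 't) gray" where
  "opp B = \<lparr>src = trg B, trg = src B, dom2 = dom2 B, cod2 = cod2 B, id1 = id1 B,
     comp1 = (\<lambda>g f. comp1 B f g), id2 = id2 B, vcomp = vcomp B, hcomp = (\<lambda>t s. hcomp B s t),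
     unit0 = unit0 B, ten0 = (\<lambda>X Y. ten0 B Y X), lw1 = (\<lambda>A f. rw1 B f A), lw2 = (\<lambda>A t. rw2 B t A),
     rw1 = (\<lambda>f A. lw1 B A f), rw2 = (\<lambda>t A. lw2 B A t), intch = (\<lambda>f g. intch B g f)\<rparr>"

lemma opp_simps [simp]: "src (opp B) = trg B" "trg (opp B) = src B" "dom2 (opp B) = dom2 B" "cod2 (opp B) = cod2 B"
  "id1 (opp B) = id1 B" "comp1 (opp B) g f = comp1 B f g" "id2 (opp B) = id2 B" "vcomp (opp B) = vcomp B"
  "hcomp (opp B) t s = hcomp B s t" "unit0 (opp B) = unit0 B" "ten0 (opp B) X Y = ten0 B Y X"
  "lw1 (opp B) A f = rw1 B f A" "lw2 (opp B) A t = rw2 B t A" "rw1 (opp B) f A = lw1 B A f"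
  "rw2 (opp B) t A = lw2 B A t" "intch (opp B) f g = intch B g f"
  by (simp_all add: opp_def)

lemma opp_hom [simp]: "hom1 (opp B) X Y = hom1 B Y X" "hom2 (opp B) = hom2 B"
  "inverse_2cells (opp B) = inverse_2cells B" "iso2 (opp B) = iso2 B" "inv2 (opp B) = inv2 B"
proof -
  show i: "inverse_2cells (opp B) = inverse_2cells B"
    by (intro ext) (simp add: inverse_2cells_def hom2_def)
  show "hom1 (opp B) X Y = hom1 B Y X" "hom2 (opp B) = hom2 B" "iso2 (opp B) = iso2 B" "inv2 (opp B) = inv2 B"
    by (auto simp: hom1_def hom2_def iso2_def inv2_def i fun_eq_iff)
qed

context gray_monoid
begin

lemma opp_gray_monoid: "gray_monoid (opp B)"
proof
  fix f g h :: 'b and s t r s' t' :: 'c and X Y Z A X' Y' X'' Y'' :: 'a and f' g' :: 'b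
  show "\<lbrakk>cod2 (opp B) s = dom2 (opp B) s'; cod2 (opp B) t = dom2 (opp B) t'; trg (opp B) (dom2 (opp B) s) = src (opp B) (dom2 (opp B) t)\<rbrakk>
     \<Longrightarrow> hcomp (opp B) (vcomp (opp B) t' t) (vcomp (opp B) s' s) = vcomp (opp B) (hcomp (opp B) t' s') (hcomp (opp B) t s)"
    using middle_four[of t t' s s'] by simp
  show "\<lbrakk>f \<in> hom1 (opp B) X X'; f' \<in> hom1 (opp B) X' X''; g \<in> hom1 (opp B) Y Y'\<rbrakk> \<Longrightarrow> intch (opp B) (comp1 (opp B) f' f) g =
      vcomp (opp B) (hcomp (opp B) (intch (opp B) f' g) (id2 (opp B) (rw1 (opp B) f Y)))
        (hcomp (opp B) (id2 (opp B) (rw1 (opp B) f' Y')) (intch (opp B) f g))"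
    using intch_comp_right[of g Y' Y f' X'' X' f X] by simp
  show "\<lbrakk>f \<in> hom1 (opp B) X X'; g \<in> hom1 (opp B) Y Y'; g' \<in> hom1 (opp B) Y' Y''\<rbrakk> \<Longrightarrow> intch (opp B) f (comp1 (opp B) g' g) =
      vcomp (opp B) (hcomp (opp B) (id2 (opp B) (lw1 (opp B) X' g')) (intch (opp B) f g))
        (hcomp (opp B) (intch (opp B) f g') (id2 (opp B) (lw1 (opp B) X g)))"
    using intch_comp_left[of g' Y'' Y' g Y f X' X] by simp
  show "\<lbrakk>s \<in> hom2 (opp B) f f'; t \<in> hom2 (opp B) g g'; f \<in> hom1 (opp B) X X'; g \<in> hom1 (opp B) Y Y'\<rbrakk> \<Longrightarrow>
     vcomp (opp B) (intch (opp B) f' g') (hcomp (opp B) (rw2 (opp B) s Y') (lw2 (opp B) X t)) =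
       vcomp (opp B) (hcomp (opp B) (lw2 (opp B) X' t) (rw2 (opp B) s Y)) (intch (opp B) f g)"
    using intch_natural[of t g g' s f f' Y' Y X' X] by simp
qed (simp_all add: src_dom_cod trg_dom_cod hcomp_id_left[unfolded trg_dom_cod] hcomp_id_right[unfolded src_dom_cod] id1_hom comp1_hom comp1_assoc comp1_id_left comp1_id_right id2_hom
    vcomp_hom vcomp_assoc vcomp_id_left vcomp_id_right hcomp_hom hcomp_assoc hcomp_id_left hcomp_id_right hcomp_id2
    lw1_hom lw2_hom lw1_id lw1_comp lw2_id lw2_vcomp lw2_hcomp rw1_hom rw2_hom rw1_id rw1_comp rw2_id rw2_vcomp rw2_hcomp
    ten0_assoc ten0_unit_left ten0_unit_right lw1_unit lw2_unit rw1_unit rw2_unit lw1_ten lw2_ten rw1_ten rw2_ten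
    lw1_rw1 lw2_rw2 intch_hom intch_iso intch_id_left intch_id_right intch_lw intch_mid intch_rw)

end

context diagrams
begin

lemma mirw_simps [simp]: "mirw [] = []" "mirw ((p, f, q) # w) = mirw w @ [(q, amir f, p)]"
  "mirw (v @ w) = mirw w @ mirw v"
  by (simp_all add: mirw_def)

lemma amir_arity [simp]: "ain (amir f) = aout f" "aout (amir f) = ain f"
  by (cases f; simp)+

lemma wok_mirw: "wok k w \<Longrightarrow> wok (sr k w) (mirw w) \<and> sr (sr k w) (mirw w) = k"
  by (induction k w rule: wok.induct) (auto simp: add_ac)

definition Fm :: "atom \<Rightarrow> 'f" where
  "Fm f = F (amir f)"

definition Tm :: "gen \<Rightarrow> 't" where
  "Tm g = sem (gmir g)"

text \<open>The recursion for \<open>pow\<close> adds a factor on the left, its reversal one on the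
  right.\<close>

lemma pow_comm: "M \<otimes>\<^sub>0 pow n = pow n \<otimes>\<^sub>0 M"
  using pow_add[of n 1] pow_add[of 1 n] by (simp add: ten0_unit_right)

lemma opp_pow: "gray_object.pow (opp B) M n = pow n"
proof -
  interpret o: gray_object "opp B" M
    by (simp add: gray_object_def opp_gray_monoid)
  show ?thesis by (induction n) (simp_all add: pow_comm)
qed

lemma opp_diagrams: "diagrams (opp B) M Fm"
proof -
  interpret o: gray_object "opp B" M
    by (simp add: gray_object_def opp_gray_monoid)
  show ?thesis
    by unfold_locales (use F_hom[of "amir _"] in \<open>simp add: opp_pow Fm_def\<close>)
qed

lemma opp_lt: "diagrams.lt (opp B) M Fm (p, f, q) = lt (q, amir f, p)"
proof -
  interpret o: diagrams "opp B" M Fm Tm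
    by (rule opp_diagrams)
  show ?thesis by (simp add: o.lt_def lt_def opp_pow o.pad1_def pad1_def lw1_rw1 Fm_def)
qed

lemma opp_ev: "wok k w \<Longrightarrow> diagrams.ev (opp B) M Fm k w = ev (sr k w) (mirw w)"
proof (induction k w rule: wok.induct)
  case (1 k)
  interpret o: diagrams "opp B" M Fm Tm by (rule opp_diagrams)
  show ?case by (simp add: opp_pow o.ev.simps(1))
next
  case (2 k p f q w)
  interpret o: diagrams "opp B" M Fm Tm by (rule opp_diagrams)
  have w: "wok (p + ain f + q) w" using 2 by simp
  note m = wok_mirw[OF w]
  have e: "sr (sr (p + ain f + q) w) (mirw w) = q + aout (amir f) + p" using m by simp
  have "ev (sr (p + ain f + q) w) (mirw w @ [(q, amir f, p)])
      = ev (sr (p + ain f + q) w) (mirw w) \<cdot> ev (q + aout (amir f) + p) [(q, amir f, p)]"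
    using m e by (subst ev_append) simp_all
  also have "ev (q + aout (amir f) + p) [(q, amir f, p)] = lt (q, amir f, p)"
    by (rule ev_single) simp
  finally show ?case using 2 w by (simp add: opp_lt)
qed

lemma tg_wok: "wok k w \<Longrightarrow> tg n w = (if w = [] then n else k)"
  by (cases w) (auto simp: tg_def)

lemma tg_mirw: "wok k w \<Longrightarrow> tg k (mirw w) = sr k w"
  using wok_mirw[of k w] tg_wok[of "sr k w" "mirw w" k] by (cases w) auto

text \<open>The clauses of \<open>mirror\<close> follow the operations of \<open>opp\<close>, so
  evaluation in the reversed Gray monoid becomes evaluation of a rewritten expression in the
  original one.\<close>

lemma opp_sem:
  "compile s = Some (k, w, D, v) \<Longrightarrow> diagrams.sem (opp B) M Fm Tm s = sem (mirror s)"
proof (induction s arbitrary: k w D v)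
  interpret o: diagrams "opp B" M Fm Tm by (rule opp_diagrams)
  {
    case (Cell g)
    show ?case unfolding mirror.simps using o.sem.simps(1)[of g] Tm_def[of g] by (rule trans)
  next
    case (Id k' w')
    then show ?case using opp_ev[of k' w'] by (auto split: if_splits)
  next
    case (Chi m f n g)
    then have *: "wok (tg m f) f" "wok (tg n g) g" "sr (tg m f) f = m" "sr (tg n g) g = n"
      by (auto simp: Let_def split: if_splits)
    show ?case
      using * opp_ev[OF *(1)] opp_ev[OF *(2)] tg_mirw[OF *(1)] tg_mirw[OF *(2)] by simp
  next
    case (ChiInv m f n g)
    then have *: "wok (tg m f) f" "wok (tg n g) g" "sr (tg m f) f = m" "sr (tg n g) g = n"
      by (auto simp: Let_def split: if_splits)
    show ?case
      using * opp_ev[OF *(1)] opp_ev[OF *(2)] tg_mirw[OF *(1)] tg_mirw[OF *(2)] by simp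
  next
    case (VC s t)
    then show ?case by (auto split: option.splits if_splits)
  next
    case (HC s t)
    then show ?case by (auto split: option.splits if_splits)
  next
    case (LW p s)
    then show ?case by (auto simp: opp_pow split: option.splits)
  next
    case (RW s q)
    then show ?case by (auto simp: opp_pow split: option.splits)
  }
qed

text \<open>The check, generator by generator, that images under \<open>gmir\<close> have the
  reversed boundary; \<open>opp_good\<close> turns it into typing in the reversed Gray
  monoid.\<close>

lemma gmir_compile: "map_option (\<lambda>(k, w, D, v). (k, w, v)) (compile (gmir g)) = Some (gin g, mirw (gdom g), mirw (gcod g))"
  by (cases g) (simp_all add: muc_expr_def mirw_def sh_def shd_def numeral_2_eq_2)

lemma opp_good:
  assumes "\<forall>h \<in> set (gens (gmir g)). good (G h)"
  shows "diagrams.good (opp B) M Fm Tm (G g)"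
proof -
  interpret o: diagrams "opp B" M Fm Tm by (rule opp_diagrams)
  obtain D where c: "compile (gmir g) = Some (gin g, mirw (gdom g), D, mirw (gcod g))"
    using gmir_compile[of g] by (cases "compile (gmir g)") auto
  have g: "goods D" by (rule goods_gens[OF c assms])
  have "sem (gmir g) \<in> hom2 B (ev (gin g) (mirw (gdom g))) (ev (gin g) (mirw (gcod g)))"
    using compile_sound[OF c g] dev_hom[OF _ _ g] by metis
  then show ?thesis
    using opp_ev[of "gout g" "gdom g"] opp_ev[of "gout g" "gcod g"] cell_wok[of "G g"]
    by (simp add: o.good_def Tm_def)
qed

end

definition wf_eq :: "gen list \<Rightarrow> expr \<times> expr \<Rightarrow> bool" where
  "wf_eq L e \<longleftrightarrow> list_all (\<lambda>g. g \<in> set L) (gens (fst e) @ gens (snd e)) \<and>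
     (case (compile (fst e), compile (snd e)) of
        (Some (k, w, D, v), Some (k', w', D', v')) \<Rightarrow> k = k' \<and> w = w' \<and> v = v' | _ \<Rightarrow> False)"

context diagrams
begin

lemma valid_wf:
  assumes "good_gens L" "wf_eq L e" "sem (fst e) = sem (snd e)"
  shows "valid e"
proof -
  obtain k w D D' v where c: "compile (fst e) = Some (k, w, D, v)" "compile (snd e) = Some (k, w, D', v)"
    using assms(2) by (auto simp: wf_eq_def split: option.splits)
  have g: "goods D" "goods D'"
    using goods_gens[OF c(1)] goods_gens[OF c(2)] assms(1,2)
    by (auto simp: wf_eq_def good_gens_def list_all_iff)
  show ?thesis
    using compile_sound[OF c(1) g(1)] compile_sound[OF c(2) g(2)] c g assms(3) by (auto simp: valid_def eqd_def)
qed

text \<open>This direction establishes the axioms in the reversed Gray monoid from their mirror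
  images; \<open>opp_validD\<close> brings the consequences back.\<close>

lemma opp_validI:
  assumes "diagrams.good_gens (opp B) M Fm Tm L" "wf_eq L e" "valid (mirror_eq e)"
  shows "diagrams.valid (opp B) M Fm Tm e"
proof -
  interpret o: diagrams "opp B" M Fm Tm by (rule opp_diagrams)
  obtain k w D D' v where c: "compile (fst e) = Some (k, w, D, v)" "compile (snd e) = Some (k, w, D', v)"
    using assms(2) by (auto simp: wf_eq_def split: option.splits)
  show ?thesis
    by (rule o.valid_wf[OF assms(1,2)])
      (use validD[OF assms(3)] opp_sem[OF c(1)] opp_sem[OF c(2)] in \<open>simp add: mirror_eq_def\<close>)
qed

lemma opp_validD:
  assumes "diagrams.valid (opp B) M Fm Tm e" "good_gens L" "wf_eq L (mirror_eq e)"
  shows "valid (mirror_eq e)"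
proof -
  interpret o: diagrams "opp B" M Fm Tm by (rule opp_diagrams)
  obtain k w D D' v where c: "compile (fst e) = Some (k, w, D, v)" "compile (snd e) = Some (k, w, D', v)"
    using assms(1) by (auto simp: o.valid_def)
  show ?thesis
    by (rule valid_wf[OF assms(2,3)])
      (use o.validD[OF assms(1)] opp_sem[OF c(1)] opp_sem[OF c(2)] in \<open>simp add: mirror_eq_def\<close>)
qed

end

section \<open>Mirror images of the axioms\<close>

context hopf_diagrams
begin

text \<open>\<open>mirror\<close> turns the associator of \<bullet> into an inverse associator with
  its arguments in reverse order, so the image is the associative law with the associator moved to
  the other side. Inverse pairs are inserted to undo this.\<close>

lemma mu_assoc_mir: "valid (mirror_eq eq_mu_assoc)"
  by (rule certified[where L = "basic_gens" and R = "[eq_coasc_inv_right, eq_asc_inv_right, eq_mu_assoc]" and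
    ss = "[RB (U 0) 0 5 0 0, RB (CY MulA 0 (V 0)) 1 4 0 0, RB (CX (V 0) 0 Mul) 4 1 0 0, SL 3, SL 2, SL 1,
    SL 0, RB (U 1) 5 0 0 0, SL 4, SL 3, SL 2, SL 1, RB (U 2) 4 0 0 0, SR 1]"])
    (simp only: good_simps, simp add: coasc_inv_right asc_inv_right mu_assoc, code_simp)

lemma asc_inv_right_mir: "valid (mirror_eq eq_asc_inv_right)"
  by (rule certified[where L = "basic_gens" and R = "[eq_coasc_inv_left]" and
    ss = "[RF (U 0) 0 0 0 0]"])
    (simp only: good_simps, simp add: coasc_inv_left, code_simp)

lemma asc_inv_left_mir: "valid (mirror_eq eq_asc_inv_left)"
  by (rule certified[where L = "basic_gens" and R = "[eq_coasc_inv_right]" and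
    ss = "[RF (U 0) 0 0 0 0]"])
    (simp only: good_simps, simp add: coasc_inv_right, code_simp)

lemma pentagon_mir: "valid (mirror_eq eq_pentagon)"
  by (rule certified[where L = "basic_gens" and R = "[eq_co_pentagonI]" and
    ss = "[RF (U 0) 0 0 0 0]"])
    (simp only: good_simps, simp add: co_pentagonI, code_simp)

lemma coasc_def_mir: "valid (mirror_eq eq_coasc_def)"
  by (rule certified[where L = "basic_gens" and R = "[eq_mul_zigzag_left, eq_coasc_def]" and
    ss = "[RB (U 0) 1 0 0 0, RB (U 0) 0 0 0 0, RB (U 0) 0 1 1 0, RB (U 0) 5 1 0 1, SR 4, SR 3, SR 2, SR 1,
    SR 0, SR 6, SR 5, SR 4, SR 5, SR 6, SR 7, SR 3, SR 2, SR 3, SR 4, SR 5, SR 6, SR 1,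
    RB (U 1) 2 2 0 0]"])
    (simp only: good_simps, simp add: mul_zigzag_left coasc_def, code_simp)

lemma coascI_def_mir: "valid (mirror_eq eq_coascI_def)"
  by (rule certified[where L = "basic_gens" and R = "[eq_mul_zigzag_left, eq_coascI_def]" and
    ss = "[RB (U 0) 1 0 0 0, RB (U 0) 1 1 1 0, RB (U 0) 0 0 0 0, RB (U 0) 0 1 0 1, SR 6, SR 4, SR 5, SR 3,
    SR 4, SR 5, SR 6, SR 7, SR 2, SR 3, SR 1, SR 2, SR 3, SR 4, SR 5, SR 6, SR 0, SR 1,
    RB (U 1) 2 2 0 0]"])
    (simp only: good_simps, simp add: mul_zigzag_left coascI_def, code_simp)

lemma mul_zigzag_left_mir: "valid (mirror_eq eq_mul_zigzag_left)"
  by (rule certified[where L = "basic_gens" and R = "[eq_mul_zigzag_right]" and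
    ss = "[RF (U 0) 0 0 0 0]"])
    (simp only: good_simps, simp add: mul_zigzag_right, code_simp)

lemma mul_zigzag_right_mir: "valid (mirror_eq eq_mul_zigzag_right)"
  by (rule certified[where L = "basic_gens" and R = "[eq_mul_zigzag_left]" and
    ss = "[RF (U 0) 0 0 0 0]"])
    (simp only: good_simps, simp add: mul_zigzag_left, code_simp)

lemma mu_lun_mir: "valid (mirror_eq eq_mu_lun)"
  by (rule certified[where L = "basic_gens" and R = "[eq_mu_run]" and
    ss = "[RF (U 0) 0 0 0 0]"])
    (simp only: good_simps, simp add: mu_run, code_simp)

lemma lun_inv_right_mir: "valid (mirror_eq eq_lun_inv_right)"
  by (rule certified[where L = "basic_gens" and R = "[eq_corun_inv_right]" and
    ss = "[RF (U 0) 0 0 0 0]"])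
    (simp only: good_simps, simp add: corun_inv_right, code_simp)

lemma triangle_mir: "valid (mirror_eq eq_triangle)"
  by (rule certified[where L = "basic_gens" and R = "[eq_co_triangle, eq_coasc_inv_right]" and
    ss = "[RB (U 0) 1 0 0 0, RF (U 1) 0 1 0 0]"])
    (simp only: good_simps, simp add: co_triangle coasc_inv_right, code_simp)

lemma colun_def_mir: "valid (mirror_eq eq_colun_def)"
  by (rule certified[where L = "basic_gens" and R = "[eq_unt_zigzag_left, eq_mul_zigzag_left, eq_corunI_def]" and
    ss = "[RB (U 0) 0 1 1 0, RB (U 1) 2 0 0 0, SR 3, SR 1, SR 2, RB (U 2) 0 2 0 0]"])
    (simp only: good_simps, simp add: unt_zigzag_left mul_zigzag_left corunI_def, code_simp)

lemma lun_inv_left_mir: "valid (mirror_eq eq_lun_inv_left)"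
  by (rule certified[where L = "basic_gens" and R = "[eq_corun_inv_left]" and
    ss = "[RF (U 0) 0 0 0 0]"])
    (simp only: good_simps, simp add: corun_inv_left, code_simp)

lemma run_inv_left_mir: "valid (mirror_eq eq_run_inv_left)"
  by (rule certified[where L = "basic_gens" and R = "[eq_colun_inv_left]" and
    ss = "[RF (U 0) 0 0 0 0]"])
    (simp only: good_simps, simp add: colun_inv_left, code_simp)

lemma corun_def_mir: "valid (mirror_eq eq_corun_def)"
  by (rule certified[where L = "basic_gens" and R = "[eq_unt_zigzag_left, eq_mul_zigzag_left, eq_colunI_def]" and
    ss = "[RB (U 0) 0 1 0 1, RB (U 1) 2 0 0 0, SR 3, SR 1, SR 2, RB (U 2) 0 2 0 0]"])
    (simp only: good_simps, simp add: unt_zigzag_left mul_zigzag_left colunI_def, code_simp)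

lemma run_inv_right_mir: "valid (mirror_eq eq_run_inv_right)"
  by (rule certified[where L = "basic_gens" and R = "[eq_colun_inv_right]" and
    ss = "[RF (U 0) 0 0 0 0]"])
    (simp only: good_simps, simp add: colun_inv_right, code_simp)

lemma eps_mu_mir: "valid (mirror_eq eq_eps_mu)"
  by (rule certified[where L = "basic_gens" and R = "[eq_eps_mu]" and
    ss = "[RF (U 0) 0 0 0 0]"])
    (simp only: good_simps, simp add: eps_mu, code_simp)

lemma eps_eta_mir: "valid (mirror_eq eq_eps_eta)"
  by (rule certified[where L = "basic_gens" and R = "[eq_eps_eta]" and
    ss = "[RF (U 0) 0 0 0 0]"])
    (simp only: good_simps, simp add: eps_eta, code_simp)

lemma colunI_def_mir: "valid (mirror_eq eq_colunI_def)"
  by (rule certified[where L = "basic_gens" and R = "[eq_unt_zigzag_left, eq_mul_zigzag_left, eq_corun_def]" and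
    ss = "[RB (U 0) 1 1 1 0, RB (U 1) 3 0 0 0, SR 2, SR 0, SR 1, RB (U 2) 2 0 0 0]"])
    (simp only: good_simps, simp add: unt_zigzag_left mul_zigzag_left corun_def, code_simp)

lemma unt_zigzag_right_mir: "valid (mirror_eq eq_unt_zigzag_right)"
  by (rule certified[where L = "basic_gens" and R = "[eq_unt_zigzag_left]" and
    ss = "[RF (U 0) 0 0 0 0]"])
    (simp only: good_simps, simp add: unt_zigzag_left, code_simp)

lemma unt_zigzag_left_mir: "valid (mirror_eq eq_unt_zigzag_left)"
  by (rule certified[where L = "basic_gens" and R = "[eq_unt_zigzag_right]" and
    ss = "[RF (U 0) 0 0 0 0]"])
    (simp only: good_simps, simp add: unt_zigzag_right, code_simp)

lemma corunI_def_mir: "valid (mirror_eq eq_corunI_def)"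
  by (rule certified[where L = "basic_gens" and R = "[eq_unt_zigzag_left, eq_mul_zigzag_left, eq_colun_def]" and
    ss = "[RB (U 0) 1 1 0 1, SR 0, RB (U 1) 3 0 0 0, SR 2, SR 1, RB (U 2) 2 0 0 0]"])
    (simp only: good_simps, simp add: unt_zigzag_left mul_zigzag_left colun_def, code_simp)

lemma mu_run_mir: "valid (mirror_eq eq_mu_run)"
  by (rule certified[where L = "basic_gens" and R = "[eq_mu_lun]" and
    ss = "[RF (U 0) 0 0 0 0]"])
    (simp only: good_simps, simp add: mu_lun, code_simp)

lemma eps_l_mir: "valid (mirror_eq eq_eps_l)"
  by (rule certified[where L = "basic_gens" and R = "[eq_eps_r]" and
    ss = "[RF (U 0) 0 0 0 0]"])
    (simp only: good_simps, simp add: eps_r, code_simp)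

lemma muh_def_mir: "valid (mirror_eq eq_muh_def)"
  by (rule certified[where L = "basic_gens" and R = "[]" and
    ss = "[]"])
    (simp only: good_simps, simp, code_simp)

lemma del_coassoc_mir: "valid (mirror_eq eq_del_coassoc)"
  by (rule certified[where L = "basic_gens" and R = "[eq_del_coassoc]" and
    ss = "[RB (U 0) 0 0 0 0]"])
    (simp only: good_simps, simp add: del_coassoc, code_simp)

lemma ax_phi_mir: "valid (mirror_eq eq_ax_phi)"
  by (rule certified[where L = "basic_gens" and R = "[eq_ax_psi]" and
    ss = "[RF (U 0) 0 0 0 0]"])
    (simp only: good_simps, simp add: ax_psi, code_simp)

lemma etac_def_mir: "valid (mirror_eq eq_etac_def)"
  by (rule certified[where L = "basic_gens" and R = "[eq_etah_def]" and
    ss = "[RF (U 0) 0 0 0 0]"])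
    (simp only: good_simps, simp add: etah_def, code_simp)

lemma etah_def_mir: "valid (mirror_eq eq_etah_def)"
  by (rule certified[where L = "basic_gens" and R = "[eq_etac_def]" and
    ss = "[RF (U 0) 0 0 0 0]"])
    (simp only: good_simps, simp add: etac_def, code_simp)

lemma eps_r_mir: "valid (mirror_eq eq_eps_r)"
  by (rule certified[where L = "basic_gens" and R = "[eq_eps_l]" and
    ss = "[RF (U 0) 0 0 0 0]"])
    (simp only: good_simps, simp add: eps_l, code_simp)

lemma del_mu_mir: "valid (mirror_eq eq_del_mu)"
  by (rule certified[where L = "basic_gens" and R = "[eq_del_mu]" and
    ss = "[RF (U 0) 0 0 0 0]"])
    (simp only: good_simps, simp add: del_mu, code_simp)

lemma ax_psi_mir: "valid (mirror_eq eq_ax_psi)"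
  by (rule certified[where L = "basic_gens" and R = "[eq_ax_phi]" and
    ss = "[RF (U 0) 0 0 0 0]"])
    (simp only: good_simps, simp add: ax_phi, code_simp)

lemma opp_good_basic: "diagrams.good_gens (opp B) M Fm Tm basic_gens"
proof -
  interpret o: diagrams "opp B" M Fm Tm by (rule opp_diagrams)
  have "\<forall>h \<in> set (gens (gmir g)). good (G h)" if "g \<in> set basic_gens" for g
    using that good_struct good_hopf
    by (auto simp: basic_gens_def struct_gens_def hopf_gens_def good_gens_def muc_expr_def)
  then show ?thesis using opp_good by (simp add: o.good_gens_def)
qed

text \<open>Every equation derived from the axioms now has a mirror image without a new certificate
  for its derivation; only the translation of its hypotheses and conclusion remains.\<close>

lemma opp_hopf: "hopf_diagrams (opp B) M Fm Tm"
proof -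
  interpret o: diagrams "opp B" M Fm Tm by (rule opp_diagrams)
  note v = opp_validI[OF opp_good_basic]
  have "o.good_gens struct_gens" "o.good_gens hopf_gens"
    using opp_good_basic by (auto simp: basic_gens_def o.good_gens_def)
  then show ?thesis
    by (unfold_locales)
      (assumption,
       rule v, code_simp, rule asc_inv_right_mir,
       rule v, code_simp, rule asc_inv_left_mir,
       rule v, code_simp, rule pentagon_mir,
       rule v, code_simp, rule coasc_def_mir,
       rule v, code_simp, rule coascI_def_mir,
       rule v, code_simp, rule mul_zigzag_left_mir,
       rule v, code_simp, rule mul_zigzag_right_mir,
       rule v, code_simp, rule lun_inv_right_mir,
       rule v, code_simp, rule triangle_mir,
       rule v, code_simp, rule colun_def_mir,
       rule v, code_simp, rule lun_inv_left_mir,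
       rule v, code_simp, rule run_inv_left_mir,
       rule v, code_simp, rule corun_def_mir,
       rule v, code_simp, rule run_inv_right_mir,
       rule v, code_simp, rule colunI_def_mir,
       rule v, code_simp, rule unt_zigzag_right_mir,
       rule v, code_simp, rule unt_zigzag_left_mir,
       rule v, code_simp, rule corunI_def_mir,
       assumption,
       rule v, code_simp, rule mu_assoc_mir,
       rule v, code_simp, rule mu_lun_mir,
       rule v, code_simp, rule eps_mu_mir,
       rule v, code_simp, rule eps_eta_mir,
       rule v, code_simp, rule mu_run_mir,
       rule v, code_simp, rule eps_l_mir,
       rule v, code_simp, rule muh_def_mir,
       rule v, code_simp, rule del_coassoc_mir,
       rule v, code_simp, rule ax_phi_mir,
       rule v, code_simp, rule etac_def_mir,
       rule v, code_simp, rule etah_def_mir,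
       rule v, code_simp, rule eps_r_mir,
       rule v, code_simp, rule del_mu_mir,
       rule v, code_simp, rule ax_psi_mir)
qed

end

section \<open>Interpretation in a map monoidale\<close>

text \<open>The numeral 1 occurs in exponents and as an index of generators; keeping its form lets
  rules such as \<open>pow_simps\<close> and \<open>ev_V\<close> match.\<close>

declare One_nat_def [simp del]

text \<open>\<open>ten2\<close> reads the objects that it tensors with off its arguments. For
  endo-1-cells they are always \<open>\<M>\<close>, which is what \<open>sem_bul\<close>
  needs.\<close>

definition endo :: "expr \<Rightarrow> bool" where
  "endo s \<longleftrightarrow> (case compile s of Some (k, w, D, v) \<Rightarrow> k = 1 \<and> sr 1 w = 1 | None \<Rightarrow> False)"

definition endow :: "word \<Rightarrow> bool" where
  "endow w \<longleftrightarrow> wok 1 w \<and> sr 1 w = 1"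

lemma endow_wok: "endow w \<Longrightarrow> wok 1 w" "endow w \<Longrightarrow> sr 1 w = 1"
  by (simp_all add: endow_def)

lemma wok_sh_1: assumes "endow w"
  shows "wok 2 (sh 0 1 w)" "wok 2 (sh 1 0 w)" "wok 3 (sh 0 2 w)" "wok 3 (sh 1 1 w)"
    "sr 2 (sh 0 1 w) = 2" "sr 2 (sh 1 0 w) = 2" "sr 3 (sh 0 2 w) = 3" "sr 3 (sh 1 1 w) = 3"
  using assms wok_sh[of 1 w 0 1] wok_sh[of 1 w 1 0] wok_sh[of 1 w 0 2] wok_sh[of 1 w 1 1]
    sr_sh[of 1 w 0 1] sr_sh[of 1 w 1 0] sr_sh[of 1 w 0 2] sr_sh[of 1 w 1 1]
  by (simp_all add: endow_def)

lemma wok_sh_2: assumes "wok 2 w" "sr 2 w = 2"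
  shows "wok 3 (sh 0 1 w)" "wok 3 (sh 1 0 w)" "sr 3 (sh 0 1 w) = 3" "sr 3 (sh 1 0 w) = 3"
  using assms wok_sh[of 2 w 0 1] wok_sh[of 2 w 1 0] sr_sh[of 2 w 0 1] sr_sh[of 2 w 1 0] by simp_all

lemma wok_ten: "endow x \<Longrightarrow> endow y \<Longrightarrow> wok 2 (ten x y)" "endow x \<Longrightarrow> endow y \<Longrightarrow> sr 2 (ten x y) = 2"
  by (simp_all add: ten_def wok_sh_1)

lemma endow_bulw: "endow x \<Longrightarrow> endow y \<Longrightarrow> endow (bulw x y)"
  unfolding endow_def[of "bulw x y"] by (simp add: bulw_def wok_ten[unfolded numeral_2_eq_2])

lemma tg_simps: "tg n [] = n" "tg n ((p, f, q) # v) = p + aout f + q"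
  by (simp_all add: tg_def)

lemma tg_endow: "endow w \<Longrightarrow> tg 1 w = 1"
  by (cases w) (auto simp: tg_def endow_def)

lemma tg_sh: "endow y \<Longrightarrow> p + aout f + q = 2 \<Longrightarrow> tg n (sh 0 1 y @ (p, f, q) # w) = 2"
  by (cases y) (auto simp: tg_def sh_def endow_def)

definition inv_ok :: "gen list \<Rightarrow> expr \<Rightarrow> expr \<times> expr \<Rightarrow> expr \<times> expr \<Rightarrow> bool" where
  "inv_ok L s d e \<longleftrightarrow> list_all (\<lambda>g. g \<in> set L) (gens s @ gens (einv s)) \<and>
     (case (compile s, compile (einv s)) of
        (Some (k, w, _, v), Some (k', v', _, w')) \<Rightarrow> k' = k \<and> v' = v \<and> w' = w \<and>
          d = (VC (einv s) s, Id k w) \<and> e = (VC s (einv s), Id k v)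
      | _ \<Rightarrow> False)"

context diagrams
begin

declare ten0_unit_right [simp] ten0_unit_left [simp] lw1_unit [simp] rw1_unit [simp] lw2_unit [simp] rw2_unit [simp]

lemma pow_simps [simp]: "pow 1 = M" "pow 2 = M \<otimes>\<^sub>0 M" "pow 3 = M \<otimes>\<^sub>0 M \<otimes>\<^sub>0 M"
  by (simp_all add: numeral_2_eq_2 numeral_3_eq_3 One_nat_def)

lemma endo_sem:
  assumes "endo s" "good_gens (gens s)"
  shows "src B (dom2 B (sem s)) = M" "trg B (dom2 B (sem s)) = M"
proof -
  obtain k w D v where c: "compile s = Some (k, w, D, v)" "k = 1" "sr 1 w = 1"
    using assms(1) by (auto simp: endo_def split: option.splits)
  have g: "goods D" by (rule goods_gens[OF c(1)]) (use assms(2) in \<open>simp add: good_gens_def\<close>)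
  have "sem s \<in> hom2 B (ev k w) (ev k v)" "wok k w"
    using compile_sound[OF c(1) g] dev_hom[OF _ _ g] by metis+
  then show "src B (dom2 B (sem s)) = M" "trg B (dom2 B (sem s)) = M"
    using c by (auto simp: hom2_def)
qed

lemma lt_simps: "lt (p, f, q) = pow p \<rhd>\<^sub>1 (F f \<lhd>\<^sub>1 pow q)"
  by (simp add: lt_def pad1_def)

lemma ev_one: "wok k [x] \<Longrightarrow> ev k [x] = lt x"
  using ev_single by (cases x) auto

lemma ev_two: "ev k ((p, f, q) # x # w) = lt (p, f, q) \<cdot> ev (p + ain f + q) (x # w)"
  by simp

lemma ev_Cons: "ev k ((p, f, q) # v @ x # w) = lt (p, f, q) \<cdot> ev (p + ain f + q) (v @ x # w)"
  "ev k ((p, f, q) # sh a b w) = lt (p, f, q) \<cdot> ev (p + ain f + q) (sh a b w)"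
  "ev k ((p, f, q) # sh a b w @ v) = lt (p, f, q) \<cdot> ev (p + ain f + q) (sh a b w @ v)"
  "ev k ((p, f, q) # ten x' y) = lt (p, f, q) \<cdot> ev (p + ain f + q) (ten x' y)"
  by simp_all

text \<open>The recursive rule ends every word in an identity. \<open>ev_rules\<close> evaluate a
  nonempty word without it, to the form used in the definition of the duoidal structure.\<close>

declare ev.simps(2) [simp del]

lemmas ev_rules = ev.simps(1) ev_one ev_two ev_Cons lt_simps

lemma ev_sh_1:
  assumes "endow w"
  shows "ev 2 (sh 0 1 w) = ev 1 w \<lhd>\<^sub>1 M" "ev 2 (sh 1 0 w) = M \<rhd>\<^sub>1 ev 1 w"
    "ev 3 (sh 0 2 w) = ev 1 w \<lhd>\<^sub>1 (M \<otimes>\<^sub>0 M)" "ev 3 (sh 1 1 w) = M \<rhd>\<^sub>1 ev 1 w \<lhd>\<^sub>1 M"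
  using assms ev_sh[of 1 w 0 1] ev_sh[of 1 w 1 0] ev_sh[of 1 w 0 2] ev_sh[of 1 w 1 1]
  by (simp_all add: endow_def pad1_def lw1_rw1)

lemma ev_sh_2:
  assumes "wok 2 w" shows "ev 3 (sh 0 1 w) = ev 2 w \<lhd>\<^sub>1 M" "ev 3 (sh 1 0 w) = M \<rhd>\<^sub>1 ev 2 w"
  using assms ev_sh[of 2 w 0 1] ev_sh[of 2 w 1 0] by (simp_all add: pad1_def)

lemma ev_endow: assumes "endow w" shows "ev 1 w \<in> hom1 B M M"
  "src B (ev 1 w) = M" "trg B (ev 1 w) = M"
  using assms by (auto simp: endow_def hom1_def)

lemma ev_ten: "endow x \<Longrightarrow> endow y \<Longrightarrow> ev 2 (ten x y) = ten1 B (ev 1 x) (ev 1 y)"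
  by (simp add: ten_def ten1_def wok_sh_1 ev_sh_1 ev_endow)

end

text \<open>\<open>CoAscI\<close>, \<open>CoLunI\<close> and \<open>CoRunI\<close> are given as
  mates and not through \<open>inv2\<close>: their typing and defining equations then hold by
  unfolding. That they are the inverses is derived in \<open>monoidale_diagrams\<close>, and
  \<open>inv_coasc\<close> recovers the form with \<open>inv2\<close>. For the unit laws, the mate
  along the identity adjunction is written without its identity factors.\<close>

locale monoidale_model = map_monoidale B + diagrams B "car B" F T
  for B :: "('o, 'f, 't, 'z) monoidale_scheme" (structure) and F T +
  assumes atoms: "F Mul = \<m>" "F Unt = \<u>" "F MulA = \<m>\<^sup>*" "F UntA = \<u>\<^sup>*"
    and cells: "T Asc = \<a>" "T AscI = inv2 B \<a>" "T Lun = \<l>" "T LunI = inv2 B \<l>" "T Run = \<r>" "T RunI = inv2 B \<r>"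
      "T EtaM = \<eta>\<^sub>m" "T EpsM = \<epsilon>\<^sub>m" "T EtaU = \<eta>\<^sub>u" "T EpsU = \<epsilon>\<^sub>u"
      "T CoAsc = coasc B" "T CoLun = colun B" "T CoRun = corun B"
    and co_cells: "T CoAscI = mate B ((\<langle>\<m>\<^sup>* \<lhd>\<^sub>1 \<M>\<rangle> \<star> \<eta>\<^sub>m \<star> \<langle>\<m> \<lhd>\<^sub>1 \<M>\<rangle>) \<odot> (\<eta>\<^sub>m \<lhd>\<^sub>2 \<M>)) ((\<m>\<^sup>* \<lhd>\<^sub>1 \<M>) \<cdot> \<m>\<^sup>*) \<a>
        ((\<M> \<rhd>\<^sub>1 \<m>\<^sup>*) \<cdot> \<m>\<^sup>*) (\<epsilon>\<^sub>m \<odot> (\<langle>\<m>\<rangle> \<star> (\<M> \<rhd>\<^sub>2 \<epsilon>\<^sub>m) \<star> \<langle>\<m>\<^sup>*\<rangle>))"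
      "T CoLunI = (\<langle>(\<u>\<^sup>* \<lhd>\<^sub>1 \<M>) \<cdot> \<m>\<^sup>*\<rangle> \<star> \<l>) \<odot> (\<langle>\<u>\<^sup>* \<lhd>\<^sub>1 \<M>\<rangle> \<star> \<eta>\<^sub>m \<star> \<langle>\<u> \<lhd>\<^sub>1 \<M>\<rangle>) \<odot> (\<eta>\<^sub>u \<lhd>\<^sub>2 \<M>)"
      "T CoRunI = (\<langle>(\<M> \<rhd>\<^sub>1 \<u>\<^sup>*) \<cdot> \<m>\<^sup>*\<rangle> \<star> \<r>) \<odot> (\<langle>\<M> \<rhd>\<^sub>1 \<u>\<^sup>*\<rangle> \<star> \<eta>\<^sub>m \<star> \<langle>\<M> \<rhd>\<^sub>1 \<u>\<rangle>) \<odot> (\<M> \<rhd>\<^sub>2 \<eta>\<^sub>u)"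
begin

lemmas model_simps = atoms cells ev_rules lw1_ten rw1_ten lw2_id rw2_id tg_simps mate_def numeral_2_eq_2[symmetric]

lemma adjunctions:
  "\<eta>\<^sub>m \<in> hom2 B (\<one> (\<M> \<otimes>\<^sub>0 \<M>)) (\<m>\<^sup>* \<cdot> \<m>)" "\<epsilon>\<^sub>m \<in> hom2 B (\<m> \<cdot> \<m>\<^sup>*) (\<one> \<M>)"
  "(\<langle>\<m>\<^sup>*\<rangle> \<star> \<epsilon>\<^sub>m) \<odot> (\<eta>\<^sub>m \<star> \<langle>\<m>\<^sup>*\<rangle>) = \<langle>\<m>\<^sup>*\<rangle>" "(\<epsilon>\<^sub>m \<star> \<langle>\<m>\<rangle>) \<odot> (\<langle>\<m>\<rangle> \<star> \<eta>\<^sub>m) = \<langle>\<m>\<rangle>"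
  "\<eta>\<^sub>u \<in> hom2 B (\<one> \<I>) (\<u>\<^sup>* \<cdot> \<u>)" "\<epsilon>\<^sub>u \<in> hom2 B (\<u> \<cdot> \<u>\<^sup>*) (\<one> \<M>)"
  "(\<langle>\<u>\<^sup>*\<rangle> \<star> \<epsilon>\<^sub>u) \<odot> (\<eta>\<^sub>u \<star> \<langle>\<u>\<^sup>*\<rangle>) = \<langle>\<u>\<^sup>*\<rangle>" "(\<epsilon>\<^sub>u \<star> \<langle>\<u>\<rangle>) \<odot> (\<langle>\<u>\<rangle> \<star> \<eta>\<^sub>u) = \<langle>\<u>\<rangle>"
  using mul_adjunction unt_adjunction mul_hom unt_hom by (auto simp: adjunction_def hom1_def)

lemma good_base: "good_gens [Asc, AscI, Lun, LunI, Run, RunI, EtaM, EpsM, EtaU, EpsU]"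
  using asc_hom lun_hom run_hom inv2_hom[OF asc_iso asc_hom] inv2_hom[OF lun_iso lun_hom] inv2_hom[OF run_iso run_hom] adjunctions
  by (simp add: good_gens_def good_def model_simps)

lemma good_struct: "good_gens struct_gens"
proof -
  let ?L = "[Asc, AscI, Lun, LunI, Run, RunI, EtaM, EpsM, EtaU, EpsU]"
  \<comment> \<open>A cell given by an expression in typed generators is typed as soon as the
    expression compiles to its boundary.\<close>
  have *: "good (G g)" if h: "certifies ?L [] (s, s) []" "map_option (\<lambda>(k, w, D, v). (k, w, v)) (compile s) = Some (gout g, gdom g, gcod g)"
    "T g = sem s" for g s
  proof -
    obtain D where "compile s = Some (gout g, gdom g, D, gcod g)"
      using h(2) by (cases "compile s") auto
    from sem_hom[OF good_base h(1) this] show ?thesis by (simp add: good_def h(3))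
  qed
  have "good (G CoAsc)"
    by (rule *[of "snd eq_coasc_def"], code_simp, code_simp) (simp add: eq_coasc_def_def coasc_def model_simps)
  moreover have "good (G CoAscI)"
    by (rule *[of "snd eq_coascI_def"], code_simp, code_simp) (simp add: eq_coascI_def_def co_cells model_simps)
  moreover have "good (G CoLun)"
    by (rule *[of "snd eq_colun_def"], code_simp, code_simp) (simp add: eq_colun_def_def colun_def model_simps)
  moreover have "good (G CoLunI)"
    by (rule *[of "snd eq_colunI_def"], code_simp, code_simp) (simp add: eq_colunI_def_def co_cells model_simps)
  moreover have "good (G CoRun)"
    by (rule *[of "snd eq_corun_def"], code_simp, code_simp) (simp add: eq_corun_def_def corun_def model_simps)
  moreover have "good (G CoRunI)"
    by (rule *[of "snd eq_corunI_def"], code_simp, code_simp) (simp add: eq_corunI_def_def co_cells model_simps)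
  ultimately show ?thesis using good_base by (simp add: good_gens_def struct_gens_def)
qed

lemma structure_equations: "inv2 B \<a> \<odot> \<a> = \<langle>\<m> \<cdot> (\<m> \<lhd>\<^sub>1 \<M>)\<rangle>" "\<a> \<odot> inv2 B \<a> = \<langle>\<m> \<cdot> (\<M> \<rhd>\<^sub>1 \<m>)\<rangle>"
  "inv2 B \<l> \<odot> \<l> = \<langle>\<m> \<cdot> (\<u> \<lhd>\<^sub>1 \<M>)\<rangle>" "\<l> \<odot> inv2 B \<l> = \<langle>\<one> \<M>\<rangle>"
  "inv2 B \<r> \<odot> \<r> = \<langle>\<m> \<cdot> (\<M> \<rhd>\<^sub>1 \<u>)\<rangle>" "\<r> \<odot> inv2 B \<r> = \<langle>\<one> \<M>\<rangle>"
  using inv2_left[OF asc_iso asc_hom] inv2_right[OF asc_iso asc_hom] inv2_left[OF lun_iso lun_hom] inv2_right[OF lun_iso lun_hom]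
    inv2_left[OF run_iso run_hom] inv2_right[OF run_iso run_hom] by simp_all

sublocale monoidale_diagrams B "car B" F T
proof (unfold_locales, rule good_struct)
  note v = valid_wf[OF good_struct]
  note s = model_simps structure_equations adjunctions
  show "valid eq_asc_inv_right" by (rule v, code_simp) (simp add: eq_asc_inv_right_def s)
  show "valid eq_asc_inv_left" by (rule v, code_simp) (simp add: eq_asc_inv_left_def s)
  show "valid eq_pentagon" by (rule v, code_simp) (use pentagon in \<open>simp add: eq_pentagon_def s\<close>)
  show "valid eq_triangle" by (rule v, code_simp) (use triangle in \<open>simp add: eq_triangle_def s\<close>)
  show "valid eq_coasc_def" by (rule v, code_simp) (simp add: eq_coasc_def_def coasc_def s)
  show "valid eq_coascI_def" by (rule v, code_simp) (simp add: eq_coascI_def_def co_cells s)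
  show "valid eq_colun_def" by (rule v, code_simp) (simp add: eq_colun_def_def colun_def s)
  show "valid eq_colunI_def" by (rule v, code_simp) (simp add: eq_colunI_def_def co_cells s)
  show "valid eq_corun_def" by (rule v, code_simp) (simp add: eq_corun_def_def corun_def s)
  show "valid eq_corunI_def" by (rule v, code_simp) (simp add: eq_corunI_def_def co_cells s)
  show "valid eq_lun_inv_left" by (rule v, code_simp) (simp add: eq_lun_inv_left_def s)
  show "valid eq_lun_inv_right" by (rule v, code_simp) (simp add: eq_lun_inv_right_def s)
  show "valid eq_run_inv_left" by (rule v, code_simp) (simp add: eq_run_inv_left_def s)
  show "valid eq_run_inv_right" by (rule v, code_simp) (simp add: eq_run_inv_right_def s)
  show "valid eq_mul_zigzag_right" by (rule v, code_simp) (simp add: eq_mul_zigzag_right_def s)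
  show "valid eq_mul_zigzag_left" by (rule v, code_simp) (simp add: eq_mul_zigzag_left_def s)
  show "valid eq_unt_zigzag_right" by (rule v, code_simp) (simp add: eq_unt_zigzag_right_def s)
  show "valid eq_unt_zigzag_left" by (rule v, code_simp) (simp add: eq_unt_zigzag_left_def s)
qed

text \<open>The definitions take \<open>inv2\<close> of composite coherence cells, whereas
  expressions contain explicit inverses. Here \<open>inv_ok\<close> checks by evaluation that d and
  e are the two inverse laws of s, and uniqueness of inverses identifies the two.\<close>

lemma sem_inv:
  assumes "good_gens L" "valid d" "valid e" "inv_ok L s d e"
  shows "sem (einv s) = inv2 B (sem s)"
proof -
  obtain k w v D E where c: "compile s = Some (k, w, D, v)" "compile (einv s) = Some (k, v, E, w)"
    and de: "d = (VC (einv s) s, Id k w)" "e = (VC s (einv s), Id k v)"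
    using assms(4) by (auto simp: inv_ok_def split: option.splits)
  have "goods D" "goods E"
    using goods_gens[OF c(1)] goods_gens[OF c(2)] assms(1,4) by (auto simp: inv_ok_def good_gens_def list_all_iff)
  then have "sem s \<in> hom2 B (ev k w) (ev k v)" "sem (einv s) \<in> hom2 B (ev k v) (ev k w)"
    using compile_sound[OF c(1)] compile_sound[OF c(2)] dev_hom by metis+
  then show ?thesis
    using validD[OF assms(2)] validD[OF assms(3)] de by (intro inv2_eq[symmetric] inverse_2cellsI) simp_all
qed

lemma sem_bul:
  assumes "endo s" "good_gens (gens s)" "endo t" "good_gens (gens t)"
  shows "sem (e_bul s t) = bul2 B (sem s) (sem t)"
  using endo_sem[OF assms(1,2)] endo_sem[OF assms(3,4)] comp1_id_right[of \<m>] mul_hom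
  by (simp add: e_bul_def bul2_def ten2_def model_simps)

lemma sem_cir: "sem (e_cir s t) = cir2 B (sem s) (sem t)"
  by (simp add: e_cir_def cir2_def)

lemma ev_bulw: "endow x \<Longrightarrow> endow y \<Longrightarrow> ev 1 (bulw x y) = bul1 B (ev 1 x) (ev 1 y)"
  by (simp add: bulw_def bul1_def wok_ten ev_ten model_simps)

lemma inv_coasc: "T CoAscI = inv2 B (coasc B)" "T CoLunI = inv2 B (colun B)" "T CoRunI = inv2 B (corun B)"
proof -
  note i = sem_inv[OF good_struct]
  have "inv_ok struct_gens (Cell CoAsc) eq_coasc_inv_left eq_coasc_inv_right" "inv_ok struct_gens (Cell CoLun) eq_colun_inv_left eq_colun_inv_right"
    "inv_ok struct_gens (Cell CoRun) eq_corun_inv_left eq_corun_inv_right"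
    by code_simp+
  from i[OF coasc_inv_left coasc_inv_right this(1)] i[OF colun_inv_left colun_inv_right this(2)] i[OF corun_inv_left corun_inv_right this(3)]
  show "T CoAscI = inv2 B (coasc B)" "T CoLunI = inv2 B (colun B)" "T CoRunI = inv2 B (corun B)"
    by (simp_all add: cells)
qed

lemmas word_simps = endow_wok wok_sh_1 wok_sh_2 wok_ten ev_sh_1 ev_sh_2 ev_ten ev_endow tg_endow tg_sh comp1_trg comp1_src lw1_src lw1_trg rw1_src rw1_trg model_simps

lemma sem_asc:
  assumes "endow x" "endow y" "endow z"
  shows "sem (e_asc x y z) = bul_asc B (ev 1 x) (ev 1 y) (ev 1 z)"
  using assms by (simp add: e_asc_def bul_asc_def word_simps ten1_def)

lemma sem_lun: "endow x \<Longrightarrow> sem (e_lun x) = bul_lun B (ev 1 x)"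
  by (simp add: e_lun_def bul_lun_def word_simps)

lemma sem_run: "endow x \<Longrightarrow> sem (e_run x) = bul_run B (ev 1 x)"
  by (simp add: e_run_def bul_run_def word_simps)

lemma sem_xi: "endow x \<Longrightarrow> endow y \<Longrightarrow> endow z \<Longrightarrow> endow w \<Longrightarrow>
    sem (e_xi x y z w) = xi B (ev 1 x) (ev 1 y) (ev 1 z) (ev 1 w)"
  by (simp add: e_xi_def xi_def word_simps)

lemma sem_alpha: "sem e_alpha = Defs.alpha B" and sem_beta: "sem e_beta = beta B"
  by (simp_all add: e_alpha_def e_beta_def Defs.alpha_def Defs.beta_def model_simps)

lemma sem_phi: "endow x \<Longrightarrow> endow y \<Longrightarrow> sem (e_phi x y) = phi B (ev 1 x) (ev 1 y)"
  by (simp add: e_phi_def phi_def Let_def word_simps sem_beta inv_coasc)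

lemma sem_psi: "endow x \<Longrightarrow> endow y \<Longrightarrow> sem (e_psi x y) = psi B (ev 1 x) (ev 1 y)"
  by (simp add: e_psi_def psi_def Let_def word_simps sem_alpha inv_coasc)

end

lemma gens_simps: "gens (e_bul s t) = gens s @ gens t" "gens (e_cir s t) = gens t @ gens s"
  "gens (e_asc x y z) = [Asc, CoAsc]" "gens (einv (e_asc x y z)) = [AscI, CoAscI]"
  "gens (e_lun x) = [Lun, CoLun]" "gens (einv (e_lun x)) = [LunI, CoLunI]"
  "gens (e_run x) = [Run, CoRun]" "gens (einv (e_run x)) = [RunI, CoRunI]"
  by (simp_all add: e_bul_def e_cir_def e_asc_def e_lun_def e_run_def)

lemma endow_simps: "endow []" "endow [(0, V n, 0)]" "endow jw"
  by (simp_all add: endow_def One_nat_def)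

lemma endo_cells:
  "endo (Cell Mu)" "endo (Cell Eta)" "endo (Cell Del)" "endo (Cell Eps)" "endo (Cell Sig)"
  "endo (Cell EpsM)" "endo (Cell EpsU)" "endo (Cell Nab)" "endo (Cell The)" "endo (Cell TheR)"
  "endo (Cell (Two n f g))" "endo (Cell (ActL f))" "endo (Cell (ActR f))" "endo (Cell (ActRA f))" "endo (Cell (ActLI f))"
  by (simp_all add: endo_def One_nat_def)

lemma endo_Id: "endow w \<Longrightarrow> endo (Id 1 w)"
  by (simp add: endo_def endow_def)

lemma endo_hopf: "endo (e_cir (Cell Mu) (Id 1 jw))" "endo (e_cir (Id 1 jw) (Cell Mu))"
  "endo (VC (e_cir (Cell Eta) (Id 1 jw)) (HC (Id 1 [(0, Unt, 0)]) (HC (Cell EtaU) (Id 0 [(0, UntA, 0)]))))"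
  "endo (VC (e_cir (Id 1 jw) (Cell Eta)) (HC (Id 1 [(0, Unt, 0)]) (HC (Cell EtaU) (Id 0 [(0, UntA, 0)]))))"
  by code_simp+

context diagrams
begin

lemma good_gens_simps: "good_gens []" "good_gens (g # L) \<longleftrightarrow> good (G g) \<and> good_gens L"
  "good_gens (L @ L') \<longleftrightarrow> good_gens L \<and> good_gens L'"
  by (auto simp: good_gens_def)

end

locale hopf_model = monoidale_model B F T
  for B :: "('o, 'f, 't, 'z) monoidale_scheme" (structure) and F T +
  assumes hopf: "hopf_monoid B (F (V 0)) (T Mu) (T Eta) (T Del) (T Eps) (T Sig)"
    and hat_cells: "T Muh = (T Mu \<star> \<langle>\<m>\<rangle>) \<odot> (\<langle>\<m> \<cdot> (F (V 0) \<otimes>\<^sub>1 F (V 0))\<rangle> \<star> \<eta>\<^sub>m)"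
      "T Etah = (T Eta \<star> \<langle>\<u>\<rangle>) \<odot> (\<langle>\<u>\<rangle> \<star> \<eta>\<^sub>u)"
      "T Etac = (\<langle>\<u>\<^sup>*\<rangle> \<star> T Eta) \<odot> (\<eta>\<^sub>u \<star> \<langle>\<u>\<^sup>*\<rangle>)"
begin

lemma bim: "bimonoid B (F (V 0)) (T Mu) (T Eta) (T Del) (T Eps)"
  using hopf by (simp add: hopf_monoid_def)

lemma mon: "bul_monoid B (F (V 0)) (T Mu) (T Eta)"
  using bim by (simp add: bimonoid_def)

lemma V_hom: "F (V n) \<in> hom1 B \<M> \<M>" "src B (F (V n)) = \<M>" "trg B (F (V n)) = \<M>"
  using F_hom[of "V n"] by (simp_all add: hom1_def)

lemma ev_V: "ev 1 [(0, V n, 0)] = F (V n)" "ev 1 [] = iobj B" "ev 1 jw = jobj B"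
  by (simp_all add: model_simps iobj_def jobj_def)

lemma ev_bul_V: "ev 1 [(0, Mul, 0), (0, V n, 1), (1, V k, 0), (0, MulA, 0)] = bul1 B (F (V n)) (F (V k))"
  "ev 1 [(0, Mul, 0), (0, V n, 1), (0, MulA, 0)] = bul1 B (F (V n)) (iobj B)"
  "ev 1 [(0, Mul, 0), (1, V n, 0), (0, MulA, 0)] = bul1 B (iobj B) (F (V n))"
  using ev_bulw[of "[(0, V n, 0)]" "[(0, V k, 0)]"] ev_bulw[of "[(0, V n, 0)]" "[]"] ev_bulw[of "[]" "[(0, V n, 0)]"]
  by (simp_all add: endow_simps ev_V bulw_def ten_def sh_def iobj_def)

lemma good_hopf_base: "good_gens [Mu, Eta, Del, Eps, Sig]"
  using hopf mon bim
  by (simp add: good_gens_simps good_def bul_monoid_def bimonoid_def hopf_monoid_def ev_V ev_bul_V)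
   (simp add: model_simps rev1_def cir1_def iobj_def jobj_def lw1_rw1)

lemma good_cellI:
  assumes "good_gens L" "list_all (\<lambda>g. g \<in> set L) (gens s)"
    "map_option (\<lambda>(k, w, D, v). (k, w, v)) (compile s) = Some (gout g, gdom g, gcod g)" "T g = sem s"
  shows "good (G g)"
proof -
  obtain D where c: "compile s = Some (gout g, gdom g, D, gcod g)"
    using assms(3) by (cases "compile s") auto
  have "goods D" using goods_gens[OF c] assms(1,2) by (auto simp: list_all_iff good_gens_def)
  then show ?thesis
    using compile_sound[OF c] dev_hom by (metis assms(4) ce.simps(1) good_def cout.simps(1) cdom.simps(1) ccod.simps(1))
qed

lemma hat_eqs: "T Muh = sem (snd eq_muh_def)" "T Etah = sem (snd eq_etah_def)" "T Etac = sem (snd eq_etac_def)"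
  using V_hom by (simp_all add: eq_muh_def_def eq_etah_def_def eq_etac_def_def muh_expr_def model_simps hat_cells ten1_def)

lemma good_hopf: "good_gens hopf_gens"
proof -
  let ?L = "struct_gens @ [Mu, Eta, Del, Eps, Sig]"
  have L: "good_gens ?L"
    using good_struct good_hopf_base by (simp add: good_gens_simps)
  have "good (G Muh)" by (rule good_cellI[OF L _ _ hat_eqs(1)]) code_simp+
  moreover have "good (G Etah)" by (rule good_cellI[OF L _ _ hat_eqs(2)]) code_simp+
  moreover have "good (G Etac)" by (rule good_cellI[OF L _ _ hat_eqs(3)]) code_simp+
  ultimately show ?thesis
    using good_hopf_base by (simp add: hopf_gens_def good_gens_simps)
qed

lemma good_basic: "good_gens basic_gens"
  using good_struct good_hopf by (simp add: basic_gens_def good_gens_simps)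

lemma basic_cells: "g \<in> set basic_gens \<Longrightarrow> good (G g)"
  using good_basic by (simp add: good_gens_def)

lemma good_cells: "good (G Asc)" "good (G AscI)" "good (G Lun)" "good (G LunI)" "good (G Run)" "good (G RunI)"
  "good (G EtaM)" "good (G EpsM)" "good (G EtaU)" "good (G EpsU)" "good (G CoAsc)" "good (G CoAscI)"
  "good (G CoLun)" "good (G CoLunI)" "good (G CoRun)" "good (G CoRunI)"
  "good (G Mu)" "good (G Eta)" "good (G Del)" "good (G Eps)" "good (G Sig)"
  by (rule basic_cells, simp add: basic_gens_def struct_gens_def hopf_gens_def)+

lemma sem_inv_units: "sem (einv (e_lun [])) = inv2 B (bul_lun B (iobj B))" "sem (einv (e_run [])) = inv2 B (bul_run B (iobj B))"
proof -
  have "inv_ok struct_gens (e_lun []) eq_inv1_li eq_inv2_li" "inv_ok struct_gens (e_run []) eq_inv1_ri eq_inv2_ri"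
    by code_simp+
  from sem_inv[OF good_struct inv1_li inv2_li this(1)] sem_inv[OF good_struct inv1_ri inv2_ri this(2)]
  show "sem (einv (e_lun [])) = inv2 B (bul_lun B (iobj B))" "sem (einv (e_run [])) = inv2 B (bul_run B (iobj B))"
    by (simp_all add: sem_lun sem_run endow_simps iobj_def)
qed

lemmas frozen_simps = sem_bul sem_cir sem_asc sem_lun sem_run sem_xi sem_phi sem_psi sem_inv_units[unfolded iobj_def]
  endow_simps endow_bulw endo_cells endo_Id gens_simps good_gens_simps good_cells cells atoms ev_V ev_bul_V ev_bulw
  lt_simps iobj_def jobj_def xi_mult_def xi_unit_def xi_comult_def ev_two ev_one

sublocale hopf_diagrams B "car B" F T
proof (unfold_locales, rule good_hopf)
  note v = valid_wf[OF good_basic]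
  note ax = mon[unfolded bul_monoid_def] bim[unfolded bimonoid_def] hopf[unfolded hopf_monoid_def]
  show "valid eq_mu_assoc" by (rule v, code_simp) (use ax in \<open>simp add: eq_mu_assoc_def frozen_simps\<close>)
  show "valid eq_mu_lun" by (rule v, code_simp) (use ax in \<open>simp add: eq_mu_lun_def frozen_simps\<close>)
  show "valid eq_mu_run" by (rule v, code_simp) (use ax in \<open>simp add: eq_mu_run_def frozen_simps\<close>)
  show "valid eq_eps_mu" by (rule v, code_simp) (use ax in \<open>simp add: eq_eps_mu_def frozen_simps\<close>)
  show "valid eq_eps_eta" by (rule v, code_simp) (use ax in \<open>simp add: eq_eps_eta_def frozen_simps\<close>)
  show "valid eq_eps_l" by (rule v, code_simp) (use ax in \<open>simp add: eq_eps_l_def frozen_simps\<close>)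
  show "valid eq_eps_r" by (rule v, code_simp) (use ax in \<open>simp add: eq_eps_r_def frozen_simps\<close>)
  show "valid eq_del_mu" by (rule v, code_simp) (use ax in \<open>simp add: eq_del_mu_def frozen_simps\<close>)
  show "valid eq_del_coassoc" by (rule v, code_simp) (use ax in \<open>simp add: eq_del_coassoc_def frozen_simps\<close>)
  show "valid eq_muh_def" by (rule v, code_simp) (use hat_eqs in \<open>simp add: eq_muh_def_def\<close>)
  show "valid eq_etah_def" by (rule v, code_simp) (use hat_eqs in \<open>simp add: eq_etah_def_def\<close>)
  show "valid eq_etac_def" by (rule v, code_simp) (use hat_eqs in \<open>simp add: eq_etac_def_def\<close>)
  show "valid eq_ax_phi" by (rule v, code_simp) (use ax in \<open>simp add: eq_ax_phi_def frozen_simps endo_hopf\<close>)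
  show "valid eq_ax_psi" by (rule v, code_simp) (use ax in \<open>simp add: eq_ax_psi_def frozen_simps endo_hopf\<close>)
qed

end

section \<open>The dual equations\<close>

text \<open>Mirror images of the equations with the corresponding names. Where the mirror image
  contains an inverse associator, the equation is restated in the direction in which the laws for
  right and two-sided actions use it.\<close>

definition "eq_free_left_assoc_right = ((VC (e_freeR wA (Cell Mu) []) (e_bul (e_freeR wA (Cell Mu) []) idA)), (VC
  (e_freeR wA (Cell Mu) []) (VC (e_bul (Id 1 (bulw [] wA)) (Cell Mu)) (e_asc (bulw [] wA) wA wA))))"
definition "eq_free_left_unit_right = ((VC (e_freeR wA (Cell Mu) []) (e_bul (Id 1 (bulw [] wA)) (Cell Eta))), (e_run
  (bulw [] wA)))"
definition "eq_free_right_assoc_right = ((VC (e_freeL [] (Cell EpsM) wA) (e_bul (Cell EpsM) (Id 1 (bulw [] wA)))),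
  (VC (e_freeL [] (Cell EpsM) wA) (VC (e_bul idI (e_freeL [] (Cell EpsM) wA)) (e_asc [] [] (bulw [] wA)))))"
definition "eq_free_right_unit_right = ((VC (e_freeL [] (Cell EpsM) wA) (e_bul (Cell EpsU) (Id 1 (bulw [] wA)))),
  (e_lun (bulw [] wA)))"
definition "eq_free_compatible_right = ((VC (e_freeR wA (Cell Mu) []) (e_bul (e_freeL [] (Cell EpsM) wA) idA)), (VC
  (e_freeL [] (Cell EpsM) wA) (VC (e_bul idI (e_freeR wA (Cell Mu) [])) (e_asc [] (bulw [] wA) wA))))"
definition "eq_trivial_assoc_right = ((VC counitR (e_bul counitR idA)), (VC counitR (VC (e_bul idI (Cell Mu)) (e_asc
  [] wA wA))))"
definition "eq_trivial_unit_right = ((VC counitR (e_bul idI (Cell Eta))), (e_run []))"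
definition "eq_trivial_compatible_right = ((VC counitR (e_bul (Cell EpsM) idA)), (VC (Cell EpsM) (VC (e_bul idI
  counitR) (e_asc [] [] wA))))"
definition "eq_counit_left_linear_right = ((VC counitR (e_freeR wA (Cell Mu) [])), (VC counitR (e_bul counitR idA)))"
definition "eq_counit_right_linear_right = ((VC counitR (e_freeL [] (Cell EpsM) wA)), (VC (Cell EpsM) (e_bul idI
  counitR)))"
definition "eq_unit_right_linear_right = ((VC unitR (Cell EpsM)), (VC (e_freeL [] (Cell EpsM) wA) (e_bul idI unitR)))"
definition "eq_counit_unit_right = ((VC counitR unitR), idI)"
definition "eq_retract_a_linear_right = ((VC retrR (Cell (ActRA 1))), (VC (Cell (ActRA 2)) (e_bul retrR idA)))"
definition "eq_retract_i_linear_right = ((VC retrR (Cell (ActLI 1))), (VC (Cell (ActLI 2)) (e_bul idI retrR)))"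
definition "eq_retract_natural_right = ((VC (Cell (ActRA 4)) (VC (e_bul (VC (Cell (Two 2 2 4)) (VC (Cell (Two 0 1
  2)) (Cell (Two 1 3 1)))) idA) splitRX')), (VC (Cell (Two 2 2 4)) (VC retrR (Cell (Two 1 3 1)))))"
definition "eq_retract_of_linear_right = (retrR, (Cell (Two 0 1 2)))"
definition "eq_section_left_linear_right = ((VC (mirror nabla) (Cell Mu)), (VC (e_freeR wA (Cell Mu) wA) (e_bul
  (mirror nabla) idA)))"
definition "eq_section_right_linear_right = ((VC (mirror nabla) (Cell Mu)), (VC (e_freeL wA (Cell Mu) wA) (e_bul idA
  (mirror nabla))))"
definition "eq_section_splits_right = ((VC (Cell Mu) (mirror nabla)), idA)"

context hopf_diagrams
begin

text \<open>Reversal exchanges left and right linearity of the section, hence the opposite order of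
  these two hypotheses in the dual lemmas.\<close>

lemma nab_right_linear_mir:
  assumes "good (G Nab)" and "valid eq_nab_left_linear"
  shows "valid (mirror_eq eq_nab_right_linear)"
  by (rule certified[where L = "basic_gens @ [Nab]" and R = "[eq_nab_left_linear]" and
    ss = "[RF (U 0) 0 0 0 0]"])
    (simp only: good_simps assms simp_thms, simp del: One_nat_def add: assms, code_simp)

lemma nab_left_linear_mir:
  assumes "good (G Nab)" and "valid eq_nab_right_linear"
  shows "valid (mirror_eq eq_nab_left_linear)"
  by (rule certified[where L = "basic_gens @ [Nab]" and R = "[eq_nab_right_linear]" and
    ss = "[RF (U 0) 0 0 0 0]"])
    (simp only: good_simps assms simp_thms, simp del: One_nat_def add: assms, code_simp)

lemma nab_splits_mir:
  assumes "good (G Nab)" and "valid eq_nab_splits"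
  shows "valid (mirror_eq eq_nab_splits)"
  by (rule certified[where L = "basic_gens @ [Nab]" and R = "[eq_nab_splits]" and
    ss = "[RF (U 0) 0 0 0 0]"])
    (simp only: good_simps assms simp_thms, simp del: One_nat_def add: assms, code_simp)

lemma act_x_assoc_mir:
  assumes "good (G (ActRA 1))" and "valid eq_ract_x_assoc"
  shows "valid (mirror_eq eq_act_x_assoc)"
  by (rule certified[where L = "basic_gens @ [ActRA 1]" and R = "[eq_coasc_inv_right, eq_asc_inv_right, eq_ract_x_assoc]" and
    ss = "[RB (U 0) 0 5 0 0, RB (CY MulA 0 (V 0)) 1 4 0 0, RB (CX (V 1) 0 Mul) 4 1 0 0, SL 3, SL 2, SL 1,
    SL 0, RB (U 1) 5 0 0 0, SL 4, SL 3, SL 2, SL 1, RB (U 2) 4 0 0 0, SR 1]"])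
    (simp only: good_simps assms simp_thms, simp del: One_nat_def add: coasc_inv_right asc_inv_right assms, code_simp)

lemma act_x_unit_mir:
  assumes "good (G (ActRA 1))" and "valid eq_ract_x_unit"
  shows "valid (mirror_eq eq_act_x_unit)"
  by (rule certified[where L = "basic_gens @ [ActRA 1]" and R = "[eq_ract_x_unit]" and
    ss = "[RF (U 0) 0 0 0 0]"])
    (simp only: good_simps assms simp_thms, simp del: One_nat_def add: assms, code_simp)

lemma act_x_compatible_mir:
  assumes "good (G (ActLI 1))" and "good (G (ActRA 1))" and "valid eq_ract_x_compatible"
  shows "valid (mirror_eq eq_act_x_compatible)"
  by (rule certified[where L = "basic_gens @ [ActLI 1, ActRA 1]" and R = "[eq_coasc_inv_right, eq_asc_inv_right, eq_ract_x_compatible]" and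
    ss = "[RB (U 0) 0 4 0 0, RB (CY MulA 0 (V 0)) 1 3 0 0, RB (U 1) 4 0 0 0, SL 3, SL 2, SL 1, SL 0,
    RB (U 2) 3 0 0 0, SR 0]"])
    (simp only: good_simps assms simp_thms, simp del: One_nat_def add: coasc_inv_right asc_inv_right assms, code_simp)

lemma act_y_assoc_mir:
  assumes "good (G (ActRA 2))" and "valid eq_ract_y_assoc"
  shows "valid (mirror_eq eq_act_y_assoc)"
  by (rule certified[where L = "basic_gens @ [ActRA 2]" and R = "[eq_coasc_inv_right, eq_asc_inv_right, eq_ract_y_assoc]" and
    ss = "[RB (U 0) 0 5 0 0, RB (CY MulA 0 (V 0)) 1 4 0 0, RB (CX (V 2) 0 Mul) 4 1 0 0, SL 3, SL 2, SL 1,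
    SL 0, RB (U 1) 5 0 0 0, SL 4, SL 3, SL 2, SL 1, RB (U 2) 4 0 0 0, SR 1]"])
    (simp only: good_simps assms simp_thms, simp del: One_nat_def add: coasc_inv_right asc_inv_right assms, code_simp)

lemma act_y_compatible_mir:
  assumes "good (G (ActLI 2))" and "good (G (ActRA 2))" and "valid eq_ract_y_compatible"
  shows "valid (mirror_eq eq_act_y_compatible)"
  by (rule certified[where L = "basic_gens @ [ActLI 2, ActRA 2]" and R = "[eq_coasc_inv_right, eq_asc_inv_right, eq_ract_y_compatible]" and
    ss = "[RB (U 0) 0 4 0 0, RB (CY MulA 0 (V 0)) 1 3 0 0, RB (U 1) 4 0 0 0, SL 3, SL 2, SL 1, SL 0,
    RB (U 2) 3 0 0 0, SR 0]"])
    (simp only: good_simps assms simp_thms, simp del: One_nat_def add: coasc_inv_right asc_inv_right assms, code_simp)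

lemma h_i_linear_mir:
  assumes "good (G (ActLI 1))" and "good (G (Two 0 1 2))" and "valid eq_h_ri_linear"
  shows "valid (mirror_eq eq_h_i_linear)"
  by (rule certified[where L = "basic_gens @ [ActLI 1, Two 0 1 2]" and R = "[eq_h_ri_linear]" and
    ss = "[RF (U 0) 0 0 0 0]"])
    (simp only: good_simps assms simp_thms, simp del: One_nat_def add: assms, code_simp)

lemma h_a_linear_mir:
  assumes "good (G (ActRA 1))" and "good (G (Two 0 1 2))" and "valid eq_h_ra_linear"
  shows "valid (mirror_eq eq_h_a_linear)"
  by (rule certified[where L = "basic_gens @ [ActRA 1, Two 0 1 2]" and R = "[eq_h_ra_linear]" and
    ss = "[RF (U 0) 0 0 0 0]"])
    (simp only: good_simps assms simp_thms, simp del: One_nat_def add: assms, code_simp)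

lemma f_a_linear_mir:
  assumes "good (G (ActRA 3))" and "good (G (Two 1 3 1))" and "valid eq_f_ra_linear"
  shows "valid (mirror_eq eq_f_a_linear)"
  by (rule certified[where L = "basic_gens @ [ActRA 3, Two 1 3 1]" and R = "[eq_f_ra_linear]" and
    ss = "[RF (U 0) 0 0 0 0]"])
    (simp only: good_simps assms simp_thms, simp del: One_nat_def add: assms, code_simp)

lemma g_a_linear_mir:
  assumes "good (G (ActRA 2))" and "good (G (Two 2 2 4))" and "valid eq_g_ra_linear"
  shows "valid (mirror_eq eq_g_a_linear)"
  by (rule certified[where L = "basic_gens @ [ActRA 2, Two 2 2 4]" and R = "[eq_g_ra_linear]" and
    ss = "[RF (U 0) 0 0 0 0]"])
    (simp only: good_simps assms simp_thms, simp del: One_nat_def add: assms, code_simp)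

lemma theta_a_linear_mir:
  assumes "good (G TheR)" and "valid eq_rtheta_a_linear"
  shows "valid (mirror_eq eq_theta_a_linear)"
  by (rule certified[where L = "basic_gens @ [TheR]" and R = "[eq_rtheta_a_linear]" and
    ss = "[RF (U 0) 0 0 0 0]"])
    (simp only: good_simps assms simp_thms, simp del: One_nat_def add: assms, code_simp)

lemma theta_i_linear_mir:
  assumes "good (G TheR)" and "valid eq_rtheta_i_linear"
  shows "valid (mirror_eq eq_theta_i_linear)"
  by (rule certified[where L = "basic_gens @ [TheR]" and R = "[eq_rtheta_i_linear]" and
    ss = "[RF (U 0) 0 0 0 0]"])
    (simp only: good_simps assms simp_thms, simp del: One_nat_def add: assms, code_simp)

lemma theta_normalized_mir:
  assumes "good (G TheR)" and "valid eq_rtheta_normalized"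
  shows "valid (mirror_eq eq_theta_normalized)"
  by (rule certified[where L = "basic_gens @ [TheR]" and R = "[eq_rtheta_normalized]" and
    ss = "[RF (U 0) 0 0 0 0]"])
    (simp only: good_simps assms simp_thms, simp del: One_nat_def add: assms, code_simp)

text \<open>Inserting the associator before its inverse moves it to the other side of the mirrored
  equation.\<close>

lemma free_left_assoc_right:
  assumes "valid (mirror_eq eq_free_left_assoc)"
  shows "valid eq_free_left_assoc_right"
  by (rule certified[where L = "basic_gens" and R = "[eq_coasc_inv_left, eq_asc_inv_left, mirror_eq eq_free_left_assoc]" and
    ss = "[RB (CX MulA 0 (V 0)) 0 6 0 0, RB (U 0) 1 7 0 0, RB (U 1) 3 0 0 0, SL 2, SL 1, SL 0,
    RB (CY Mul 0 Mul) 3 1 0 0, SL 2, SL 1, RB (CY (V 0) 0 Mul) 4 2 1 0, SL 3, SL 2,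
    RB (CY MulA 0 Mul) 5 3 0 0, SL 4, SL 3, RB (U 2) 6 0 0 0, SR 3, SR 4, SR 2, SR 3, SR 1, SR 2,
    SR 0, SR 1]"])
    (simp only: good_simps assms simp_thms, simp del: One_nat_def add: coasc_inv_left asc_inv_left assms, code_simp)

lemma free_left_unit_right:
  assumes "valid (mirror_eq eq_free_left_unit)"
  shows "valid eq_free_left_unit_right"
  by (rule certified[where L = "basic_gens" and R = "[mirror_eq eq_free_left_unit]" and
    ss = "[RF (U 0) 0 0 0 0]"])
    (simp only: good_simps assms simp_thms, simp del: One_nat_def add: assms, code_simp)

lemma free_right_assoc_right:
  assumes "valid (mirror_eq eq_free_right_assoc)"
  shows "valid eq_free_right_assoc_right"
  by (rule certified[where L = "basic_gens" and R = "[eq_coasc_inv_left, eq_asc_inv_left, mirror_eq eq_free_right_assoc]" and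
    ss = "[RB (CX MulA 0 Mul) 0 2 0 0, RB (CX MulA 1 (V 0)) 1 3 0 0, RB (CX MulA 0 MulA) 2 4 0 0,
    RB (U 0) 3 5 0 0, RB (U 1) 5 0 0 0, SL 4, SL 3, SL 2, SL 1, SL 0, RB (U 2) 5 0 0 0, SR 0, SR 1,
    SR 2, SR 3]"])
    (simp only: good_simps assms simp_thms, simp del: One_nat_def add: coasc_inv_left asc_inv_left assms, code_simp)

lemma free_right_unit_right:
  assumes "valid (mirror_eq eq_free_right_unit)"
  shows "valid eq_free_right_unit_right"
  by (rule certified[where L = "basic_gens" and R = "[mirror_eq eq_free_right_unit]" and
    ss = "[RF (U 0) 0 0 0 0]"])
    (simp only: good_simps assms simp_thms, simp del: One_nat_def add: assms, code_simp)

lemma free_compatible_right: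
  assumes "valid (mirror_eq eq_free_compatible)"
  shows "valid eq_free_compatible_right"
  by (rule certified[where L = "basic_gens" and R = "[eq_coasc_inv_left, eq_asc_inv_left, mirror_eq eq_free_compatible]" and
    ss = "[RB (CX MulA 0 (V 0)) 0 5 0 0, RB (U 0) 1 6 0 0, RB (U 1) 3 0 0 0, SL 2, SL 1, SL 0,
    RB (U 2) 3 0 0 0, SR 0, SR 1]"])
    (simp only: good_simps assms simp_thms, simp del: One_nat_def add: coasc_inv_left asc_inv_left assms, code_simp)

lemma trivial_assoc_right:
  assumes "valid (mirror_eq eq_trivial_assoc)"
  shows "valid eq_trivial_assoc_right"
  by (rule certified[where L = "basic_gens" and R = "[eq_coasc_inv_left, eq_asc_inv_left, mirror_eq eq_trivial_assoc]" and
    ss = "[RB (CX MulA 0 (V 0)) 0 3 0 0, RB (U 0) 1 4 0 0, RB (U 1) 3 0 0 0, SL 2, SL 1, SL 0,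
    RB (U 2) 3 0 0 0, SR 0, SR 1]"])
    (simp only: good_simps assms simp_thms, simp del: One_nat_def add: coasc_inv_left asc_inv_left assms, code_simp)

lemma trivial_unit_right:
  assumes "valid (mirror_eq eq_trivial_unit)"
  shows "valid eq_trivial_unit_right"
  by (rule certified[where L = "basic_gens" and R = "[mirror_eq eq_trivial_unit]" and
    ss = "[RF (U 0) 0 0 0 0]"])
    (simp only: good_simps assms simp_thms, simp del: One_nat_def add: assms, code_simp)

lemma trivial_compatible_right:
  assumes "valid (mirror_eq eq_trivial_compatible)"
  shows "valid eq_trivial_compatible_right"
  by (rule certified[where L = "basic_gens" and R = "[eq_coasc_inv_left, eq_asc_inv_left, mirror_eq eq_trivial_compatible]" and
    ss = "[RB (CX MulA 0 (V 0)) 0 2 0 0, RB (U 0) 1 3 0 0, RB (U 1) 3 0 0 0, SL 2, SL 1, SL 0,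
    RB (U 2) 3 0 0 0, SR 0, SR 1]"])
    (simp only: good_simps assms simp_thms, simp del: One_nat_def add: coasc_inv_left asc_inv_left assms, code_simp)

lemma counit_left_linear_right:
  assumes "valid (mirror_eq eq_counit_left_linear)"
  shows "valid eq_counit_left_linear_right"
  by (rule certified[where L = "basic_gens" and R = "[mirror_eq eq_counit_left_linear]" and
    ss = "[RF (U 0) 0 0 0 0]"])
    (simp only: good_simps assms simp_thms, simp del: One_nat_def add: assms, code_simp)

lemma counit_right_linear_right:
  assumes "valid (mirror_eq eq_counit_right_linear)"
  shows "valid eq_counit_right_linear_right"
  by (rule certified[where L = "basic_gens" and R = "[mirror_eq eq_counit_right_linear]" and
    ss = "[RF (U 0) 0 0 0 0]"])
    (simp only: good_simps assms simp_thms, simp del: One_nat_def add: assms, code_simp)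

lemma unit_right_linear_right:
  assumes "valid (mirror_eq eq_unit_right_linear)"
  shows "valid eq_unit_right_linear_right"
  by (rule certified[where L = "basic_gens" and R = "[mirror_eq eq_unit_right_linear]" and
    ss = "[RF (U 0) 0 0 0 0]"])
    (simp only: good_simps assms simp_thms, simp del: One_nat_def add: assms, code_simp)

lemma counit_unit_right:
  assumes "valid (mirror_eq eq_counit_unit)"
  shows "valid eq_counit_unit_right"
  by (rule certified[where L = "basic_gens" and R = "[mirror_eq eq_counit_unit]" and
    ss = "[RF (U 0) 0 0 0 0]"])
    (simp only: good_simps assms simp_thms, simp del: One_nat_def add: assms, code_simp)

lemma retract_a_linear_right:
    assumes "good (G (ActRA 1))" and "good (G (ActRA 2))" and "good (G Nab)" and "good (G (Two 0 1 2))" and "valid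
    (mirror_eq eq_retract_a_linear)"
  shows "valid eq_retract_a_linear_right"
  by (rule certified[where L = "basic_gens @ [ActRA 1, ActRA 2, Nab, Two 0 1 2]" and R = "[mirror_eq eq_retract_a_linear]" and
    ss = "[RF (U 0) 0 0 0 0]"])
    (simp only: good_simps assms simp_thms, simp del: One_nat_def add: assms, code_simp)

lemma retract_i_linear_right:
    assumes "good (G (ActLI 1))" and "good (G (ActRA 1))" and "good (G (ActRA 2))" and "good (G Nab)" and "good (G
    (Two 0 1 2))" and "valid (mirror_eq eq_retract_i_linear)"
  shows "valid eq_retract_i_linear_right"
  by (rule certified[where L = "basic_gens @ [ActLI 1, ActRA 1, ActRA 2, Nab, Two 0 1 2]" and R = "[mirror_eq eq_retract_i_linear]" and
    ss = "[RF (U 0) 0 0 0 0]"])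
    (simp only: good_simps assms simp_thms, simp del: One_nat_def add: assms, code_simp)

lemma retract_natural_right:
    assumes "good (G (ActRA 3))" and "good (G (ActRA 4))" and "good (G Nab)" and "good (G (Two 0 1 2))" and "good (G
    (Two 1 3 1))" and "good (G (Two 2 2 4))" and "valid (mirror_eq eq_retract_natural)"
  shows "valid eq_retract_natural_right"
  by (rule certified[where L = "basic_gens @ [ActRA 3, ActRA 4, Nab, Two 0 1 2, Two 1 3 1, Two 2 2 4]" and R = "[mirror_eq eq_retract_natural]" and
    ss = "[RF (U 0) 0 0 0 0]"])
    (simp only: good_simps assms simp_thms, simp del: One_nat_def add: assms, code_simp)

lemma retract_of_linear_right:
    assumes "good (G (ActRA 1))" and "good (G (ActRA 2))" and "good (G Nab)" and "good (G (Two 0 1 2))" and "valid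
    (mirror_eq eq_retract_of_linear)"
  shows "valid eq_retract_of_linear_right"
  by (rule certified[where L = "basic_gens @ [ActRA 1, ActRA 2, Nab, Two 0 1 2]" and R = "[mirror_eq eq_retract_of_linear]" and
    ss = "[RF (U 0) 0 0 0 0]"])
    (simp only: good_simps assms simp_thms, simp del: One_nat_def add: assms, code_simp)

lemma section_left_linear_right:
  assumes "good (G TheR)" and "valid (mirror_eq eq_section_left_linear)"
  shows "valid eq_section_left_linear_right"
  by (rule certified[where L = "basic_gens @ [TheR]" and R = "[mirror_eq eq_section_left_linear]" and
    ss = "[RF (U 0) 0 0 0 0]"])
    (simp only: good_simps assms simp_thms, simp del: One_nat_def add: assms, code_simp)

lemma section_right_linear_right:
  assumes "good (G TheR)" and "valid (mirror_eq eq_section_right_linear)"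
  shows "valid eq_section_right_linear_right"
  by (rule certified[where L = "basic_gens @ [TheR]" and R = "[mirror_eq eq_section_right_linear]" and
    ss = "[RF (U 0) 0 0 0 0]"])
    (simp only: good_simps assms simp_thms, simp del: One_nat_def add: assms, code_simp)

lemma section_splits_right:
  assumes "good (G TheR)" and "valid (mirror_eq eq_section_splits)"
  shows "valid eq_section_splits_right"
  by (rule certified[where L = "basic_gens @ [TheR]" and R = "[mirror_eq eq_section_splits]" and
    ss = "[RF (U 0) 0 0 0 0]"])
    (simp only: good_simps assms simp_thms, simp del: One_nat_def add: assms, code_simp)

text \<open>The left-hand equation is used in the reversed Gray monoid, \<open>opp_validD\<close>
  carries its mirror image back, and the lemma ending in \<open>_right\<close> restates it. The
  other lemmas ending in \<open>_dual\<close> follow this pattern, translating hypotheses as well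
  where there are any.\<close>

lemma free_left_assoc_dual: "valid eq_free_left_assoc_right"
  by (rule free_left_assoc_right[OF opp_validD[OF hopf_diagrams.free_left_assoc[OF opp_hopf] good_simps(4)]]) code_simp

lemma free_left_unit_dual: "valid eq_free_left_unit_right"
  by (rule free_left_unit_right[OF opp_validD[OF hopf_diagrams.free_left_unit[OF opp_hopf] good_simps(4)]]) code_simp

lemma free_right_assoc_dual: "valid eq_free_right_assoc_right"
  by (rule free_right_assoc_right[OF opp_validD[OF monoidale_diagrams.free_right_assoc[OF hopf_diagrams.axioms(1)[OF opp_hopf]] good_simps(4)]]) code_simp

lemma free_right_unit_dual: "valid eq_free_right_unit_right"
  by (rule free_right_unit_right[OF opp_validD[OF monoidale_diagrams.free_right_unit[OF hopf_diagrams.axioms(1)[OF opp_hopf]] good_simps(4)]]) code_simp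

lemma free_compatible_dual: "valid eq_free_compatible_right"
  by (rule free_compatible_right[OF opp_validD[OF hopf_diagrams.free_compatible[OF opp_hopf] good_simps(4)]]) code_simp

lemma trivial_assoc_dual: "valid eq_trivial_assoc_right"
  by (rule trivial_assoc_right[OF opp_validD[OF hopf_diagrams.trivial_assoc[OF opp_hopf] good_simps(4)]]) code_simp

lemma trivial_unit_dual: "valid eq_trivial_unit_right"
  by (rule trivial_unit_right[OF opp_validD[OF hopf_diagrams.trivial_unit[OF opp_hopf] good_simps(4)]]) code_simp

lemma trivial_compatible_dual: "valid eq_trivial_compatible_right"
  by (rule trivial_compatible_right[OF opp_validD[OF hopf_diagrams.trivial_compatible[OF opp_hopf] good_simps(4)]]) code_simp

lemma counit_left_linear_dual: "valid eq_counit_left_linear_right"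
  by (rule counit_left_linear_right[OF opp_validD[OF hopf_diagrams.counit_left_linear[OF opp_hopf] good_simps(4)]]) code_simp

lemma counit_right_linear_dual: "valid eq_counit_right_linear_right"
  by (rule counit_right_linear_right[OF opp_validD[OF hopf_diagrams.counit_right_linear[OF opp_hopf] good_simps(4)]]) code_simp

lemma unit_right_linear_dual: "valid eq_unit_right_linear_right"
  by (rule unit_right_linear_right[OF opp_validD[OF hopf_diagrams.unit_right_linear[OF opp_hopf] good_simps(4)]]) code_simp

lemma counit_unit_dual: "valid eq_counit_unit_right"
  by (rule counit_unit_right[OF opp_validD[OF hopf_diagrams.counit_unit[OF opp_hopf] good_simps(4)]]) code_simp

lemma opp_good_gens: "good_gens (concat (map (\<lambda>g. gens (gmir g)) L)) \<Longrightarrow> diagrams.good_gens (opp B) M Fm Tm L"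
  using opp_good diagrams.good_gens_def[OF opp_diagrams, of Tm L] by (auto simp: good_gens_def)

lemma retract_a_linear_dual:
  assumes g: "good (G (ActRA 1))" "good (G (ActRA 2))" "good (G Nab)" "good (G (Two 0 1 2))"
    and h: "valid eq_ract_y_assoc" "valid eq_ract_x_assoc" "valid eq_nab_right_linear" "valid eq_nab_left_linear"
  shows "valid eq_retract_a_linear_right"
proof -
  interpret o: hopf_diagrams "opp B" M Fm Tm by (rule opp_hopf)
  have L: "good_gens (basic_gens @ [ActRA 1, ActRA 2, Nab, Two 0 1 2])" using g by (simp add: good_simps)
  have e: "o.good_gens [ActL 1, ActL 2, Nab, Two 0 1 2]" by (rule opp_good_gens) (simp add: g good_simps)
  then have o: "o.good_gens (basic_gens @ [ActL 1, ActL 2, Nab, Two 0 1 2])" by (simp add: o.good_simps)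
  note v = opp_validI[OF o]
  have "o.valid eq_retract_a_linear"
    by (rule o.retract_a_linear; (use e in \<open>simp add: o.good_simps; fail\<close>)?; rule v, code_simp)
      (simp_all add: g h act_y_assoc_mir act_x_assoc_mir nab_left_linear_mir nab_right_linear_mir)
  then have "valid (mirror_eq eq_retract_a_linear)"
    by (rule opp_validD[OF _ L]) code_simp
  then show ?thesis
    by (intro retract_a_linear_right g)
qed

lemma retract_i_linear_dual:
  assumes g: "good (G (ActRA 1))" "good (G (ActRA 2))" "good (G (ActLI 1))" "good (G Nab)" "good (G (Two 0 1 2))" "good (G (ActLI 2))"
    and h: "valid eq_ract_x_compatible" "valid eq_ract_y_compatible" "valid eq_h_ri_linear"
  shows "valid eq_retract_i_linear_right"
proof -
  interpret o: hopf_diagrams "opp B" M Fm Tm by (rule opp_hopf)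
  have L: "good_gens (basic_gens @ [ActRA 1, ActRA 2, ActLI 1, Nab, Two 0 1 2, ActLI 2])" using g by (simp add: good_simps)
  have e: "o.good_gens [ActL 1, ActL 2, ActR 1, Nab, Two 0 1 2, ActR 2]" by (rule opp_good_gens) (simp add: g good_simps)
  then have o: "o.good_gens (basic_gens @ [ActL 1, ActL 2, ActR 1, Nab, Two 0 1 2, ActR 2])" by (simp add: o.good_simps)
  note v = opp_validI[OF o]
  have "o.valid eq_retract_i_linear"
    by (rule o.retract_i_linear; (use e in \<open>simp add: o.good_simps; fail\<close>)?; rule v, code_simp)
      (simp_all add: g h act_x_compatible_mir act_y_compatible_mir h_i_linear_mir)
  then have "valid (mirror_eq eq_retract_i_linear)"
    by (rule opp_validD[OF _ L]) code_simp
  then show ?thesis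
    by (intro retract_i_linear_right g)
qed

lemma retract_natural_dual:
  assumes g: "good (G (ActRA 3))" "good (G (ActRA 4))" "good (G Nab)" "good (G (Two 0 1 2))" "good (G (Two 1 3 1))" "good (G (Two 2 2 4))" "good (G (ActRA 1))" "good (G (ActRA 2))"
    and h: "valid eq_f_ra_linear" "valid eq_g_ra_linear"
  shows "valid eq_retract_natural_right"
proof -
  interpret o: hopf_diagrams "opp B" M Fm Tm by (rule opp_hopf)
  have L: "good_gens (basic_gens @ [ActRA 3, ActRA 4, Nab, Two 0 1 2, Two 1 3 1, Two 2 2 4, ActRA 1, ActRA 2])" using g by (simp add: good_simps)
  have e: "o.good_gens [ActL 3, ActL 4, Nab, Two 0 1 2, Two 1 3 1, Two 2 2 4, ActL 1, ActL 2]" by (rule opp_good_gens) (simp add: g good_simps)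
  then have o: "o.good_gens (basic_gens @ [ActL 3, ActL 4, Nab, Two 0 1 2, Two 1 3 1, Two 2 2 4, ActL 1, ActL 2])" by (simp add: o.good_simps)
  note v = opp_validI[OF o]
  have "o.valid eq_retract_natural"
    by (rule o.retract_natural; (use e in \<open>simp add: o.good_simps; fail\<close>)?; rule v, code_simp)
      (simp_all add: g h f_a_linear_mir g_a_linear_mir)
  then have "valid (mirror_eq eq_retract_natural)"
    by (rule opp_validD[OF _ L]) code_simp
  then show ?thesis
    by (intro retract_natural_right g)
qed

lemma retract_of_linear_dual:
  assumes g: "good (G (ActRA 1))" "good (G (ActRA 2))" "good (G Nab)" "good (G (Two 0 1 2))"
    and h: "valid eq_h_ra_linear" "valid eq_ract_x_assoc" "valid eq_ract_x_unit" "valid eq_nab_splits"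
  shows "valid eq_retract_of_linear_right"
proof -
  interpret o: hopf_diagrams "opp B" M Fm Tm by (rule opp_hopf)
  have L: "good_gens (basic_gens @ [ActRA 1, ActRA 2, Nab, Two 0 1 2])" using g by (simp add: good_simps)
  have e: "o.good_gens [ActL 1, ActL 2, Nab, Two 0 1 2]" by (rule opp_good_gens) (simp add: g good_simps)
  then have o: "o.good_gens (basic_gens @ [ActL 1, ActL 2, Nab, Two 0 1 2])" by (simp add: o.good_simps)
  note v = opp_validI[OF o]
  have "o.valid eq_retract_of_linear"
    by (rule o.retract_of_linear; (use e in \<open>simp add: o.good_simps; fail\<close>)?; rule v, code_simp)
      (simp_all add: g h h_a_linear_mir act_x_assoc_mir act_x_unit_mir nab_splits_mir)
  then have "valid (mirror_eq eq_retract_of_linear)"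
    by (rule opp_validD[OF _ L]) code_simp
  then show ?thesis
    by (intro retract_of_linear_right g)
qed

lemma section_left_linear_dual:
  assumes g: "good (G TheR)"
    and h: "valid eq_rtheta_a_linear"
  shows "valid eq_section_left_linear_right"
proof -
  interpret o: hopf_diagrams "opp B" M Fm Tm by (rule opp_hopf)
  have L: "good_gens (basic_gens @ [TheR])" using g by (simp add: good_simps)
  have e: "o.good_gens [The]" by (rule opp_good_gens) (simp add: g good_simps)
  then have o: "o.good_gens (basic_gens @ [The])" by (simp add: o.good_simps)
  note v = opp_validI[OF o]
  have "o.valid eq_section_left_linear"
    by (rule o.section_left_linear; (use e in \<open>simp add: o.good_simps; fail\<close>)?; rule v, code_simp)
      (simp_all add: g h theta_a_linear_mir)
  then have "valid (mirror_eq eq_section_left_linear)"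
    by (rule opp_validD[OF _ L]) code_simp
  then show ?thesis
    by (intro section_left_linear_right g)
qed

lemma section_right_linear_dual:
  assumes g: "good (G TheR)"
    and h: "valid eq_rtheta_i_linear"
  shows "valid eq_section_right_linear_right"
proof -
  interpret o: hopf_diagrams "opp B" M Fm Tm by (rule opp_hopf)
  have L: "good_gens (basic_gens @ [TheR])" using g by (simp add: good_simps)
  have e: "o.good_gens [The]" by (rule opp_good_gens) (simp add: g good_simps)
  then have o: "o.good_gens (basic_gens @ [The])" by (simp add: o.good_simps)
  note v = opp_validI[OF o]
  have "o.valid eq_section_right_linear"
    by (rule o.section_right_linear; (use e in \<open>simp add: o.good_simps; fail\<close>)?; rule v, code_simp)
      (simp_all add: g h theta_i_linear_mir)
  then have "valid (mirror_eq eq_section_right_linear)"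
    by (rule opp_validD[OF _ L]) code_simp
  then show ?thesis
    by (intro section_right_linear_right g)
qed

lemma section_splits_dual:
  assumes g: "good (G TheR)"
    and h: "valid eq_rtheta_normalized"
  shows "valid eq_section_splits_right"
proof -
  interpret o: hopf_diagrams "opp B" M Fm Tm by (rule opp_hopf)
  have L: "good_gens (basic_gens @ [TheR])" using g by (simp add: good_simps)
  have e: "o.good_gens [The]" by (rule opp_good_gens) (simp add: g good_simps)
  then have o: "o.good_gens (basic_gens @ [The])" by (simp add: o.good_simps)
  note v = opp_validI[OF o]
  have "o.valid eq_section_splits"
    by (rule o.section_splits; (use e in \<open>simp add: o.good_simps; fail\<close>)?; rule v, code_simp)
      (simp_all add: g h theta_normalized_mir)
  then have "valid (mirror_eq eq_section_splits)"
    by (rule opp_validD[OF _ L]) code_simp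
  then show ?thesis
    by (intro section_splits_right g)
qed

end

section \<open>Modules over the Hopf monoid\<close>

context
  fixes B :: "('o, 'f, 't, 'z) monoidale_scheme" (structure)
begin

text \<open>A section \<open>s : a \<Rightarrow> a \<bullet> a\<close> of the multiplication that is a morphism of bimodules yields a natural
  section of every action, by inserting the element \<open>s \<odot> \<eta>\<close>; averaging a 2-cell over it makes it a
  morphism of modules.\<close>

definition split_left :: "'f \<Rightarrow> 't \<Rightarrow> 't \<Rightarrow> 'f \<Rightarrow> 't \<Rightarrow> 't" where
  "split_left a \<eta> s x l = (\<langle>a\<rangle> \<bullet>\<^sub>2 l) \<odot> bul_asc B a a x \<odot> ((s \<odot> \<eta>) \<bullet>\<^sub>2 \<langle>x\<rangle>) \<odot> inv2 B (bul_lun B x)"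

definition retract_left :: "'f \<Rightarrow> 't \<Rightarrow> 't \<Rightarrow> 'f \<Rightarrow> 't \<Rightarrow> 't \<Rightarrow> 't \<Rightarrow> 't" where
  "retract_left a \<eta> s x l l' h = l' \<odot> (\<langle>a\<rangle> \<bullet>\<^sub>2 h) \<odot> split_left a \<eta> s x l"

definition split_right :: "'f \<Rightarrow> 't \<Rightarrow> 't \<Rightarrow> 'f \<Rightarrow> 't \<Rightarrow> 't" where
  "split_right a \<eta> s x r = (r \<bullet>\<^sub>2 \<langle>a\<rangle>) \<odot> inv2 B (bul_asc B x a a) \<odot> (\<langle>x\<rangle> \<bullet>\<^sub>2 (s \<odot> \<eta>)) \<odot> inv2 B (bul_run B x)"

definition retract_right :: "'f \<Rightarrow> 't \<Rightarrow> 't \<Rightarrow> 'f \<Rightarrow> 't \<Rightarrow> 't \<Rightarrow> 't \<Rightarrow> 't" where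
  "retract_right a \<eta> s x r r' h = r' \<odot> (h \<bullet>\<^sub>2 \<langle>a\<rangle>) \<odot> split_right a \<eta> s x r"

end

lemma endo_more: "endo counitL" "endo counitR" "endo unitL" "endo unitR" "endo nabla" "endo (mirror nabla)"
  "endo retr" "endo retrR" "endo (VC (Cell Nab) (Cell Eta))"
  "endo (e_freeL wA (Cell Mu) [])" "endo (e_freeR [] (Cell EpsM) wA)" "endo (e_freeR wA (Cell Mu) [])" "endo (e_freeL [] (Cell EpsM) wA)"
  "endo (VC (Cell (Two 2 2 4)) (VC (Cell (Two 0 1 2)) (Cell (Two 1 3 1))))"
  by code_simp+

lemma gens_free: "gens (e_freeL p m z) = gens m @ [AscI, CoAscI]" "gens (e_freeR p m z) = gens m @ [Asc, CoAsc]"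
  by (simp_all add: e_freeL_def e_freeR_def gens_simps)

definition shape :: "expr \<Rightarrow> (nat \<times> word \<times> word) option" where
  "shape s = map_option (\<lambda>(k, w, D, v). (k, w, v)) (compile s)"

lemma shape_retr: "shape retr = Some (1, wX, wY)" "shape retrR = Some (1, wX, wY)"
  by code_simp+

definition "eq_inv1_x3aa = (VC (einv (e_asc wX' wA wA)) (e_asc wX' wA wA), Id 1 (bulw (bulw wX' wA) wA))"
definition "eq_inv2_x3aa = (VC (e_asc wX' wA wA) (einv (e_asc wX' wA wA)), Id 1 (bulw wX' (bulw wA wA)))"

context hopf_model
begin

lemma sem_typed: "shape s = Some (k, w, v) \<Longrightarrow> good_gens (gens s) \<Longrightarrow> sem s \<in> hom2 B (ev k w) (ev k v)"
  using goods_gens[of s] compile_sound[of s] dev_hom by (auto simp: good_gens_def shape_def)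

lemma good_gens_sub: "good_gens L \<Longrightarrow> list_all (\<lambda>g. g \<in> set L) (gens s) \<Longrightarrow> good_gens (gens s)"
  by (auto simp: good_gens_def list_all_iff)

lemma inv1_x3aa: "valid eq_inv1_x3aa"
  by (rule certified[where L = "struct_gens" and R = "[eq_coasc_inv_left, eq_asc_inv_left]" and
    ss = "[SL 1, SL 2, SL 3, RF (U 0) 4 5 0 0, SL 0, SL 1, SL 2, SL 3, RF (CX MulA 0 (V 0)) 4 4 0 0,
    RF (CY (V 3) 0 Mul) 1 1 0 0, RF (U 1) 0 0 0 0]"])
    (simp only: good_struct simp_thms, simp add: coasc_inv_left asc_inv_left, code_simp)

lemma inv2_x3aa: "valid eq_inv2_x3aa"
  by (rule certified[where L = "struct_gens" and R = "[eq_asc_inv_right, eq_coasc_inv_right]" and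
    ss = "[SR 2, SR 3, SR 4, RF (U 0) 5 0 0 0, SR 0, SR 1, SR 2, SR 3, RF (CX (V 3) 0 Mul) 4 1 0 0,
    RF (CY MulA 0 (V 0)) 1 4 0 0, RF (U 1) 0 5 0 0]"])
    (simp only: good_struct simp_thms, simp add: asc_inv_right coasc_inv_right, code_simp)

lemma sem_inv_asc: "sem (einv (e_asc wA wA [])) = inv2 B (bul_asc B (F (V 0)) (F (V 0)) (iobj B))"
  "sem (einv (e_asc wA wA wX)) = inv2 B (bul_asc B (F (V 0)) (F (V 0)) (F (V 1)))"
  "sem (einv (e_asc wA wA wA)) = inv2 B (bul_asc B (F (V 0)) (F (V 0)) (F (V 0)))"
  "sem (einv (e_asc [] [] wA)) = inv2 B (bul_asc B (iobj B) (iobj B) (F (V 0)))"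
  "sem (einv (e_asc wX wA wA)) = inv2 B (bul_asc B (F (V 1)) (F (V 0)) (F (V 0)))"
  "sem (einv (e_asc [] wA wA)) = inv2 B (bul_asc B (iobj B) (F (V 0)) (F (V 0)))"
  "sem (einv (e_asc wX' wA wA)) = inv2 B (bul_asc B (F (V 3)) (F (V 0)) (F (V 0)))"
proof -
  have "inv_ok struct_gens (e_asc wA wA []) eq_inv1_aai eq_inv2_aai" "inv_ok struct_gens (e_asc wA wA wX) eq_inv1_aax eq_inv2_aax"
    "inv_ok struct_gens (e_asc wA wA wA) eq_inv1_aaa eq_inv2_aaa" "inv_ok struct_gens (e_asc [] [] wA) eq_inv1_iia eq_inv2_iia"
    "inv_ok struct_gens (e_asc wX wA wA) eq_inv1_xaa eq_inv2_xaa" "inv_ok struct_gens (e_asc [] wA wA) eq_inv1_iaa eq_inv2_iaa"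
    "inv_ok struct_gens (e_asc wX' wA wA) eq_inv1_x3aa eq_inv2_x3aa"
    by code_simp+
  note i = this[THEN sem_inv[OF good_struct, rotated -1]]
  show "sem (einv (e_asc wA wA [])) = inv2 B (bul_asc B (F (V 0)) (F (V 0)) (iobj B))"
    "sem (einv (e_asc wA wA wX)) = inv2 B (bul_asc B (F (V 0)) (F (V 0)) (F (V 1)))"
    "sem (einv (e_asc wA wA wA)) = inv2 B (bul_asc B (F (V 0)) (F (V 0)) (F (V 0)))"
    "sem (einv (e_asc [] [] wA)) = inv2 B (bul_asc B (iobj B) (iobj B) (F (V 0)))"
    "sem (einv (e_asc wX wA wA)) = inv2 B (bul_asc B (F (V 1)) (F (V 0)) (F (V 0)))"
    "sem (einv (e_asc [] wA wA)) = inv2 B (bul_asc B (iobj B) (F (V 0)) (F (V 0)))"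
    "sem (einv (e_asc wX' wA wA)) = inv2 B (bul_asc B (F (V 3)) (F (V 0)) (F (V 0)))"
    using i(1)[OF inv1_aai inv2_aai] i(2)[OF inv1_aax inv2_aax] i(3)[OF inv1_aaa inv2_aaa]
      i(4)[OF inv1_iia inv2_iia] i(5)[OF inv1_xaa inv2_xaa] i(6)[OF inv1_iaa inv2_iaa]
      i(7)[OF inv1_x3aa inv2_x3aa]
    by (simp_all add: sem_asc endow_simps ev_V iobj_def)
qed

lemma sem_inv_unit: "sem (einv (e_lun wX)) = inv2 B (bul_lun B (F (V 1)))" "sem (einv (e_lun wX')) = inv2 B (bul_lun B (F (V 3)))"
  "sem (einv (e_run wX)) = inv2 B (bul_run B (F (V 1)))" "sem (einv (e_run wX')) = inv2 B (bul_run B (F (V 3)))"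
proof -
  have "inv_ok struct_gens (e_lun wX) eq_inv1_lx eq_inv2_lx" "inv_ok struct_gens (e_lun wX') eq_inv1_lx3 eq_inv2_lx3"
    "inv_ok struct_gens (e_run wX) eq_inv1_rx eq_inv2_rx" "inv_ok struct_gens (e_run wX') eq_inv1_rx3 eq_inv2_rx3"
    by code_simp+
  note i = this[THEN sem_inv[OF good_struct, rotated -1]]
  show "sem (einv (e_lun wX)) = inv2 B (bul_lun B (F (V 1)))" "sem (einv (e_lun wX')) = inv2 B (bul_lun B (F (V 3)))"
    "sem (einv (e_run wX)) = inv2 B (bul_run B (F (V 1)))" "sem (einv (e_run wX')) = inv2 B (bul_run B (F (V 3)))"
    using i(1)[OF inv1_lx inv2_lx] i(2)[OF inv1_lx3 inv2_lx3] i(3)[OF inv1_rx inv2_rx] i(4)[OF inv1_rx3 inv2_rx3]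
    by (simp_all add: sem_lun sem_run endow_simps ev_V)
qed

lemma sem_free: "sem (e_freeL wA (Cell Mu) []) = free_left_action B (F (V 0)) (T Mu) (iobj B)"
  "sem (e_freeL wA (Cell Mu) wA) = free_left_action B (F (V 0)) (T Mu) (F (V 0))"
  "sem (e_freeL [] (Cell EpsM) wA) = free_left_action B (iobj B) (xi_mult B) (F (V 0))"
  "sem (e_freeR [] (Cell EpsM) wA) = free_right_action B (iobj B) (xi_mult B) (F (V 0))"
  "sem (e_freeR wA (Cell Mu) []) = free_right_action B (F (V 0)) (T Mu) (iobj B)"
  "sem (e_freeR wA (Cell Mu) wA) = free_right_action B (F (V 0)) (T Mu) (F (V 0))"
  by (simp_all add: e_freeL_def e_freeR_def free_left_action_def free_right_action_def frozen_simps sem_inv_asc[unfolded iobj_def])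

lemmas module_simps = frozen_simps endo_more gens_free sem_inv_asc[unfolded iobj_def] sem_inv_unit sem_free[unfolded iobj_def xi_mult_def]

lemma retr_eq: assumes "good (G Nab)" "good (G (ActL 1))" "good (G (ActL 2))" "good (G (Two 0 1 2))"
  shows "sem retr = retract_left B (F (V 0)) (T Eta) (T Nab) (F (V 1)) (T (ActL 1)) (T (ActL 2)) (T (Two 0 1 2))"
  using assms by (simp add: retr_def splitX_def e_split_def retract_left_def split_left_def module_simps)

lemma gens_retr: "gens retr = [ActL 2, Two 0 1 2, ActL 1, Asc, CoAsc, Nab, Eta, LunI, CoLunI]"
  "gens retrR = [ActRA 2, Two 0 1 2, ActRA 1, AscI, CoAscI, Nab, Eta, RunI, CoRunI]"
  by (simp_all add: retr_def splitX_def e_split_def retrR_def splitRX_def e_splitR_def gens_simps)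

abbreviation (input) "bim_ai n \<equiv> bimodule B (F (V 0)) (T Mu) (T Eta) \<i> (xi_mult B) (xi_unit B) (F (V n)) (T (ActL n)) (T (ActR n))"
abbreviation (input) "hom_l m n \<equiv> left_module_hom B (F (V 0)) (F (V m)) (T (ActL m)) (F (V n)) (T (ActL n))"
abbreviation (input) "hom_ri m n \<equiv> right_module_hom B \<i> (F (V m)) (T (ActR m)) (F (V n)) (T (ActR n))"

lemma bim_ai_good: "bim_ai n \<Longrightarrow> good (G (ActL n))" "bim_ai n \<Longrightarrow> good (G (ActR n))"
  by (simp_all add: bimodule_def left_module_def right_module_def good_def ev_V ev_bul_V)

lemma hom_good: "t \<in> hom2 B (F (V m)) (F (V n)) \<Longrightarrow> t = T (Two i m n) \<Longrightarrow> good (G (Two i m n))"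
  by (simp add: good_def ev_V)

context
  assumes nab: "left_module_hom B (F (V 0)) (F (V 0)) (T Mu) (bul1 B (F (V 0)) (F (V 0))) (free_left_action B (F (V 0)) (T Mu) (F (V 0))) (T Nab)"
    "right_module_hom B (F (V 0)) (F (V 0)) (T Mu) (bul1 B (F (V 0)) (F (V 0))) (free_right_action B (F (V 0)) (T Mu) (F (V 0))) (T Nab)"
    and nab_split: "T Mu \<odot> T Nab = \<langle>F (V 0)\<rangle>"
begin

lemma nab_good: "good (G Nab)"
  using nab(1) by (simp add: good_def left_module_hom_def ev_V ev_bul_V)

lemma nab_valid: "valid eq_nab_left_linear" "valid eq_nab_right_linear" "valid eq_nab_splits"
proof -
  have g: "good_gens (basic_gens @ [Nab])"
    using nab_good by (simp add: good_simps)
  note v = valid_wf[OF g]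
  show "valid eq_nab_left_linear" by (rule v, code_simp) (use nab nab_good in \<open>simp add: eq_nab_left_linear_def left_module_hom_def module_simps\<close>)
  show "valid eq_nab_right_linear" by (rule v, code_simp) (use nab nab_good in \<open>simp add: eq_nab_right_linear_def right_module_hom_def module_simps\<close>)
  show "valid eq_nab_splits" by (rule v, code_simp) (use nab_split in \<open>simp add: eq_nab_splits_def module_simps\<close>)
qed

lemma retract_left_hom:
  assumes x: "bim_ai 1" and y: "bim_ai 2" and h: "hom_ri 1 2 (T (Two 0 1 2))"
  shows "hom_l 1 2 (retract_left B (F (V 0)) (T Eta) (T Nab) (F (V 1)) (T (ActL 1)) (T (ActL 2)) (T (Two 0 1 2)))" (is ?L)
    and "hom_ri 1 2 (retract_left B (F (V 0)) (T Eta) (T Nab) (F (V 1)) (T (ActL 1)) (T (ActL 2)) (T (Two 0 1 2)))" (is ?R)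
    and "hom_l 1 2 (T (Two 0 1 2)) \<Longrightarrow>
      retract_left B (F (V 0)) (T Eta) (T Nab) (F (V 1)) (T (ActL 1)) (T (ActL 2)) (T (Two 0 1 2)) = T (Two 0 1 2)" (is "?h \<Longrightarrow> ?I")
proof -
  have h': "good (G (Two 0 1 2))" using h by (intro hom_good) (simp_all add: right_module_hom_def)
  note g = nab_good bim_ai_good[OF x] bim_ai_good[OF y] h'
  have L: "good_gens (basic_gens @ [Nab, ActL 1, ActR 1, ActL 2, ActR 2, Two 0 1 2])"
    using g by (simp add: good_simps)
  note v = valid_wf[OF L] and D = left_module_def right_module_def bimodule_def left_module_hom_def right_module_hom_def
  \<comment> \<open>The module axioms are read as valid equations, from which the certified lemmas
    apply; \<open>validD\<close> then translates their conclusions back into equations between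
    2-cells.\<close>
  have "valid eq_act_x_assoc" by (rule v, code_simp) (use x g in \<open>simp add: eq_act_x_assoc_def D module_simps\<close>)
  moreover have "valid eq_act_x_unit" by (rule v, code_simp) (use x g in \<open>simp add: eq_act_x_unit_def D module_simps\<close>)
  moreover have "valid eq_act_y_assoc" by (rule v, code_simp) (use y g in \<open>simp add: eq_act_y_assoc_def D module_simps\<close>)
  moreover have "valid eq_act_x_compatible" by (rule v, code_simp) (use x g in \<open>simp add: eq_act_x_compatible_def D module_simps\<close>)
  moreover have "valid eq_act_y_compatible" by (rule v, code_simp) (use y g in \<open>simp add: eq_act_y_compatible_def D module_simps\<close>)
  moreover have "valid eq_h_i_linear" by (rule v, code_simp) (use h g in \<open>simp add: eq_h_i_linear_def D module_simps\<close>)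
  ultimately have p: "valid eq_retract_a_linear" "valid eq_retract_i_linear" "valid eq_h_a_linear \<Longrightarrow> valid eq_retract_of_linear"
    using retract_a_linear retract_i_linear retract_of_linear nab_valid g by blast+
  have t: "sem retr \<in> hom2 B (F (V 1)) (F (V 2))"
    using sem_typed[of retr 1 wX wY, unfolded gens_retr shape_retr] g by (simp add: module_simps)
  note e = retr_eq[OF g(1,2,4,6)]
  show ?L using t validD[OF p(1)] g by (simp add: eq_retract_a_linear_def D module_simps gens_retr e)
  show ?R using t validD[OF p(2)] g by (simp add: eq_retract_i_linear_def D module_simps gens_retr e)
  assume h: ?h
  have "valid eq_h_a_linear" by (rule v, code_simp) (use g h in \<open>simp add: eq_h_a_linear_def D module_simps\<close>)
  then show ?I using validD[OF p(3)] by (simp add: eq_retract_of_linear_def e)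
qed

lemma retract_left_natural:
  assumes x: "bim_ai 1" "bim_ai 2" "bim_ai 3" "bim_ai 4" and h: "T (Two 0 1 2) \<in> hom2 B (F (V 1)) (F (V 2))"
    and f: "hom_l 3 1 (T (Two 1 3 1))" and k: "hom_l 2 4 (T (Two 2 2 4))"
  shows "retract_left B (F (V 0)) (T Eta) (T Nab) (F (V 3)) (T (ActL 3)) (T (ActL 4)) (T (Two 2 2 4) \<odot> T (Two 0 1 2) \<odot> T (Two 1 3 1))
    = T (Two 2 2 4) \<odot> retract_left B (F (V 0)) (T Eta) (T Nab) (F (V 1)) (T (ActL 1)) (T (ActL 2)) (T (Two 0 1 2)) \<odot> T (Two 1 3 1)"
proof -
  have "good (G (Two 0 1 2))" "good (G (Two 1 3 1))" "good (G (Two 2 2 4))"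
    using h f k by (auto intro!: hom_good simp: left_module_hom_def)
  note g = nab_good bim_ai_good(1)[OF x(1)] bim_ai_good(1)[OF x(2)] bim_ai_good(1)[OF x(3)] bim_ai_good(1)[OF x(4)] this
  have L: "good_gens (basic_gens @ [Nab, ActL 1, ActL 2, ActL 3, ActL 4, Two 0 1 2, Two 1 3 1, Two 2 2 4])"
    using g by (simp add: good_simps)
  note v = valid_wf[OF L]
  have "valid eq_f_a_linear" by (rule v, code_simp) (use f g in \<open>simp add: eq_f_a_linear_def left_module_hom_def module_simps\<close>)
  moreover have "valid eq_g_a_linear" by (rule v, code_simp) (use k g in \<open>simp add: eq_g_a_linear_def left_module_hom_def module_simps\<close>)
  ultimately have "valid eq_retract_natural" using retract_natural g by blast
  from validD[OF this] show ?thesis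
    using g by (simp add: eq_retract_natural_def retr_eq[OF g(1,2,3,6)] splitX'_def e_split_def retract_left_def[of _ _ _ _ "F (V 3)"] split_left_def[of _ _ _ _ "F (V 3)"] module_simps)
qed

end

end

section \<open>Averaging for right actions\<close>

context hopf_model
begin

lemma retrR_eq: assumes "good (G Nab)" "good (G (ActRA 1))" "good (G (ActRA 2))" "good (G (Two 0 1 2))"
  shows "sem retrR = retract_right B (F (V 0)) (T Eta) (T Nab) (F (V 1)) (T (ActRA 1)) (T (ActRA 2)) (T (Two 0 1 2))"
  using assms by (simp add: retrR_def splitRX_def e_splitR_def retract_right_def split_right_def module_simps)

abbreviation (input) "bim_ia n \<equiv> bimodule B \<i> (xi_mult B) (xi_unit B) (F (V 0)) (T Mu) (T Eta) (F (V n)) (T (ActLI n)) (T (ActRA n))"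
abbreviation (input) "hom_ra m n \<equiv> right_module_hom B (F (V 0)) (F (V m)) (T (ActRA m)) (F (V n)) (T (ActRA n))"
abbreviation (input) "hom_li m n \<equiv> left_module_hom B \<i> (F (V m)) (T (ActLI m)) (F (V n)) (T (ActLI n))"

lemma bim_ia_good: "bim_ia n \<Longrightarrow> good (G (ActRA n))" "bim_ia n \<Longrightarrow> good (G (ActLI n))"
  by (simp_all add: bimodule_def left_module_def right_module_def good_def ev_V ev_bul_V)

context
  assumes nab: "left_module_hom B (F (V 0)) (F (V 0)) (T Mu) (bul1 B (F (V 0)) (F (V 0))) (free_left_action B (F (V 0)) (T Mu) (F (V 0))) (T Nab)"
    "right_module_hom B (F (V 0)) (F (V 0)) (T Mu) (bul1 B (F (V 0)) (F (V 0))) (free_right_action B (F (V 0)) (T Mu) (F (V 0))) (T Nab)"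
    and nab_split: "T Mu \<odot> T Nab = \<langle>F (V 0)\<rangle>"
begin

lemma retract_right_hom:
  assumes x: "bim_ia 1" and y: "bim_ia 2" and h: "hom_li 1 2 (T (Two 0 1 2))"
  shows "hom_ra 1 2 (retract_right B (F (V 0)) (T Eta) (T Nab) (F (V 1)) (T (ActRA 1)) (T (ActRA 2)) (T (Two 0 1 2)))" (is ?L)
    and "hom_li 1 2 (retract_right B (F (V 0)) (T Eta) (T Nab) (F (V 1)) (T (ActRA 1)) (T (ActRA 2)) (T (Two 0 1 2)))" (is ?R)
    and "hom_ra 1 2 (T (Two 0 1 2)) \<Longrightarrow>
      retract_right B (F (V 0)) (T Eta) (T Nab) (F (V 1)) (T (ActRA 1)) (T (ActRA 2)) (T (Two 0 1 2)) = T (Two 0 1 2)" (is "?h \<Longrightarrow> ?I")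
proof -
  have h': "good (G (Two 0 1 2))" using h by (intro hom_good) (simp_all add: left_module_hom_def)
  note nab_valid = nab_valid[OF nab nab_split] and nab_good = nab_good[OF nab nab_split]
  note g = nab_good bim_ia_good[OF x] bim_ia_good[OF y] h'
  have L: "good_gens (basic_gens @ [Nab, ActRA 1, ActLI 1, ActRA 2, ActLI 2, Two 0 1 2])"
    using g by (simp add: good_simps)
  note v = valid_wf[OF L] and D = left_module_def right_module_def bimodule_def left_module_hom_def right_module_hom_def
  have "valid eq_ract_x_assoc" by (rule v, code_simp) (use x g in \<open>simp add: eq_ract_x_assoc_def D module_simps\<close>)
  moreover have "valid eq_ract_x_unit" by (rule v, code_simp) (use x g in \<open>simp add: eq_ract_x_unit_def D module_simps\<close>)
  moreover have "valid eq_ract_y_assoc" by (rule v, code_simp) (use y g in \<open>simp add: eq_ract_y_assoc_def D module_simps\<close>)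
  moreover have "valid eq_ract_x_compatible" by (rule v, code_simp) (use x g in \<open>simp add: eq_ract_x_compatible_def D module_simps\<close>)
  moreover have "valid eq_ract_y_compatible" by (rule v, code_simp) (use y g in \<open>simp add: eq_ract_y_compatible_def D module_simps\<close>)
  moreover have "valid eq_h_ri_linear" by (rule v, code_simp) (use h g in \<open>simp add: eq_h_ri_linear_def D module_simps\<close>)
  ultimately have p: "valid eq_retract_a_linear_right" "valid eq_retract_i_linear_right" "valid eq_h_ra_linear \<Longrightarrow> valid eq_retract_of_linear_right"
    using retract_a_linear_dual retract_i_linear_dual retract_of_linear_dual nab_valid g by blast+
  have t: "sem retrR \<in> hom2 B (F (V 1)) (F (V 2))"
    using sem_typed[of retrR 1 wX wY, unfolded gens_retr shape_retr] g by (simp add: module_simps)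
  note e = retrR_eq[OF g(1,2,4,6)]
  show ?L using t validD[OF p(1)] g by (simp add: eq_retract_a_linear_right_def D module_simps gens_retr e)
  show ?R using t validD[OF p(2)] g by (simp add: eq_retract_i_linear_right_def D module_simps gens_retr e)
  assume h: ?h
  have "valid eq_h_ra_linear" by (rule v, code_simp) (use g h in \<open>simp add: eq_h_ra_linear_def D module_simps\<close>)
  then show ?I using validD[OF p(3)] by (simp add: eq_retract_of_linear_right_def e)
qed

lemma retract_right_natural:
  assumes x: "bim_ia 1" "bim_ia 2" "bim_ia 3" "bim_ia 4" and h: "T (Two 0 1 2) \<in> hom2 B (F (V 1)) (F (V 2))"
    and f: "hom_ra 3 1 (T (Two 1 3 1))" and k: "hom_ra 2 4 (T (Two 2 2 4))"
  shows "retract_right B (F (V 0)) (T Eta) (T Nab) (F (V 3)) (T (ActRA 3)) (T (ActRA 4)) (T (Two 2 2 4) \<odot> T (Two 0 1 2) \<odot> T (Two 1 3 1))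
    = T (Two 2 2 4) \<odot> retract_right B (F (V 0)) (T Eta) (T Nab) (F (V 1)) (T (ActRA 1)) (T (ActRA 2)) (T (Two 0 1 2)) \<odot> T (Two 1 3 1)"
proof -
  have "good (G (Two 0 1 2))" "good (G (Two 1 3 1))" "good (G (Two 2 2 4))"
    using h f k by (auto intro!: hom_good simp: right_module_hom_def)
  note g = nab_good[OF nab nab_split] bim_ia_good(1)[OF x(1)] bim_ia_good(1)[OF x(2)] bim_ia_good(1)[OF x(3)] bim_ia_good(1)[OF x(4)] this
  have L: "good_gens (basic_gens @ [Nab, ActRA 1, ActRA 2, ActRA 3, ActRA 4, Two 0 1 2, Two 1 3 1, Two 2 2 4])"
    using g by (simp add: good_simps)
  note v = valid_wf[OF L]
  have "valid eq_f_ra_linear" by (rule v, code_simp) (use f g in \<open>simp add: eq_f_ra_linear_def right_module_hom_def module_simps\<close>)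
  moreover have "valid eq_g_ra_linear" by (rule v, code_simp) (use k g in \<open>simp add: eq_g_ra_linear_def right_module_hom_def module_simps\<close>)
  ultimately have "valid eq_retract_natural_right" using retract_natural_dual g by blast
  from validD[OF this] show ?thesis
    using g by (simp add: eq_retract_natural_right_def retrR_eq[OF g(1,2,3,6)] splitRX'_def e_splitR_def retract_right_def[of _ _ _ _ "F (V 3)"] split_right_def[of _ _ _ _ "F (V 3)"] module_simps)
qed

end

section \<open>Free and trivial bimodules, and separability from an integral\<close>

lemmas module_defs = left_module_def right_module_def bimodule_def left_module_hom_def right_module_hom_def

lemma shape_more: "shape (e_freeL wA (Cell Mu) []) = Some (1, bulw wA (bulw wA []), bulw wA [])"
  "shape (e_freeR [] (Cell EpsM) wA) = Some (1, bulw (bulw wA []) [], bulw wA [])"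
  "shape (e_freeR wA (Cell Mu) []) = Some (1, bulw (bulw [] wA) wA, bulw [] wA)"
  "shape (e_freeL [] (Cell EpsM) wA) = Some (1, bulw [] (bulw [] wA), bulw [] wA)"
  "shape counitL = Some (1, bulw wA [], [])" "shape counitR = Some (1, bulw [] wA, [])"
  "shape unitL = Some (1, [], bulw wA [])" "shape unitR = Some (1, [], bulw [] wA)"
  "shape nabla = Some (1, wA, bulw wA wA)" "shape (mirror nabla) = Some (1, wA, bulw wA wA)"
  by code_simp+

lemma sem_counits: "sem counitL = xi_mult B \<odot> (T Eps \<bullet>\<^sub>2 \<langle>\<i>\<rangle>)" "sem counitR = xi_mult B \<odot> (\<langle>\<i>\<rangle> \<bullet>\<^sub>2 T Eps)"
  by (simp_all add: counitL_def counitR_def module_simps)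

lemma typed_more: "sem (e_freeL wA (Cell Mu) []) \<in> hom2 B (F (V 0) \<bullet>\<^sub>1 F (V 0) \<bullet>\<^sub>1 \<i>) (F (V 0) \<bullet>\<^sub>1 \<i>)"
  "sem (e_freeR [] (Cell EpsM) wA) \<in> hom2 B ((F (V 0) \<bullet>\<^sub>1 \<i>) \<bullet>\<^sub>1 \<i>) (F (V 0) \<bullet>\<^sub>1 \<i>)"
  "sem (e_freeR wA (Cell Mu) []) \<in> hom2 B ((\<i> \<bullet>\<^sub>1 F (V 0)) \<bullet>\<^sub>1 F (V 0)) (\<i> \<bullet>\<^sub>1 F (V 0))"
  "sem (e_freeL [] (Cell EpsM) wA) \<in> hom2 B (\<i> \<bullet>\<^sub>1 \<i> \<bullet>\<^sub>1 F (V 0)) (\<i> \<bullet>\<^sub>1 F (V 0))"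
  "sem counitL \<in> hom2 B (F (V 0) \<bullet>\<^sub>1 \<i>) \<i>" "sem counitR \<in> hom2 B (\<i> \<bullet>\<^sub>1 F (V 0)) \<i>"
  "sem unitL \<in> hom2 B \<i> (F (V 0) \<bullet>\<^sub>1 \<i>)" "sem unitR \<in> hom2 B \<i> (\<i> \<bullet>\<^sub>1 F (V 0))"
  using shape_more(1-8)[THEN sem_typed]
  by (simp_all del: sem.simps add: gens_free gens_simps good_gens_simps good_cells counitL_def counitR_def unitL_def unitR_def ev_bulw endow_simps endow_bulw ev_V iobj_def)

lemma gens_more: "gens counitL = [EpsM, Eps]" "gens counitR = [EpsM, Eps]" "gens unitL = [Eta, LunI, CoLunI]" "gens unitR = [Eta, RunI, CoRunI]"
  by (simp_all add: counitL_def counitR_def unitL_def unitR_def gens_simps)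

lemmas fold_simps = sem_bul sem_cir sem_asc sem_lun sem_run endow_simps endow_bulw endo_cells endo_Id endo_more
  gens_simps gens_free gens_more good_gens_simps good_cells cells ev_V ev_bul_V ev_bulw iobj_def xi_mult_def xi_unit_def

lemma bul_hom: "F (V 0) \<bullet>\<^sub>1 \<i> \<in> hom1 B \<M> \<M>" "\<i> \<bullet>\<^sub>1 F (V 0) \<in> hom1 B \<M> \<M>" "\<i> \<in> hom1 B \<M> \<M>"
  using ev_endow(1)[of "bulw wA []"] ev_endow(1)[of "bulw [] wA"] id1_hom[of \<M>]
  by (simp_all add: endow_bulw endow_simps ev_bulw ev_V iobj_def)

lemma free_bimodule_left: "bimodule B (F (V 0)) (T Mu) (T Eta) \<i> (xi_mult B) (xi_unit B) (F (V 0) \<bullet>\<^sub>1 \<i>)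
    (free_left_action B (F (V 0)) (T Mu) \<i>) (free_right_action B \<i> (xi_mult B) (F (V 0)))"
  using bul_hom typed_more[unfolded sem_free] validD[OF free_left_assoc] validD[OF free_left_unit] validD[OF free_right_assoc] validD[OF free_right_unit] validD[OF free_compatible]
  by (simp add: eq_free_left_assoc_def eq_free_left_unit_def eq_free_right_assoc_def eq_free_right_unit_def eq_free_compatible_def module_defs fold_simps sem_free[unfolded iobj_def xi_mult_def])

lemma free_bimodule_right: "bimodule B \<i> (xi_mult B) (xi_unit B) (F (V 0)) (T Mu) (T Eta) (\<i> \<bullet>\<^sub>1 F (V 0))
    (free_left_action B \<i> (xi_mult B) (F (V 0))) (free_right_action B (F (V 0)) (T Mu) \<i>)"
  using bul_hom typed_more[unfolded sem_free] validD[OF free_left_assoc_dual] validD[OF free_left_unit_dual] validD[OF free_right_assoc_dual] validD[OF free_right_unit_dual] validD[OF free_compatible_dual]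
  by (simp add: eq_free_left_assoc_right_def eq_free_left_unit_right_def eq_free_right_assoc_right_def eq_free_right_unit_right_def eq_free_compatible_right_def module_defs fold_simps sem_free[unfolded iobj_def xi_mult_def])

lemma unit_modules: "left_module B \<i> (xi_mult B) (xi_unit B) \<i> (xi_mult B)" "right_module B \<i> (xi_mult B) (xi_unit B) \<i> (xi_mult B)"
proof -
  have "xi_mult B \<in> hom2 B (\<i> \<bullet>\<^sub>1 \<i>) \<i>"
    using good_cells(8) ev_bulw[of "[]" "[]"] by (simp add: good_def fold_simps bulw_def ten_def sh_def)
  then show "left_module B \<i> (xi_mult B) (xi_unit B) \<i> (xi_mult B)" "right_module B \<i> (xi_mult B) (xi_unit B) \<i> (xi_mult B)"
    using bul_hom validD[OF i_assoc] validD[OF i_lun] validD[OF i_run]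
    by (simp_all add: eq_i_assoc_def eq_i_lun_def eq_i_run_def module_defs fold_simps)
qed

lemma trivial_bimodule_left: "bimodule B (F (V 0)) (T Mu) (T Eta) \<i> (xi_mult B) (xi_unit B) \<i> (xi_mult B \<odot> (T Eps \<bullet>\<^sub>2 \<langle>\<i>\<rangle>)) (xi_mult B)"
  using bul_hom typed_more unit_modules validD[OF trivial_assoc] validD[OF trivial_unit] validD[OF trivial_compatible] unfolding sem_counits[symmetric]
  by (simp add: eq_trivial_assoc_def eq_trivial_unit_def eq_trivial_compatible_def module_defs fold_simps)

lemma trivial_bimodule_right: "bimodule B \<i> (xi_mult B) (xi_unit B) (F (V 0)) (T Mu) (T Eta) \<i> (xi_mult B) (xi_mult B \<odot> (\<langle>\<i>\<rangle> \<bullet>\<^sub>2 T Eps))"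
  using bul_hom typed_more unit_modules validD[OF trivial_assoc_dual] validD[OF trivial_unit_dual] validD[OF trivial_compatible_dual] unfolding sem_counits[symmetric]
  by (simp add: eq_trivial_assoc_right_def eq_trivial_unit_right_def eq_trivial_compatible_right_def module_defs fold_simps)

text \<open>The splitting is \<eta> \<bullet> \<i> after the unit isomorphism \<i> \<cong> \<j>
  \<bullet> \<i>. It splits the counit because \<epsilon> \<odot> \<eta> is the unit of \<i>. Its
  \<i>-linearity makes the counit a split epimorphism in the base category of the forgetful
  functor.\<close>

lemma counit_left:
  "left_module_hom B (F (V 0)) (F (V 0) \<bullet>\<^sub>1 \<i>) (free_left_action B (F (V 0)) (T Mu) \<i>) \<i> (xi_mult B \<odot> (T Eps \<bullet>\<^sub>2 \<langle>\<i>\<rangle>)) (xi_mult B \<odot> (T Eps \<bullet>\<^sub>2 \<langle>\<i>\<rangle>))"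
  "right_module_hom B \<i> (F (V 0) \<bullet>\<^sub>1 \<i>) (free_right_action B \<i> (xi_mult B) (F (V 0))) \<i> (xi_mult B) (xi_mult B \<odot> (T Eps \<bullet>\<^sub>2 \<langle>\<i>\<rangle>))"
  "\<exists>s. right_module_hom B \<i> \<i> (xi_mult B) (F (V 0) \<bullet>\<^sub>1 \<i>) (free_right_action B \<i> (xi_mult B) (F (V 0))) s \<and> (xi_mult B \<odot> (T Eps \<bullet>\<^sub>2 \<langle>\<i>\<rangle>)) \<odot> s = \<langle>\<i>\<rangle>"
  using typed_more validD[OF counit_left_linear] validD[OF counit_right_linear] validD[OF unit_right_linear] validD[OF counit_unit] unfolding sem_counits[symmetric]
  by (auto intro!: exI[of _ "sem unitL"] simp: eq_counit_left_linear_def eq_counit_right_linear_def eq_unit_right_linear_def eq_counit_unit_def module_defs fold_simps sem_free[unfolded iobj_def xi_mult_def])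

lemma counit_right:
  "right_module_hom B (F (V 0)) (\<i> \<bullet>\<^sub>1 F (V 0)) (free_right_action B (F (V 0)) (T Mu) \<i>) \<i> (xi_mult B \<odot> (\<langle>\<i>\<rangle> \<bullet>\<^sub>2 T Eps)) (xi_mult B \<odot> (\<langle>\<i>\<rangle> \<bullet>\<^sub>2 T Eps))"
  "left_module_hom B \<i> (\<i> \<bullet>\<^sub>1 F (V 0)) (free_left_action B \<i> (xi_mult B) (F (V 0))) \<i> (xi_mult B) (xi_mult B \<odot> (\<langle>\<i>\<rangle> \<bullet>\<^sub>2 T Eps))"
  "\<exists>s. left_module_hom B \<i> \<i> (xi_mult B) (\<i> \<bullet>\<^sub>1 F (V 0)) (free_left_action B \<i> (xi_mult B) (F (V 0))) s \<and> (xi_mult B \<odot> (\<langle>\<i>\<rangle> \<bullet>\<^sub>2 T Eps)) \<odot> s = \<langle>\<i>\<rangle>"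
  using typed_more validD[OF counit_left_linear_dual] validD[OF counit_right_linear_dual] validD[OF unit_right_linear_dual] validD[OF counit_unit_dual] unfolding sem_counits[symmetric]
  by (auto intro!: exI[of _ "sem unitR"] simp: eq_counit_left_linear_right_def eq_counit_right_linear_right_def eq_unit_right_linear_right_def eq_counit_unit_right_def module_defs fold_simps sem_free[unfolded iobj_def xi_mult_def])

lemma separable_left:
  assumes "normalized_left_integral B (F (V 0)) (T Mu) (T Eps) (T The)"
  shows "separable_monoid B (F (V 0)) (T Mu) (T Eta)"
proof -
  note A = assms[unfolded normalized_left_integral_def left_integral_def]
  have g: "good (G The)"
    using A by (simp add: good_def module_defs ev_V ev_bul_V iobj_def)
  then have L: "good_gens (basic_gens @ [The])" by (simp add: good_simps)
  note v = valid_wf[OF L]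
  have "valid eq_theta_a_linear" by (rule v, code_simp) (use A g in \<open>simp add: eq_theta_a_linear_def sem_counits module_defs module_simps\<close>)
  moreover have "valid eq_theta_i_linear" by (rule v, code_simp) (use A g in \<open>simp add: eq_theta_i_linear_def module_defs module_simps\<close>)
  moreover have "valid eq_theta_normalized" by (rule v, code_simp) (use A g in \<open>simp add: eq_theta_normalized_def module_defs module_simps\<close>)
  ultimately have "valid eq_section_left_linear" "valid eq_section_right_linear" "valid eq_section_splits" using section_left_linear section_right_linear section_splits g by blast+
  note X = this[THEN validD]
  have n: "good_gens (gens nabla)" by (rule good_gens_sub[OF L]) code_simp
  from sem_typed[OF shape_more(9) n] X mon show ?thesis
    unfolding separable_monoid_def
    by (auto intro!: exI[of _ "sem nabla"] simp: n eq_section_left_linear_def eq_section_right_linear_def eq_section_splits_def module_defs fold_simps sem_free[unfolded iobj_def xi_mult_def])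
qed

lemma separable_right:
  assumes "normalized_right_integral B (F (V 0)) (T Mu) (T Eps) (T TheR)"
  shows "separable_monoid B (F (V 0)) (T Mu) (T Eta)"
proof -
  note A = assms[unfolded normalized_right_integral_def right_integral_def]
  have g: "good (G TheR)"
    using A by (simp add: good_def module_defs ev_V ev_bul_V iobj_def)
  then have L: "good_gens (basic_gens @ [TheR])" by (simp add: good_simps)
  note v = valid_wf[OF L]
  have "valid eq_rtheta_a_linear" by (rule v, code_simp) (use A g in \<open>simp add: eq_rtheta_a_linear_def sem_counits module_defs module_simps\<close>)
  moreover have "valid eq_rtheta_i_linear" by (rule v, code_simp) (use A g in \<open>simp add: eq_rtheta_i_linear_def module_defs module_simps\<close>)
  moreover have "valid eq_rtheta_normalized" by (rule v, code_simp) (use A g in \<open>simp add: eq_rtheta_normalized_def module_defs module_simps\<close>)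
  ultimately have "valid eq_section_left_linear_right" "valid eq_section_right_linear_right" "valid eq_section_splits_right" using section_left_linear_dual section_right_linear_dual section_splits_dual g by blast+
  note X = this[THEN validD]
  have n: "good_gens (gens (mirror nabla))" by (rule good_gens_sub[OF L]) code_simp
  from sem_typed[OF shape_more(10) n] X mon show ?thesis
    unfolding separable_monoid_def
    by (auto intro!: exI[of _ "sem (mirror nabla)"] simp: n eq_section_left_linear_right_def eq_section_right_linear_right_def eq_section_splits_right_def module_defs fold_simps sem_free[unfolded iobj_def xi_mult_def])
qed

text \<open>A splitting in the bimodule category has the counit as one composite factor, while
  normalization is stated with the composition associated to the right.\<close>

lemma counit_comp:
  "t \<in> hom2 B f (F (V 0) \<bullet>\<^sub>1 \<i>) \<Longrightarrow> (xi_mult B \<odot> (T Eps \<bullet>\<^sub>2 \<langle>\<i>\<rangle>)) \<odot> t = xi_mult B \<odot> (T Eps \<bullet>\<^sub>2 \<langle>\<i>\<rangle>) \<odot> t"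
  "t \<in> hom2 B f (\<i> \<bullet>\<^sub>1 F (V 0)) \<Longrightarrow> (xi_mult B \<odot> (\<langle>\<i>\<rangle> \<bullet>\<^sub>2 T Eps)) \<odot> t = xi_mult B \<odot> (\<langle>\<i>\<rangle> \<bullet>\<^sub>2 T Eps) \<odot> t"
proof -
  have s: "shape (e_bul (Cell Eps) idI) = Some (1, bulw wA [], bulw [] [])" "shape (e_bul idI (Cell Eps)) = Some (1, bulw [] wA, bulw [] [])"
    by code_simp+
  have t: "T Eps \<bullet>\<^sub>2 \<langle>\<i>\<rangle> \<in> hom2 B (F (V 0) \<bullet>\<^sub>1 \<i>) (\<i> \<bullet>\<^sub>1 \<i>)" "\<langle>\<i>\<rangle> \<bullet>\<^sub>2 T Eps \<in> hom2 B (\<i> \<bullet>\<^sub>1 F (V 0)) (\<i> \<bullet>\<^sub>1 \<i>)"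
    using s[THEN sem_typed] by (simp_all add: fold_simps)
  have x: "xi_mult B \<in> hom2 B (\<i> \<bullet>\<^sub>1 \<i>) \<i>"
    using unit_modules(1) by (simp add: left_module_def)
  show "t \<in> hom2 B f (F (V 0) \<bullet>\<^sub>1 \<i>) \<Longrightarrow> (xi_mult B \<odot> (T Eps \<bullet>\<^sub>2 \<langle>\<i>\<rangle>)) \<odot> t = xi_mult B \<odot> (T Eps \<bullet>\<^sub>2 \<langle>\<i>\<rangle>) \<odot> t"
    "t \<in> hom2 B f (\<i> \<bullet>\<^sub>1 F (V 0)) \<Longrightarrow> (xi_mult B \<odot> (\<langle>\<i>\<rangle> \<bullet>\<^sub>2 T Eps)) \<odot> t = xi_mult B \<odot> (\<langle>\<i>\<rangle> \<bullet>\<^sub>2 T Eps) \<odot> t"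
    using t x by (auto intro!: vcomp_assoc simp: hom2_def)
qed

end

section \<open>Separability\<close>

fun atom_of :: "('o, 'f, 't, 'z) monoidale_scheme \<Rightarrow> (nat \<Rightarrow> 'f) \<Rightarrow> atom \<Rightarrow> 'f" where
  "atom_of B X Mul = mul B" | "atom_of B X Unt = unt B"
| "atom_of B X MulA = mul_adj B" | "atom_of B X UntA = unt_adj B"
| "atom_of B X (V n) = X n"

context
  fixes B :: "('o, 'f, 't, 'z) monoidale_scheme" (structure)
begin

text \<open>\<open>S\<close> supplies the generators outside the Hopf structure: actions, module
  morphisms, a section or an integral. Generators without a meaning in a given application may
  receive any value, since typing is demanded cell by cell.\<close>

fun cell_of :: "'f \<Rightarrow> 't \<Rightarrow> 't \<Rightarrow> 't \<Rightarrow> 't \<Rightarrow> 't \<Rightarrow> (gen \<Rightarrow> 't) \<Rightarrow> gen \<Rightarrow> 't" where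
  "cell_of a \<mu> \<eta> \<delta> \<epsilon> \<sigma> S Asc = \<a>" | "cell_of a \<mu> \<eta> \<delta> \<epsilon> \<sigma> S AscI = inv2 B \<a>"
| "cell_of a \<mu> \<eta> \<delta> \<epsilon> \<sigma> S Lun = \<l>" | "cell_of a \<mu> \<eta> \<delta> \<epsilon> \<sigma> S LunI = inv2 B \<l>"
| "cell_of a \<mu> \<eta> \<delta> \<epsilon> \<sigma> S Run = \<r>" | "cell_of a \<mu> \<eta> \<delta> \<epsilon> \<sigma> S RunI = inv2 B \<r>"
| "cell_of a \<mu> \<eta> \<delta> \<epsilon> \<sigma> S EtaM = \<eta>\<^sub>m" | "cell_of a \<mu> \<eta> \<delta> \<epsilon> \<sigma> S EpsM = \<epsilon>\<^sub>m"
| "cell_of a \<mu> \<eta> \<delta> \<epsilon> \<sigma> S EtaU = \<eta>\<^sub>u" | "cell_of a \<mu> \<eta> \<delta> \<epsilon> \<sigma> S EpsU = \<epsilon>\<^sub>u"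
| "cell_of a \<mu> \<eta> \<delta> \<epsilon> \<sigma> S CoAsc = coasc B" | "cell_of a \<mu> \<eta> \<delta> \<epsilon> \<sigma> S CoLun = colun B"
| "cell_of a \<mu> \<eta> \<delta> \<epsilon> \<sigma> S CoRun = corun B"
| "cell_of a \<mu> \<eta> \<delta> \<epsilon> \<sigma> S CoAscI = mate B
    ((\<langle>\<m>\<^sup>* \<lhd>\<^sub>1 \<M>\<rangle> \<star> \<eta>\<^sub>m \<star> \<langle>\<m> \<lhd>\<^sub>1 \<M>\<rangle>) \<odot> (\<eta>\<^sub>m \<lhd>\<^sub>2 \<M>)) ((\<m>\<^sup>* \<lhd>\<^sub>1 \<M>) \<cdot> \<m>\<^sup>*) \<a>
    ((\<M> \<rhd>\<^sub>1 \<m>\<^sup>*) \<cdot> \<m>\<^sup>*) (\<epsilon>\<^sub>m \<odot> (\<langle>\<m>\<rangle> \<star> (\<M> \<rhd>\<^sub>2 \<epsilon>\<^sub>m) \<star> \<langle>\<m>\<^sup>*\<rangle>))"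
| "cell_of a \<mu> \<eta> \<delta> \<epsilon> \<sigma> S CoLunI =
    (\<langle>(\<u>\<^sup>* \<lhd>\<^sub>1 \<M>) \<cdot> \<m>\<^sup>*\<rangle> \<star> \<l>) \<odot> (\<langle>\<u>\<^sup>* \<lhd>\<^sub>1 \<M>\<rangle> \<star> \<eta>\<^sub>m \<star> \<langle>\<u> \<lhd>\<^sub>1 \<M>\<rangle>) \<odot> (\<eta>\<^sub>u \<lhd>\<^sub>2 \<M>)"
| "cell_of a \<mu> \<eta> \<delta> \<epsilon> \<sigma> S CoRunI =
    (\<langle>(\<M> \<rhd>\<^sub>1 \<u>\<^sup>*) \<cdot> \<m>\<^sup>*\<rangle> \<star> \<r>) \<odot> (\<langle>\<M> \<rhd>\<^sub>1 \<u>\<^sup>*\<rangle> \<star> \<eta>\<^sub>m \<star> \<langle>\<M> \<rhd>\<^sub>1 \<u>\<rangle>) \<odot> (\<M> \<rhd>\<^sub>2 \<eta>\<^sub>u)"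
| "cell_of a \<mu> \<eta> \<delta> \<epsilon> \<sigma> S Mu = \<mu>" | "cell_of a \<mu> \<eta> \<delta> \<epsilon> \<sigma> S Eta = \<eta>"
| "cell_of a \<mu> \<eta> \<delta> \<epsilon> \<sigma> S Del = \<delta>" | "cell_of a \<mu> \<eta> \<delta> \<epsilon> \<sigma> S Eps = \<epsilon>"
| "cell_of a \<mu> \<eta> \<delta> \<epsilon> \<sigma> S Sig = \<sigma>"
| "cell_of a \<mu> \<eta> \<delta> \<epsilon> \<sigma> S Muh = (\<mu> \<star> \<langle>\<m>\<rangle>) \<odot> (\<langle>\<m> \<cdot> (a \<otimes>\<^sub>1 a)\<rangle> \<star> \<eta>\<^sub>m)"
| "cell_of a \<mu> \<eta> \<delta> \<epsilon> \<sigma> S Etah = (\<eta> \<star> \<langle>\<u>\<rangle>) \<odot> (\<langle>\<u>\<rangle> \<star> \<eta>\<^sub>u)"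
| "cell_of a \<mu> \<eta> \<delta> \<epsilon> \<sigma> S Etac = (\<langle>\<u>\<^sup>*\<rangle> \<star> \<eta>) \<odot> (\<eta>\<^sub>u \<star> \<langle>\<u>\<^sup>*\<rangle>)"
| "cell_of a \<mu> \<eta> \<delta> \<epsilon> \<sigma> S g = S g"

end

context
  fixes B :: "('o, 'f, 't, 'z) monoidale_scheme" (structure) and a \<mu> \<eta> \<delta> \<epsilon> \<sigma>
  assumes monoidale: "map_monoidale B" and hopf: "hopf_monoid B a \<mu> \<eta> \<delta> \<epsilon> \<sigma>"
begin

abbreviation (input) "bim_ai \<equiv> bimodule B a \<mu> \<eta> \<i> (xi_mult B) (xi_unit B)"
abbreviation (input) "bim_ia \<equiv> bimodule B \<i> (xi_mult B) (xi_unit B) a \<mu> \<eta>"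
abbreviation (input) "sep s \<equiv> left_module_hom B a a \<mu> (a \<bullet>\<^sub>1 a) (free_left_action B a \<mu> a) s \<and>
  right_module_hom B a a \<mu> (a \<bullet>\<^sub>1 a) (free_right_action B a \<mu> a) s \<and> \<mu> \<odot> s = \<langle>a\<rangle>"

lemma object_hom: "a \<in> hom1 B \<M> \<M>"
  using hopf by (simp add: hopf_monoid_def bimonoid_def bul_monoid_def)

lemma hopf_model_instance:
  assumes "\<And>n. X n \<in> hom1 B \<M> \<M>" "X 0 = a"
  shows "hopf_model B (atom_of B X) (cell_of B a \<mu> \<eta> \<delta> \<epsilon> \<sigma> S)"
proof -
  interpret map_monoidale B by (rule monoidale)
  interpret gray_object B \<M> ..
  have adj: "\<m>\<^sup>* \<in> hom1 B \<M> (\<M> \<otimes>\<^sub>0 \<M>)" "\<u>\<^sup>* \<in> hom1 B \<M> \<I>"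
    using mul_adjunction unt_adjunction mul_hom unt_hom by (auto simp: adjunction_def hom1_def)
  have p: "pow 1 = \<M>" "pow 2 = \<M> \<otimes>\<^sub>0 \<M>"
    by (simp_all add: numeral_2_eq_2 One_nat_def ten0_unit_right)
  have "atom_of B X f \<in> hom1 B (pow (ain f)) (pow (aout f))" for f
    using mul_hom unt_hom adj assms(1) by (cases f) (simp_all add: p)
  then show ?thesis
    by unfold_locales (simp_all add: hopf assms)
qed

lemma retract_left:
  assumes s: "sep s" and x: "bim_ai x l r" and y: "bim_ai y l' r'" and h: "right_module_hom B \<i> x r y r' h"
  shows "left_module_hom B a x l y l' (retract_left B a \<eta> s x l l' h)"
    and "right_module_hom B \<i> x r y r' (retract_left B a \<eta> s x l l' h)"
    and "left_module_hom B a x l y l' h \<Longrightarrow> retract_left B a \<eta> s x l l' h = h"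
proof -
  \<comment> \<open>The section s enters as the default value of the update, which interprets
    \<open>Nab\<close>; likewise the default a interprets \<open>V 0\<close>. The updates provide
    the modules, their actions and the 2-cell to be averaged.\<close>
  interpret m: hopf_model B "atom_of B ((\<lambda>_. a)(1 := x, 2 := y))"
    "cell_of B a \<mu> \<eta> \<delta> \<epsilon> \<sigma> ((\<lambda>_. s)(ActL 1 := l, ActL 2 := l', ActR 1 := r, ActR 2 := r', Two 0 1 2 := h))"
    by (rule hopf_model_instance) (use x y object_hom in \<open>auto simp: bimodule_def left_module_def\<close>)
  show "left_module_hom B a x l y l' (retract_left B a \<eta> s x l l' h)"
    "right_module_hom B \<i> x r y r' (retract_left B a \<eta> s x l l' h)"
    "left_module_hom B a x l y l' h \<Longrightarrow> retract_left B a \<eta> s x l l' h = h"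
    using m.retract_left_hom assms by simp_all
qed

lemma retract_left_comp:
  assumes s: "sep s" and x: "bim_ai x l r" "bim_ai y l' r'" "bim_ai x' k t" "bim_ai y' k' t'"
    and h: "right_module_hom B \<i> x r y r' h" and f: "left_module_hom B a x' k x l f" and g: "left_module_hom B a y l' y' k' g"
  shows "retract_left B a \<eta> s x' k k' (g \<odot> h \<odot> f) = g \<odot> retract_left B a \<eta> s x l l' h \<odot> f"
proof -
  interpret m: hopf_model B "atom_of B ((\<lambda>_. a)(1 := x, 2 := y, 3 := x', 4 := y'))"
    "cell_of B a \<mu> \<eta> \<delta> \<epsilon> \<sigma> ((\<lambda>_. s)(ActL 1 := l, ActL 2 := l', ActL 3 := k, ActL 4 := k',
       ActR 1 := r, ActR 2 := r', ActR 3 := t, ActR 4 := t', Two 0 1 2 := h, Two 1 3 1 := f, Two 2 2 4 := g))"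
    by (rule hopf_model_instance) (use x object_hom in \<open>auto simp: bimodule_def left_module_def\<close>)
  show ?thesis using m.retract_left_natural assms by (simp add: right_module_hom_def)
qed

lemma retract_right:
  assumes s: "sep s" and x: "bim_ia x l r" and y: "bim_ia y l' r'" and h: "left_module_hom B \<i> x l y l' h"
  shows "right_module_hom B a x r y r' (retract_right B a \<eta> s x r r' h)"
    and "left_module_hom B \<i> x l y l' (retract_right B a \<eta> s x r r' h)"
    and "right_module_hom B a x r y r' h \<Longrightarrow> retract_right B a \<eta> s x r r' h = h"
proof -
  interpret m: hopf_model B "atom_of B ((\<lambda>_. a)(1 := x, 2 := y))"
    "cell_of B a \<mu> \<eta> \<delta> \<epsilon> \<sigma> ((\<lambda>_. s)(ActLI 1 := l, ActLI 2 := l', ActRA 1 := r, ActRA 2 := r', Two 0 1 2 := h))"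
    by (rule hopf_model_instance) (use x y object_hom in \<open>auto simp: bimodule_def left_module_def\<close>)
  show "right_module_hom B a x r y r' (retract_right B a \<eta> s x r r' h)"
    "left_module_hom B \<i> x l y l' (retract_right B a \<eta> s x r r' h)"
    "right_module_hom B a x r y r' h \<Longrightarrow> retract_right B a \<eta> s x r r' h = h"
    using m.retract_right_hom assms by simp_all
qed

lemma retract_right_comp:
  assumes s: "sep s" and x: "bim_ia x l r" "bim_ia y l' r'" "bim_ia x' k t" "bim_ia y' k' t'"
    and h: "left_module_hom B \<i> x l y l' h" and f: "right_module_hom B a x' t x r f" and g: "right_module_hom B a y r' y' t' g"
  shows "retract_right B a \<eta> s x' t t' (g \<odot> h \<odot> f) = g \<odot> retract_right B a \<eta> s x r r' h \<odot> f"
proof -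
  interpret m: hopf_model B "atom_of B ((\<lambda>_. a)(1 := x, 2 := y, 3 := x', 4 := y'))"
    "cell_of B a \<mu> \<eta> \<delta> \<epsilon> \<sigma> ((\<lambda>_. s)(ActLI 1 := l, ActLI 2 := l', ActLI 3 := k, ActLI 4 := k',
       ActRA 1 := r, ActRA 2 := r', ActRA 3 := t, ActRA 4 := t', Two 0 1 2 := h, Two 1 3 1 := f, Two 2 2 4 := g))"
    by (rule hopf_model_instance) (use x object_hom in \<open>auto simp: bimodule_def left_module_def\<close>)
  show ?thesis using m.retract_right_natural assms by (simp add: left_module_hom_def)
qed

lemma separable_functor_left:
  assumes "separable_monoid B a \<mu> \<eta>"
  shows "separable_functor (bimod_a_i B a \<mu> \<eta>) (mod_i B) forget_left (\<lambda>t. t)"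
proof -
  obtain s where s: "sep s" using assms by (auto simp: separable_monoid_def)
  show ?thesis
    unfolding separable_functor_def
    by (rule exI[of _ "\<lambda>(x, l, r) (y, l', r') h. retract_left B a \<eta> s x l l' h"])
      (auto simp: bimod_a_i_def bimodule_cat_def mod_i_def right_module_cat_def forget_left_def
        intro: retract_left[OF s] retract_left_comp[OF s])
qed

lemma separable_functor_right:
  assumes "separable_monoid B a \<mu> \<eta>"
  shows "separable_functor (bimod_i_a B a \<mu> \<eta>) (i_mod B) forget_right (\<lambda>t. t)"
proof -
  obtain s where s: "sep s" using assms by (auto simp: separable_monoid_def)
  show ?thesis
    unfolding separable_functor_def
    by (rule exI[of _ "\<lambda>(x, l, r) (y, l', r') h. retract_right B a \<eta> s x r r' h"])
      (auto simp: bimod_i_a_def bimodule_cat_def i_mod_def left_module_cat_def forget_right_def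
        intro: retract_right[OF s] retract_right_comp[OF s])
qed

lemma left_integral_of_reflection:
  assumes "reflects_split_epis (bimod_a_i B a \<mu> \<eta>) (mod_i B) forget_left (\<lambda>t. t)"
  shows "\<exists>\<theta>. normalized_left_integral B a \<mu> \<epsilon> \<theta>"
proof -
  \<comment> \<open>Here \<mu> is a placeholder for the generators other than those of the Hopf
    monoid, and a for all variables: the bimodules involved are built from the structure of a
    itself.\<close>
  interpret m: hopf_model B "atom_of B (\<lambda>_. a)" "cell_of B a \<mu> \<eta> \<delta> \<epsilon> \<sigma> (\<lambda>_. \<mu>)"
    by (rule hopf_model_instance) (simp_all add: object_hom)
  let ?x = "(a \<bullet>\<^sub>1 \<i>, free_left_action B a \<mu> \<i>, free_right_action B \<i> (xi_mult B) a)"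
  let ?e = "xi_mult B \<odot> (\<epsilon> \<bullet>\<^sub>2 \<langle>\<i>\<rangle>)"
  have "split_epi (bimod_a_i B a \<mu> \<eta>) ?x (\<i>, ?e, xi_mult B) ?e"
    using assms[unfolded reflects_split_epis_def, rule_format, of ?x "(\<i>, ?e, xi_mult B)" ?e]
      m.free_bimodule_left m.trivial_bimodule_left m.counit_left
    by (auto simp: split_epi_def bimod_a_i_def bimodule_cat_def mod_i_def right_module_cat_def forget_left_def)
  then obtain \<theta> where t: "left_integral B a \<mu> \<epsilon> \<theta>" "?e \<odot> \<theta> = \<langle>\<i>\<rangle>"
    by (auto simp: split_epi_def bimod_a_i_def bimodule_cat_def left_integral_def)
  moreover from this have "?e \<odot> \<theta> = xi_mult B \<odot> (\<epsilon> \<bullet>\<^sub>2 \<langle>\<i>\<rangle>) \<odot> \<theta>"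
    using m.counit_comp(1)[of \<theta> "\<i>"] by (simp add: left_integral_def left_module_hom_def)
  ultimately show ?thesis by (auto simp: normalized_left_integral_def)
qed

lemma right_integral_of_reflection:
  assumes "reflects_split_epis (bimod_i_a B a \<mu> \<eta>) (i_mod B) forget_right (\<lambda>t. t)"
  shows "\<exists>\<theta>. normalized_right_integral B a \<mu> \<epsilon> \<theta>"
proof -
  interpret m: hopf_model B "atom_of B (\<lambda>_. a)" "cell_of B a \<mu> \<eta> \<delta> \<epsilon> \<sigma> (\<lambda>_. \<mu>)"
    by (rule hopf_model_instance) (simp_all add: object_hom)
  let ?x = "(\<i> \<bullet>\<^sub>1 a, free_left_action B \<i> (xi_mult B) a, free_right_action B a \<mu> \<i>)"
  let ?e = "xi_mult B \<odot> (\<langle>\<i>\<rangle> \<bullet>\<^sub>2 \<epsilon>)"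
  have "split_epi (bimod_i_a B a \<mu> \<eta>) ?x (\<i>, xi_mult B, ?e) ?e"
    using assms[unfolded reflects_split_epis_def, rule_format, of ?x "(\<i>, xi_mult B, ?e)" ?e]
      m.free_bimodule_right m.trivial_bimodule_right m.counit_right
    by (auto simp: split_epi_def bimod_i_a_def bimodule_cat_def i_mod_def left_module_cat_def forget_right_def)
  then obtain \<theta> where t: "right_integral B a \<mu> \<epsilon> \<theta>" "?e \<odot> \<theta> = \<langle>\<i>\<rangle>"
    by (auto simp: split_epi_def bimod_i_a_def bimodule_cat_def right_integral_def)
  moreover from this have "?e \<odot> \<theta> = xi_mult B \<odot> (\<langle>\<i>\<rangle> \<bullet>\<^sub>2 \<epsilon>) \<odot> \<theta>"
    using m.counit_comp(2)[of \<theta> "\<i>"] by (simp add: right_integral_def right_module_hom_def)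
  ultimately show ?thesis by (auto simp: normalized_right_integral_def)
qed

lemma separable_of_left_integral:
  assumes "normalized_left_integral B a \<mu> \<epsilon> \<theta>"
  shows "separable_monoid B a \<mu> \<eta>"
proof -
  \<comment> \<open>The default value interprets \<open>The\<close> as the given integral.\<close>
  interpret m: hopf_model B "atom_of B (\<lambda>_. a)" "cell_of B a \<mu> \<eta> \<delta> \<epsilon> \<sigma> (\<lambda>_. \<theta>)"
    by (rule hopf_model_instance) (simp_all add: object_hom)
  show ?thesis using m.separable_left assms by simp
qed

lemma separable_of_right_integral:
  assumes "normalized_right_integral B a \<mu> \<epsilon> \<theta>"
  shows "separable_monoid B a \<mu> \<eta>"
proof -
  interpret m: hopf_model B "atom_of B (\<lambda>_. a)" "cell_of B a \<mu> \<eta> \<delta> \<epsilon> \<sigma> (\<lambda>_. \<theta>)"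
    by (rule hopf_model_instance) (simp_all add: object_hom)
  show ?thesis using m.separable_right assms by simp
qed

end

text \<open>If s splits the image of f, then its retract P(s) splits f: by naturality f P(s) = P(f
  s) = P(1) = 1. The records \<open>cat\<close> carry no laws, so the identity laws used here appear
  as hypotheses.\<close>

lemma separable_reflects_split_epis:
  assumes sep: "separable_functor X Y Fo (\<lambda>t. t)"
    and comp: "Comp Y = Comp X" and idn: "\<And>x. Idn Y (Fo x) = Idn X x"
    and id_hom: "\<And>x. x \<in> Ob X \<Longrightarrow> Idn X x \<in> Hom X x x"
    and unit: "\<And>x y h. h \<in> Hom X x y \<or> h \<in> Hom Y (Fo x) (Fo y) \<Longrightarrow> Comp X h (Idn X x) = h"
  shows "reflects_split_epis X Y Fo (\<lambda>t. t)"
  unfolding reflects_split_epis_def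
proof (intro ballI impI)
  fix x y f
  assume x: "x \<in> Ob X" and y: "y \<in> Ob X" and f: "f \<in> Hom X x y" and "split_epi Y (Fo x) (Fo y) f"
  then obtain s where s: "s \<in> Hom Y (Fo y) (Fo x)" "Comp X f s = Idn X y"
    by (auto simp: split_epi_def comp idn)
  obtain P where P: "\<forall>x \<in> Ob X. \<forall>y \<in> Ob X. \<forall>h \<in> Hom Y (Fo x) (Fo y). P x y h \<in> Hom X x y"
    "\<forall>x \<in> Ob X. \<forall>y \<in> Ob X. \<forall>x' \<in> Ob X. \<forall>y' \<in> Ob X. \<forall>f \<in> Hom X x' x. \<forall>g \<in> Hom X y y'. \<forall>h \<in> Hom Y (Fo x) (Fo y).
      P x' y' (Comp X g (Comp X h f)) = Comp X g (Comp X (P x y h) f)"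
    "\<forall>x \<in> Ob X. \<forall>y \<in> Ob X. \<forall>f \<in> Hom X x y. P x y f = f"
    using sep unfolding separable_functor_def comp by (elim exE conjE) (rule that)
  have h: "P y x s \<in> Hom X y x"
    by (rule P(1)[rule_format, OF y x s(1)])
  \<comment> \<open>Naturality is two-sided; f is taken on the left and the identity of y on the
    right.\<close>
  have "P y y (Comp X f (Comp X s (Idn X y))) = Comp X f (Comp X (P y x s) (Idn X y))"
    by (rule P(2)[rule_format, OF y x y y id_hom[OF y] f s(1)])
  then have "Comp X f (P y x s) = Idn X y"
    using P(3)[rule_format, OF y y id_hom[OF y]] unit[OF disjI1[OF h]] unit[OF disjI2[OF s(1)]] s(2) by simp
  then show "split_epi X x y f"
    using f h by (auto simp: split_epi_def)
qed

text \<open>Together with the next lemma this shows that identity 2-cells are morphisms of modules,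
  one of the category laws that the reflection of split epimorphisms relies on.\<close>

lemma (in map_monoidale) bul2_id2: "f \<in> hom1 B \<M> \<M> \<Longrightarrow> g \<in> hom1 B \<M> \<M> \<Longrightarrow> \<langle>f\<rangle> \<bullet>\<^sub>2 \<langle>g\<rangle> = \<langle>f \<bullet>\<^sub>1 g\<rangle>"
  using mul_hom mul_adjunction id2_hom[of f] id2_hom[of g]
  by (simp add: bul2_def bul1_def ten2_def ten1_def rw2_id lw2_id hcomp_id2 hom1_def hom2_def adjunction_def
      lw1_src lw1_trg rw1_src rw1_trg comp1_src comp1_trg)

lemma (in map_monoidale) module_hom_id2:
  assumes "f \<in> hom1 B \<M> \<M>" "x \<in> hom1 B \<M> \<M>"
  shows "l \<in> hom2 B (f \<bullet>\<^sub>1 x) x \<Longrightarrow> left_module_hom B f x l x l \<langle>x\<rangle>" "r \<in> hom2 B (x \<bullet>\<^sub>1 f) x \<Longrightarrow> right_module_hom B f x r x r \<langle>x\<rangle>"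
  using assms id2_hom[of x] vcomp_id_left[of l] vcomp_id_right[of l] vcomp_id_left[of r] vcomp_id_right[of r]
  by (auto simp: left_module_hom_def right_module_hom_def bul2_id2 hom2_def)

theorem theorem2p4:
  fixes B :: "('o, 'f, 't) monoidale"
    and a :: 'f and \<mu> \<eta> \<delta> \<epsilon> \<sigma> :: 't
  assumes frobenius: "naturally_frobenius_map_monoidale B"
    and hopf: "hopf_monoid B a \<mu> \<eta> \<delta> \<epsilon> \<sigma>"
  shows "(separable_monoid B a \<mu> \<eta>
            \<longleftrightarrow> (\<exists>\<theta>. normalized_left_integral B a \<mu> \<epsilon> \<theta>)) \<and>
         (separable_monoid B a \<mu> \<eta>
            \<longleftrightarrow> (\<exists>\<theta>. normalized_right_integral B a \<mu> \<epsilon> \<theta>)) \<and>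
         (separable_monoid B a \<mu> \<eta>
            \<longleftrightarrow> separable_functor (bimod_a_i B a \<mu> \<eta>) (mod_i B) forget_left (\<lambda>t. t)) \<and>
         (separable_monoid B a \<mu> \<eta>
            \<longleftrightarrow> separable_functor (bimod_i_a B a \<mu> \<eta>) (i_mod B) forget_right (\<lambda>t. t)) \<and>
         (separable_monoid B a \<mu> \<eta>
            \<longleftrightarrow> reflects_split_epis (bimod_a_i B a \<mu> \<eta>) (mod_i B) forget_left (\<lambda>t. t)) \<and>
         (separable_monoid B a \<mu> \<eta>
            \<longleftrightarrow> reflects_split_epis (bimod_i_a B a \<mu> \<eta>) (i_mod B) forget_right (\<lambda>t. t))"
proof -
  have B: "map_monoidale B"
    using frobenius by (simp add: naturally_frobenius_map_monoidale_def)
  note H = B hopf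
  interpret map_monoidale B by (rule B)
  have i: "iobj B \<in> hom1 B (car B) (car B)" using id1_hom by (simp add: iobj_def)
  have u: "left_module_hom B f x l y l' t \<Longrightarrow> t \<odot>\<^bsub>B\<^esub> \<langle>x\<rangle>\<^bsub>B\<^esub> = t" "right_module_hom B f x l y l' t \<Longrightarrow> t \<odot>\<^bsub>B\<^esub> \<langle>x\<rangle>\<^bsub>B\<^esub> = t" for f x l y l' t
    using vcomp_id_right[of t] by (auto simp: left_module_hom_def right_module_hom_def hom2_def)
  have D: "bimodule B f \<mu>' \<eta>' g \<nu> \<iota> x l r \<Longrightarrow> x \<in> hom1 B (car B) (car B) \<and> l \<in> hom2 B (bul1 B f x) x \<and> r \<in> hom2 B (bul1 B x g) x"
    for f \<mu>' \<eta>' g \<nu> \<iota> x l r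
    by (simp add: bimodule_def left_module_def right_module_def)
  have "reflects_split_epis (bimod_a_i B a \<mu> \<eta>) (mod_i B) forget_left (\<lambda>t. t)"
    if "separable_functor (bimod_a_i B a \<mu> \<eta>) (mod_i B) forget_left (\<lambda>t. t)"
    using object_hom[OF H] i
    by (intro separable_reflects_split_epis[OF that])
      (auto simp: bimod_a_i_def bimodule_cat_def mod_i_def right_module_cat_def forget_left_def dest!: D dest: u intro: module_hom_id2)
  moreover have "reflects_split_epis (bimod_i_a B a \<mu> \<eta>) (i_mod B) forget_right (\<lambda>t. t)"
    if "separable_functor (bimod_i_a B a \<mu> \<eta>) (i_mod B) forget_right (\<lambda>t. t)"
    using object_hom[OF H] i
    by (intro separable_reflects_split_epis[OF that])
      (auto simp: bimod_i_a_def bimodule_cat_def i_mod_def left_module_cat_def forget_right_def dest!: D dest: u intro: module_hom_id2)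
  \<comment> \<open>On each side the implications form a cycle: separability of a, separability of
    the forgetful functor, reflection of split epimorphisms, a normalized integral, separability of
    a. The two cycles meet in the separability of a.\<close>
  ultimately show ?thesis
    using separable_functor_left[OF H] separable_functor_right[OF H]
      left_integral_of_reflection[OF H] right_integral_of_reflection[OF H]
      separable_of_left_integral[OF H] separable_of_right_integral[OF H]
    by blast
qed

end
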